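(* Consider the noisy voter-exclusion process with rates $q_e,q_v,\beta,\delta$ on $\mathcal{S}$ and semigroup $S(t)$. Let $\mu\in\mathcal{P}$, and let $\delta_0,\delta_1$ be the point masses on the configurations of all $0$'s and all $1$'s. Assume that the condition $$P^x\Big[\int_0^\infty \big(\beta(X(t))+\delta(X(t))\big)\,dt=\infty\Big]=1\ \text{ for all }x\in\mathcal{S}$$ does not hold, and that $$P^E\Big[\int_0^\infty q_v(E_t)\,dt=\infty\Big]=1\ \text{ for all }E\in\mathcal{S}_2 .$$ Then: (a) the limits $\lim_{t\to\infty}\delta_0S(t)=\mu^0$ and $\lim_{t\to\infty}\delta_1S(t)=\mu^1$ exist; (b) $\mathcal{I}_e=\{\mu^0,\mu^1\}$; and (c) for $\lambda\in[0,1]$, $\lim_{t\to\infty}\mu S(t)=\lambda\mu^1+(1-\lambda)\mu^0$ if and only if $$\lim_{t\to\infty}\sum_y p_t(x,y)\,\mu\{\eta:\eta(y)=1\}=\lambda\quad\text{for all }x\in\mathcal{S}.$$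
   Context: $\mathcal{S}$ is a countable set; $q_e(x,y)\ge 0$ and $q_v(x,y)\ge 0$ for $x,y\in\mathcal{S}$; $q(x,y)=q_e(x,y)+q_v(x,y)$ and $q_x=\sum_y q(x,y)$. Standing assumptions: (a) $\mathcal{S}$ is irreducible with respect to $q(x,y)$; (b) $q_e(x,y)=q_e(y,x)$; (c) $\sup_x q_x<\infty$; (d) $\inf_x q_x>0$; $\beta,\delta:\mathcal{S}\to[0,\infty)$ satisfy $\sup_x(\beta(x)+\delta(x))<\infty$; and $q_v(x,y)>0$ for some $x,y\in\mathcal{S}$. For $\eta\in\{0,1\}^{\mathcal{S}}$, $\eta_x$ is $\eta$ with the value at $x$ replaced by $1-\eta(x)$, and $\eta_{xy}$ is $\eta$ with the values at $x$ and $y$ interchanged. The noisy voter-exclusion (NVE) process is the Feller process $\eta_t$ on $\{0,1\}^{\mathcal{S}}$ whose generator is the closure of the operator, defined on functions $f$ depending on finitely many coordinates, $$\Omega f(\eta)=\sum_{\eta(x)=1,\eta(y)=0}q_e(x,y)[f(\eta_{xy})-f(\eta)]+\sum_x c(x,\eta)[f(\eta_x)-f(\eta)],$$ where $c(x,\eta)=\beta(x)+\sum_y q_v(x,y)\eta(y)$ if $\eta(x)=0$ and $c(x,\eta)=\delta(x)+\sum_y q_v(x,y)[1-\eta(y)]$ if $\eta(x)=1$. Its semigroup is $S(t)$; $\mu S(t)$ is the law at time $t$ when the initial law is $\mu$. $\mathcal{P}$ is the set of probability measures on $\{0,1\}^{\mathcal{S}}$ (limits of measures are weak limits); $\mathcal{I}$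 is the set of invariant probability measures of the NVE process and $\mathcal{I}_e$ is the set of extreme points of $\mathcal{I}$. $X(t)$ is the continuous time Markov chain on $\mathcal{S}$ with transition rates $q(x,y)$, $P^x$ is its law started from $x$, and $p_t(x,y)=P^x(X(t)=y)$. $\mathcal{S}_2=\{(x,y)\in\mathcal{S}^2:x\ne y\}$. $E_t=(x_t,y_t)\in\mathcal{S}_2$ is the two-particle exclusion process with transition rates $q(x,y)$: each particle jumps from $u$ to $v$ at rate $q(u,v)$, jumps to the site occupied by the other particle being suppressed. $P^E$ is its law started from $E$. For $E=(x,y)$, $q_v(E)=q_v(x,y)+q_v(y,x)$. *)

theory Defs
  imports "HOL-Probability.Probability"
begin

definition total_rate :: "('s \<Rightarrow> 's \<Rightarrow> real) \<Rightarrow> ('s \<Rightarrow> 's \<Rightarrow> real) \<Rightarrow> 's \<Rightarrow> 's \<Rightarrow> real" where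
  "total_rate qe qv x y = qe x y + qv x y"

definition exit_rate :: "('s \<Rightarrow> 's \<Rightarrow> real) \<Rightarrow> 's \<Rightarrow> real" where
  "exit_rate q x = (\<Sum>\<^sub>\<infinity>y. q x y)"

definition irreducible_rates :: "('s \<Rightarrow> 's \<Rightarrow> real) \<Rightarrow> bool" where
  "irreducible_rates q \<longleftrightarrow> (\<forall>x y. (x, y) \<in> {(u, v). q u v > 0}\<^sup>*)"

definition trans_prob :: "('a \<Rightarrow> 'w measure) \<Rightarrow> (real \<Rightarrow> 'w \<Rightarrow> 'a) \<Rightarrow> real \<Rightarrow> 'a \<Rightarrow> 'a \<Rightarrow> real" where
  "trans_prob P X t x y = measure (P x) {w \<in> space (P x). X t w = y}"

text \<open>
  \<open>markov_chain A r P X\<close>: under the laws \<open>P x\<close>, \<open>x \<in> A\<close>, the process \<open>X\<close> is a Markov chain on the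
  countable set \<open>A\<close> that starts at \<open>x\<close>, has right-continuous paths (for the discrete topology
  on \<open>A\<close>), and jumps from \<open>x\<close> to \<open>y \<noteq> x\<close> at rate \<open>r x y\<close>. The derivative at \<open>0\<close> on the diagonal
  is minus the total rate of leaving \<open>x\<close>; the values \<open>r x x\<close> are irrelevant.
  For bounded total rates this determines the law of the process uniquely.
\<close>

definition markov_chain ::
    "'a set \<Rightarrow> ('a \<Rightarrow> 'a \<Rightarrow> real) \<Rightarrow> ('a \<Rightarrow> 'w measure) \<Rightarrow> (real \<Rightarrow> 'w \<Rightarrow> 'a) \<Rightarrow> bool" where
  "markov_chain A r P X \<longleftrightarrow> (\<forall>x\<in>A.
      prob_space (P x) \<and>
      (\<forall>t\<ge>0. X t \<in> P x \<rightarrow>\<^sub>M count_space A) \<and>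
      trans_prob P X 0 x x = 1 \<and>
      (\<forall>w\<in>space (P x). \<forall>t\<ge>0. \<forall>\<^sub>F s in at_right t. X s w = X t w) \<and>
      (\<forall>s\<ge>0. \<forall>t\<ge>0. \<forall>y\<in>A. \<forall>z\<in>A.
        \<forall>B \<in> sigma_sets (space (P x)) {{w \<in> space (P x). X u w = a} | u a. 0 \<le> u \<and> u \<le> s}.
          measure (P x) {w \<in> B. X s w = y \<and> X (s + t) w = z}
            = measure (P x) {w \<in> B. X s w = y} * trans_prob P X t y z) \<and>
      (\<forall>y\<in>A - {x}. ((\<lambda>t. trans_prob P X t x y) has_real_derivative r x y) (at 0 within {0..})) \<and>
      ((\<lambda>t. trans_prob P X t x x) has_real_derivative - (\<Sum>\<^sub>\<infinity>y\<in>A - {x}. r x y)) (at 0 within {0..}))"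

definition S2 :: "('s \<times> 's) set" where
  "S2 = {(x, y). x \<noteq> y}"

text \<open>
  Only used between distinct elements of \<^const>\<open>S2\<close>; since the target must lie in \<^const>\<open>S2\<close>,
  jumps onto the site occupied by the other particle are suppressed.
\<close>

fun exclusion_rate :: "('s \<Rightarrow> 's \<Rightarrow> real) \<Rightarrow> 's \<times> 's \<Rightarrow> 's \<times> 's \<Rightarrow> real" where
  "exclusion_rate q (x, y) (u, v) =
     (if u \<noteq> x \<and> v = y then q x u else if u = x \<and> v \<noteq> y then q y v else 0)"

fun pair_rate :: "('s \<Rightarrow> 's \<Rightarrow> real) \<Rightarrow> 's \<times> 's \<Rightarrow> real" where
  "pair_rate qv (x, y) = qv x y + qv y x"

definition as_infinite_integral ::
    "'a set \<Rightarrow> ('a \<Rightarrow> 'w measure) \<Rightarrow> (real \<Rightarrow> 'w \<Rightarrow> 'a) \<Rightarrow> ('a \<Rightarrow> real) \<Rightarrow> bool" where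
  "as_infinite_integral A P X V \<longleftrightarrow> (\<forall>x\<in>A.
      measure (P x) {w \<in> space (P x). (\<integral>\<^sup>+t\<in>{0..}. ennreal (V (X t w)) \<partial>lborel) = \<infinity>} = 1)"

definition weak_lim :: "('b \<Rightarrow> 'a::topological_space measure) \<Rightarrow> 'a measure \<Rightarrow> 'b filter \<Rightarrow> bool" where
  "weak_lim M N F \<longleftrightarrow>
     (\<forall>f :: 'a \<Rightarrow>\<^sub>C real. ((\<lambda>t. \<integral>\<zeta>. f \<zeta> \<partial>M t) \<longlongrightarrow> (\<integral>\<zeta>. f \<zeta> \<partial>N)) F)"

definition mixture :: "real \<Rightarrow> 'a::topological_space measure \<Rightarrow> 'a measure \<Rightarrow> 'a measure" where
  "mixture a M N = measure_of UNIV (sets borel)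
     (\<lambda>B. ennreal a * emeasure M B + ennreal (1 - a) * emeasure N B)"

lemma emeasure_mixture:
  assumes "sets M = sets borel" "sets N = sets borel" "B \<in> sets borel"
  shows "emeasure (mixture a M N) B = ennreal a * emeasure M B + ennreal (1 - a) * emeasure N B"
  unfolding mixture_def
proof (rule emeasure_measure_of_sigma)
  show "sigma_algebra UNIV (sets (borel :: 'a measure))"
    using sets.sigma_algebra_axioms[of "borel :: 'a measure"] by simp
  show "countably_additive (sets (borel :: 'a measure))
      (\<lambda>B. ennreal a * emeasure M B + ennreal (1 - a) * emeasure N B)"
    using assms(1,2)
    by (auto simp: countably_additive_def suminf_add[symmetric] suminf_emeasure image_subset_iff)
qed (use assms in \<open>auto simp: positive_def\<close>)

definition extreme_measures :: "'a::topological_space measure set \<Rightarrow> 'a measure set" where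
  "extreme_measures C = {\<mu> \<in> C.
     \<forall>\<nu>1\<in>C. \<forall>\<nu>2\<in>C. \<forall>a. 0 < a \<and> a < 1 \<and> \<mu> = mixture a \<nu>1 \<nu>2 \<longrightarrow> \<nu>1 = \<nu>2}"

text \<open>
  A Feller process is given by its transition kernels \<open>K t \<eta>\<close>, the law at time \<open>t\<close> of the process
  started from \<open>\<eta>\<close>. The semigroup acts on functions by \<open>S(t) f \<eta> = \<integral> f d(K t \<eta>)\<close> and
  on measures by \<open>\<mu> S(t) = \<mu> \<bind> K t\<close>. On a compact space, such as \<open>'s \<Rightarrow> bool\<close> with the product
  topology, all continuous functions are bounded, so \<open>'a \<Rightarrow>\<^sub>C real\<close> is the space of
  continuous functions with the supremum norm.
\<close>

definition semigroup_fun ::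
    "(real \<Rightarrow> 'a \<Rightarrow> 'a measure) \<Rightarrow> real \<Rightarrow> ('a \<Rightarrow> real) \<Rightarrow> 'a \<Rightarrow> real" where
  "semigroup_fun K t f \<eta> = (\<integral>\<zeta>. f \<zeta> \<partial>K t \<eta>)"

definition feller_kernel :: "(real \<Rightarrow> 'a::topological_space \<Rightarrow> 'a measure) \<Rightarrow> bool" where
  "feller_kernel K \<longleftrightarrow>
     (\<forall>t\<ge>0. K t \<in> borel \<rightarrow>\<^sub>M prob_algebra borel) \<and>
     (\<forall>\<eta>. K 0 \<eta> = return borel \<eta>) \<and>
     (\<forall>s\<ge>0. \<forall>t\<ge>0. \<forall>\<eta>. K (s + t) \<eta> = K s \<eta> \<bind> K t) \<and>
     (\<forall>t\<ge>0. \<forall>f :: 'a \<Rightarrow>\<^sub>C real. continuous_on UNIV (semigroup_fun K t f)) \<and>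
     (\<forall>f :: 'a \<Rightarrow>\<^sub>C real. uniform_limit UNIV (\<lambda>t. semigroup_fun K t f) f (at_right 0))"

definition generator ::
    "(real \<Rightarrow> 'a::topological_space \<Rightarrow> 'a measure) \<Rightarrow> (('a \<Rightarrow>\<^sub>C real) \<times> ('a \<Rightarrow>\<^sub>C real)) set" where
  "generator K = {(f, g).
     uniform_limit UNIV (\<lambda>t \<eta>. (semigroup_fun K t (apply_bcontfun f) \<eta> - apply_bcontfun f \<eta>) / t)
       (apply_bcontfun g) (at_right 0)}"

definition invariant_measures ::
    "(real \<Rightarrow> 'a::topological_space \<Rightarrow> 'a measure) \<Rightarrow> 'a measure set" where
  "invariant_measures K = {\<mu> \<in> space (prob_algebra borel). \<forall>t\<ge>0. \<mu> \<bind> K t = \<mu>}"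

text \<open>Configurations are predicates: \<open>\<eta> x\<close> stands for \<open>\<eta>(x) = 1\<close>.\<close>

definition flip :: "('s \<Rightarrow> bool) \<Rightarrow> 's \<Rightarrow> 's \<Rightarrow> bool" where
  "flip \<eta> x = \<eta>(x := \<not> \<eta> x)"

definition swap :: "('s \<Rightarrow> bool) \<Rightarrow> 's \<Rightarrow> 's \<Rightarrow> 's \<Rightarrow> bool" where
  "swap \<eta> x y = \<eta>(x := \<eta> y, y := \<eta> x)"

definition finitely_dependent :: "(('s \<Rightarrow> bool) \<Rightarrow> real) \<Rightarrow> bool" where
  "finitely_dependent f \<longleftrightarrow>
     (\<exists>\<Lambda>. finite \<Lambda> \<and> (\<forall>\<eta> \<zeta>. (\<forall>x\<in>\<Lambda>. \<eta> x = \<zeta> x) \<longrightarrow> f \<eta> = f \<zeta>))"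

definition flip_rate ::
    "('s \<Rightarrow> 's \<Rightarrow> real) \<Rightarrow> ('s \<Rightarrow> real) \<Rightarrow> ('s \<Rightarrow> real) \<Rightarrow> 's \<Rightarrow> ('s \<Rightarrow> bool) \<Rightarrow> real" where
  "flip_rate qv \<beta> \<delta> x \<eta> =
     (if \<eta> x then \<delta> x + (\<Sum>\<^sub>\<infinity>y. qv x y * (1 - of_bool (\<eta> y)))
      else \<beta> x + (\<Sum>\<^sub>\<infinity>y. qv x y * of_bool (\<eta> y)))"

definition nve_operator ::
    "('s \<Rightarrow> 's \<Rightarrow> real) \<Rightarrow> ('s \<Rightarrow> 's \<Rightarrow> real) \<Rightarrow> ('s \<Rightarrow> real) \<Rightarrow> ('s \<Rightarrow> real) \<Rightarrow>
     (('s \<Rightarrow> bool) \<Rightarrow> real) \<Rightarrow> ('s \<Rightarrow> bool) \<Rightarrow> real" where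
  "nve_operator qe qv \<beta> \<delta> f \<eta> =
     (\<Sum>\<^sub>\<infinity>(x, y)\<in>{(x, y). \<eta> x \<and> \<not> \<eta> y}. qe x y * (f (swap \<eta> x y) - f \<eta>)) +
     (\<Sum>\<^sub>\<infinity>x. flip_rate qv \<beta> \<delta> x \<eta> * (f (flip \<eta> x) - f \<eta>))"

definition nve_process ::
    "('s \<Rightarrow> 's \<Rightarrow> real) \<Rightarrow> ('s \<Rightarrow> 's \<Rightarrow> real) \<Rightarrow> ('s \<Rightarrow> real) \<Rightarrow> ('s \<Rightarrow> real) \<Rightarrow>
     (real \<Rightarrow> ('s \<Rightarrow> bool) \<Rightarrow> ('s \<Rightarrow> bool) measure) \<Rightarrow> bool" where
  "nve_process qe qv \<beta> \<delta> K \<longleftrightarrow>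
     feller_kernel K \<and>
     generator K = closure {(f, g). finitely_dependent (apply_bcontfun f) \<and>
       apply_bcontfun g = nve_operator qe qv \<beta> \<delta> (apply_bcontfun f)}"

end

theory Submission
  imports Defs
begin

text \<open>
  The process is studied through its moments \<open>u t A\<close>, the probability that all sites of a finite set \<open>A\<close> are occupied
  at time \<open>t\<close>. Symmetry of \<open>q\<^sub>e\<close> turns the generator, applied to the indicator of this event, into the generator
  of a dual process of finite sets (\<open>nve_operator_occupied\<close>): its particles move by exclusion with rates \<open>q\<^sub>e\<close>, jump and
  coalesce with rates \<open>q\<^sub>v\<close>, leave the system at rate \<open>\<beta>\<close>, and at rate \<open>\<delta>\<close> the value of the whole set is replaced
  by \<open>0\<close>. So the moments solve a linear equation (\<open>dual_solution_moment\<close>). Since the number of dual particles never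
  increases, the equation restricted to sets of bounded size has a bounded generator. It therefore has unique solutions
  and obeys a comparison principle, and no dual process has to be constructed.

  For a single particle, the difference of two solutions evolves by the walk \<open>X\<close> killed at rate \<open>\<beta> + \<delta>\<close>. Let \<open>s x\<close> be
  the probability that this walk is never killed. By the Feynman-Kac formula the failure of the noise condition means that
  \<open>s\<close> is not identically \<open>0\<close>, and the condition on \<open>q\<^sub>v\<close> means that the two-particle exclusion process killed at rate
  \<open>q\<^sub>v(E)\<close> dies almost surely (\<open>infinite_integral_iff\<close>). The latter forces bounded harmonic functions of \<open>X\<close> to be
  constant (\<open>bounded_harmonic_constant\<close>): for harmonic \<open>f\<close> the function \<open>\<bar>f x - f y\<bar>\<close> is subharmonic for the killed
  pair. The limit of \<open>P\<^sub>t s\<close>, where \<open>P\<^sub>t\<close> is the semigroup of \<open>X\<close>, is harmonic, hence constant, and it can only be \<open>1\<close>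
  (\<open>free_survival_tendsto\<close>). Thus, for an initial density \<open>\<rho>\<close> with values in \<open>[0, 1]\<close>, the killed evolution of \<open>\<rho>\<close>
  tends to \<open>\<theta> s\<close> if and only if \<open>P\<^sub>t \<rho>\<close> tends to \<open>\<theta>\<close> (\<open>killed_tendsto_iff_free_tendsto\<close>).

  For several particles, the expected number of pairs in the dual is dominated by the number of surviving killed pairs
  (\<open>dual_generator_pair_sum_le\<close>), which tends to \<open>0\<close>. The dual ends up with at most one particle, so a solution that tends
  to \<open>0\<close> on singletons tends to \<open>0\<close> on every finite set (\<open>dual_solution_tendsto_0\<close>). Applied to the difference of \<open>u\<close>
  and the \<open>\<theta>\<close>-mixture of the solutions started from all ones and all zeros, this shows that all moments converge to those
  of \<open>\<theta> \<mu>\<^sup>1 + (1 - \<theta>) \<mu>\<^sup>0\<close> exactly when \<open>P\<^sub>t \<rho>\<close> tends to \<open>\<theta>\<close> (\<open>dual_solution_limit_iff\<close>), where \<open>\<rho>\<close> is the initial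
  density. The two extreme solutions converge because they are monotone in time. On a compact space of configurations,
  moments determine a measure, their convergence is weak convergence, and limits of moments are again the moments of a
  measure; this gives (a) and (c). The density of an invariant measure minus that of \<open>\<mu>\<^sup>0\<close> is invariant under the killed
  walk, hence a multiple \<open>\<kappa> s\<close> with \<open>0 \<le> \<kappa> \<le> 1\<close> (\<open>stationary_dual_solution\<close>), so the invariant measures form the
  segment between \<open>\<mu>\<^sup>0\<close> and \<open>\<mu>\<^sup>1\<close>, which differ because \<open>s\<close> does not vanish; this gives (b).
\<close>

section \<open>Semigroups generated by bounded positive operators\<close>

text \<open>
  Adding \<open>e (t - a)\<close> makes the right derivative strictly positive, so the last point at which the function is still
  at least its initial value cannot lie before \<open>b\<close>.
\<close>

lemma right_derivative_nonneg_imp_le: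
  fixes f f' :: "real \<Rightarrow> real"
  assumes ab: "a \<le> b" and cont: "continuous_on {a..b} f"
    and der: "\<And>t. a \<le> t \<Longrightarrow> t < b \<Longrightarrow> (f has_real_derivative f' t) (at_right t)"
    and nonneg: "\<And>t. a \<le> t \<Longrightarrow> t < b \<Longrightarrow> 0 \<le> f' t"
  shows "f a \<le> f b"
proof (cases "a = b")
  case False
  with ab have "a < b" by simp
  have approx: "f a \<le> f b + e * (b - a)" if "0 < e" for e
  proof -
    define g where "g t = f t + e * (t - a)" for t
    have contg: "continuous_on {a..b} g"
      unfolding g_def by (intro continuous_intros cont)
    have "closedin (top_of_set {a..b}) {t \<in> {a..b}. g a \<le> g t}"
    proof -
      have "{t \<in> {a..b}. g a \<le> g t} = {a..b} \<inter> g -` {g a..}" by auto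
      then show ?thesis using continuous_closedin_preimage[OF contg closed_atLeast] by metis
    qed
    then have "compact {t \<in> {a..b}. g a \<le> g t}"
      using closedin_compact by blast
    moreover have "{t \<in> {a..b}. g a \<le> g t} \<noteq> {}"
      using ab by auto
    ultimately obtain c where c: "c \<in> {a..b}" "g a \<le> g c"
      and max: "\<And>t. t \<in> {a..b} \<Longrightarrow> g a \<le> g t \<Longrightarrow> t \<le> c"
      using compact_attains_sup[of "{t \<in> {a..b}. g a \<le> g t}"] by auto
    have "c = b"
    proof (rule ccontr)
      assume "c \<noteq> b"
      with c have cb: "a \<le> c" "c < b" by auto
      have "(g has_real_derivative f' c + e) (at_right c)"
        unfolding g_def by (auto intro!: derivative_eq_intros der cb)
      moreover have "0 < f' c + e" using nonneg[OF cb] that by simp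
      ultimately obtain d where d: "d > 0" "\<And>h. h > 0 \<Longrightarrow> c + h \<in> {c<..} \<Longrightarrow> h < d \<Longrightarrow> g c < g (c + h)"
        using has_real_derivative_pos_inc_right[of g "f' c + e" c "{c<..}"] by auto
      define h where "h = min (d / 2) (b - c)"
      have "h > 0" "h < d" "c + h \<le> b" using d(1) cb by (auto simp: h_def min_def)
      then show False using d(2)[of h] max[of "c + h"] c by auto
    qed
    then show ?thesis using c by (simp add: g_def)
  qed
  show ?thesis
  proof (rule field_le_epsilon)
    fix e :: real assume "0 < e"
    then show "f a \<le> f b + e"
      using approx[of "e / (b - a)"] \<open>a < b\<close> by simp
  qed
qed simp

definition bounded_fun :: "('a \<Rightarrow> real) \<Rightarrow> bool" where
  "bounded_fun f \<longleftrightarrow> (\<exists>M. \<forall>x. \<bar>f x\<bar> \<le> M)"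

lemma bounded_funI: "(\<And>x. \<bar>f x\<bar> \<le> M) \<Longrightarrow> bounded_fun f"
  unfolding bounded_fun_def by blast

lemma bounded_funD: "bounded_fun f \<Longrightarrow> \<exists>M\<ge>0. \<forall>x. \<bar>f x\<bar> \<le> M"
  unfolding bounded_fun_def by (meson abs_ge_zero order_trans)

lemma bounded_fun_const [intro, simp]: "bounded_fun (\<lambda>x. a)"
  by (rule bounded_funI[of _ "\<bar>a\<bar>"]) simp

lemma bounded_fun_add [intro]:
  assumes "bounded_fun f" "bounded_fun g" shows "bounded_fun (\<lambda>x. f x + g x)"
proof -
  obtain M N where "\<And>x. \<bar>f x\<bar> \<le> M" "\<And>x. \<bar>g x\<bar> \<le> N"
    using assms by (auto simp: bounded_fun_def)
  then show ?thesis
    by (intro bounded_funI[of _ "M + N"]) (meson abs_triangle_ineq add_mono order_trans)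
qed

lemma bounded_fun_mult [intro]:
  assumes "bounded_fun f" "bounded_fun g" shows "bounded_fun (\<lambda>x. f x * g x)"
proof -
  obtain M N where "0 \<le> M" "\<And>x. \<bar>f x\<bar> \<le> M" "\<And>x. \<bar>g x\<bar> \<le> N"
    using bounded_funD[OF assms(1)] bounded_funD[OF assms(2)] by auto
  then show ?thesis
    by (intro bounded_funI[of _ "M * N"]) (auto simp: abs_mult intro!: mult_mono)
qed

lemma bounded_fun_minus [intro]: "bounded_fun f \<Longrightarrow> bounded_fun (\<lambda>x. - f x)"
  by (auto simp: bounded_fun_def)

lemma bounded_fun_diff [intro]: "bounded_fun f \<Longrightarrow> bounded_fun g \<Longrightarrow> bounded_fun (\<lambda>x. f x - g x)"
  using bounded_fun_add[of f "\<lambda>x. - g x"] by auto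

lemma bounded_fun_abs [intro]: "bounded_fun f \<Longrightarrow> bounded_fun (\<lambda>x. \<bar>f x\<bar>)"
  by (auto simp: bounded_fun_def)

lemma bounded_fun_compose: "bounded_fun f \<Longrightarrow> bounded_fun (\<lambda>x. f (g x))"
  by (auto simp: bounded_fun_def)

lemma bounded_fun_sum [intro]:
  "(\<And>i. i \<in> I \<Longrightarrow> bounded_fun (f i)) \<Longrightarrow> bounded_fun (\<lambda>x. \<Sum>i\<in>I. f i x)"
  by (induction I rule: infinite_finite_induct) auto

text \<open>
  A bounded generator \<open>G\<close> of a sub-Markovian semigroup is written as \<open>G f = B f - c f\<close> with \<open>B\<close>
  positive of mass at most \<open>c\<close>. Continuity along bounded pointwise convergent sequences stands in
  for \<open>B\<close> being given by a kernel.
\<close>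

locale positive_operator =
  fixes B :: "('a \<Rightarrow> real) \<Rightarrow> 'a \<Rightarrow> real" and c :: real
  assumes op_add: "bounded_fun f \<Longrightarrow> bounded_fun g \<Longrightarrow> B (\<lambda>x. f x + g x) y = B f y + B g y"
    and op_scale: "bounded_fun f \<Longrightarrow> B (\<lambda>x. a * f x) y = a * B f y"
    and op_nonneg: "bounded_fun f \<Longrightarrow> (\<And>x. 0 \<le> f x) \<Longrightarrow> 0 \<le> B f y"
    and op_mass: "B (\<lambda>x. 1) y \<le> c"
    and op_tendsto: "(\<And>n x. \<bar>F n x\<bar> \<le> M) \<Longrightarrow> (\<And>x. (\<lambda>n. F n x) \<longlonglongrightarrow> f x) \<Longrightarrow>
      (\<lambda>n. B (F n) y) \<longlonglongrightarrow> B f y"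
begin

lemma c_nonneg: "0 \<le> c"
proof -
  have "0 \<le> B (\<lambda>x. 1) undefined" by (rule op_nonneg) auto
  also have "\<dots> \<le> c" by (rule op_mass)
  finally show ?thesis .
qed

lemma op_const: "B (\<lambda>x. a) y = a * B (\<lambda>x. 1) y"
  using op_scale[of "\<lambda>x. 1" a y] by simp

lemma op_minus: "bounded_fun f \<Longrightarrow> B (\<lambda>x. - f x) y = - B f y"
  using op_scale[of f "-1" y] by simp

lemma op_diff: "bounded_fun f \<Longrightarrow> bounded_fun g \<Longrightarrow> B (\<lambda>x. f x - g x) y = B f y - B g y"
  using op_add[of f "\<lambda>x. - g x" y] by (simp add: op_minus bounded_fun_minus)

lemma op_mono:
  assumes "bounded_fun f" "bounded_fun g" "\<And>x. f x \<le> g x"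
  shows "B f y \<le> B g y"
proof -
  have "0 \<le> B (\<lambda>x. g x - f x) y"
    by (rule op_nonneg) (use assms in auto)
  then show ?thesis using op_diff[OF assms(2,1), of y] by simp
qed

lemma op_abs_le:
  assumes "0 \<le> M" "\<And>x. \<bar>f x\<bar> \<le> M"
  shows "\<bar>B f y\<bar> \<le> M * c"
proof -
  have f: "bounded_fun f" by (rule bounded_funI) (rule assms(2))
  have m: "M * B (\<lambda>x. 1) y \<le> M * c" by (rule mult_left_mono[OF op_mass assms(1)])
  have le: "f x \<le> M" "- f x \<le> M" for x using assms(2)[of x] by auto
  have "B f y \<le> B (\<lambda>x. M) y"
    by (rule op_mono[OF f]) (use le in auto)
  moreover have "B (\<lambda>x. - f x) y \<le> B (\<lambda>x. M) y"
    by (rule op_mono[OF bounded_fun_minus[OF f]]) (use le in auto)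
  ultimately show ?thesis using m op_const[of M y] op_minus[OF f, of y] by linarith
qed

lemma bounded_fun_op: "bounded_fun f \<Longrightarrow> bounded_fun (B f)"
  by (metis bounded_funD bounded_funI op_abs_le)

lemma op_sum:
  assumes "\<And>i. i \<in> I \<Longrightarrow> bounded_fun (f i)"
  shows "B (\<lambda>x. \<Sum>i\<in>I. f i x) y = (\<Sum>i\<in>I. B (f i) y)"
  using assms
proof (induction I rule: infinite_finite_induct)
  case (insert i I)
  then show ?case by (simp add: op_add bounded_fun_sum)
qed (use op_const[of 0 y] in auto)

text \<open>
  The Picard iteration behind the comparison principle: a lower bound \<open>- C (c t)^n / n!\<close> for
  \<open>exp (c t) u\<close> improves itself from \<open>n\<close> to \<open>n + 1\<close>. Only right derivatives enter because
  transition functions are first seen to be differentiable from the right.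
\<close>

lemma comparison:
  fixes u u' :: "real \<Rightarrow> 'a \<Rightarrow> real"
  assumes bound: "\<And>t x. 0 \<le> t \<Longrightarrow> \<bar>u t x\<bar> \<le> M"
    and cont: "\<And>x. continuous_on {0..} (\<lambda>t. u t x)"
    and der: "\<And>t x. 0 \<le> t \<Longrightarrow> ((\<lambda>t. u t x) has_real_derivative u' t x) (at_right t)"
    and super: "\<And>t x. 0 \<le> t \<Longrightarrow> B (u t) x - c * u t x \<le> u' t x"
    and init: "\<And>x. 0 \<le> u 0 x"
    and T: "0 \<le> T"
  shows "0 \<le> u T x"
proof -
  define C where "C = M * exp (c * T)"
  have "0 \<le> M" using bound[of 0 x] by auto
  then have C: "0 \<le> C" by (simp add: C_def)
  have iter: "- (C * ((c * t) ^ n / fact n)) \<le> exp (c * t) * u t x"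
    if "0 \<le> t" "t \<le> T" for n t x
    using that
  proof (induction n arbitrary: t x)
    case 0
    have "exp (c * t) * \<bar>u t x\<bar> \<le> exp (c * T) * M"
      using 0 bound c_nonneg by (intro mult_mono) (auto simp: mult_left_mono)
    then have "\<bar>exp (c * t) * u t x\<bar> \<le> C"
      by (simp add: abs_mult C_def mult.commute)
    then show ?case by simp
  next
    case (Suc n)
    define h where "h s = exp (c * s) * u s x + C * ((c * s) ^ Suc n / fact (Suc n))" for s
    define h' where "h' s = exp (c * s) * (u' s x + c * u s x) + C * c * ((c * s) ^ n / fact n)" for s
    have "h 0 \<le> h t"
    proof (rule right_derivative_nonneg_imp_le[where f = h and f' = h'])
      show "continuous_on {0..t} h"
        unfolding h_def by (intro continuous_intros continuous_on_subset[OF cont]) auto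
      fix s assume s: "0 \<le> s" "s < t"
      have 1: "((\<lambda>s. exp (c * s) * u s x) has_real_derivative exp (c * s) * (u' s x + c * u s x)) (at_right s)"
        by (auto intro!: derivative_eq_intros der[OF s(1)] simp: algebra_simps)
      have "((\<lambda>s. C / fact (Suc n) * (c * s) ^ Suc n) has_real_derivative
          C / fact (Suc n) * (real (Suc n) * c * (c * s) ^ n)) (at_right s)"
        by (rule derivative_eq_intros refl | simp)+
      also have "C / fact (Suc n) * (real (Suc n) * c * (c * s) ^ n) = C * c * ((c * s) ^ n / fact n)"
        by (simp del: of_nat_Suc)
      finally have 2: "((\<lambda>s. C * ((c * s) ^ Suc n / fact (Suc n))) has_real_derivative
          C * c * ((c * s) ^ n / fact n)) (at_right s)" by simp
      show "(h has_real_derivative h' s) (at_right s)"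
        unfolding h_def h'_def by (rule DERIV_add[OF 1 2])
      define m where "m = C * ((c * s) ^ n / fact n) * exp (- (c * s))"
      have m: "0 \<le> m" using C c_nonneg s by (simp add: m_def)
      have mu: "- m \<le> u s y" for y
      proof -
        have "- (C * ((c * s) ^ n / fact n)) * exp (- (c * s)) \<le> exp (c * s) * u s y * exp (- (c * s))"
          using Suc.IH[of s y] s Suc.prems by (intro mult_right_mono) auto
        then show ?thesis by (simp add: m_def exp_minus field_simps)
      qed
      have us: "bounded_fun (u s)" by (rule bounded_funI) (rule bound[OF s(1)])
      have "B (\<lambda>y. - m) x \<le> B (u s) x"
        by (rule op_mono) (use us mu in auto)
      moreover have "m * B (\<lambda>x. 1) x \<le> m * c"
        by (rule mult_left_mono[OF op_mass m])
      ultimately have "- (m * c) \<le> B (u s) x"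
        using op_const[of "- m" x] by simp
      also have "\<dots> \<le> u' s x + c * u s x" using super[OF s(1), of x] by simp
      finally have "exp (c * s) * (- (m * c)) \<le> exp (c * s) * (u' s x + c * u s x)"
        by (intro mult_left_mono) auto
      moreover have "exp (c * s) * (- (m * c)) = - (C * c * ((c * s) ^ n / fact n))"
        by (simp add: m_def exp_minus)
      ultimately show "0 \<le> h' s" by (simp add: h'_def)
    qed (use Suc.prems in auto)
    moreover have "0 \<le> h 0" using init by (simp add: h_def)
    ultimately show ?case by (simp add: h_def)
  qed
  have "(\<lambda>n. inverse (fact n) * (c * T) ^ n) \<longlonglongrightarrow> 0"
    by (rule summable_LIMSEQ_zero[OF summable_exp])
  then have "(\<lambda>n. - (C * (inverse (fact n) * (c * T) ^ n))) \<longlonglongrightarrow> - (C * 0)"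
    by (intro tendsto_intros)
  then have lim: "(\<lambda>n. - (C * ((c * T) ^ n / fact n))) \<longlonglongrightarrow> 0"
    by (simp add: field_simps)
  have "0 \<le> exp (c * T) * u T x"
    by (rule LIMSEQ_le_const2[OF lim]) (use iter[of T] T in auto)
  then show ?thesis by (simp add: zero_le_mult_iff)
qed

text \<open>
  The exponential series of \<open>t (B - c)\<close>, with the factor \<open>exp (- c t)\<close> pulled out so that only powers of the positive
  operator \<open>B\<close> occur.
\<close>

definition evol :: "real \<Rightarrow> ('a \<Rightarrow> real) \<Rightarrow> 'a \<Rightarrow> real" where
  "evol t f x = exp (- c * t) * (\<Sum>n. (B ^^ n) f x / fact n * t ^ n)"

lemma iterate_abs_le:
  assumes "0 \<le> M" "\<And>x. \<bar>f x\<bar> \<le> M"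
  shows "\<bar>(B ^^ n) f x\<bar> \<le> M * c ^ n"
proof (induction n arbitrary: x)
  case (Suc n)
  have "\<bar>B ((B ^^ n) f) x\<bar> \<le> (M * c ^ n) * c"
    by (rule op_abs_le) (use assms c_nonneg Suc in auto)
  then show ?case by (simp add: mult_ac)
qed (simp add: assms)

lemma bounded_fun_iterate: "bounded_fun f \<Longrightarrow> bounded_fun ((B ^^ n) f)"
  by (induction n) (auto intro: bounded_fun_op)

lemma series_term_le:
  assumes "0 \<le> M" "\<And>x. \<bar>f x\<bar> \<le> M"
  shows "\<bar>(B ^^ n) f x / fact n * t ^ n\<bar> \<le> M * (inverse (fact n) * (c * \<bar>t\<bar>) ^ n)"
proof -
  have "\<bar>(B ^^ n) f x\<bar> * (\<bar>t\<bar> ^ n / fact n) \<le> (M * c ^ n) * (\<bar>t\<bar> ^ n / fact n)"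
    by (intro mult_right_mono iterate_abs_le assms) auto
  then show ?thesis
    by (simp add: abs_mult power_abs power_mult_distrib field_simps)
qed

lemma summable_majorant: "summable (\<lambda>n. (M::real) * (inverse (fact n) * (c * \<bar>t\<bar>) ^ n))"
  by (intro summable_mult summable_exp)

lemma suminf_majorant: "(\<Sum>n. (M::real) * (inverse (fact n) * (c * \<bar>t\<bar>) ^ n)) = M * exp (c * \<bar>t\<bar>)"
  by (simp add: suminf_mult summable_exp exp_def divide_inverse scaleR_conv_of_real)

lemma series_summable:
  assumes "bounded_fun f"
  shows "summable (\<lambda>n. (B ^^ n) f x / fact n * t ^ n)"
proof -
  obtain M where "0 \<le> M" "\<And>x. \<bar>f x\<bar> \<le> M" using bounded_funD[OF assms] by auto
  then show ?thesis
    by (intro summable_comparison_test'[OF summable_majorant[of M t], of 0])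
      (use series_term_le[of M f] in auto)
qed

lemma evol_abs_le:
  assumes M: "0 \<le> M" "\<And>x. \<bar>f x\<bar> \<le> M" and t: "0 \<le> t"
  shows "\<bar>evol t f x\<bar> \<le> M"
proof -
  have f: "bounded_fun f" by (rule bounded_funI) (rule M(2))
  have s: "summable (\<lambda>n. \<bar>(B ^^ n) f x / fact n * t ^ n\<bar>)"
    by (rule summable_comparison_test'[OF summable_majorant[of M t], of 0])
      (use series_term_le[where f = f, OF M] in auto)
  have "\<bar>\<Sum>n. (B ^^ n) f x / fact n * t ^ n\<bar> \<le> (\<Sum>n. \<bar>(B ^^ n) f x / fact n * t ^ n\<bar>)"
    by (rule summable_rabs[OF s])
  also have "\<dots> \<le> M * exp (c * \<bar>t\<bar>)"
    unfolding suminf_majorant[symmetric]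
    by (rule suminf_le[OF series_term_le[where f = f, OF M] s summable_majorant])
  finally show ?thesis
    using t unfolding evol_def abs_mult by (simp add: exp_minus divide_simps mult.commute)
qed

lemma bounded_fun_evol: "bounded_fun f \<Longrightarrow> 0 \<le> t \<Longrightarrow> bounded_fun (evol t f)"
  by (metis bounded_funD bounded_funI evol_abs_le)

lemma evol_0: "evol 0 f = f"
proof
  fix x
  show "evol 0 f x = f x"
    using powser_zero[of "\<lambda>n. (B ^^ n) f x / fact n"] by (simp add: evol_def)
qed

lemma op_series:
  assumes "bounded_fun f"
  shows "B (\<lambda>y. \<Sum>n. (B ^^ n) f y / fact n * t ^ n) x = (\<Sum>n. (B ^^ Suc n) f x / fact n * t ^ n)"
proof -
  obtain M where M: "0 \<le> M" "\<And>x. \<bar>f x\<bar> \<le> M" using bounded_funD[OF assms] by auto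
  define F where "F N y = (\<Sum>n<N. (B ^^ n) f y / fact n * t ^ n)" for N y
  have b: "bounded_fun (\<lambda>y. (B ^^ n) f y / fact n * t ^ n)" for n
    using bounded_fun_mult[OF bounded_fun_iterate[OF assms, of n] bounded_fun_const[of "t ^ n / fact n"]]
    by simp
  have "(\<lambda>N. B (F N) x) \<longlonglongrightarrow> B (\<lambda>y. \<Sum>n. (B ^^ n) f y / fact n * t ^ n) x"
  proof (rule op_tendsto)
    show "(\<lambda>N. F N y) \<longlonglongrightarrow> (\<Sum>n. (B ^^ n) f y / fact n * t ^ n)" for y
      unfolding F_def by (rule summable_LIMSEQ[OF series_summable[OF assms]])
    show "\<bar>F N y\<bar> \<le> M * exp (c * \<bar>t\<bar>)" for N y
    proof -
      have "\<bar>F N y\<bar> \<le> (\<Sum>n<N. M * (inverse (fact n) * (c * \<bar>t\<bar>) ^ n))"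
        unfolding F_def by (rule order_trans[OF sum_abs sum_mono]) (rule series_term_le[where f = f, OF M])
      also have "\<dots> \<le> M * exp (c * \<bar>t\<bar>)"
        unfolding suminf_majorant[symmetric]
        by (rule sum_le_suminf[OF summable_majorant]) (use M c_nonneg in auto)
      finally show ?thesis .
    qed
  qed
  moreover have "B (F N) x = (\<Sum>n<N. (B ^^ Suc n) f x / fact n * t ^ n)" for N
  proof -
    have "B (F N) x = (\<Sum>n<N. B (\<lambda>y. (B ^^ n) f y / fact n * t ^ n) x)"
      unfolding F_def by (rule op_sum) (rule b)
    also have "\<dots> = (\<Sum>n<N. (B ^^ Suc n) f x / fact n * t ^ n)"
    proof (rule sum.cong[OF refl])
      fix n
      show "B (\<lambda>y. (B ^^ n) f y / fact n * t ^ n) x = (B ^^ Suc n) f x / fact n * t ^ n"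
        using op_scale[OF bounded_fun_iterate[OF assms, of n], of "t ^ n / fact n" x]
        by (simp add: mult.commute)
    qed
    finally show ?thesis .
  qed
  ultimately have 1: "(\<lambda>n. (B ^^ Suc n) f x / fact n * t ^ n) sums B (\<lambda>y. \<Sum>n. (B ^^ n) f y / fact n * t ^ n) x"
    by (simp add: sums_def)
  then show ?thesis by (rule sums_unique)
qed

lemma evol_derivative:
  assumes f: "bounded_fun f" and t: "0 \<le> t"
  shows "((\<lambda>t. evol t f x) has_real_derivative B (evol t f) x - c * evol t f x) (at t)"
proof -
  let ?E = "\<lambda>t y. \<Sum>n. (B ^^ n) f y / fact n * t ^ n"
  have bE: "bounded_fun (?E t)"
  proof -
    have "?E t = (\<lambda>y. exp (c * t) * evol t f y)"
      by (simp add: evol_def fun_eq_iff exp_minus)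
    then show ?thesis using bounded_fun_evol[OF f t] by (simp add: bounded_fun_mult)
  qed
  have "((\<lambda>t. ?E t x) has_real_derivative (\<Sum>n. diffs (\<lambda>n. (B ^^ n) f x / fact n) n * t ^ n)) (at t)"
    by (rule termdiffs_strong_converges_everywhere) (rule series_summable[OF f])
  also have "(\<Sum>n. diffs (\<lambda>n. (B ^^ n) f x / fact n) n * t ^ n) = B (?E t) x"
    unfolding op_series[OF f] by (simp add: diffs_def del: of_nat_Suc)
  finally have "((\<lambda>t. exp (- c * t) * ?E t x) has_real_derivative
      exp (- c * t) * B (?E t) x - c * (exp (- c * t) * ?E t x)) (at t)"
    by (auto intro!: derivative_eq_intros simp: algebra_simps)
  moreover have "exp (- c * t) * B (?E t) x = B (evol t f) x"
    using op_scale[OF bE, of "exp (- c * t)" x] unfolding evol_def by (rule sym)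
  ultimately show ?thesis by (simp add: evol_def)
qed

lemma evol_continuous:
  assumes "bounded_fun f"
  shows "continuous_on {0..} (\<lambda>t. evol t f x)"
proof (rule continuous_at_imp_continuous_on, rule ballI)
  fix t :: real assume "t \<in> {0..}"
  then show "isCont (\<lambda>t. evol t f x) t"
    using DERIV_isCont[OF evol_derivative[OF assms]] by simp
qed

lemma evol_le_supersolution:
  fixes u u' :: "real \<Rightarrow> 'a \<Rightarrow> real"
  assumes bound: "\<And>t x. 0 \<le> t \<Longrightarrow> \<bar>u t x\<bar> \<le> M"
    and cont: "\<And>x. continuous_on {0..} (\<lambda>t. u t x)"
    and der: "\<And>t x. 0 \<le> t \<Longrightarrow> ((\<lambda>t. u t x) has_real_derivative u' t x) (at_right t)"
    and super: "\<And>t x. 0 \<le> t \<Longrightarrow> B (u t) x - c * u t x \<le> u' t x"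
    and f: "bounded_fun f" and init: "\<And>x. f x \<le> u 0 x"
    and T: "0 \<le> T"
  shows "evol T f x \<le> u T x"
proof -
  obtain N where N: "0 \<le> N" "\<And>x. \<bar>f x\<bar> \<le> N" using bounded_funD[OF f] by auto
  have "0 \<le> u T x - evol T f x"
  proof (rule comparison[where u = "\<lambda>t x. u t x - evol t f x" and M = "M + N"
        and u' = "\<lambda>t x. u' t x - (B (evol t f) x - c * evol t f x)"])
    fix t :: real and x assume t: "0 \<le> t"
    show "\<bar>u t x - evol t f x\<bar> \<le> M + N"
      using bound[OF t, of x] evol_abs_le[where f = f, OF N t, of x] by linarith
    show "((\<lambda>t. u t x - evol t f x) has_real_derivative
        u' t x - (B (evol t f) x - c * evol t f x)) (at_right t)"
      by (intro DERIV_diff der t has_field_derivative_at_within[OF evol_derivative] f)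
    have "B (\<lambda>x. u t x - evol t f x) x = B (u t) x - B (evol t f) x"
      by (rule op_diff) (auto intro: bounded_funI[OF bound[OF t]] bounded_fun_evol f t)
    then show "B (\<lambda>x. u t x - evol t f x) x - c * (u t x - evol t f x) \<le>
        u' t x - (B (evol t f) x - c * evol t f x)"
      using super[OF t, of x] by (simp add: algebra_simps)
  next
    show "continuous_on {0..} (\<lambda>t. u t x - evol t f x)" for x
      by (intro continuous_on_diff cont evol_continuous f)
    show "0 \<le> u 0 x - evol 0 f x" for x using init[of x] by (simp add: evol_0)
  qed (rule T)
  then show ?thesis by simp
qed

lemma evol_minus: "bounded_fun f \<Longrightarrow> evol t (\<lambda>x. - f x) x = - evol t f x"
proof -
  assume f: "bounded_fun f"
  have "(B ^^ n) (\<lambda>x. - f x) = (\<lambda>y. - (B ^^ n) f y)" for n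
    by (induction n) (auto simp: op_minus[OF bounded_fun_iterate[OF f]])
  then show ?thesis
    using suminf_minus[OF series_summable[OF f, of x t]] by (simp add: evol_def)
qed

lemma evol_unique:
  fixes u :: "real \<Rightarrow> 'a \<Rightarrow> real"
  assumes bound: "\<And>t x. 0 \<le> t \<Longrightarrow> \<bar>u t x\<bar> \<le> M"
    and cont: "\<And>x. continuous_on {0..} (\<lambda>t. u t x)"
    and der: "\<And>t x. 0 \<le> t \<Longrightarrow> ((\<lambda>t. u t x) has_real_derivative B (u t) x - c * u t x) (at_right t)"
    and T: "0 \<le> T"
  shows "u T x = evol T (u 0) x"
proof (rule antisym)
  have f: "bounded_fun (u t)" if "0 \<le> t" for t by (rule bounded_funI) (rule bound[OF that])
  show "evol T (u 0) x \<le> u T x"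
    by (rule evol_le_supersolution[OF bound cont der _ f _ T]) auto
  have "evol T (\<lambda>x. - u 0 x) x \<le> - u T x"
  proof (rule evol_le_supersolution[where u' = "\<lambda>t x. - (B (u t) x - c * u t x)"])
    show "((\<lambda>t. - u t x) has_real_derivative - (B (u t) x - c * u t x)) (at_right t)"
      if "0 \<le> t" for t x by (intro DERIV_minus der that)
    show "B (\<lambda>x. - u t x) x - c * - u t x \<le> - (B (u t) x - c * u t x)" if "0 \<le> t" for t x
      by (simp add: op_minus[OF f[OF that]])
  qed (use bound T in \<open>auto intro!: continuous_intros cont f\<close>)
  then show "u T x \<le> evol T (u 0) x" by (simp add: evol_minus f)
qed

lemma evol_nonneg:
  assumes "bounded_fun f" "\<And>x. 0 \<le> f x" "0 \<le> t"
  shows "0 \<le> evol t f x"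
proof -
  obtain N where N: "0 \<le> N" "\<And>x. \<bar>f x\<bar> \<le> N" using bounded_funD[OF assms(1)] by auto
  show ?thesis
    by (rule comparison[where u = "\<lambda>t. evol t f", OF evol_abs_le[where f = f, OF N] evol_continuous[OF assms(1)]
          has_field_derivative_at_within[OF evol_derivative[OF assms(1)]]])
      (use assms in \<open>auto simp: evol_0\<close>)
qed

lemma evol_add:
  assumes f: "bounded_fun f" and g: "bounded_fun g"
  shows "evol t (\<lambda>x. f x + g x) x = evol t f x + evol t g x"
proof -
  have "(B ^^ n) (\<lambda>x. f x + g x) = (\<lambda>y. (B ^^ n) f y + (B ^^ n) g y)" for n
    by (induction n) (auto simp: op_add[OF bounded_fun_iterate[OF f] bounded_fun_iterate[OF g]])
  then show ?thesis
    using suminf_add[OF series_summable[OF f, of x t] series_summable[OF g, of x t]]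
    by (simp add: evol_def add_divide_distrib distrib_right flip: distrib_left)
qed

lemma evol_diff:
  assumes f: "bounded_fun f" and g: "bounded_fun g"
  shows "evol t (\<lambda>x. f x - g x) x = evol t f x - evol t g x"
  using evol_add[OF f bounded_fun_minus[OF g], of t x] by (simp add: evol_minus[OF g])

lemma evol_scale:
  assumes f: "bounded_fun f"
  shows "evol t (\<lambda>x. a * f x) x = a * evol t f x"
proof -
  have "(B ^^ n) (\<lambda>x. a * f x) = (\<lambda>y. a * (B ^^ n) f y)" for n
    by (induction n) (auto simp: op_scale[OF bounded_fun_iterate[OF f]])
  then show ?thesis
    using suminf_mult[OF series_summable[OF f], of a x t] by (simp add: evol_def mult.assoc)
qed

lemma evol_mono:
  assumes "bounded_fun f" "bounded_fun g" "\<And>x. f x \<le> g x" "0 \<le> t"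
  shows "evol t f x \<le> evol t g x"
proof -
  have "0 \<le> evol t (\<lambda>x. g x - f x) x"
    by (rule evol_nonneg) (use assms in auto)
  then show ?thesis by (simp add: evol_diff assms)
qed

lemma evol_abs_le_evol:
  assumes "bounded_fun f" "bounded_fun g" "\<And>x. \<bar>f x\<bar> \<le> g x" "0 \<le> t"
  shows "\<bar>evol t f x\<bar> \<le> evol t g x"
proof -
  have le: "f x \<le> g x" "- f x \<le> g x" for x using assms(3)[of x] by auto
  have "evol t f x \<le> evol t g x" by (rule evol_mono[OF assms(1,2) le(1) assms(4)])
  moreover have "evol t (\<lambda>x. - f x) x \<le> evol t g x"
    by (rule evol_mono[OF bounded_fun_minus[OF assms(1)] assms(2) le(2) assms(4)])
  ultimately show ?thesis by (simp add: evol_minus assms)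
qed

lemma evol_semigroup:
  assumes f: "bounded_fun f" and s: "0 \<le> s" and t: "0 \<le> t"
  shows "evol (s + t) f x = evol s (evol t f) x"
proof -
  obtain N where N: "0 \<le> N" "\<And>x. \<bar>f x\<bar> \<le> N" using bounded_funD[OF f] by auto
  have der: "((\<lambda>s. evol (s + t) f x) has_real_derivative
      B (evol (s + t) f) x - c * evol (s + t) f x) (at s)" if "0 \<le> s" for s x
    using DERIV_shift[THEN iffD1, OF evol_derivative[OF f, of "s + t" x]] that t by simp
  have "evol (s + t) f x = evol s (evol (0 + t) f) x"
  proof (rule evol_unique[where u = "\<lambda>s. evol (s + t) f" and M = N])
    show "continuous_on {0..} (\<lambda>s. evol (s + t) f x)" for x
      using DERIV_isCont[OF der] by (intro continuous_at_imp_continuous_on) auto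
  qed (use evol_abs_le[where f = f, OF N] t s in \<open>auto intro: has_field_derivative_at_within[OF der]\<close>)
  then show ?thesis by simp
qed

lemma evol_tendsto:
  assumes bound: "\<And>n x. \<bar>F n x\<bar> \<le> M" and lim: "\<And>x. (\<lambda>n. F n x) \<longlonglongrightarrow> f x"
  shows "(\<lambda>n. evol t (F n) x) \<longlonglongrightarrow> evol t f x"
proof -
  have M: "0 \<le> M" using bound[of 0 x] by auto
  have iter: "(\<lambda>n. (B ^^ k) (F n) x) \<longlonglongrightarrow> (B ^^ k) f x" for k x
  proof (induction k arbitrary: x)
    case (Suc k)
    show ?case
      using op_tendsto[where F = "\<lambda>n. (B ^^ k) (F n)", OF iterate_abs_le[OF M bound] Suc] by simp
  qed (simp add: lim)
  have "(\<lambda>n. \<Sum>k. (B ^^ k) (F n) x / fact k * t ^ k) \<longlonglongrightarrow> (\<Sum>k. (B ^^ k) f x / fact k * t ^ k)"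
  proof (rule tannerys_theorem[THEN conjunct2, THEN conjunct2])
    show "\<forall>\<^sub>F (k, n) in at_top \<times>\<^sub>F sequentially. norm ((B ^^ k) (F n) x / fact k * t ^ k)
        \<le> M * (inverse (fact k) * (c * \<bar>t\<bar>) ^ k)"
      using series_term_le[OF M bound] by (intro always_eventually) (auto simp: case_prod_unfold)
    show "summable (\<lambda>k. M * (inverse (fact k) * (c * \<bar>t\<bar>) ^ k))" by (rule summable_majorant)
  qed (auto intro!: tendsto_intros iter)
  then show ?thesis unfolding evol_def by (rule tendsto_mult_left)
qed

lemma evol_le_of_superharmonic:
  assumes "bounded_fun f" "\<And>x. B f x \<le> c * f x" "0 \<le> t"
  shows "evol t f x \<le> f x"
proof -
  obtain N where N: "0 \<le> N" "\<And>x. \<bar>f x\<bar> \<le> N" using bounded_funD[OF assms(1)] by auto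
  show ?thesis
    by (rule evol_le_supersolution[where u = "\<lambda>t. f" and u' = "\<lambda>t x. 0" and M = N])
      (use N assms in auto)
qed

lemma evol_ge_of_subharmonic:
  assumes f: "bounded_fun f" and sub: "\<And>x. c * f x \<le> B f x" and t: "0 \<le> t"
  shows "f x \<le> evol t f x"
  using evol_le_of_superharmonic[of "\<lambda>x. - f x" t x] assms
  by (simp add: evol_minus op_minus bounded_fun_minus)

lemma evol_one_le: "0 \<le> t \<Longrightarrow> evol t (\<lambda>x. 1) x \<le> 1"
  by (rule evol_le_of_superharmonic) (use op_mass in auto)

lemma harmonic_of_evol_fixed:
  assumes f: "bounded_fun f" and fixed: "\<And>t x. 0 \<le> t \<Longrightarrow> evol t f x = f x"
  shows "B f x = c * f x"
proof -
  have "((\<lambda>t. evol t f x) has_real_derivative B f x - c * f x) (at 0 within {0..})"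
    using has_field_derivative_at_within[OF evol_derivative[OF f, of 0 x], of "{0..}"] by (simp add: evol_0)
  then have "((\<lambda>t. f x) has_real_derivative B f x - c * f x) (at 0 within {0..})"
    by (rule has_field_derivative_transform_within[of _ _ _ _ 1]) (auto simp: fixed)
  moreover have "((\<lambda>t. f x) has_real_derivative 0) (at 0 within {0..})" by simp
  ultimately have "B f x - c * f x = 0"
    unfolding has_field_derivative_iff
    by (intro tendsto_unique[rotated]) (auto simp: at_within_Ici_at_right)
  then show ?thesis by simp
qed

end

section \<open>Sums with summable weights\<close>

lemma weighted_summable_on:
  fixes a f :: "'i \<Rightarrow> real"
  assumes a: "\<And>i. i \<in> S \<Longrightarrow> 0 \<le> a i" "a summable_on S" and f: "\<And>i. i \<in> S \<Longrightarrow> \<bar>f i\<bar> \<le> M"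
  shows "(\<lambda>i. a i * f i) summable_on S"
proof -
  have "(\<lambda>i. M * a i) summable_on S"
    by (rule summable_on_cmult_right[OF a(2)])
  moreover have "norm (a i * f i) \<le> M * a i" if "i \<in> S" for i
    using mult_left_mono[OF f[OF that] a(1)[OF that]] a(1)[OF that] by (simp add: abs_mult mult.commute)
  ultimately have "(\<lambda>i. norm (a i * f i)) summable_on S"
    by (rule Infinite_Sum.abs_summable_on_comparison_test')
  then show ?thesis by (rule summable_on_iff_abs_summable_on_real[THEN iffD2])
qed

lemma weighted_infsum_eq_integral:
  fixes a f :: "'i \<Rightarrow> real"
  assumes "\<And>i. i \<in> S \<Longrightarrow> 0 \<le> a i" "a summable_on S" "\<And>i. i \<in> S \<Longrightarrow> \<bar>f i\<bar> \<le> M"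
  shows "integrable (count_space S) (\<lambda>i. a i * f i)"
    and "(\<Sum>\<^sub>\<infinity>i\<in>S. a i * f i) = (\<integral>i. a i * f i \<partial>count_space S)"
proof -
  have "Infinite_Set_Sum.abs_summable_on (\<lambda>i. a i * f i) S"
    unfolding abs_summable_equivalent[symmetric] summable_on_iff_abs_summable_on_real[symmetric]
    by (rule weighted_summable_on[of S a f M, OF assms])
  then show "integrable (count_space S) (\<lambda>i. a i * f i)"
    and "(\<Sum>\<^sub>\<infinity>i\<in>S. a i * f i) = (\<integral>i. a i * f i \<partial>count_space S)"
    by (simp_all add: infsetsum_infsum[symmetric] infsetsum_def Infinite_Set_Sum.abs_summable_on_def)
qed

lemma weighted_infsum_tendsto:
  fixes a f :: "'i \<Rightarrow> real"
  assumes a: "\<And>i. i \<in> S \<Longrightarrow> 0 \<le> a i" "a summable_on S"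
    and F: "\<And>n i. i \<in> S \<Longrightarrow> \<bar>F n i\<bar> \<le> M" and lim: "\<And>i. i \<in> S \<Longrightarrow> (\<lambda>n. F n i) \<longlonglongrightarrow> f i"
  shows "(\<lambda>n. \<Sum>\<^sub>\<infinity>i\<in>S. a i * F n i) \<longlonglongrightarrow> (\<Sum>\<^sub>\<infinity>i\<in>S. a i * f i)"
proof -
  have f: "\<bar>f i\<bar> \<le> M" if "i \<in> S" for i
    by (rule LIMSEQ_le_const2[OF tendsto_rabs[OF lim[OF that]]]) (use F that in auto)
  have "(\<lambda>n. \<integral>i. a i * F n i \<partial>count_space S) \<longlonglongrightarrow> (\<integral>i. a i * f i \<partial>count_space S)"
  proof (rule integral_dominated_convergence[where w = "\<lambda>i. a i * M"])
    show "integrable (count_space S) (\<lambda>i. a i * M)"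
      by (rule weighted_infsum_eq_integral[where M = "\<bar>M\<bar>"]) (use a in auto)
    show "AE i in count_space S. norm (a i * F n i) \<le> a i * M" for n
      using F a by (auto simp: AE_count_space abs_mult intro!: mult_left_mono)
    show "AE i in count_space S. (\<lambda>n. a i * F n i) \<longlonglongrightarrow> a i * f i"
      using lim by (auto simp: AE_count_space intro!: tendsto_intros)
  qed auto
  moreover have "(\<Sum>\<^sub>\<infinity>i\<in>S. a i * F n i) = (\<integral>i. a i * F n i \<partial>count_space S)" for n
    by (rule weighted_infsum_eq_integral[where M = M]) (use a F in auto)
  moreover have "(\<Sum>\<^sub>\<infinity>i\<in>S. a i * f i) = (\<integral>i. a i * f i \<partial>count_space S)"
    by (rule weighted_infsum_eq_integral[where M = M]) (use a f in auto)
  ultimately show ?thesis by simp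
qed

lemma integral_weighted_infsum:
  fixes a :: "'i::countable \<Rightarrow> real" and g :: "'i \<Rightarrow> 'b \<Rightarrow> real"
  assumes "finite_measure N" and a: "\<And>i. i \<in> S \<Longrightarrow> 0 \<le> a i" "a summable_on S"
    and g: "\<And>i. i \<in> S \<Longrightarrow> g i \<in> borel_measurable N" "\<And>i w. i \<in> S \<Longrightarrow> \<bar>g i w\<bar> \<le> M"
  shows "(\<integral>w. (\<Sum>\<^sub>\<infinity>i\<in>S. a i * g i w) \<partial>N) = (\<Sum>\<^sub>\<infinity>i\<in>S. a i * (\<integral>w. g i w \<partial>N))"
proof -
  interpret finite_measure N by fact
  interpret pair_sigma_finite "count_space S" N
    by (intro pair_sigma_finite.intro sigma_finite_measure_count_space_countable) (auto intro: sigma_finite_measure_axioms)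
  have gi: "integrable N (g i)" if "i \<in> S" for i
    by (rule integrable_const_bound[where B = M]) (use g that in auto)
  have gb: "(\<integral>w. \<bar>g i w\<bar> \<partial>N) \<le> M * measure N (space N)" if "i \<in> S" for i
    using integral_mono[OF integrable_abs[OF gi[OF that]] integrable_const[of M]] g(2)[OF that]
    by (simp add: mult.commute)
  have int: "integrable (count_space S \<Otimes>\<^sub>M N) (case_prod (\<lambda>i w. a i * g i w))"
  proof (rule Fubini_integrable)
    show "(\<lambda>(i, w). a i * g i w) \<in> borel_measurable (count_space S \<Otimes>\<^sub>M N)"
      by (intro measurable_pair_measure_countable1) (use g in auto)
    have "integrable (count_space S) (\<lambda>i. a i * (\<integral>w. \<bar>g i w\<bar> \<partial>N))"
      by (rule weighted_infsum_eq_integral[where M = "M * measure N (space N)"]) (use a gb in auto)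
    then show "integrable (count_space S) (\<lambda>i. \<integral>w. norm (case (i, w) of (i, w) \<Rightarrow> a i * g i w) \<partial>N)"
      by (rule Bochner_Integration.integrable_cong[THEN iffD1, rotated 2]) (use a in \<open>auto simp: abs_mult\<close>)
  qed (auto simp: AE_count_space gi)
  have "(\<integral>w. (\<Sum>\<^sub>\<infinity>i\<in>S. a i * g i w) \<partial>N) = (\<integral>w. (\<integral>i. a i * g i w \<partial>count_space S) \<partial>N)"
    by (intro Bochner_Integration.integral_cong refl weighted_infsum_eq_integral[where M = M]) (use a g in auto)
  also have "\<dots> = (\<integral>i. (\<integral>w. a i * g i w \<partial>N) \<partial>count_space S)"
    by (rule Fubini_integral[OF int])
  also have "\<dots> = (\<integral>i. a i * (\<integral>w. g i w \<partial>N) \<partial>count_space S)"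
    by simp
  also have "\<dots> = (\<Sum>\<^sub>\<infinity>i\<in>S. a i * (\<integral>w. g i w \<partial>N))"
  proof (rule weighted_infsum_eq_integral(2)[symmetric, where M = "M * measure N (space N)"])
    show "\<bar>\<integral>w. g i w \<partial>N\<bar> \<le> M * measure N (space N)" if "i \<in> S" for i
      using integral_abs_bound[of N "g i"] gb[OF that] by linarith
  qed (use a in auto)
  finally show ?thesis .
qed

text \<open>
  Scheffe's lemma: nonnegative weights that converge pointwise without losing mass converge in
  \<open>l^1\<close>, hence against every bounded function.
\<close>

lemma weighted_infsum_tendsto_of_mass:
  fixes a :: "'h \<Rightarrow> 'i \<Rightarrow> real" and b f :: "'i \<Rightarrow> real"
  assumes a: "\<forall>\<^sub>F h in F. (\<forall>i\<in>S. 0 \<le> a h i) \<and> a h summable_on S"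
    and b: "\<And>i. i \<in> S \<Longrightarrow> 0 \<le> b i" "b summable_on S"
    and lim: "\<And>i. i \<in> S \<Longrightarrow> ((\<lambda>h. a h i) \<longlongrightarrow> b i) F"
    and mass: "((\<lambda>h. \<Sum>\<^sub>\<infinity>i\<in>S. a h i) \<longlongrightarrow> (\<Sum>\<^sub>\<infinity>i\<in>S. b i)) F"
    and f: "\<And>i. i \<in> S \<Longrightarrow> \<bar>f i\<bar> \<le> M"
  shows "((\<lambda>h. \<Sum>\<^sub>\<infinity>i\<in>S. a h i * f i) \<longlongrightarrow> (\<Sum>\<^sub>\<infinity>i\<in>S. b i * f i)) F"
proof (rule tendstoI)
  fix e :: real assume e: "0 < e"
  define N where "N = \<bar>M\<bar> + 1"
  have N: "0 < N" by (simp add: N_def)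
  have fN: "\<bar>f i\<bar> \<le> N" if "i \<in> S" for i using f[OF that] by (simp add: N_def)
  define d where "d = e / (4 * N)"
  have d: "0 < d" "N * d = e / 4" using e N by (simp_all add: d_def)
  obtain T where T: "finite T" "T \<subseteq> S" "dist (sum b T) (infsum b S) \<le> d"
    using infsum_finite_approximation[OF b(2) d(1)] by blast
  have tail: "\<bar>(\<Sum>\<^sub>\<infinity>i\<in>S. w i * f i) - (\<Sum>i\<in>T. w i * f i)\<bar> \<le> N * (infsum w S - sum w T)"
    if w: "\<forall>i\<in>S. 0 \<le> w i" "w summable_on S" for w
  proof -
    have split: "infsum u S = sum u T + infsum u (S - T)" if "u summable_on S" for u :: "'i \<Rightarrow> real"
    proof -
      have "infsum u (T \<union> (S - T)) = infsum u T + infsum u (S - T)"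
        by (rule infsum_Un_disjoint) (use T that in \<open>auto intro: summable_on_subset_banach\<close>)
      moreover have "T \<union> (S - T) = S" using T by auto
      ultimately show ?thesis using T by simp
    qed
    have wf: "(\<lambda>i. w i * f i) summable_on S"
      by (rule weighted_summable_on[where M = N]) (use w fN in auto)
    have "\<bar>\<Sum>\<^sub>\<infinity>i\<in>S - T. w i * f i\<bar> \<le> (\<Sum>\<^sub>\<infinity>i\<in>S - T. N * w i)"
      unfolding real_norm_def[symmetric]
    proof (rule norm_infsum_le[OF has_sum_infsum has_sum_infsum])
      show "(\<lambda>i. w i * f i) summable_on S - T" by (rule summable_on_subset_banach[OF wf]) auto
      show "(\<lambda>i. N * w i) summable_on S - T"
        by (intro summable_on_cmult_right summable_on_subset_banach[OF w(2)]) auto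
      show "norm (w i * f i) \<le> N * w i" if "i \<in> S - T" for i
        using mult_left_mono[of "\<bar>f i\<bar>" N "w i"] fN[of i] w(1) that by (auto simp: abs_mult mult.commute)
    qed
    also have "\<dots> = N * infsum w (S - T)" by (rule infsum_cmult_right')
    finally show ?thesis using split[OF wf] split[OF w(2)] by simp
  qed
  have "infsum b S - sum b T \<le> d" using T(3) by (simp add: dist_real_def)
  then have bd: "N * (infsum b S - sum b T) \<le> N * d" using N by (intro mult_left_mono) auto
  have tailb: "\<bar>(\<Sum>\<^sub>\<infinity>i\<in>S. b i * f i) - (\<Sum>i\<in>T. b i * f i)\<bar> \<le> N * d"
    using tail[of b] b bd by fastforce
  have "((\<lambda>h. N * (infsum (a h) S - sum (a h) T)) \<longlongrightarrow> N * (infsum b S - sum b T)) F"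
    by (intro tendsto_intros mass lim) (use T in auto)
  moreover have "N * (infsum b S - sum b T) < e / 2"
    using bd d(2) e by linarith
  ultimately have ev1: "\<forall>\<^sub>F h in F. N * (infsum (a h) S - sum (a h) T) < e / 2"
    by (rule order_tendstoD(2))
  have "((\<lambda>h. \<Sum>i\<in>T. a h i * f i) \<longlongrightarrow> (\<Sum>i\<in>T. b i * f i)) F"
    by (intro tendsto_intros lim) (use T in auto)
  then have ev2: "\<forall>\<^sub>F h in F. dist (\<Sum>i\<in>T. a h i * f i) (\<Sum>i\<in>T. b i * f i) < e / 4"
    by (rule tendstoD) (use e in simp)
  show "\<forall>\<^sub>F h in F. dist (\<Sum>\<^sub>\<infinity>i\<in>S. a h i * f i) (\<Sum>\<^sub>\<infinity>i\<in>S. b i * f i) < e"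
    using a ev1 ev2
  proof eventually_elim
    case (elim h)
    then have "\<bar>(\<Sum>\<^sub>\<infinity>i\<in>S. a h i * f i) - (\<Sum>i\<in>T. a h i * f i)\<bar> < e / 2"
      using tail[of "a h"] by auto
    with elim(3) tailb d(2) show ?case unfolding dist_real_def by linarith
  qed
qed

section \<open>Generators of jump processes\<close>

text \<open>
  The properties required of \<open>\<lambda>f. B f x\<close> by \<open>positive_operator\<close>, apart from the bound on the mass. They are stable
  under sums, so they can be checked jump by jump.
\<close>

definition positive_functional :: "(('a \<Rightarrow> real) \<Rightarrow> real) \<Rightarrow> bool" where
  "positive_functional \<phi> \<longleftrightarrow>
     (\<forall>f g. bounded_fun f \<longrightarrow> bounded_fun g \<longrightarrow> \<phi> (\<lambda>x. f x + g x) = \<phi> f + \<phi> g) \<and>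
     (\<forall>f a. bounded_fun f \<longrightarrow> \<phi> (\<lambda>x. a * f x) = a * \<phi> f) \<and>
     (\<forall>f. bounded_fun f \<longrightarrow> (\<forall>x. 0 \<le> f x) \<longrightarrow> 0 \<le> \<phi> f) \<and>
     (\<forall>F f M. (\<forall>n x. \<bar>F n x\<bar> \<le> M) \<longrightarrow> (\<forall>x. (\<lambda>n. F n x) \<longlonglongrightarrow> f x) \<longrightarrow> (\<lambda>n. \<phi> (F n)) \<longlonglongrightarrow> \<phi> f)"

lemma positive_functional_eval:
  assumes "0 \<le> a" shows "positive_functional (\<lambda>f. a * f x)"
  using assms by (auto simp: positive_functional_def algebra_simps intro!: tendsto_intros)

lemma positive_functional_add:
  assumes "positive_functional \<phi>" "positive_functional \<psi>"
  shows "positive_functional (\<lambda>f. \<phi> f + \<psi> f)"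
  unfolding positive_functional_def
proof (intro conjI allI impI)
  note p = assms(1)[unfolded positive_functional_def] and q = assms(2)[unfolded positive_functional_def]
  fix f g :: "_ \<Rightarrow> real" and r :: real and F :: "nat \<Rightarrow> _ \<Rightarrow> real" and M :: real
  show "\<phi> (\<lambda>x. f x + g x) + \<psi> (\<lambda>x. f x + g x) = \<phi> f + \<psi> f + (\<phi> g + \<psi> g)"
    if "bounded_fun f" "bounded_fun g"
    using p[THEN conjunct1, rule_format, OF that] q[THEN conjunct1, rule_format, OF that] by simp
  show "\<phi> (\<lambda>x. r * f x) + \<psi> (\<lambda>x. r * f x) = r * (\<phi> f + \<psi> f)" if "bounded_fun f"
    using p[THEN conjunct2, THEN conjunct1, rule_format, OF that]
      q[THEN conjunct2, THEN conjunct1, rule_format, OF that] by (simp add: distrib_left)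
  show "0 \<le> \<phi> f + \<psi> f" if "bounded_fun f" "\<forall>x. 0 \<le> f x"
    using p[THEN conjunct2, THEN conjunct2, THEN conjunct1, rule_format, OF that(1)]
      q[THEN conjunct2, THEN conjunct2, THEN conjunct1, rule_format, OF that(1)] that(2)
    by (simp add: add_nonneg_nonneg)
  show "(\<lambda>n. \<phi> (F n) + \<psi> (F n)) \<longlonglongrightarrow> \<phi> f + \<psi> f"
    if "\<forall>n x. \<bar>F n x\<bar> \<le> M" "\<forall>x. (\<lambda>n. F n x) \<longlonglongrightarrow> f x"
    by (rule tendsto_add[OF p[THEN conjunct2, THEN conjunct2, THEN conjunct2, rule_format, OF that[rule_format]]
          q[THEN conjunct2, THEN conjunct2, THEN conjunct2, rule_format, OF that[rule_format]]])
qed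

lemma positive_functional_zero: "positive_functional (\<lambda>f. 0)"
  by (simp add: positive_functional_def)

lemma positive_functional_sum:
  "(\<And>i. i \<in> I \<Longrightarrow> positive_functional (\<phi> i)) \<Longrightarrow> positive_functional (\<lambda>f. \<Sum>i\<in>I. \<phi> i f)"
  by (induction I rule: infinite_finite_induct) (auto intro: positive_functional_add positive_functional_zero)

lemma positive_functional_infsum:
  fixes a :: "'i \<Rightarrow> real"
  assumes a: "\<And>i. i \<in> S \<Longrightarrow> 0 \<le> a i" "a summable_on S"
  shows "positive_functional (\<lambda>f. \<Sum>\<^sub>\<infinity>i\<in>S. a i * f (\<tau> i))"
  unfolding positive_functional_def
proof (intro conjI allI impI)
  have sum: "(\<lambda>i. a i * f (\<tau> i)) summable_on S" if f: "bounded_fun f" for f :: "_ \<Rightarrow> real"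
  proof -
    obtain M where "\<And>x. \<bar>f x\<bar> \<le> M" using bounded_funD[OF f] by auto
    then show ?thesis by (intro weighted_summable_on[where M = M] a) auto
  qed
  fix f g :: "_ \<Rightarrow> real" and r :: real and F :: "nat \<Rightarrow> _ \<Rightarrow> real" and M :: real
  show "(\<Sum>\<^sub>\<infinity>i\<in>S. a i * (f (\<tau> i) + g (\<tau> i))) = (\<Sum>\<^sub>\<infinity>i\<in>S. a i * f (\<tau> i)) + (\<Sum>\<^sub>\<infinity>i\<in>S. a i * g (\<tau> i))"
    if "bounded_fun f" "bounded_fun g"
    by (simp add: distrib_left infsum_add sum that)
  show "(\<Sum>\<^sub>\<infinity>i\<in>S. a i * (r * f (\<tau> i))) = r * (\<Sum>\<^sub>\<infinity>i\<in>S. a i * f (\<tau> i))" if "bounded_fun f"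
    by (simp add: mult.left_commute[of _ r] infsum_cmult_right')
  show "0 \<le> (\<Sum>\<^sub>\<infinity>i\<in>S. a i * f (\<tau> i))" if "\<forall>x. 0 \<le> f x"
    by (rule infsum_nonneg) (use a that in auto)
  show "(\<lambda>n. \<Sum>\<^sub>\<infinity>i\<in>S. a i * F n (\<tau> i)) \<longlonglongrightarrow> (\<Sum>\<^sub>\<infinity>i\<in>S. a i * f (\<tau> i))"
    if "\<forall>n x. \<bar>F n x\<bar> \<le> M" "\<forall>x. (\<lambda>n. F n x) \<longlonglongrightarrow> f x"
    by (rule weighted_infsum_tendsto[where M = M]) (use a that in auto)
qed

lemma positive_functional_cong:
  assumes \<phi>: "positive_functional \<phi>" and eq: "\<And>f. bounded_fun f \<Longrightarrow> \<psi> f = \<phi> f"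
  shows "positive_functional \<psi>"
  unfolding positive_functional_def
proof (intro conjI allI impI)
  fix f g :: "_ \<Rightarrow> real" and r :: real and F :: "nat \<Rightarrow> _ \<Rightarrow> real" and M :: real
  show "(\<lambda>n. \<psi> (F n)) \<longlonglongrightarrow> \<psi> f" if F: "\<forall>n x. \<bar>F n x\<bar> \<le> M" "\<forall>x. (\<lambda>n. F n x) \<longlonglongrightarrow> f x"
  proof -
    have "\<bar>f x\<bar> \<le> M" for x
      by (rule LIMSEQ_le_const2[OF tendsto_rabs[OF F(2)[rule_format]]]) (use F in auto)
    then have "bounded_fun f" by (rule bounded_funI)
    moreover have "bounded_fun (F n)" for n by (rule bounded_funI) (use F in auto)
    moreover have "(\<lambda>n. \<phi> (F n)) \<longlonglongrightarrow> \<phi> f"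
      by (rule \<phi>[unfolded positive_functional_def, THEN conjunct2, THEN conjunct2, THEN conjunct2,
            rule_format, OF F[rule_format]])
    ultimately show ?thesis by (simp add: eq)
  qed
  note p = \<phi>[unfolded positive_functional_def]
  show "\<psi> (\<lambda>x. f x + g x) = \<psi> f + \<psi> g" if fg: "bounded_fun f" "bounded_fun g"
    using p[THEN conjunct1, rule_format, OF fg]
    by (simp add: eq[OF fg(1)] eq[OF fg(2)] eq[OF bounded_fun_add[OF fg]])
  show "\<psi> (\<lambda>x. r * f x) = r * \<psi> f" if f: "bounded_fun f"
    using p[THEN conjunct2, THEN conjunct1, rule_format, OF f]
    by (simp add: eq[OF f] eq[OF bounded_fun_mult[OF bounded_fun_const f]])
  show "0 \<le> \<psi> f" if f: "bounded_fun f" "\<forall>x. 0 \<le> f x"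
    using p[THEN conjunct2, THEN conjunct2, THEN conjunct1, rule_format, OF f(1)] f by (simp add: eq[OF f(1)])
qed

lemma positive_operatorI:
  assumes "\<And>x. positive_functional (\<lambda>f. B f x)" "\<And>x. B (\<lambda>x. 1) x \<le> c"
  shows "positive_operator B c"
proof
  fix f g :: "'a \<Rightarrow> real" and r :: real and F :: "nat \<Rightarrow> 'a \<Rightarrow> real" and M :: real and y
  note p = assms(1)[of y, unfolded positive_functional_def]
  show "B (\<lambda>x. f x + g x) y = B f y + B g y" if "bounded_fun f" "bounded_fun g"
    by (rule p[THEN conjunct1, rule_format, OF that])
  show "B (\<lambda>x. r * f x) y = r * B f y" if "bounded_fun f"
    by (rule p[THEN conjunct2, THEN conjunct1, rule_format, OF that])
  show "0 \<le> B f y" if "bounded_fun f" "\<And>x. 0 \<le> f x"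
    by (rule p[THEN conjunct2, THEN conjunct2, THEN conjunct1, rule_format, OF that])
  show "(\<lambda>n. B (F n) y) \<longlonglongrightarrow> B f y"
    if "\<And>n x. \<bar>F n x\<bar> \<le> M" "\<And>x. (\<lambda>n. F n x) \<longlonglongrightarrow> f x"
    by (rule p[THEN conjunct2, THEN conjunct2, THEN conjunct2, rule_format, OF that])
qed (rule assms(2))

text \<open>
  \<open>V\<close> is a rate of killing. Points outside of \<open>A\<close> are made absorbing, so that functions on the whole type can be used.
\<close>

definition jump_generator ::
    "'a set \<Rightarrow> ('a \<Rightarrow> 'a \<Rightarrow> real) \<Rightarrow> ('a \<Rightarrow> real) \<Rightarrow> ('a \<Rightarrow> real) \<Rightarrow> 'a \<Rightarrow> real" where
  "jump_generator A r V f x =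
     (if x \<in> A then (\<Sum>\<^sub>\<infinity>y\<in>A - {x}. r x y * (f y - f x)) - V x * f x else 0)"

locale jump_rates =
  fixes A :: "'a set" and r :: "'a \<Rightarrow> 'a \<Rightarrow> real" and V :: "'a \<Rightarrow> real" and c :: real
  assumes rate_nonneg: "x \<in> A \<Longrightarrow> y \<in> A \<Longrightarrow> x \<noteq> y \<Longrightarrow> 0 \<le> r x y"
    and killing_nonneg: "x \<in> A \<Longrightarrow> 0 \<le> V x"
    and rate_summable: "x \<in> A \<Longrightarrow> r x summable_on A - {x}"
    and total_rate_le: "x \<in> A \<Longrightarrow> (\<Sum>\<^sub>\<infinity>y\<in>A - {x}. r x y) + V x \<le> c"
    and bound_nonneg: "0 \<le> c"
begin

abbreviation "gen \<equiv> jump_generator A r V"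

lemma jump_summable:
  assumes "x \<in> A" "bounded_fun f"
  shows "(\<lambda>y. r x y * f y) summable_on A - {x}"
proof -
  obtain M where "\<And>x. \<bar>f x\<bar> \<le> M" using bounded_funD[OF assms(2)] by auto
  then show ?thesis using assms by (intro weighted_summable_on[where M = M] rate_summable rate_nonneg) auto
qed

lemma gen_eq:
  assumes "x \<in> A" "bounded_fun f"
  shows "gen f x = (\<Sum>\<^sub>\<infinity>y\<in>A - {x}. r x y * f y) - ((\<Sum>\<^sub>\<infinity>y\<in>A - {x}. r x y) + V x) * f x"
proof -
  have "(\<Sum>\<^sub>\<infinity>y\<in>A - {x}. r x y * (f y - f x)) = (\<Sum>\<^sub>\<infinity>y\<in>A - {x}. r x y * f y + (- f x) * r x y)"
    by (simp add: algebra_simps)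
  also have "\<dots> = (\<Sum>\<^sub>\<infinity>y\<in>A - {x}. r x y * f y) + (\<Sum>\<^sub>\<infinity>y\<in>A - {x}. (- f x) * r x y)"
    by (intro infsum_add jump_summable summable_on_cmult_right rate_summable assms)
  also have "\<dots> = (\<Sum>\<^sub>\<infinity>y\<in>A - {x}. r x y * f y) - f x * (\<Sum>\<^sub>\<infinity>y\<in>A - {x}. r x y)"
    unfolding infsum_cmult_right' by simp
  finally show ?thesis using assms(1) by (simp add: jump_generator_def algebra_simps)
qed

sublocale positive_operator "\<lambda>f x. gen f x + c * f x" c
proof (rule positive_operatorI)
  fix x
  show "positive_functional (\<lambda>f. gen f x + c * f x)"
  proof (cases "x \<in> A")
    case True
    show ?thesis
    proof (rule positive_functional_cong)
      show "positive_functional (\<lambda>f. (\<Sum>\<^sub>\<infinity>y\<in>A - {x}. r x y * f y) +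
          (c - ((\<Sum>\<^sub>\<infinity>y\<in>A - {x}. r x y) + V x)) * f x)"
        by (intro positive_functional_add positive_functional_infsum positive_functional_eval)
          (use True rate_nonneg rate_summable total_rate_le in auto)
    qed (simp add: gen_eq[OF True] algebra_simps)
  next
    case False
    then show ?thesis
      using positive_functional_eval[OF bound_nonneg, of x] by (simp add: jump_generator_def)
  qed
  show "gen (\<lambda>x. 1) x + c * 1 \<le> c"
    using killing_nonneg by (simp add: jump_generator_def)
qed

lemma gen_derivative:
  assumes "bounded_fun f" "0 \<le> t"
  shows "((\<lambda>t. evol t f x) has_real_derivative gen (evol t f) x) (at t)"
  using evol_derivative[OF assms, of x] by simp

lemma gen_eq_0_of_evol_fixed:
  assumes "bounded_fun f" "\<And>t x. 0 \<le> t \<Longrightarrow> evol t f x = f x"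
  shows "gen f x = 0"
  using harmonic_of_evol_fixed[OF assms, of x] by simp

end

section \<open>Transition functions of Markov chains\<close>

locale markov_jump_process = jump_rates A r V c
  for A :: "'a::countable set" and r V c +
  fixes P :: "'a \<Rightarrow> 'w measure" and X :: "real \<Rightarrow> 'w \<Rightarrow> 'a"
  assumes chain: "markov_chain A r P X"
begin

sublocale free: jump_rates A r "\<lambda>x. 0" c
proof
  show "(\<Sum>\<^sub>\<infinity>y\<in>A - {x}. r x y) + 0 \<le> c" if "x \<in> A" for x
    using total_rate_le[OF that] killing_nonneg[OF that] by simp
qed (use rate_nonneg rate_summable bound_nonneg in auto)

lemma prob_space_P: "x \<in> A \<Longrightarrow> prob_space (P x)"
  using chain by (simp add: markov_chain_def)

lemma measurable_X_A: "x \<in> A \<Longrightarrow> 0 \<le> t \<Longrightarrow> X t \<in> P x \<rightarrow>\<^sub>M count_space A"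
  using chain by (simp add: markov_chain_def)

lemma X_in_A: "x \<in> A \<Longrightarrow> 0 \<le> t \<Longrightarrow> w \<in> space (P x) \<Longrightarrow> X t w \<in> A"
  using measurable_space[OF measurable_X_A] by fastforce

lemma measurable_X: "x \<in> A \<Longrightarrow> 0 \<le> t \<Longrightarrow> X t \<in> P x \<rightarrow>\<^sub>M count_space UNIV"
  using measurable_compose[OF measurable_X_A, of x t "\<lambda>y. y" "count_space UNIV"] by simp

text \<open>
  The value outside of \<open>A\<close> matches the convention that \<open>jump_generator\<close> is absorbing there.
\<close>

definition law :: "real \<Rightarrow> 'a \<Rightarrow> 'a pmf" where
  "law t x = (if x \<in> A \<and> 0 \<le> t then Abs_pmf (distr (P x) (count_space UNIV) (X t)) else return_pmf x)"

lemma measure_pmf_law: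
  assumes "x \<in> A" "0 \<le> t"
  shows "measure_pmf (law t x) = distr (P x) (count_space UNIV) (X t)"
proof -
  interpret D: prob_space "distr (P x) (count_space UNIV) (X t)"
    by (rule prob_space.prob_space_distr[OF prob_space_P measurable_X]) (use assms in auto)
  have "AE y in distr (P x) (count_space UNIV) (X t).
      measure (distr (P x) (count_space UNIV) (X t)) {y} \<noteq> 0"
    by (rule D.AE_support_countable[THEN iffD2]) (auto intro: exI[of _ UNIV])
  then show ?thesis
    using assms D.prob_space_axioms by (simp add: law_def Abs_pmf_inverse)
qed

lemma pmf_law:
  assumes "x \<in> A" "0 \<le> t"
  shows "pmf (law t x) y = trans_prob P X t x y"
  using assms measure_distr[OF measurable_X[OF assms], of "{y}"]
  by (simp add: pmf.rep_eq measure_pmf_law trans_prob_def vimage_def Int_def conj_commute)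

lemma pmf_law_outside: "x \<in> A \<Longrightarrow> 0 \<le> t \<Longrightarrow> y \<notin> A \<Longrightarrow> pmf (law t x) y = 0"
proof -
  assume "x \<in> A" "0 \<le> t" "y \<notin> A"
  moreover from this have "{w \<in> space (P x). X t w = y} = {}" using X_in_A by blast
  ultimately show ?thesis by (simp add: pmf_law trans_prob_def del: Collect_empty_eq)
qed

definition past :: "'a \<Rightarrow> real \<Rightarrow> 'w measure" where
  "past x s = sigma (space (P x)) {{w \<in> space (P x). X u w = a} | u a. 0 \<le> u \<and> u \<le> s}"

lemma space_past: "space (past x s) = space (P x)"
  unfolding past_def by (rule space_measure_of) auto

lemma sets_past: "sets (past x s) = sigma_sets (space (P x)) {{w \<in> space (P x). X u w = a} | u a. 0 \<le> u \<and> u \<le> s}"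
  unfolding past_def by (rule sets_measure_of) auto

lemma sets_level: "x \<in> A \<Longrightarrow> 0 \<le> u \<Longrightarrow> {w \<in> space (P x). X u w = a} \<in> sets (P x)"
  using measurable_sets[OF measurable_X, of x u "{a}"] by (simp add: vimage_def Int_def conj_commute)

lemma subalgebra_past: "x \<in> A \<Longrightarrow> subalgebra (P x) (past x s)"
proof -
  assume x: "x \<in> A"
  have "sigma_sets (space (P x)) {{w \<in> space (P x). X u w = a} | u a. 0 \<le> u \<and> u \<le> s} \<subseteq> sets (P x)"
    by (rule sets.sigma_sets_subset) (use sets_level[OF x] in auto)
  then show ?thesis by (simp add: subalgebra_def space_past sets_past)
qed

lemma measurable_X_past:
  assumes "x \<in> A" "0 \<le> u" "u \<le> s"
  shows "X u \<in> past x s \<rightarrow>\<^sub>M count_space UNIV"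
  unfolding measurable_count_space_eq2_countable
proof (safe)
  fix a
  have "X u -` {a} \<inter> space (past x s) = {w \<in> space (P x). X u w = a}"
    by (auto simp: space_past)
  then show "X u -` {a} \<inter> space (past x s) \<in> sets (past x s)"
    unfolding sets_past using assms by (intro sigma_sets.Basic) auto
qed auto

lemma markov_property:
  assumes x: "x \<in> A" and s: "0 \<le> s" and t: "0 \<le> t" and B: "B \<in> sets (past x s)"
    and y: "y \<in> A" and z: "z \<in> A"
  shows "measure (P x) {w \<in> B. X s w = y \<and> X (s + t) w = z} = measure (P x) {w \<in> B. X s w = y} * pmf (law t y) z"
proof -
  have "\<forall>s\<ge>0. \<forall>t\<ge>0. \<forall>y\<in>A. \<forall>z\<in>A. \<forall>B\<in>sets (past x s).
      measure (P x) {w \<in> B. X s w = y \<and> X (s + t) w = z} = measure (P x) {w \<in> B. X s w = y} * trans_prob P X t y z"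
    using chain[unfolded markov_chain_def, rule_format, OF x] unfolding sets_past by (elim conjE)
  from this[rule_format, OF s t y z B] show ?thesis by (simp only: pmf_law[OF y t])
qed

text \<open>
  On an event of the past with \<open>X s = y\<close> the law of \<open>X (s + t)\<close> is a multiple of \<open>law t y\<close>. Both measures live on a
  countable set, where they need only be compared on points.
\<close>

lemma markov_nn_indicator_at:
  fixes f :: "'a \<Rightarrow> ennreal"
  assumes x: "x \<in> A" and s: "0 \<le> s" and t: "0 \<le> t" and B: "B \<in> sets (past x s)"
  shows "(\<integral>\<^sup>+w. indicator {w \<in> B. X s w = y} w * f (X (s + t) w) \<partial>P x) =
    (\<integral>\<^sup>+w. indicator {w \<in> B. X s w = y} w * (\<integral>\<^sup>+z. f z \<partial>law t y) \<partial>P x)"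
proof -
  interpret prob_space "P x" by (rule prob_space_P[OF x])
  have B': "B \<in> sets (P x)" using B subalgebra_past[OF x] by (auto simp: subalgebra_def)
  have Bs: "B \<subseteq> space (P x)" by (rule sets.sets_into_space[OF B'])
  define D where "D = {w \<in> B. X s w = y}"
  have "D = B \<inter> {w \<in> space (P x). X s w = y}" using Bs by (auto simp: D_def)
  then have D: "D \<in> sets (P x)" using B' sets_level[OF x s] by auto
  note [measurable] = measurable_X[OF x add_nonneg_nonneg[OF s t]] D
  have "distr (density (P x) (indicator D)) (count_space UNIV) (X (s + t)) =
      scale_measure (emeasure (P x) D) (measure_pmf (law t y))" (is "?M = ?N")
  proof (rule measure_eqI_countable[of _ UNIV])
    fix z
    have lvl: "{w \<in> space (P x). X (s + t) w = z} \<in> sets (P x)" by (rule sets_level[OF x]) (use s t in auto)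
    have "emeasure ?M {z} = emeasure (density (P x) (indicator D)) {w \<in> space (P x). X (s + t) w = z}"
      by (subst emeasure_distr) (auto simp: vimage_def Int_def conj_commute)
    also have "\<dots> = (\<integral>\<^sup>+w. indicator (D \<inter> {w \<in> space (P x). X (s + t) w = z}) w \<partial>P x)"
      unfolding indicator_inter_arith by (rule emeasure_density) (use lvl in auto)
    also have "\<dots> = emeasure (P x) (D \<inter> {w \<in> space (P x). X (s + t) w = z})"
      using D lvl by (intro nn_integral_indicator) auto
    also have "D \<inter> {w \<in> space (P x). X (s + t) w = z} = {w \<in> B. X s w = y \<and> X (s + t) w = z}"
      using Bs by (auto simp: D_def)
    also have "emeasure (P x) \<dots> = emeasure (P x) D * pmf (law t y) z"
    proof (cases "y \<in> A \<and> z \<in> A")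
      case True
      then show ?thesis
        using markov_property[OF x s t B, of y z] by (simp add: emeasure_eq_measure D_def ennreal_mult)
    next
      case False
      then have "{w \<in> B. X s w = y \<and> X (s + t) w = z} = {}" "y \<notin> A \<Longrightarrow> D = {}"
        using X_in_A[OF x] s t Bs by (auto simp: D_def)
      with False show ?thesis
        using t by (cases "y \<in> A") (simp_all add: pmf_law_outside del: Collect_empty_eq)
    qed
    finally show "emeasure ?M {z} = emeasure ?N {z}"
      by (simp add: emeasure_pmf_single)
  qed auto
  then have "nn_integral ?M f = nn_integral ?N f" by simp
  moreover have "nn_integral ?M f = (\<integral>\<^sup>+w. indicator D w * f (X (s + t) w) \<partial>P x)"
    by (subst nn_integral_distr, simp, simp, subst nn_integral_density) auto
  moreover have "nn_integral ?N f = (\<integral>\<^sup>+w. indicator D w * (\<integral>\<^sup>+z. f z \<partial>law t y) \<partial>P x)"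
    by (simp add: nn_integral_scale_measure nn_integral_multc)
  ultimately show ?thesis by (simp add: D_def)
qed

lemma markov_nn_indicator:
  fixes f :: "'a \<Rightarrow> ennreal"
  assumes x: "x \<in> A" and s: "0 \<le> s" and t: "0 \<le> t" and B: "B \<in> sets (past x s)"
  shows "(\<integral>\<^sup>+w. indicator B w * f (X (s + t) w) \<partial>P x) =
    (\<integral>\<^sup>+w. indicator B w * (\<integral>\<^sup>+z. f z \<partial>law t (X s w)) \<partial>P x)"
proof -
  interpret prob_space "P x" by (rule prob_space_P[OF x])
  interpret pair_sigma_finite "P x" "count_space (UNIV::'a set)"
    by (intro pair_sigma_finite.intro sigma_finite_measure_count_space_countable) (auto intro: sigma_finite_measure_axioms)
  have B': "B \<in> sets (P x)" using B subalgebra_past[OF x] by (auto simp: subalgebra_def)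
  have Bs: "B \<subseteq> space (P x)" by (rule sets.sets_into_space[OF B'])
  have D: "{w \<in> B. X s w = y} \<in> sets (P x)" for y
  proof -
    have "{w \<in> B. X s w = y} = B \<inter> {w \<in> space (P x). X s w = y}" using Bs by auto
    then show ?thesis using B' sets_level[OF x s] by auto
  qed
  have split: "(\<integral>\<^sup>+w. indicator B w * h w \<partial>P x) =
      (\<integral>\<^sup>+y. (\<integral>\<^sup>+w. indicator {w \<in> B. X s w = y} w * h w \<partial>P x) \<partial>count_space UNIV)"
    if h[measurable]: "h \<in> borel_measurable (P x)" for h :: "'w \<Rightarrow> ennreal"
  proof -
    have "(\<integral>\<^sup>+w. indicator B w * h w \<partial>P x) =
        (\<integral>\<^sup>+w. (\<integral>\<^sup>+y. (indicator B w * h w) * indicator {X s w} y \<partial>count_space UNIV) \<partial>P x)"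
      by (intro nn_integral_cong) (simp del: nn_integral_indicator_singleton add: nn_integral_cmult)
    also have "\<dots> = (\<integral>\<^sup>+w. (\<integral>\<^sup>+y. indicator {w \<in> B. X s w = y} w * h w \<partial>count_space UNIV) \<partial>P x)"
      by (intro nn_integral_cong) (auto split: split_indicator)
    also have "\<dots> = (\<integral>\<^sup>+y. (\<integral>\<^sup>+w. indicator {w \<in> B. X s w = y} w * h w \<partial>P x) \<partial>count_space UNIV)"
    proof (rule Fubini'[symmetric])
      have "(\<lambda>(y, w). indicator {w \<in> B. X s w = y} w * h w) \<in> borel_measurable (count_space UNIV \<Otimes>\<^sub>M P x)"
        by (intro measurable_pair_measure_countable1) (use D in auto)
      then show "(\<lambda>(w, y). indicator {w \<in> B. X s w = y} w * h w) \<in> borel_measurable (P x \<Otimes>\<^sub>M count_space UNIV)"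
        by (subst measurable_pair_swap_iff) (simp add: case_prod_unfold)
    qed
    finally show ?thesis .
  qed
  have m1: "(\<lambda>w. f (X (s + t) w)) \<in> borel_measurable (P x)"
    by (rule measurable_compose[OF measurable_X]) (use x s t in auto)
  have m2: "(\<lambda>w. \<integral>\<^sup>+z. f z \<partial>law t (X s w)) \<in> borel_measurable (P x)"
    by (rule measurable_compose[OF measurable_X[OF x s], where g = "\<lambda>y. \<integral>\<^sup>+z. f z \<partial>law t y"]) auto
  show ?thesis
    unfolding split[OF m1] split[OF m2] markov_nn_indicator_at[OF x s t B]
    by (intro nn_integral_cong) (auto split: split_indicator)
qed

text \<open>
  The measures whose densities are \<open>f (X (s + t))\<close> and its mean given \<open>X s\<close> agree on all events of the past, hence
  give the same integral to every weight \<open>Z\<close> that is measurable with respect to the past.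
\<close>

lemma markov_nn:
  fixes f :: "'a \<Rightarrow> ennreal"
  assumes x: "x \<in> A" and s: "0 \<le> s" and t: "0 \<le> t" and Z: "Z \<in> borel_measurable (past x s)"
  shows "(\<integral>\<^sup>+w. Z w * f (X (s + t) w) \<partial>P x) = (\<integral>\<^sup>+w. Z w * (\<integral>\<^sup>+z. f z \<partial>law t (X s w)) \<partial>P x)"
proof -
  have m1[measurable]: "(\<lambda>w. f (X (s + t) w)) \<in> borel_measurable (P x)"
    by (rule measurable_compose[OF measurable_X]) (use x s t in auto)
  have m2[measurable]: "(\<lambda>w. \<integral>\<^sup>+z. f z \<partial>law t (X s w)) \<in> borel_measurable (P x)"
    by (rule measurable_compose[OF measurable_X[OF x s], where g = "\<lambda>y. \<integral>\<^sup>+z. f z \<partial>law t y"]) auto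
  let ?M = "density (P x) (\<lambda>w. f (X (s + t) w))"
  let ?N = "density (P x) (\<lambda>w. \<integral>\<^sup>+z. f z \<partial>law t (X s w))"
  have sub: "subalgebra (P x) (past x s)" by (rule subalgebra_past[OF x])
  then have subM: "subalgebra ?M (past x s)" and subN: "subalgebra ?N (past x s)"
    by (simp_all add: subalgebra_def)
  have ZP[measurable]: "Z \<in> borel_measurable (P x)" by (rule measurable_from_subalg[OF sub Z])
  have "restr_to_subalg ?M (past x s) = restr_to_subalg ?N (past x s)"
  proof (rule measure_eqI)
    fix B assume "B \<in> sets (restr_to_subalg ?M (past x s))"
    then have B: "B \<in> sets (past x s)" by (simp add: sets_restr_to_subalg[OF subM])
    then have B'[measurable]: "B \<in> sets (P x)" using sub by (auto simp: subalgebra_def)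
    show "emeasure (restr_to_subalg ?M (past x s)) B = emeasure (restr_to_subalg ?N (past x s)) B"
      using markov_nn_indicator[OF x s t B, of f]
      by (simp add: emeasure_restr_to_subalg[OF subM B] emeasure_restr_to_subalg[OF subN B]
          emeasure_density mult.commute)
  qed (simp add: sets_restr_to_subalg[OF subM] sets_restr_to_subalg[OF subN])
  then have "nn_integral ?M Z = nn_integral ?N Z"
    using nn_integral_subalgebra2[OF subM Z] nn_integral_subalgebra2[OF subN Z] by simp
  then show ?thesis by (simp add: nn_integral_density mult.commute)
qed

definition mean :: "real \<Rightarrow> ('a \<Rightarrow> real) \<Rightarrow> 'a \<Rightarrow> real" where
  "mean t f x = measure_pmf.expectation (law t x) f"

lemma integrable_law: "bounded_fun f \<Longrightarrow> integrable (measure_pmf (law t x)) f"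
proof -
  assume f: "bounded_fun f"
  obtain M where "\<And>x. \<bar>f x\<bar> \<le> M" using bounded_funD[OF f] by auto
  then show ?thesis by (intro measure_pmf.integrable_const_bound[where B = M]) auto
qed

lemma mean_add: "bounded_fun f \<Longrightarrow> bounded_fun g \<Longrightarrow> mean t (\<lambda>x. f x + g x) x = mean t f x + mean t g x"
  unfolding mean_def by (intro Bochner_Integration.integral_add integrable_law)

lemma mean_const: "mean t (\<lambda>x. a) x = a"
  by (simp add: mean_def)

lemma mean_diff_const: "bounded_fun f \<Longrightarrow> mean t (\<lambda>x. f x - a) x = mean t f x - a"
  using mean_add[of f "\<lambda>x. - a" t x] by (simp add: mean_const)

lemma mean_mono: "bounded_fun f \<Longrightarrow> bounded_fun g \<Longrightarrow> (\<And>x. f x \<le> g x) \<Longrightarrow> mean t f x \<le> mean t g x"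
  unfolding mean_def by (intro integral_mono integrable_law)

lemma mean_abs_le:
  assumes "\<And>x. \<bar>f x\<bar> \<le> M" shows "\<bar>mean t f x\<bar> \<le> M"
proof -
  have f: "bounded_fun f" by (rule bounded_funI) (rule assms)
  have le: "f x \<le> M" "- M \<le> f x" for x using assms[of x] by auto
  show ?thesis
    using mean_mono[OF f bounded_fun_const le(1), of t x] mean_mono[OF bounded_fun_const f le(2), of t x]
    by (simp add: mean_const)
qed

lemma mean_eq_integral:
  assumes "x \<in> A" "0 \<le> t"
  shows "mean t f x = (\<integral>w. f (X t w) \<partial>P x)"
  unfolding mean_def measure_pmf_law[OF assms]
  by (rule integral_distr[OF measurable_X[OF assms]]) simp

lemma mean_outside: "x \<notin> A \<Longrightarrow> mean t f x = f x"
  by (simp add: mean_def law_def)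

lemma markov_integral:
  assumes x: "x \<in> A" and s: "0 \<le> s" and t: "0 \<le> t"
    and Z: "Z \<in> borel_measurable (past x s)" "\<And>w. 0 \<le> Z w"
    and f: "bounded_fun f" "\<And>y. 0 \<le> f y"
  shows "(\<integral>w. Z w * f (X (s + t) w) \<partial>P x) = (\<integral>w. Z w * mean t f (X s w) \<partial>P x)"
proof -
  have ZP[measurable]: "Z \<in> borel_measurable (P x)"
    by (rule measurable_from_subalg[OF subalgebra_past[OF x] Z(1)])
  have m1[measurable]: "(\<lambda>w. f (X (s + t) w)) \<in> borel_measurable (P x)"
    by (rule measurable_compose[OF measurable_X]) (use x s t in auto)
  have m2[measurable]: "(\<lambda>w. mean t f (X s w)) \<in> borel_measurable (P x)"
    by (rule measurable_compose[OF measurable_X[OF x s], where g = "\<lambda>y. mean t f y"]) auto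
  have nn: "(\<integral>\<^sup>+z. ennreal (f z) \<partial>law t y) = ennreal (mean t f y)" for y
    unfolding mean_def by (intro nn_integral_eq_integral integrable_law f) (use f in auto)
  have mean_nonneg: "0 \<le> mean t f y" for y
    unfolding mean_def using f by (simp add: integral_nonneg_AE)
  have "(\<integral>\<^sup>+w. ennreal (Z w * f (X (s + t) w)) \<partial>P x) = (\<integral>\<^sup>+w. ennreal (Z w * mean t f (X s w)) \<partial>P x)"
    using markov_nn[OF x s t, of "\<lambda>w. ennreal (Z w)" "\<lambda>z. ennreal (f z)"] Z f mean_nonneg
    by (simp add: nn ennreal_mult)
  then show ?thesis
    using Z f mean_nonneg by (simp add: integral_eq_nn_integral)
qed

lemma mean_semigroup:
  assumes s: "0 \<le> s" and t: "0 \<le> t" and f: "bounded_fun f"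
  shows "mean (s + t) f x = mean s (mean t f) x"
proof (cases "x \<in> A")
  case True
  interpret prob_space "P x" by (rule prob_space_P[OF True])
  obtain M where M: "\<And>x. \<bar>f x\<bar> \<le> M" using bounded_funD[OF f] by auto
  define g where "g y = f y + M" for y
  have g: "bounded_fun g" "0 \<le> g y" for y
    unfolding g_def using f M[of y] by auto
  have "mean (s + t) g x = mean s (mean t g) x"
    using markov_integral[OF True s t, of "\<lambda>w. 1" g] g s t by (simp add: mean_eq_integral True)
  moreover have "mean u g y = mean u f y + M" for u y
    unfolding g_def using mean_add[OF f, of "\<lambda>x. M" u y] by (simp add: mean_const)
  moreover have "mean s (\<lambda>y. mean t f y + M) x = mean s (mean t f) x + M"
    using mean_add[of "mean t f" "\<lambda>x. M" s x] bounded_funI[of "mean t f" M, OF mean_abs_le[where f = f, OF M]]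
    by (simp add: mean_const)
  moreover have "mean t g = (\<lambda>y. mean t f y + M)" using calculation(2) by auto
  ultimately show ?thesis by simp
qed (simp add: mean_outside)

lemma pmf_summable_on: "pmf p summable_on UNIV"
  using pmf_abs_summable[of p UNIV] unfolding abs_summable_equivalent[symmetric]
  by (rule summable_on_iff_abs_summable_on_real[THEN iffD2])

lemma mean_minus_eq_infsum:
  assumes x: "x \<in> A" and h: "0 \<le> h" and f: "bounded_fun f"
  shows "mean h f x - f x = (\<Sum>\<^sub>\<infinity>y\<in>A - {x}. pmf (law h x) y * (f y - f x))"
proof -
  obtain M where M: "\<And>x. \<bar>f x\<bar> \<le> M" using bounded_funD[OF f] by auto
  have sum: "(\<lambda>y. pmf (law h x) y) summable_on UNIV"
    by (rule pmf_summable_on)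
  have bd: "\<bar>f y - f x\<bar> \<le> 2 * M" for y using M[of x] M[of y] by linarith
  have s: "Infinite_Set_Sum.abs_summable_on (\<lambda>y. pmf (law h x) y * (f y - f x)) UNIV"
    unfolding abs_summable_equivalent[symmetric] summable_on_iff_abs_summable_on_real[symmetric]
    by (rule weighted_summable_on[where M = "2 * M"]) (use sum bd in auto)
  have "mean h f x - f x = mean h (\<lambda>y. f y - f x) x" by (simp add: mean_diff_const f)
  also have "\<dots> = (\<Sum>\<^sub>\<infinity>y. pmf (law h x) y * (f y - f x))"
    unfolding mean_def pmf_expectation_eq_infsetsum by (rule infsetsum_infsum[OF s])
  also have "\<dots> = (\<Sum>\<^sub>\<infinity>y\<in>A - {x}. pmf (law h x) y * (f y - f x))"
    by (rule infsum_cong_neutral) (use pmf_law_outside[OF x h] in auto)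
  finally show ?thesis .
qed

lemma pmf_law_mass:
  assumes x: "x \<in> A" and h: "0 \<le> h"
  shows "pmf (law h x) summable_on A - {x}"
    and "(\<Sum>\<^sub>\<infinity>y\<in>A - {x}. pmf (law h x) y) = 1 - pmf (law h x) x"
proof -
  have "pmf (law h x) summable_on UNIV"
    by (rule pmf_summable_on)
  then show "pmf (law h x) summable_on A - {x}" by (rule summable_on_subset_banach) simp
  define f :: "'a \<Rightarrow> real" where "f = indicator (- {x})"
  have "mean h f x = 1 - pmf (law h x) x"
    using measure_pmf.prob_compl[of "{x}" "law h x"]
    by (simp add: mean_def f_def Compl_eq_Diff_UNIV pmf.rep_eq)
  moreover have "(\<Sum>\<^sub>\<infinity>y\<in>A - {x}. pmf (law h x) y * (f y - f x)) = (\<Sum>\<^sub>\<infinity>y\<in>A - {x}. pmf (law h x) y)"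
    by (rule infsum_cong) (auto simp: f_def)
  moreover have "bounded_fun f" by (rule bounded_funI[of _ 1]) (simp add: f_def indicator_def)
  ultimately show "(\<Sum>\<^sub>\<infinity>y\<in>A - {x}. pmf (law h x) y) = 1 - pmf (law h x) x"
    using mean_minus_eq_infsum[OF x h, of f] by (simp add: f_def)
qed

lemma pmf_law_0: "x \<in> A \<Longrightarrow> y \<noteq> x \<Longrightarrow> pmf (law 0 x) y = 0"
proof -
  assume x: "x \<in> A" and y: "y \<noteq> x"
  have "pmf (law 0 x) x = 1" using chain x by (simp add: pmf_law markov_chain_def)
  moreover have "pmf (law 0 x) y + pmf (law 0 x) x = measure_pmf.prob (law 0 x) {y, x}"
    using y by (simp add: measure_measure_pmf_finite)
  moreover have "\<dots> \<le> 1" by (rule measure_pmf.prob_le_1)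
  ultimately show ?thesis using pmf_nonneg[of "law 0 x" y] by linarith
qed

lemma pmf_law_derivative:
  assumes x: "x \<in> A"
  shows "y \<in> A - {x} \<Longrightarrow> ((\<lambda>h. pmf (law h x) y / h) \<longlongrightarrow> r x y) (at_right 0)"
    and "((\<lambda>h. (1 - pmf (law h x) x) / h) \<longlongrightarrow> (\<Sum>\<^sub>\<infinity>y\<in>A - {x}. r x y)) (at_right 0)"
    and "((\<lambda>h. 1 - pmf (law h x) x) \<longlongrightarrow> 0) (at_right 0)"
proof -
  have ev: "\<forall>\<^sub>F h in at_right (0::real). 0 < h" by (simp add: eventually_at_right_less)
  show "((\<lambda>h. pmf (law h x) y / h) \<longlongrightarrow> r x y) (at_right 0)" if y: "y \<in> A - {x}"
  proof -
    have "((\<lambda>t. trans_prob P X t x y) has_real_derivative r x y) (at_right 0)"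
      using chain x y unfolding markov_chain_def by (simp add: at_within_Ici_at_right)
    then have "((\<lambda>h. (trans_prob P X h x y - trans_prob P X 0 x y) / (h - 0)) \<longlongrightarrow> r x y) (at_right 0)"
      unfolding has_field_derivative_iff .
    then show ?thesis
      by (rule Lim_transform_eventually)
        (use ev in eventually_elim, use pmf_law_0[OF x, of y] y pmf_law[OF x] in auto)
  qed
  have "((\<lambda>t. trans_prob P X t x x) has_real_derivative - (\<Sum>\<^sub>\<infinity>y\<in>A - {x}. r x y)) (at_right 0)"
    using chain x unfolding markov_chain_def by (simp add: at_within_Ici_at_right)
  then have "((\<lambda>h. (trans_prob P X h x x - trans_prob P X 0 x x) / (h - 0)) \<longlongrightarrow>
      - (\<Sum>\<^sub>\<infinity>y\<in>A - {x}. r x y)) (at_right 0)"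
    unfolding has_field_derivative_iff .
  moreover have "trans_prob P X 0 x x = 1" using chain x by (simp add: markov_chain_def)
  ultimately have "((\<lambda>h. - ((trans_prob P X h x x - 1) / h)) \<longlongrightarrow>
      - (- (\<Sum>\<^sub>\<infinity>y\<in>A - {x}. r x y))) (at_right 0)"
    by (intro tendsto_minus) simp
  then have lim: "((\<lambda>h. - ((trans_prob P X h x x - 1) / h)) \<longlongrightarrow> (\<Sum>\<^sub>\<infinity>y\<in>A - {x}. r x y)) (at_right 0)"
    by simp
  then show lim2: "((\<lambda>h. (1 - pmf (law h x) x) / h) \<longlongrightarrow> (\<Sum>\<^sub>\<infinity>y\<in>A - {x}. r x y)) (at_right 0)"
    by (rule Lim_transform_eventually)
      (use ev in eventually_elim, use pmf_law[OF x] in \<open>auto simp: field_simps\<close>)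
  have "((\<lambda>h. h * ((1 - pmf (law h x) x) / h)) \<longlongrightarrow> 0 * (\<Sum>\<^sub>\<infinity>y\<in>A - {x}. r x y)) (at_right 0)"
    by (intro tendsto_mult lim2) (auto intro: tendsto_ident_at)
  then have "((\<lambda>h. h * ((1 - pmf (law h x) x) / h)) \<longlongrightarrow> 0) (at_right 0)" by simp
  then show "((\<lambda>h. 1 - pmf (law h x) x) \<longlongrightarrow> 0) (at_right 0)"
    by (rule Lim_transform_eventually) (use ev in eventually_elim, auto)
qed

text \<open>
  The rates are given entry by entry, but \<open>markov_chain\<close> also fixes the derivative on the diagonal: no mass is lost as
  \<open>h\<close> tends to \<open>0\<close>, so Scheffe's lemma gives the derivative against every bounded function.
\<close>

lemma mean_derivative_0:
  assumes x: "x \<in> A" and f: "bounded_fun f"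
  shows "((\<lambda>h. (mean h f x - f x) / h) \<longlongrightarrow> free.gen f x) (at_right 0)"
proof -
  obtain M where M: "\<And>x. \<bar>f x\<bar> \<le> M" using bounded_funD[OF f] by auto
  have ev: "\<forall>\<^sub>F h in at_right (0::real). 0 < h" by (simp add: eventually_at_right_less)
  have "((\<lambda>h. \<Sum>\<^sub>\<infinity>y\<in>A - {x}. pmf (law h x) y / h * (f y - f x)) \<longlongrightarrow>
      (\<Sum>\<^sub>\<infinity>y\<in>A - {x}. r x y * (f y - f x))) (at_right 0)"
  proof (rule weighted_infsum_tendsto_of_mass[where M = "2 * M"])
    show "\<forall>\<^sub>F h in at_right 0. (\<forall>y\<in>A - {x}. 0 \<le> pmf (law h x) y / h) \<and>
        (\<lambda>y. pmf (law h x) y / h) summable_on (A - {x})"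
      using ev
    proof eventually_elim
      case (elim h)
      then show ?case
        using summable_on_cmult_right[OF pmf_law_mass(1)[OF x], of h "1 / h"] by simp
    qed
    have "((\<lambda>h. (1 - pmf (law h x) x) / h) \<longlongrightarrow> (\<Sum>\<^sub>\<infinity>y\<in>A - {x}. r x y)) (at_right 0)"
      by (rule pmf_law_derivative(2)[OF x])
    then show "((\<lambda>h. \<Sum>\<^sub>\<infinity>y\<in>A - {x}. pmf (law h x) y / h) \<longlongrightarrow> (\<Sum>\<^sub>\<infinity>y\<in>A - {x}. r x y)) (at_right 0)"
    proof (rule Lim_transform_eventually)
      show "\<forall>\<^sub>F h in at_right 0. (1 - pmf (law h x) x) / h = (\<Sum>\<^sub>\<infinity>y\<in>A - {x}. pmf (law h x) y / h)"
        using ev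
      proof eventually_elim
        case (elim h)
        then show ?case
          using pmf_law_mass(2)[OF x, of h] infsum_cmult_right'[of "1 / h" "pmf (law h x)" "A - {x}"] by simp
      qed
    qed
    show "\<bar>f y - f x\<bar> \<le> 2 * M" for y using M[of x] M[of y] by linarith
  qed (use x rate_nonneg rate_summable pmf_law_derivative(1)[OF x] in auto)
  then have "((\<lambda>h. \<Sum>\<^sub>\<infinity>y\<in>A - {x}. pmf (law h x) y / h * (f y - f x)) \<longlongrightarrow> free.gen f x) (at_right 0)"
    using x by (simp add: jump_generator_def)
  then show ?thesis
  proof (rule Lim_transform_eventually)
    show "\<forall>\<^sub>F h in at_right 0. (\<Sum>\<^sub>\<infinity>y\<in>A - {x}. pmf (law h x) y / h * (f y - f x)) = (mean h f x - f x) / h"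
      using ev
    proof eventually_elim
      case (elim h)
      then show ?case
        using mean_minus_eq_infsum[OF x _ f, of h]
          infsum_cmult_right'[of "1 / h" "\<lambda>y. pmf (law h x) y * (f y - f x)" "A - {x}"] by simp
    qed
  qed
qed

text \<open>
  The semigroup property reduces an increment over \<open>[s, s + h]\<close> to the probability of having left \<open>x\<close> at time \<open>h\<close>,
  which does not depend on \<open>s\<close>.
\<close>

lemma mean_continuous:
  assumes f: "bounded_fun f"
  shows "continuous_on {0..} (\<lambda>t. mean t f x)"
proof (cases "x \<in> A")
  case x: True
  obtain M where M: "0 \<le> M" "\<And>x. \<bar>f x\<bar> \<le> M" using bounded_funD[OF f] by auto
  have inc: "\<bar>mean (s + h) f x - mean s f x\<bar> \<le> 2 * M * (1 - pmf (law h x) x)" if "0 \<le> s" "0 \<le> h" for s h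
  proof -
    have b: "\<bar>mean s f y - mean s f x\<bar> \<le> 2 * M" for y
      using mean_abs_le[where f = f, OF M(2), of s x] mean_abs_le[where f = f, OF M(2), of s y] by linarith
    have bs: "bounded_fun (mean s f)" by (rule bounded_funI[OF mean_abs_le[where f = f, OF M(2)]])
    have "mean (s + h) f x - mean s f x = mean h (mean s f) x - mean s f x"
      using mean_semigroup[OF that(2,1) f, of x] by (simp add: add.commute)
    also have "\<dots> = (\<Sum>\<^sub>\<infinity>y\<in>A - {x}. pmf (law h x) y * (mean s f y - mean s f x))"
      by (rule mean_minus_eq_infsum[OF x that(2) bs])
    finally have "\<bar>mean (s + h) f x - mean s f x\<bar> = norm (\<Sum>\<^sub>\<infinity>y\<in>A - {x}. pmf (law h x) y * (mean s f y - mean s f x))"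
      by simp
    also have "\<dots> \<le> (\<Sum>\<^sub>\<infinity>y\<in>A - {x}. 2 * M * pmf (law h x) y)"
    proof (rule norm_infsum_le[OF has_sum_infsum has_sum_infsum])
      show "(\<lambda>y. pmf (law h x) y * (mean s f y - mean s f x)) summable_on A - {x}"
        by (rule weighted_summable_on[where M = "2 * M"]) (use b pmf_law_mass(1)[OF x that(2)] in auto)
      show "(\<lambda>y. 2 * M * pmf (law h x) y) summable_on A - {x}"
        by (intro summable_on_cmult_right pmf_law_mass(1)[OF x that(2)])
      show "norm (pmf (law h x) y * (mean s f y - mean s f x)) \<le> 2 * M * pmf (law h x) y" for y
        using mult_left_mono[OF b[of y] pmf_nonneg[of "law h x" y]] by (simp add: abs_mult mult.commute)
    qed
    also have "\<dots> = 2 * M * (1 - pmf (law h x) x)"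
      by (simp add: infsum_cmult_right' pmf_law_mass(2)[OF x that(2)])
    finally show ?thesis .
  qed
  show ?thesis
    unfolding continuous_on_def
  proof
    fix t :: real assume t: "t \<in> {0..}"
    have ab: "filterlim (\<lambda>s. \<bar>s - t\<bar>) (at_right 0) (at t within {0..})"
      unfolding filterlim_at
      by (auto simp: eventually_at_filter intro!: tendsto_eq_intros)
    have "((\<lambda>s. 2 * M * (1 - pmf (law \<bar>s - t\<bar> x) x)) \<longlongrightarrow> 2 * M * 0) (at t within {0..})"
      by (intro tendsto_mult tendsto_const filterlim_compose[OF pmf_law_derivative(3)[OF x] ab])
    then have lim: "((\<lambda>s. 2 * M * (1 - pmf (law \<bar>s - t\<bar> x) x)) \<longlongrightarrow> 0) (at t within {0..})" by simp
    have "((\<lambda>s. mean s f x - mean t f x) \<longlongrightarrow> 0) (at t within {0..})"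
    proof (rule Lim_null_comparison[OF _ lim])
      have "\<bar>mean s f x - mean t f x\<bar> \<le> 2 * M * (1 - pmf (law \<bar>s - t\<bar> x) x)" if "s \<in> {0..}" for s
        using inc[of t "s - t"] inc[of s "t - s"] t that by (cases "t \<le> s") (auto simp: abs_minus_commute)
      then show "\<forall>\<^sub>F s in at t within {0..}. norm (mean s f x - mean t f x) \<le> 2 * M * (1 - pmf (law \<bar>s - t\<bar> x) x)"
        by (auto simp: eventually_at_filter)
    qed
    then show "((\<lambda>s. mean s f x) \<longlongrightarrow> mean t f x) (at t within {0..})" by (rule LIM_zero_cancel)
  qed
qed (simp add: mean_outside)

text \<open>
  The transition function solves the backward equation from the right, and this equation has only one bounded solution.
\<close>

lemma mean_eq_evol:
  assumes f: "bounded_fun f" and t: "0 \<le> t"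
  shows "mean t f x = free.evol t f x"
proof -
  obtain M where M: "0 \<le> M" "\<And>x. \<bar>f x\<bar> \<le> M" using bounded_funD[OF f] by auto
  have m0: "mean 0 f = f"
  proof
    fix x
    have "(\<Sum>\<^sub>\<infinity>y\<in>A - {x}. pmf (law 0 x) y * (f y - f x)) = 0" if "x \<in> A"
      by (rule infsum_0) (use pmf_law_0[OF that] in auto)
    then show "mean 0 f x = f x"
      using mean_minus_eq_infsum[of x 0 f, OF _ _ f] mean_outside[of x 0 f] by force
  qed
  have bs: "bounded_fun (mean s f)" for s by (rule bounded_funI[OF mean_abs_le[where f = f, OF M(2)]])
  have "mean t f x = free.evol t (mean 0 f) x"
  proof (rule free.evol_unique[where M = M and u = "\<lambda>t. mean t f"])
    show "\<bar>mean t f x\<bar> \<le> M" for t x by (rule mean_abs_le[where f = f, OF M(2)])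
    show "continuous_on {0..} (\<lambda>t. mean t f x)" for x by (rule mean_continuous[OF f])
    fix t :: real and x assume t: "0 \<le> t"
    have "((\<lambda>t. mean t f x) has_real_derivative free.gen (mean t f) x) (at_right t)"
    proof (cases "x \<in> A")
      case True
      have ev: "\<forall>\<^sub>F h in at_right (0::real). 0 < h" by (simp add: eventually_at_right_less)
      have "((\<lambda>h. (mean h (mean t f) x - mean t f x) / h) \<longlongrightarrow> free.gen (mean t f) x) (at_right 0)"
        by (rule mean_derivative_0[OF True bs])
      then have "((\<lambda>h. (mean (h + t) f x - mean t f x) / (h + t - t)) \<longlongrightarrow> free.gen (mean t f) x) (at_right 0)"
        by (rule Lim_transform_eventually)
          (use ev in eventually_elim, simp add: mean_semigroup[OF _ t f])
      then show ?thesis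
        unfolding has_field_derivative_iff by (subst filterlim_at_right_to_0)
    next
      case False
      then show ?thesis by (simp add: mean_outside jump_generator_def)
    qed
    then show "((\<lambda>t. mean t f x) has_real_derivative free.gen (mean t f) x + c * mean t f x - c * mean t f x) (at_right t)"
      by simp
  qed (rule t)
  then show ?thesis by (simp add: m0)
qed

end

section \<open>The Feynman-Kac formula\<close>

context positive_operator
begin

lemma generator_abs_le:
  assumes "0 \<le> M" "\<And>x. \<bar>f x\<bar> \<le> M"
  shows "\<bar>B f x - c * f x\<bar> \<le> 2 * c * M"
proof -
  have "\<bar>c * f x\<bar> \<le> c * M" using assms(2) c_nonneg by (simp add: abs_mult mult_left_mono)
  with op_abs_le[of M f x, OF assms] show ?thesis by (simp add: mult.commute)
qed

lemma evol_minus_initial_le: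
  assumes M: "0 \<le> M" "\<And>x. \<bar>f x\<bar> \<le> M" and t: "0 \<le> t"
  shows "\<bar>evol t f x - f x\<bar> \<le> 2 * c * M * t"
proof (cases "t = 0")
  case False
  have f: "bounded_fun f" by (rule bounded_funI[OF M(2)])
  have "\<exists>z>0. z < t \<and> evol t f x - evol 0 f x = (t - 0) * (B (evol z f) x - c * evol z f x)"
    by (rule MVT2[of 0 t "\<lambda>t. evol t f x"]) (use False t in \<open>auto intro: evol_derivative[OF f]\<close>)
  then obtain z where z: "0 < z" "evol t f x - f x = t * (B (evol z f) x - c * evol z f x)"
    by (auto simp: evol_0)
  have "\<bar>B (evol z f) x - c * evol z f x\<bar> \<le> 2 * c * M"
    by (rule generator_abs_le[OF M(1)]) (rule evol_abs_le[OF M], use z in simp)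
  then have "t * \<bar>B (evol z f) x - c * evol z f x\<bar> \<le> t * (2 * c * M)"
    using t by (intro mult_left_mono)
  then show ?thesis using t by (simp add: z(2) abs_mult mult.commute)
qed (simp add: evol_0)

lemma evol_taylor:
  assumes M: "0 \<le> M" "\<And>x. \<bar>f x\<bar> \<le> M" and t: "0 \<le> t"
  shows "\<bar>evol t f x - f x - t * (B f x - c * f x)\<bar> \<le> 4 * c\<^sup>2 * M * t\<^sup>2"
proof (cases "t = 0")
  case False
  have f: "bounded_fun f" by (rule bounded_funI[OF M(2)])
  have "\<exists>z>0. z < t \<and> evol t f x - evol 0 f x = (t - 0) * (B (evol z f) x - c * evol z f x)"
    by (rule MVT2[of 0 t "\<lambda>t. evol t f x"]) (use False t in \<open>auto intro: evol_derivative[OF f]\<close>)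
  then obtain z where z: "0 < z" "z < t" "evol t f x - f x = t * (B (evol z f) x - c * evol z f x)"
    by (auto simp: evol_0)
  define g where "g y = evol z f y - f y" for y
  have g: "\<bar>g y\<bar> \<le> 2 * c * M * z" for y
    unfolding g_def by (rule evol_minus_initial_le[where f = f, OF M]) (use z in simp)
  have Bg: "B g x = B (evol z f) x - B f x"
    unfolding g_def by (rule op_diff) (use f z in \<open>auto intro: bounded_fun_evol\<close>)
  have eq: "evol t f x - f x - t * (B f x - c * f x) = t * (B g x - c * g x)"
    unfolding z(3) Bg by (simp add: g_def algebra_simps)
  have "\<bar>B g x - c * g x\<bar> \<le> 2 * c * (2 * c * M * z)"
    by (rule generator_abs_le[OF _ g]) (use z M c_nonneg in auto)
  then have "\<bar>t * (B g x - c * g x)\<bar> \<le> t * (2 * c * (2 * c * M * z))"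
    using t by (simp add: abs_mult mult_left_mono)
  also have "\<dots> \<le> t * (2 * c * (2 * c * M * t))"
    using t z M c_nonneg by (intro mult_left_mono) auto
  finally show ?thesis unfolding eq by (simp add: power2_eq_square mult_ac)
qed (simp add: evol_0)

end

lemma exp_minus_approx:
  assumes "0 \<le> (u::real)"
  shows "\<bar>exp (- u) - 1 + u\<bar> \<le> u\<^sup>2"
proof -
  have "1 - u \<le> exp (- u)" using exp_ge_add_one_self[of "- u"] by simp
  moreover have "exp (- u) \<le> 1 - u + u\<^sup>2"
  proof -
    have "1 \<le> (1 + u) * (1 - u + u\<^sup>2)" using assms by (simp add: algebra_simps power2_eq_square)
    also have "\<dots> \<le> exp u * (1 - u + u\<^sup>2)"
    proof (rule mult_right_mono[OF exp_ge_add_one_self])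
      have "0 \<le> (1 - u / 2)\<^sup>2 + 3 / 4 * u\<^sup>2" by simp
      then show "0 \<le> 1 - u + u\<^sup>2" by (simp add: power2_eq_square algebra_simps)
    qed
    finally show ?thesis by (simp add: exp_minus divide_simps mult.commute)
  qed
  ultimately show ?thesis by simp
qed

text \<open>
  Right endpoints make Riemann sums converge for paths that are merely right-continuous: the grid point
  above \<open>s\<close> tends to \<open>s\<close> from the right.
\<close>

context
  fixes v :: "real \<Rightarrow> real" and K :: real
  assumes bounds: "\<And>s. 0 \<le> s \<Longrightarrow> 0 \<le> v s \<and> v s \<le> K"
    and right_cont: "\<And>t. 0 \<le> t \<Longrightarrow> \<forall>\<^sub>F s in at_right t. v s = v t"
begin

lemma grid_tendsto:
  assumes s: "0 < s"
  shows "(\<lambda>k. v (\<lceil>s * real (Suc k)\<rceil> / real (Suc k))) \<longlonglongrightarrow> v s"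
proof -
  obtain d where d: "d > s" "\<And>u. u > s \<Longrightarrow> u < d \<Longrightarrow> v u = v s"
    using right_cont[of s] s unfolding eventually_at_right_field by auto
  have near: "s \<le> \<lceil>s * real (Suc k)\<rceil> / real (Suc k)"
    "\<lceil>s * real (Suc k)\<rceil> / real (Suc k) \<le> s + 1 / real (Suc k)" for k
  proof -
    have K: "0 < real (Suc k)" by simp
    have "s * real (Suc k) \<le> \<lceil>s * real (Suc k)\<rceil>" by linarith
    then show "s \<le> \<lceil>s * real (Suc k)\<rceil> / real (Suc k)"
      unfolding pos_le_divide_eq[OF K] .
    have "\<lceil>s * real (Suc k)\<rceil> \<le> s * real (Suc k) + 1" by linarith
    also have "\<dots> = (s + 1 / real (Suc k)) * real (Suc k)" unfolding distrib_right by simp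
    finally show "\<lceil>s * real (Suc k)\<rceil> / real (Suc k) \<le> s + 1 / real (Suc k)"
      unfolding pos_divide_le_eq[OF K] .
  qed
  have "(\<lambda>k. s + 1 / real (Suc k)) \<longlonglongrightarrow> s + 0"
    by (intro tendsto_add tendsto_const LIMSEQ_inverse_real_of_nat[unfolded inverse_eq_divide])
  then have "\<forall>\<^sub>F k in sequentially. s + 1 / real (Suc k) < d"
    using d(1) by (intro order_tendstoD(2)) auto
  then have "\<forall>\<^sub>F k in sequentially. v (\<lceil>s * real (Suc k)\<rceil> / real (Suc k)) = v s"
  proof eventually_elim
    case (elim k)
    show ?case
      using d(2)[of "\<lceil>s * real (Suc k)\<rceil> / real (Suc k)"] near[of k] elim
      by (cases "s = \<lceil>s * real (Suc k)\<rceil> / real (Suc k)") auto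
  qed
  then show ?thesis by (rule tendsto_eventually)
qed

lemma grid_measurable: "(\<lambda>s::real. v (\<lceil>s * real (Suc k)\<rceil> / real (Suc k))) \<in> borel_measurable borel"
proof -
  have "(\<lambda>s::real. \<lceil>s * real (Suc k)\<rceil>) \<in> borel \<rightarrow>\<^sub>M count_space UNIV" by measurable
  then show ?thesis
    by (rule measurable_compose[where g = "\<lambda>i. v (real_of_int i / real (Suc k))"]) simp
qed

lemma path_measurable: "(\<lambda>s. indicator {0<..} s * v s) \<in> borel_measurable borel"
proof (rule borel_measurable_LIMSEQ_real)
  show "(\<lambda>k. indicator {0<..} s * v (\<lceil>s * real (Suc k)\<rceil> / real (Suc k))) \<longlonglongrightarrow> indicator {0<..} s * v s" for s
    using grid_tendsto[of s] by (cases "0 < s") (auto simp: indicator_def)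
  show "(\<lambda>s. indicator {0<..} s * v (\<lceil>s * real (Suc k)\<rceil> / real (Suc k))) \<in> borel_measurable borel" for k
    using grid_measurable[of k] by measurable
qed

lemma path_integrable: "set_integrable lborel {0<..b} v"
proof -
  have "integrable lborel (\<lambda>s. indicator {0<..b} s * (indicator {0<..} s * v s))"
  proof (rule Bochner_Integration.integrable_bound)
    show "integrable lborel (\<lambda>s. indicator {0<..b} s * K)"
      by (cases "0 \<le> b") (auto intro!: integrable_mult_left integrable_real_indicator simp: emeasure_lborel_Ioc)
    show "(\<lambda>s. indicator {0<..b} s * (indicator {0<..} s * v s)) \<in> borel_measurable lborel"
      using path_measurable by measurable
    show "AE s in lborel. norm (indicator {0<..b} s * (indicator {0<..} s * v s)) \<le> norm (indicator {0<..b} s * K)"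
    proof (rule AE_I2)
      fix s :: real
      show "norm (indicator {0<..b} s * (indicator {0<..} s * v s)) \<le> norm (indicator {0<..b} s * K)"
        using bounds[of s] by (cases "0 < s") (simp_all add: indicator_def)
    qed
  qed
  then show ?thesis
    unfolding set_integrable_def
    by (rule Bochner_Integration.integrable_cong[THEN iffD1, rotated 2]) (auto simp: indicator_def)
qed

lemma grid_integral:
  "set_integrable lborel {0<..real n / real (Suc k)} (\<lambda>s. v (\<lceil>s * real (Suc k)\<rceil> / real (Suc k))) \<and>
   (LINT s:{0<..real n / real (Suc k)}|lborel. v (\<lceil>s * real (Suc k)\<rceil> / real (Suc k))) =
   (\<Sum>i=1..n. v (real i / real (Suc k)) / real (Suc k))"
proof (induction n)
  case 0
  show ?case by (simp add: set_integrable_def set_lebesgue_integral_def)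
next
  case (Suc n)
  let ?h = "\<lambda>s. v (\<lceil>s * real (Suc k)\<rceil> / real (Suc k))"
  let ?a = "real n / real (Suc k)" and ?b = "real (Suc n) / real (Suc k)"
  have ab: "?a \<le> ?b" by (simp add: divide_right_mono)
  have ce: "\<lceil>s * real (Suc k)\<rceil> = int (Suc n)" if "s \<in> {?a<..?b}" for s
    using that by (intro ceiling_unique) (auto simp: field_simps)
  have eq: "indicator {?a<..?b} s *\<^sub>R ?h s = indicator {?a<..?b} s * v ?b" for s
    using ce[of s] by (auto simp: indicator_def)
  have fin: "emeasure lborel {?a<..?b} < \<infinity>" using ab by (simp add: emeasure_lborel_Ioc)
  have int: "set_integrable lborel {?a<..?b} ?h"
    unfolding set_integrable_def eq by (intro integrable_mult_left integrable_real_indicator) (use fin in auto)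
  have "(LINT s:{?a<..?b}|lborel. ?h s) = (LINT s|lborel. indicator {?a<..?b} s * v ?b)"
    unfolding set_lebesgue_integral_def eq ..
  also have "\<dots> = measure lborel {?a<..?b} * v ?b" by simp
  also have "measure lborel {?a<..?b} = 1 / real (Suc k)"
  proof -
    have "?b - ?a = (real (Suc n) - real n) / real (Suc k)" by (simp only: diff_divide_distrib)
    then show ?thesis using measure_lborel_Ioc[OF ab] by simp
  qed
  finally have val: "(LINT s:{?a<..?b}|lborel. ?h s) = v ?b / real (Suc k)" by simp
  have un: "{0<..?b} = {0<..?a} \<union> {?a<..?b}" 
    by (rule ivl_disj_un_two(6)[symmetric, OF _ ab]) simp
  have "set_integrable lborel {0<..?b} ?h"
    unfolding un using Suc int by (intro set_integrable_Un) auto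
  moreover have "(LINT s:{0<..?b}|lborel. ?h s) = (LINT s:{0<..?a}|lborel. ?h s) + (LINT s:{?a<..?b}|lborel. ?h s)"
    unfolding un using Suc int by (intro set_integral_Un) auto
  ultimately show ?case using Suc val by simp
qed

lemma riemann_sum_tendsto:
  "(\<lambda>k. \<Sum>i=1..m * Suc k. v (real i / real (Suc k)) / real (Suc k)) \<longlonglongrightarrow> (LINT s:{0<..real m}|lborel. v s)"
proof -
  have "(\<lambda>k. LINT s|lborel. indicator {0<..real m} s *\<^sub>R v (\<lceil>s * real (Suc k)\<rceil> / real (Suc k)))
      \<longlonglongrightarrow> (LINT s|lborel. indicator {0<..real m} s *\<^sub>R v s)"
  proof (rule integral_dominated_convergence[where w = "\<lambda>s. indicator {0<..real m} s * K"])
    show "(\<lambda>s. indicator {0<..real m} s *\<^sub>R v s) \<in> borel_measurable lborel"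
      using path_integrable[of "real m"] unfolding set_integrable_def by (rule borel_measurable_integrable)
    show "(\<lambda>s. indicator {0<..real m} s *\<^sub>R v (\<lceil>s * real (Suc k)\<rceil> / real (Suc k))) \<in> borel_measurable lborel" for k
      using grid_measurable[of k] by measurable
    show "integrable lborel (\<lambda>s. indicator {0<..real m} s * K)"
      by (auto intro!: integrable_mult_left integrable_real_indicator simp: emeasure_lborel_Ioc)
    show "AE s in lborel. (\<lambda>k. indicator {0<..real m} s *\<^sub>R v (\<lceil>s * real (Suc k)\<rceil> / real (Suc k)))
        \<longlonglongrightarrow> indicator {0<..real m} s *\<^sub>R v s"
      using grid_tendsto by (auto simp: indicator_def)
    show "AE s in lborel. norm (indicator {0<..real m} s *\<^sub>R v (\<lceil>s * real (Suc k)\<rceil> / real (Suc k)))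
        \<le> indicator {0<..real m} s * K" for k
    proof (rule AE_I2)
      fix s :: real
      have "0 \<le> real_of_int \<lceil>s * real (Suc k)\<rceil> / real (Suc k)" if "0 < s"
      proof -
        have "0 \<le> s * real (Suc k)" using that by simp
        then have "0 \<le> \<lceil>s * real (Suc k)\<rceil>" by linarith
        then show ?thesis by simp
      qed
      then show "norm (indicator {0<..real m} s *\<^sub>R v (\<lceil>s * real (Suc k)\<rceil> / real (Suc k)))
          \<le> indicator {0<..real m} s * K"
        using bounds[of "\<lceil>s * real (Suc k)\<rceil> / real (Suc k)"] by (auto simp: indicator_def)
    qed
  qed
  moreover have "(LINT s|lborel. indicator {0<..real m} s *\<^sub>R v (\<lceil>s * real (Suc k)\<rceil> / real (Suc k))) =
      (\<Sum>i=1..m * Suc k. v (real i / real (Suc k)) / real (Suc k))" for k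
  proof -
    have eq: "real (m * Suc k) / real (Suc k) = real m"
      unfolding of_nat_mult by (rule nonzero_mult_div_cancel_right) simp
    show ?thesis
      using grid_integral[of "m * Suc k" k, THEN conjunct2] unfolding set_lebesgue_integral_def eq .
  qed
  ultimately show ?thesis unfolding set_lebesgue_integral_def by simp
qed

lemma path_integral_mono: "m \<le> n \<Longrightarrow> (LINT s:{0<..real m}|lborel. v s) \<le> (LINT s:{0<..real n}|lborel. v s)"
  unfolding set_lebesgue_integral_def
  by (rule integral_mono[OF path_integrable[unfolded set_integrable_def] path_integrable[unfolded set_integrable_def]])
    (use bounds in \<open>auto simp: indicator_def\<close>)

lemma path_integral_nonneg: "0 \<le> (LINT s:{0<..real m}|lborel. v s)"
  using path_integral_mono[of 0 m] by (simp add: set_lebesgue_integral_def)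

lemma total_path_integral:
  "(\<integral>\<^sup>+s\<in>{0..}. ennreal (v s) \<partial>lborel) = (SUP m. ennreal (LINT s:{0<..real m}|lborel. v s))"
proof -
  let ?g = "\<lambda>m s. ennreal (indicator {0<..real m} s * v s)"
  have "(\<integral>\<^sup>+s\<in>{0..}. ennreal (v s) \<partial>lborel) = (\<integral>\<^sup>+s. (SUP m. ?g m s) \<partial>lborel)"
  proof (rule nn_integral_cong_AE)
    have "AE s in lborel. s \<noteq> (0::real)" by (rule AE_lborel_singleton)
    then show "AE s in lborel. ennreal (v s) * indicator {0..} s = (SUP m. ?g m s)"
    proof eventually_elim
      case (elim s)
      show ?case
      proof (cases "0 < s")
        case True
        obtain m where m: "s \<le> real m" using real_arch_simple by blast
        have "(SUP m. ?g m s) = ennreal (v s)"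
        proof (rule antisym)
          show "(SUP m. ?g m s) \<le> ennreal (v s)"
            by (rule SUP_least) (use True bounds[of s] in \<open>auto simp: indicator_def\<close>)
          show "ennreal (v s) \<le> (SUP m. ?g m s)"
            by (rule SUP_upper2[of m]) (use True m in auto)
        qed
        then show ?thesis using True by (simp add: indicator_def)
      qed (use elim in \<open>simp add: indicator_def\<close>)
    qed
  qed
  also have "\<dots> = (SUP m. \<integral>\<^sup>+s. ?g m s \<partial>lborel)"
  proof (rule nn_integral_monotone_convergence_SUP)
    show "incseq ?g"
      by (rule incseq_SucI) (auto simp: le_fun_def indicator_def intro!: ennreal_leI bounds[THEN conjunct1])
    show "?g m \<in> borel_measurable lborel" for m
      using borel_measurable_integrable[OF path_integrable[of "real m", unfolded set_integrable_def]] by simp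
  qed
  also have "\<dots> = (SUP m. ennreal (LINT s:{0<..real m}|lborel. v s))"
  proof (rule SUP_cong[OF refl])
    fix m
    show "(\<integral>\<^sup>+s. ?g m s \<partial>lborel) = ennreal (LINT s:{0<..real m}|lborel. v s)"
      using nn_integral_eq_integral[OF path_integrable[of "real m", unfolded set_integrable_def]] bounds
      by (simp add: set_lebesgue_integral_def indicator_def)
  qed
  finally show ?thesis .
qed

end

context markov_jump_process
begin

definition weight :: "real \<Rightarrow> 'a \<Rightarrow> real" where
  "weight h y = (if y \<in> A then exp (- (h * V y)) else 1)"

definition killed_step :: "real \<Rightarrow> ('a \<Rightarrow> real) \<Rightarrow> 'a \<Rightarrow> real" where
  "killed_step h f = mean h (\<lambda>y. weight h y * f y)"

lemma V_le: "x \<in> A \<Longrightarrow> V x \<le> c"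
proof -
  assume x: "x \<in> A"
  have "0 \<le> (\<Sum>\<^sub>\<infinity>y\<in>A - {x}. r x y)" by (rule infsum_nonneg) (use rate_nonneg x in auto)
  then show ?thesis using total_rate_le[OF x] by linarith
qed

lemma weight_bounds: "0 \<le> h \<Longrightarrow> 0 \<le> weight h y \<and> weight h y \<le> 1"
  using killing_nonneg[of y] by (auto simp: weight_def)

lemma weight_mult_abs_le:
  assumes "0 \<le> h" "\<And>x. \<bar>f x\<bar> \<le> M" shows "\<bar>weight h y * f y\<bar> \<le> M"
proof -
  have "\<bar>weight h y * f y\<bar> \<le> 1 * \<bar>f y\<bar>"
    unfolding abs_mult using weight_bounds[OF assms(1), of y] by (intro mult_right_mono) auto
  then show ?thesis using assms(2)[of y] by simp
qed

lemma killed_step_abs_le: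
  assumes "0 \<le> h" "\<And>x. \<bar>f x\<bar> \<le> M" shows "\<bar>killed_step h f x\<bar> \<le> M"
  unfolding killed_step_def by (rule mean_abs_le) (rule weight_mult_abs_le[OF assms])

text \<open>
  One step of length \<open>h\<close> that first lets the chain run and then applies the killing weight agrees with the killed
  evolution up to second order. The constant collects \<open>4 + 4\<close> from two Taylor expansions, \<open>1\<close> from the exponential
  weight, and \<open>2\<close> from moving the weight through the generator.
\<close>

lemma killed_step_error:
  assumes h: "0 \<le> h" and f: "\<And>x. \<bar>f x\<bar> \<le> 1"
  shows "\<bar>killed_step h f x - evol h f x\<bar> \<le> 11 * c\<^sup>2 * h\<^sup>2"
proof -
  define g where "g y = weight h y * f y" for y
  have bf: "bounded_fun f" by (rule bounded_funI[OF f])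
  have g1: "\<bar>g y\<bar> \<le> 1" for y unfolding g_def by (rule weight_mult_abs_le[OF h f])
  have bg: "bounded_fun g" by (rule bounded_funI[OF g1])
  have w: "\<bar>weight h y - 1\<bar> \<le> h * c" for y
  proof (cases "y \<in> A")
    case True
    have "1 - h * V y \<le> exp (- (h * V y))" using exp_ge_add_one_self[of "- (h * V y)"] by simp
    moreover have "h * V y \<le> h * c" using V_le[OF True] h by (intro mult_left_mono)
    ultimately show ?thesis
      using weight_bounds[OF h, of y] True by (simp add: weight_def)
  qed (use h bound_nonneg in \<open>simp add: weight_def\<close>)
  have gf: "\<bar>g y - f y\<bar> \<le> h * c" for y
  proof -
    have "\<bar>g y - f y\<bar> = \<bar>weight h y - 1\<bar> * \<bar>f y\<bar>"
      by (simp add: g_def abs_mult[symmetric] algebra_simps)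
    also have "\<dots> \<le> (h * c) * 1" using w[of y] f[of y] h bound_nonneg by (intro mult_mono) auto
    finally show ?thesis by simp
  qed
  define W where "W = (if x \<in> A then V x * f x else 0)"
  have second: "\<bar>g x - f x + h * W\<bar> \<le> c\<^sup>2 * h\<^sup>2"
  proof (cases "x \<in> A")
    case True
    have "\<bar>g x - f x + h * W\<bar> = \<bar>exp (- (h * V x)) - 1 + h * V x\<bar> * \<bar>f x\<bar>"
      using True by (simp add: g_def W_def weight_def abs_mult[symmetric] algebra_simps)
    also have "\<dots> \<le> (h * V x)\<^sup>2 * 1"
      by (intro mult_mono exp_minus_approx f) (use h killing_nonneg[OF True] in auto)
    also have "\<dots> \<le> (h * c)\<^sup>2"
      using h killing_nonneg[OF True] V_le[OF True] by (simp add: power_mono mult_left_mono)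
    finally show ?thesis by (simp add: power_mult_distrib mult.commute)
  qed (simp add: g_def W_def weight_def)
  have gen: "free.gen f x = gen f x + W"
    by (simp add: jump_generator_def W_def)
  have "free.gen g x - free.gen f x = (free.gen (\<lambda>y. g y - f y) x + c * (g x - f x)) - c * (g x - f x)"
    using free.op_diff[OF bg bf, of x] by (simp add: algebra_simps)
  also have "\<bar>\<dots>\<bar> \<le> 2 * c * (h * c)"
    by (rule free.generator_abs_le) (use gf h bound_nonneg in auto)
  finally have third: "\<bar>h * (free.gen g x - free.gen f x)\<bar> \<le> 2 * c\<^sup>2 * h\<^sup>2"
    using h mult_left_mono[of "\<bar>free.gen g x - free.gen f x\<bar>" "2 * c * (h * c)" h]
    by (simp add: abs_mult power2_eq_square mult_ac)
  have e1: "\<bar>free.evol h g x - g x - h * free.gen g x\<bar> \<le> 4 * c\<^sup>2 * h\<^sup>2"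
    using free.evol_taylor[where f = g and M = 1 and x = x, OF _ g1 h] by simp
  have e2: "\<bar>evol h f x - f x - h * gen f x\<bar> \<le> 4 * c\<^sup>2 * h\<^sup>2"
    using evol_taylor[where f = f and M = 1 and x = x, OF _ f h] by simp
  have "killed_step h f x = free.evol h g x"
    unfolding killed_step_def g_def[symmetric] by (rule mean_eq_evol[OF bg h])
  then have "killed_step h f x - evol h f x =
      (free.evol h g x - g x - h * free.gen g x) - (evol h f x - f x - h * gen f x)
      + (g x - f x + h * W) + h * (free.gen g x - free.gen f x)"
    unfolding gen by (simp add: algebra_simps)
  then show ?thesis using e1 e2 second third by linarith
qed

lemma killed_step_diff:
  "bounded_fun f \<Longrightarrow> bounded_fun g \<Longrightarrow> 0 \<le> h \<Longrightarrow>
    killed_step h f x - killed_step h g x = killed_step h (\<lambda>y. f y - g y) x"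
proof -
  assume f: "bounded_fun f" and g: "bounded_fun g" and h: "0 \<le> h"
  have b: "bounded_fun (\<lambda>y. weight h y * u y)" if u: "bounded_fun u" for u
  proof -
    obtain M where "\<And>y. \<bar>u y\<bar> \<le> M" using bounded_funD[OF u] by auto
    then show ?thesis by (intro bounded_funI[of _ M] weight_mult_abs_le[OF h])
  qed
  show ?thesis
    unfolding killed_step_def mean_def right_diff_distrib
    by (intro Bochner_Integration.integral_diff[symmetric] integrable_law b f g)
qed

lemma killed_steps_error:
  assumes h: "0 \<le> h"
  shows "\<bar>(killed_step h ^^ n) (\<lambda>x. 1) x - evol (real n * h) (\<lambda>x. 1) x\<bar> \<le> real n * (11 * c\<^sup>2 * h\<^sup>2)"
proof (induction n arbitrary: x)
  case 0
  show ?case by (simp add: evol_0)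
next
  case (Suc n)
  let ?F = "(killed_step h ^^ n) (\<lambda>x. 1)" and ?E = "evol (real n * h) (\<lambda>x. 1)"
  have F1: "\<bar>?F y\<bar> \<le> 1" for y
    by (induction n arbitrary: y) (auto intro: killed_step_abs_le[OF h])
  have E1: "\<bar>?E y\<bar> \<le> 1" for y by (rule evol_abs_le) (use h in auto)
  note b = bounded_funI[of ?F, OF F1] bounded_funI[of ?E, OF E1]
  have "evol (real (Suc n) * h) (\<lambda>x. 1) x = evol h ?E x"
    using evol_semigroup[of "\<lambda>x. 1" h "real n * h" x] h by (simp add: algebra_simps)
  then have "(killed_step h ^^ Suc n) (\<lambda>x. 1) x - evol (real (Suc n) * h) (\<lambda>x. 1) x
      = killed_step h (\<lambda>y. ?F y - ?E y) x + (killed_step h ?E x - evol h ?E x)"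
    using killed_step_diff[OF b h, of x] by simp
  moreover have "\<bar>killed_step h (\<lambda>y. ?F y - ?E y) x\<bar> \<le> real n * (11 * c\<^sup>2 * h\<^sup>2)"
    by (rule killed_step_abs_le[OF h]) (rule Suc)
  moreover have "\<bar>killed_step h ?E x - evol h ?E x\<bar> \<le> 11 * c\<^sup>2 * h\<^sup>2"
    by (rule killed_step_error[OF h E1])
  ultimately show ?case by (simp add: algebra_simps)
qed

lemma killed_steps_eq_integral:
  assumes x: "x \<in> A" and h: "0 \<le> h" and f: "\<And>y. 0 \<le> f y" "\<And>y. f y \<le> 1"
  shows "(\<integral>w. (\<Prod>i=1..n. weight h (X (real i * h) w)) * f (X (real n * h) w) \<partial>P x) = (killed_step h ^^ n) f x"
  using f
proof (induction n arbitrary: f)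
  case 0
  have "mean 0 f x = f x"
    using mean_eq_evol[of f 0 x] 0 by (simp add: free.evol_0 bounded_funI[of f 1])
  then show ?case using mean_eq_integral[OF x, of 0 f] by simp
next
  case (Suc n)
  let ?Z = "\<lambda>w. \<Prod>i=1..n. weight h (X (real i * h) w)" and ?g = "\<lambda>y. weight h y * f y"
  have Z: "?Z \<in> borel_measurable (past x (real n * h))"
  proof (rule borel_measurable_prod)
    fix i assume i: "i \<in> {1..n}"
    show "(\<lambda>w. weight h (X (real i * h) w)) \<in> borel_measurable (past x (real n * h))"
      by (rule measurable_compose[OF measurable_X_past[OF x]]) (use i h in \<open>auto intro: mult_right_mono\<close>)
  qed
  have g1: "\<bar>?g y\<bar> \<le> 1" for y by (rule weight_mult_abs_le[OF h]) (use Suc.prems in \<open>auto simp: abs_le_iff intro: order_trans[of _ 0]\<close>)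
  have g0: "0 \<le> ?g y" for y using Suc.prems weight_bounds[OF h] by auto
  have "(\<integral>w. (\<Prod>i=1..Suc n. weight h (X (real i * h) w)) * f (X (real (Suc n) * h) w) \<partial>P x) =
      (\<integral>w. ?Z w * ?g (X (real n * h + h) w) \<partial>P x)"
    by (simp add: algebra_simps)
  also have "\<dots> = (\<integral>w. ?Z w * killed_step h f (X (real n * h) w) \<partial>P x)"
    unfolding killed_step_def
    by (rule markov_integral[OF x _ h Z _ bounded_funI[OF g1] g0]) (use h weight_bounds[OF h] in \<open>auto intro: prod_nonneg\<close>)
  also have "\<dots> = (killed_step h ^^ n) (killed_step h f) x"
  proof (rule Suc.IH)
    fix y
    have "\<bar>killed_step h f y\<bar> \<le> 1" unfolding killed_step_def by (rule mean_abs_le[OF g1])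
    then show "killed_step h f y \<le> 1" by simp
    show "0 \<le> killed_step h f y"
      unfolding killed_step_def mean_def using g0 by (simp add: integral_nonneg_AE)
  qed
  finally show ?case by (simp add: funpow_swap1)
qed

definition path_integral :: "nat \<Rightarrow> 'w \<Rightarrow> real" where
  "path_integral m w = (LINT s:{0<..real m}|lborel. V (X s w))"

lemma path_assumptions:
  assumes x: "x \<in> A" and w: "w \<in> space (P x)"
  shows "\<And>s. 0 \<le> s \<Longrightarrow> 0 \<le> V (X s w) \<and> V (X s w) \<le> c"
    and "\<And>t. 0 \<le> t \<Longrightarrow> \<forall>\<^sub>F s in at_right t. V (X s w) = V (X t w)"
proof -
  show "0 \<le> V (X s w) \<and> V (X s w) \<le> c" if "0 \<le> s" for s
    using X_in_A[OF x that w] killing_nonneg V_le by auto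
  show "\<forall>\<^sub>F s in at_right t. V (X s w) = V (X t w)" if t: "0 \<le> t" for t
  proof -
    have "\<forall>w\<in>space (P x). \<forall>t\<ge>0. \<forall>\<^sub>F s in at_right t. X s w = X t w"
      using chain[unfolded markov_chain_def, rule_format, OF x] by (elim conjE)
    then have "\<forall>\<^sub>F s in at_right t. X s w = X t w" using w t by blast
    then show ?thesis by eventually_elim simp
  qed
qed

lemma riemann_sum_measurable:
  assumes x: "x \<in> A"
  shows "(\<lambda>w. \<Sum>i=1..n. V (X (real i / real (Suc k)) w) / real (Suc k)) \<in> borel_measurable (P x)"
proof (rule borel_measurable_sum)
  fix i :: nat
  have "(\<lambda>w. V (X (real i / real (Suc k)) w)) \<in> borel_measurable (P x)"
    by (rule measurable_compose[OF measurable_X[OF x]]) auto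
  then show "(\<lambda>w. V (X (real i / real (Suc k)) w) / real (Suc k)) \<in> borel_measurable (P x)" by simp
qed

lemma path_integral_measurable:
  assumes x: "x \<in> A"
  shows "path_integral m \<in> borel_measurable (P x)"
proof (rule borel_measurable_LIMSEQ_real)
  show "(\<lambda>k. \<Sum>i=1..m * Suc k. V (X (real i / real (Suc k)) w) / real (Suc k)) \<longlonglongrightarrow> path_integral m w"
    if "w \<in> space (P x)" for w
    unfolding path_integral_def
    by (rule riemann_sum_tendsto[of "\<lambda>s. V (X s w)", OF path_assumptions[OF x that]])
qed (rule riemann_sum_measurable[OF x])

text \<open>
  A product of \<open>m (k + 1)\<close> steps of length \<open>1 / (k + 1)\<close> is, by the Markov property, the expectation of the exponential
  of a Riemann sum. As \<open>k\<close> grows the Riemann sums converge along every path, and the accumulated error of the steps is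
  of order \<open>1 / k\<close>.
\<close>

lemma feynman_kac:
  assumes x: "x \<in> A"
  shows "(\<integral>w. exp (- path_integral m w) \<partial>P x) = evol (real m) (\<lambda>x. 1) x"
proof -
  interpret prob_space "P x" by (rule prob_space_P[OF x])
  let ?R = "\<lambda>k w. \<Sum>i=1..m * Suc k. V (X (real i / real (Suc k)) w) / real (Suc k)"
  let ?h = "\<lambda>k. 1 / real (Suc k)"
  have steps: "(\<integral>w. exp (- ?R k w) \<partial>P x) = (killed_step (?h k) ^^ (m * Suc k)) (\<lambda>x. 1) x" for k
  proof -
    have "(\<integral>w. exp (- ?R k w) \<partial>P x) = (\<integral>w. (\<Prod>i=1..m * Suc k. weight (?h k) (X (real i * ?h k) w)) \<partial>P x)"
    proof (rule Bochner_Integration.integral_cong[OF refl])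
      fix w assume w: "w \<in> space (P x)"
      have "weight (?h k) (X (real i * ?h k) w) = exp (- (V (X (real i / real (Suc k)) w) / real (Suc k)))" for i
        using X_in_A[OF x _ w, of "real i * ?h k"] by (simp add: weight_def del: of_nat_Suc)
      then show "exp (- ?R k w) = (\<Prod>i=1..m * Suc k. weight (?h k) (X (real i * ?h k) w))"
        by (simp add: exp_sum sum_negf[symmetric] del: of_nat_Suc mult_Suc_right)
    qed
    also have "\<dots> = (killed_step (?h k) ^^ (m * Suc k)) (\<lambda>x. 1) x"
      using killed_steps_eq_integral[OF x, of "?h k" "\<lambda>x. 1" "m * Suc k"] by simp
    finally show ?thesis .
  qed
  have "(\<lambda>k. \<integral>w. exp (- ?R k w) \<partial>P x) \<longlonglongrightarrow> (\<integral>w. exp (- path_integral m w) \<partial>P x)"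
  proof (rule integral_dominated_convergence[where w = "\<lambda>w. 1"])
    show "(\<lambda>w. exp (- path_integral m w)) \<in> borel_measurable (P x)"
      using path_integral_measurable[OF x, of m] by measurable
    show "(\<lambda>w. exp (- ?R k w)) \<in> borel_measurable (P x)" for k
      by (rule measurable_compose[OF borel_measurable_uminus[OF riemann_sum_measurable[OF x]] borel_measurable_exp])
    show "AE w in P x. (\<lambda>k. exp (- ?R k w)) \<longlonglongrightarrow> exp (- path_integral m w)"
    proof (rule AE_I2)
      fix w assume w: "w \<in> space (P x)"
      show "(\<lambda>k. exp (- ?R k w)) \<longlonglongrightarrow> exp (- path_integral m w)"
        unfolding path_integral_def
        by (intro tendsto_exp tendsto_minus riemann_sum_tendsto[of "\<lambda>s. V (X s w)", OF path_assumptions[OF x w]])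
    qed
    show "AE w in P x. norm (exp (- ?R k w)) \<le> 1" for k
    proof (rule AE_I2)
      fix w assume w: "w \<in> space (P x)"
      have "0 \<le> ?R k w"
        by (intro sum_nonneg divide_nonneg_nonneg) (use path_assumptions(1)[OF x w] in auto)
      then show "norm (exp (- ?R k w)) \<le> 1" by simp
    qed
  qed simp
  moreover have "(\<lambda>k. \<integral>w. exp (- ?R k w) \<partial>P x) \<longlonglongrightarrow> evol (real m) (\<lambda>x. 1) x"
  proof -
    have lim: "(\<lambda>k. real m * (11 * c\<^sup>2) * inverse (real (Suc k))) \<longlonglongrightarrow> 0"
      using tendsto_mult_left[OF LIMSEQ_inverse_real_of_nat, of "real m * (11 * c\<^sup>2)"] by simp
    have "(\<lambda>k. (\<integral>w. exp (- ?R k w) \<partial>P x) - evol (real m) (\<lambda>x. 1) x) \<longlonglongrightarrow> 0"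
    proof (rule Lim_null_comparison[OF always_eventually lim], rule allI)
      fix k
      have 1: "real (m * Suc k) * ?h k = real m"
        unfolding of_nat_mult by (simp del: of_nat_Suc)
      have 2: "real (m * Suc k) * (11 * c\<^sup>2 * (?h k)\<^sup>2) = real m * (11 * c\<^sup>2) * inverse (real (Suc k))"
      proof -
        define K where "K = real (Suc k)"
        have "K \<noteq> 0" by (simp add: K_def)
        then show ?thesis
          unfolding of_nat_mult K_def[symmetric] by (simp add: power2_eq_square field_simps)
      qed
      show "norm ((\<integral>w. exp (- ?R k w) \<partial>P x) - evol (real m) (\<lambda>x. 1) x)
          \<le> real m * (11 * c\<^sup>2) * inverse (real (Suc k))"
        using killed_steps_error[of "?h k" "m * Suc k" x] unfolding steps 1 2 by simp
    qed
    then show ?thesis by (rule LIM_zero_cancel)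
  qed
  ultimately show ?thesis by (rule LIMSEQ_unique)
qed

text \<open>
  In the limit \<open>m \<rightarrow> \<infinity>\<close> the Feynman-Kac formula gives the expectation of \<open>exp (- I)\<close>, where \<open>I\<close> is the total
  killing along the path. It vanishes if and only if \<open>I\<close> is almost surely infinite.
\<close>

lemma infinite_integral_iff:
  assumes x: "x \<in> A"
  shows "measure (P x) {w \<in> space (P x). (\<integral>\<^sup>+t\<in>{0..}. ennreal (V (X t w)) \<partial>lborel) = \<infinity>} = 1 \<longleftrightarrow>
    (\<lambda>m. evol (real m) (\<lambda>x. 1) x) \<longlonglongrightarrow> 0"
proof -
  interpret prob_space "P x" by (rule prob_space_P[OF x])
  define I where "I w = (\<integral>\<^sup>+t\<in>{0..}. ennreal (V (X t w)) \<partial>lborel)" for w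
  have I: "I w = (SUP m. ennreal (path_integral m w))" if "w \<in> space (P x)" for w
    unfolding I_def path_integral_def
    by (rule total_path_integral[of "\<lambda>s. V (X s w)", OF path_assumptions[OF x that]])
  have "(\<lambda>w. SUP m. ennreal (path_integral m w)) \<in> borel_measurable (P x)"
    using path_integral_measurable[OF x] by measurable
  then have I_meas: "I \<in> borel_measurable (P x)"
    by (rule measurable_cong[THEN iffD2, rotated]) (rule I)
  have ev: "{w \<in> space (P x). I w = \<infinity>} \<in> events" using I_meas by measurable
  define e where "e w = (if I w = \<infinity> then 0 else exp (- enn2real (I w)))" for w
  have e_meas: "e \<in> borel_measurable (P x)" unfolding e_def using I_meas by measurable
  have lim: "(\<lambda>m. exp (- path_integral m w)) \<longlonglongrightarrow> e w" if w: "w \<in> space (P x)" for w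
  proof -
    note mono = path_integral_mono[of "\<lambda>s. V (X s w)", OF path_assumptions[OF x w]]
    note nonneg = path_integral_nonneg[of "\<lambda>s. V (X s w)", OF path_assumptions[OF x w]]
    have inc: "incseq (\<lambda>m. ennreal (path_integral m w))"
      unfolding path_integral_def by (intro incseq_SucI ennreal_leI mono) auto
    have L: "(\<lambda>m. ennreal (path_integral m w)) \<longlonglongrightarrow> I w"
      unfolding I[OF w] by (rule LIMSEQ_SUP[OF inc])
    show ?thesis
    proof (cases "I w = \<infinity>")
      case True
      have "filterlim (\<lambda>m. path_integral m w) at_top sequentially"
        unfolding filterlim_at_top
      proof
        fix Z :: real
        have "\<forall>\<^sub>F m in sequentially. ennreal \<bar>Z\<bar> < ennreal (path_integral m w)"
          using L unfolding True by (rule order_tendstoD(1)) simp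
        then show "\<forall>\<^sub>F m in sequentially. Z \<le> path_integral m w"
        proof eventually_elim
          case (elim m)
          then have "\<bar>Z\<bar> < path_integral m w" by (simp add: ennreal_less_iff)
          then show ?case by linarith
        qed
      qed
      then have "(\<lambda>m. exp (- path_integral m w)) \<longlonglongrightarrow> 0"
        by (intro filterlim_compose[OF exp_at_bot] filterlim_compose[OF filterlim_uminus_at_bot_at_top])
      then show ?thesis using True by (simp add: e_def)
    next
      case False
      have "(\<lambda>m. enn2real (ennreal (path_integral m w))) \<longlonglongrightarrow> enn2real (I w)"
        by (rule tendsto_enn2real) (use L False in \<open>simp_all add: top.not_eq_extremum\<close>)
      moreover have "enn2real (ennreal (path_integral m w)) = path_integral m w" for m
        using nonneg[of m] by (simp add: path_integral_def)
      ultimately have "(\<lambda>m. exp (- path_integral m w)) \<longlonglongrightarrow> exp (- enn2real (I w))"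
        by (intro tendsto_exp tendsto_minus) simp
      then show ?thesis using False by (simp add: e_def)
    qed
  qed
  have "(\<lambda>m. \<integral>w. exp (- path_integral m w) \<partial>P x) \<longlonglongrightarrow> (\<integral>w. e w \<partial>P x)"
  proof (rule integral_dominated_convergence[where w = "\<lambda>w. 1"])
    show "AE w in P x. (\<lambda>m. exp (- path_integral m w)) \<longlonglongrightarrow> e w" by (rule AE_I2) (rule lim)
    show "AE w in P x. norm (exp (- path_integral m w)) \<le> 1" for m
    proof (rule AE_I2)
      fix w assume w: "w \<in> space (P x)"
      show "norm (exp (- path_integral m w)) \<le> 1"
        using path_integral_nonneg[of "\<lambda>s. V (X s w)", OF path_assumptions[OF x w], of m]
        by (simp add: path_integral_def)
    qed
    show "(\<lambda>w. exp (- path_integral m w)) \<in> borel_measurable (P x)" for m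
      using path_integral_measurable[OF x, of m] by measurable
  qed (use e_meas in auto)
  then have L: "(\<lambda>m. evol (real m) (\<lambda>x. 1) x) \<longlonglongrightarrow> (\<integral>w. e w \<partial>P x)"
    by (simp add: feynman_kac[OF x])
  have e01: "0 \<le> e w \<and> e w \<le> 1" for w by (simp add: e_def)
  have "integrable (P x) e" by (rule integrable_const_bound[where B = 1]) (use e01 e_meas in auto)
  then have "(\<integral>w. e w \<partial>P x) = 0 \<longleftrightarrow> (AE w in P x. e w = 0)"
    by (rule integral_nonneg_eq_0_iff_AE) (use e01 in auto)
  also have "\<dots> \<longleftrightarrow> (AE w in P x. I w = \<infinity>)" by (simp add: e_def)
  also have "\<dots> \<longleftrightarrow> prob {w \<in> space (P x). I w = \<infinity>} = 1"
    by (rule prob_Collect_eq_1[OF ev, symmetric])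
  finally have iff: "(\<integral>w. e w \<partial>P x) = 0 \<longleftrightarrow> prob {w \<in> space (P x). I w = \<infinity>} = 1" .
  show ?thesis
    unfolding I_def[symmetric] iff[symmetric]
  proof
    assume "(\<lambda>m. evol (real m) (\<lambda>x. 1) x) \<longlonglongrightarrow> 0"
    then show "(\<integral>w. e w \<partial>P x) = 0" by (rule LIMSEQ_unique[OF L])
  qed (use L in simp)
qed

end

section \<open>One particle\<close>

lemma mono_bounded_tendsto_at_top:
  fixes f :: "real \<Rightarrow> real"
  assumes mono: "\<And>s t. 0 \<le> s \<Longrightarrow> s \<le> t \<Longrightarrow> f s \<le> f t" and bound: "\<And>t. 0 \<le> t \<Longrightarrow> f t \<le> M"
  shows "\<exists>L. (f \<longlongrightarrow> L) at_top \<and> (\<forall>t\<ge>0. f t \<le> L)"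
proof -
  have bdd: "bdd_above (f ` {0..})" using bound by (auto simp: bdd_above_def)
  define L where "L = Sup (f ` {0..})"
  have le: "f t \<le> L" if "0 \<le> t" for t
    unfolding L_def by (rule cSup_upper[OF _ bdd]) (use that in auto)
  have "(f \<longlongrightarrow> L) at_top"
  proof (rule order_tendstoI)
    fix a assume "a < L"
    then obtain s where s: "0 \<le> s" "a < f s"
      unfolding L_def using less_cSup_iff[OF _ bdd, of a] by auto
    have "a < f t" if "s \<le> t" for t using mono[OF s(1) that] s(2) by simp
    then show "\<forall>\<^sub>F t in at_top. a < f t" by (rule eventually_at_top_linorderI)
  next
    fix a assume "L < a"
    then have "f t < a" if "0 \<le> t" for t using le[OF that] by simp
    then show "\<forall>\<^sub>F t in at_top. f t < a" by (rule eventually_at_top_linorderI)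
  qed
  then show ?thesis using le by blast
qed

lemma antimono_bounded_tendsto_at_top:
  fixes f :: "real \<Rightarrow> real"
  assumes mono: "\<And>s t. 0 \<le> s \<Longrightarrow> s \<le> t \<Longrightarrow> f t \<le> f s" and bound: "\<And>t. 0 \<le> t \<Longrightarrow> M \<le> f t"
  shows "\<exists>L. (f \<longlongrightarrow> L) at_top \<and> (\<forall>t\<ge>0. L \<le> f t)"
proof -
  have "\<exists>L. ((\<lambda>t. - f t) \<longlongrightarrow> L) at_top \<and> (\<forall>t\<ge>0. - f t \<le> L)"
    by (rule mono_bounded_tendsto_at_top[of _ "- M"]) (simp_all add: mono bound)
  then obtain L where L: "((\<lambda>t. - f t) \<longlongrightarrow> L) at_top" "\<forall>t\<ge>0. - f t \<le> L" by blast
  have "(f \<longlongrightarrow> - L) at_top" using tendsto_minus[OF L(1)] by simp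
  moreover have "- L \<le> f t" if "0 \<le> t" for t using L(2)[rule_format, OF that] by simp
  ultimately show ?thesis by blast
qed

text \<open>
  The form in which the Markov property is used below: first let \<open>t\<close> tend to infinity for a fixed \<open>r\<close>, with an error
  that is small when \<open>r\<close> is large.
\<close>

lemma tendsto_at_top_by_shift:
  fixes f :: "real \<Rightarrow> real"
  assumes "\<And>e. 0 < e \<Longrightarrow> \<exists>r. \<forall>\<^sub>F t in at_top. \<bar>f (r + t) - l\<bar> < e"
  shows "(f \<longlongrightarrow> l) at_top"
proof (rule tendstoI)
  fix e :: real assume "0 < e"
  then obtain r where "\<forall>\<^sub>F t in at_top. \<bar>f (r + t) - l\<bar> < e" using assms by blast
  then obtain T where T: "\<And>t. T \<le> t \<Longrightarrow> \<bar>f (r + t) - l\<bar> < e"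
    by (auto simp: eventually_at_top_linorder)
  show "\<forall>\<^sub>F t in at_top. dist (f t) l < e"
  proof (rule eventually_at_top_linorderI)
    fix t assume "r + T \<le> t"
    then show "dist (f t) l < e" using T[of "t - r"] by (simp add: dist_real_def)
  qed
qed

lemma tendsto_at_top_add_const:
  fixes f :: "real \<Rightarrow> real"
  assumes "(f \<longlongrightarrow> l) at_top"
  shows "((\<lambda>t. f (r + t)) \<longlongrightarrow> l) at_top"
  by (rule filterlim_compose[OF assms]) (rule filterlim_tendsto_add_at_top[OF tendsto_const filterlim_ident])

context positive_operator
begin

lemma evol_tendsto_at_top:
  assumes bound: "\<And>t x. 0 \<le> t \<Longrightarrow> \<bar>F t x\<bar> \<le> M" and lim: "\<And>x. ((\<lambda>t::real. F t x) \<longlongrightarrow> f x) at_top"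
  shows "((\<lambda>t. evol r (F t) x) \<longlongrightarrow> evol r f x) at_top"
proof (rule tendsto_at_topI_sequentially)
  fix X :: "nat \<Rightarrow> real" assume X: "filterlim X at_top sequentially"
  define Y where "Y n = max 0 (X n)" for n
  have ev: "\<forall>\<^sub>F n in sequentially. Y n = X n"
    using X unfolding filterlim_at_top by (auto elim!: allE[of _ 0] eventually_mono simp: Y_def)
  have "(\<lambda>n. evol r (F (Y n)) x) \<longlonglongrightarrow> evol r f x"
  proof (rule evol_tendsto[where M = M])
    show "\<bar>F (Y n) x\<bar> \<le> M" for n x by (rule bound) (simp add: Y_def)
    show "(\<lambda>n. F (Y n) x) \<longlonglongrightarrow> f x" for x
      by (rule Lim_transform_eventually[OF filterlim_compose[OF lim X]])
        (use ev in eventually_elim, simp)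
  qed
  then show "(\<lambda>n. evol r (F (X n)) x) \<longlonglongrightarrow> evol r f x"
    by (rule Lim_transform_eventually) (use ev in eventually_elim, simp)
qed

lemma evol_const: "evol t (\<lambda>x. a) x = a * evol t (\<lambda>x. 1) x"
  using evol_scale[of "\<lambda>x. 1" t a x] by simp

lemma evol_one_antimono:
  assumes "0 \<le> s" "s \<le> t"
  shows "evol t (\<lambda>x. 1) x \<le> evol s (\<lambda>x. 1) x"
proof -
  have "evol t (\<lambda>x. 1) x = evol s (evol (t - s) (\<lambda>x. 1)) x"
    using evol_semigroup[of "\<lambda>x. 1" s "t - s" x] assms by simp
  also have "\<dots> \<le> evol s (\<lambda>x. 1) x"
    by (rule evol_mono[OF bounded_fun_evol bounded_fun_const evol_one_le assms(1)]) (use assms in auto)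
  finally show ?thesis .
qed

text \<open>
  The probability of never being killed. The limit exists because the total mass \<open>evol t 1\<close> decreases in \<open>t\<close>.
\<close>

definition survival :: "'a \<Rightarrow> real" where
  "survival x = Lim at_top (\<lambda>t. evol t (\<lambda>x. 1) x)"

lemma survival_tendsto: "((\<lambda>t. evol t (\<lambda>x. 1) x) \<longlongrightarrow> survival x) at_top"
  and survival_le: "0 \<le> t \<Longrightarrow> survival x \<le> evol t (\<lambda>x. 1) x"
proof -
  have nonneg: "0 \<le> evol t (\<lambda>x. 1) x" if "0 \<le> t" for t by (rule evol_nonneg[OF _ _ that]) auto
  obtain L where L: "((\<lambda>t. evol t (\<lambda>x. 1) x) \<longlongrightarrow> L) at_top" "\<forall>t\<ge>0. L \<le> evol t (\<lambda>x. 1) x"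
    using antimono_bounded_tendsto_at_top[of "\<lambda>t. evol t (\<lambda>x. 1) x", OF evol_one_antimono nonneg] by blast
  have "survival x = L" unfolding survival_def by (rule tendsto_Lim[OF _ L(1)]) simp
  then show "((\<lambda>t. evol t (\<lambda>x. 1) x) \<longlongrightarrow> survival x) at_top"
    and "0 \<le> t \<Longrightarrow> survival x \<le> evol t (\<lambda>x. 1) x" using L by auto
qed

lemma survival_bounds: "0 \<le> survival x" "survival x \<le> 1"
proof -
  show "0 \<le> survival x"
    by (rule tendsto_lowerbound[OF survival_tendsto])
      (auto intro!: eventually_at_top_linorderI[of 0] evol_nonneg)
  show "survival x \<le> 1" using survival_le[of 0 x] by (simp add: evol_0)
qed

lemma bounded_fun_survival: "bounded_fun survival"
proof (rule bounded_funI)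
  show "\<bar>survival x\<bar> \<le> 1" for x using survival_bounds[of x] by simp
qed

lemma evol_survival: "0 \<le> t \<Longrightarrow> evol t survival x = survival x"
proof -
  assume t: "0 \<le> t"
  have "((\<lambda>u. evol t (evol u (\<lambda>x. 1)) x) \<longlongrightarrow> evol t survival x) at_top"
    by (rule evol_tendsto_at_top[OF _ survival_tendsto, where M = 1]) (rule evol_abs_le, auto)
  moreover have "((\<lambda>u. evol t (evol u (\<lambda>x. 1)) x) \<longlongrightarrow> survival x) at_top"
  proof (rule Lim_transform_eventually[OF tendsto_at_top_add_const[OF survival_tendsto, of t x]])
    show "\<forall>\<^sub>F u in at_top. evol (t + u) (\<lambda>x. 1) x = evol t (evol u (\<lambda>x. 1)) x"
      by (rule eventually_at_top_linorderI[of 0]) (rule evol_semigroup, use t in auto)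
  qed
  ultimately show ?thesis by (rule tendsto_unique[OF trivial_limit_at_top_linorder])
qed

lemma evol_one_tendsto_0:
  assumes "(\<lambda>m. evol (real m) (\<lambda>x. 1) x) \<longlonglongrightarrow> 0"
  shows "survival x = 0"
  by (rule LIMSEQ_unique[OF filterlim_compose[OF survival_tendsto filterlim_real_sequentially] assms])

end

locale nve_rates =
  fixes qe qv :: "'s::countable \<Rightarrow> 's \<Rightarrow> real" and \<beta> \<delta> :: "'s \<Rightarrow> real"
  assumes qe_nonneg: "0 \<le> qe x y" and qv_nonneg: "0 \<le> qv x y"
    and qe_sym: "qe x y = qe y x"
    and q_summable: "total_rate qe qv x summable_on UNIV"
    and q_bounded: "bdd_above (range (exit_rate (total_rate qe qv)))"
    and \<beta>_nonneg: "0 \<le> \<beta> x" and \<delta>_nonneg: "0 \<le> \<delta> x"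
    and \<beta>\<delta>_bounded: "bdd_above (range (\<lambda>x. \<beta> x + \<delta> x))"
begin

abbreviation "q \<equiv> total_rate qe qv"

definition "rate_bound = Sup (range (exit_rate q)) + Sup (range (\<lambda>x. \<beta> x + \<delta> x))"

lemma q_nonneg: "0 \<le> q x y"
  by (simp add: total_rate_def qe_nonneg qv_nonneg)

lemma qe_summable: "qe x summable_on UNIV" and qv_summable: "qv x summable_on UNIV"
  by (rule summable_on_comparison_test[OF q_summable[of x]]; simp add: total_rate_def qe_nonneg qv_nonneg)+

lemma summable_q: "q x summable_on S"
  by (rule summable_on_subset_banach[OF q_summable]) simp

lemma infsum_q_le: "(\<Sum>\<^sub>\<infinity>y\<in>S. q x y) + (\<beta> z + \<delta> z) \<le> rate_bound"
proof -
  have "(\<Sum>\<^sub>\<infinity>y\<in>S. q x y) \<le> exit_rate q x"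
    unfolding exit_rate_def
    by (rule infsum_mono_neutral) (use q_nonneg summable_q in auto)
  also have "\<dots> \<le> Sup (range (exit_rate q))" by (rule cSup_upper[OF _ q_bounded]) simp
  finally have 1: "(\<Sum>\<^sub>\<infinity>y\<in>S. q x y) \<le> Sup (range (exit_rate q))" .
  have "\<beta> z + \<delta> z \<le> Sup (range (\<lambda>x. \<beta> x + \<delta> x))" by (rule cSup_upper[OF _ \<beta>\<delta>_bounded]) simp
  with 1 show ?thesis unfolding rate_bound_def by linarith
qed

lemma infsum_q_le': "(\<Sum>\<^sub>\<infinity>y\<in>S. q x y) \<le> rate_bound"
  using infsum_q_le[of x S x] \<beta>_nonneg[of x] \<delta>_nonneg[of x] by linarith

lemma rate_bound_nonneg: "0 \<le> rate_bound"
  using infsum_q_le'[of undefined "{}"] by simp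

lemma q_le: "q x y \<le> rate_bound"
  using infsum_q_le'[of x "{y}"] by simp

text \<open>
  The three processes that govern the limit: the walk killed by the noise, the walk itself, and the pair of exclusion
  particles killed at rate \<open>q\<^sub>v\<close>. The common bound \<open>4 * rate_bound\<close> is dictated by the pair, whose two particles
  contribute two \<open>rate_bound\<close> by their jumps and two by the killing; sharing it lets the generators be compared directly.
\<close>

sublocale killed: jump_rates UNIV q "\<lambda>x. \<beta> x + \<delta> x" "4 * rate_bound"
proof
  show "(\<Sum>\<^sub>\<infinity>y\<in>UNIV - {x}. q x y) + (\<beta> x + \<delta> x) \<le> 4 * rate_bound" for x
    using infsum_q_le[of x "UNIV - {x}" x] rate_bound_nonneg by linarith
qed (use q_nonneg \<beta>_nonneg \<delta>_nonneg summable_q rate_bound_nonneg in auto)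

sublocale free: jump_rates UNIV q "\<lambda>x. 0" "4 * rate_bound"
proof
  show "(\<Sum>\<^sub>\<infinity>y\<in>UNIV - {x}. q x y) + 0 \<le> 4 * rate_bound" for x
    using infsum_q_le'[of x "UNIV - {x}"] rate_bound_nonneg by linarith
qed (use q_nonneg summable_q rate_bound_nonneg in auto)

lemma weighted_q_summable:
  assumes "bounded_fun f" shows "(\<lambda>z. q x z * f z) summable_on S"
proof -
  obtain M where "\<And>x. \<bar>f x\<bar> \<le> M" using bounded_funD[OF assms] by auto
  then show ?thesis by (intro weighted_summable_on[where M = M] q_nonneg summable_q)
qed

text \<open>
  In the pair process only the two one-site moves away from \<open>(x, y)\<close> have positive rate.
\<close>

lemma exclusion_has_sum:
  assumes xy: "x \<noteq> y" and f: "bounded_fun f"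
  shows "((\<lambda>p. exclusion_rate q (x, y) p * f p) has_sum
    ((\<Sum>\<^sub>\<infinity>u\<in>UNIV - {x, y}. q x u * f (u, y)) + (\<Sum>\<^sub>\<infinity>v\<in>UNIV - {x, y}. q y v * f (x, v)))) (S2 - {(x, y)})"
proof -
  let ?g = "\<lambda>p. exclusion_rate q (x, y) p * f p"
  let ?T1 = "(\<lambda>u. (u, y)) ` (UNIV - {x, y})" and ?T2 = "(\<lambda>v. (x, v)) ` (UNIV - {x, y})"
  have "((\<lambda>u. q x u * f (u, y)) has_sum (\<Sum>\<^sub>\<infinity>u\<in>UNIV - {x, y}. q x u * f (u, y))) (UNIV - {x, y})"
    by (intro has_sum_infsum weighted_q_summable bounded_fun_compose[OF f])
  then have "((?g \<circ> (\<lambda>u. (u, y))) has_sum (\<Sum>\<^sub>\<infinity>u\<in>UNIV - {x, y}. q x u * f (u, y))) (UNIV - {x, y})"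
    by (rule has_sum_cong[THEN iffD1, rotated]) auto
  then have 1: "(?g has_sum (\<Sum>\<^sub>\<infinity>u\<in>UNIV - {x, y}. q x u * f (u, y))) ?T1"
    by (subst has_sum_reindex) (auto simp: inj_on_def)
  have "((\<lambda>v. q y v * f (x, v)) has_sum (\<Sum>\<^sub>\<infinity>v\<in>UNIV - {x, y}. q y v * f (x, v))) (UNIV - {x, y})"
    by (intro has_sum_infsum weighted_q_summable bounded_fun_compose[OF f])
  then have "((?g \<circ> (\<lambda>v. (x, v))) has_sum (\<Sum>\<^sub>\<infinity>v\<in>UNIV - {x, y}. q y v * f (x, v))) (UNIV - {x, y})"
    by (rule has_sum_cong[THEN iffD1, rotated]) auto
  then have 2: "(?g has_sum (\<Sum>\<^sub>\<infinity>v\<in>UNIV - {x, y}. q y v * f (x, v))) ?T2"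
    by (subst has_sum_reindex) (auto simp: inj_on_def)
  have "(?g has_sum ((\<Sum>\<^sub>\<infinity>u\<in>UNIV - {x, y}. q x u * f (u, y)) + (\<Sum>\<^sub>\<infinity>v\<in>UNIV - {x, y}. q y v * f (x, v)))) (?T1 \<union> ?T2)"
    by (rule has_sum_Un_disjoint[OF 1 2]) auto
  then show ?thesis
  proof (rule has_sum_cong_neutral[THEN iffD1, rotated -1])
    fix p assume "p \<in> (S2 - {(x, y)}) - (?T1 \<union> ?T2)"
    then show "?g p = 0" by (cases p) (auto simp: S2_def)
  next
    fix p assume "p \<in> (?T1 \<union> ?T2) - (S2 - {(x, y)})"
    then show "?g p = 0" using xy by (auto simp: S2_def)
  qed simp
qed

sublocale pair: jump_rates S2 "exclusion_rate q" "pair_rate qv" "4 * rate_bound"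
proof
  fix p p' :: "'s \<times> 's" assume p: "p \<in> S2"
  obtain x y where xy: "p = (x, y)" "x \<noteq> y" using p by (auto simp: S2_def)
  have sum: "((\<lambda>p. exclusion_rate q (x, y) p * 1) has_sum
    ((\<Sum>\<^sub>\<infinity>u\<in>UNIV - {x, y}. q x u * 1) + (\<Sum>\<^sub>\<infinity>v\<in>UNIV - {x, y}. q y v * 1))) (S2 - {(x, y)})"
    by (rule exclusion_has_sum[OF xy(2)]) auto
  show "0 \<le> exclusion_rate q p p'" using xy q_nonneg by (cases p') auto
  show "0 \<le> pair_rate qv p" using xy qv_nonneg by simp
  show "exclusion_rate q p summable_on S2 - {p}"
    using has_sum_imp_summable[OF sum] by (simp add: xy)
  have "(\<Sum>\<^sub>\<infinity>p'\<in>S2 - {p}. exclusion_rate q p p') =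
      (\<Sum>\<^sub>\<infinity>u\<in>UNIV - {x, y}. q x u) + (\<Sum>\<^sub>\<infinity>v\<in>UNIV - {x, y}. q y v)"
    using infsumI[OF sum] by (simp add: xy)
  also have "\<dots> \<le> rate_bound + rate_bound" by (intro add_mono infsum_q_le')
  finally have "(\<Sum>\<^sub>\<infinity>p'\<in>S2 - {p}. exclusion_rate q p p') \<le> 2 * rate_bound" by simp
  moreover have "qv x y \<le> rate_bound" "qv y x \<le> rate_bound"
    using q_le[of x y] q_le[of y x] qe_nonneg[of x y] qe_nonneg[of y x] by (simp_all add: total_rate_def)
  ultimately show "(\<Sum>\<^sub>\<infinity>p'\<in>S2 - {p}. exclusion_rate q p p') + pair_rate qv p \<le> 4 * rate_bound"
    by (simp add: xy)
qed (use rate_bound_nonneg in auto)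

lemma pair_generator_eq:
  assumes xy: "x \<noteq> y" and f: "bounded_fun f"
  shows "pair.gen f (x, y) =
    (\<Sum>\<^sub>\<infinity>u\<in>UNIV - {x, y}. q x u * (f (u, y) - f (x, y))) +
    (\<Sum>\<^sub>\<infinity>v\<in>UNIV - {x, y}. q y v * (f (x, v) - f (x, y))) - (qv x y + qv y x) * f (x, y)"
  using infsumI[OF exclusion_has_sum[OF xy, of "\<lambda>p. f p - f (x, y)"]] f xy
  by (simp add: jump_generator_def S2_def bounded_fun_diff)

lemma killed_le_free:
  assumes f: "bounded_fun f" "\<And>x. 0 \<le> f x" and t: "0 \<le> t"
  shows "killed.evol t f x \<le> free.evol t f x"
proof -
  obtain M where M: "0 \<le> M" "\<And>x. \<bar>f x\<bar> \<le> M" using bounded_funD[OF f(1)] by auto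
  show ?thesis
  proof (rule killed.evol_le_supersolution[where u = "\<lambda>t. free.evol t f" and u' = "\<lambda>t. free.gen (free.evol t f)" and M = M])
    show "\<bar>free.evol t f x\<bar> \<le> M" if "0 \<le> t" for t x
      by (rule free.evol_abs_le[where f = f, OF M that])
    show "continuous_on {0..} (\<lambda>t. free.evol t f x)" for x by (rule free.evol_continuous[OF f(1)])
    show "((\<lambda>t. free.evol t f x) has_real_derivative free.gen (free.evol t f) x) (at_right t)" if "0 \<le> t" for t x
      by (rule has_field_derivative_at_within[OF free.gen_derivative[OF f(1) that]])
    show "killed.gen (free.evol t f) x + 4 * rate_bound * free.evol t f x - 4 * rate_bound * free.evol t f x
        \<le> free.gen (free.evol t f) x" if "0 \<le> t" for t x
      using free.evol_nonneg[OF f that, of x] \<beta>_nonneg[of x] \<delta>_nonneg[of x] by (simp add: jump_generator_def)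
  qed (use f t in \<open>auto simp: free.evol_0\<close>)
qed

lemma free_evol_one: "0 \<le> t \<Longrightarrow> free.evol t (\<lambda>x. 1) x = 1"
proof -
  assume t: "0 \<le> t"
  have "free.evol t (\<lambda>x. 1) x \<le> 1" by (rule free.evol_one_le[OF t])
  moreover have "1 \<le> free.evol t (\<lambda>x. 1) x"
    by (rule free.evol_ge_of_subharmonic[of "\<lambda>x. 1", OF _ _ t]) (auto simp: jump_generator_def)
  ultimately show ?thesis by simp
qed

end

locale voter_rates = nve_rates +
  assumes pairs_meet: "x \<noteq> y \<Longrightarrow> pair.survival (x, y) = 0"
begin

text \<open>
  Bounded harmonic functions of the walk are constant: the difference \<open>\<bar>f x - f y\<bar>\<close> of the values at two
  particles is subharmonic for the pair process killed at rate \<open>q\<^sub>v\<close>, because suppressing the jump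
  of one particle onto the other gains \<open>(q(x,y) + q(y,x)) \<bar>f x - f y\<bar>\<close>, which pays for the killing.
\<close>

lemma bounded_harmonic_constant:
  assumes f: "bounded_fun f" and harm: "\<And>x. free.gen f x = 0"
  shows "f x = f y"
proof (cases "x = y")
  case False
  obtain M where M: "0 \<le> M" "\<And>x. \<bar>f x\<bar> \<le> M" using bounded_funD[OF f] by auto
  define g where "g p = \<bar>f (fst p) - f (snd p)\<bar>" for p :: "'a \<times> 'a"
  have g2: "\<bar>g p\<bar> \<le> 2 * M" for p
    using M(2)[of "fst p"] M(2)[of "snd p"] unfolding g_def by linarith
  have bg: "bounded_fun g" by (rule bounded_funI[OF g2])
  have half: "q x y * \<bar>f x - f y\<bar> \<le> (\<Sum>\<^sub>\<infinity>u\<in>UNIV - {x, y}. q x u * (\<bar>f u - f y\<bar> - \<bar>f x - f y\<bar>))"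
    if xy: "x \<noteq> y" for x y
  proof -
    define \<sigma> :: real where "\<sigma> = (if f y \<le> f x then 1 else -1)"
    have bd: "bounded_fun (\<lambda>u. \<bar>f u - f y\<bar> - \<bar>f x - f y\<bar>)" "bounded_fun (\<lambda>u. f u - f x)"
      by (intro bounded_fun_diff bounded_fun_abs bounded_fun_const f)+
    have "0 = \<sigma> * (\<Sum>\<^sub>\<infinity>u\<in>UNIV - {x}. q x u * (f u - f x))"
      using harm[of x] by (simp add: jump_generator_def)
    also have "\<dots> = (\<Sum>\<^sub>\<infinity>u\<in>UNIV - {x}. \<sigma> * (q x u * (f u - f x)))"
      by (rule infsum_cmult_right'[symmetric])
    also have "\<dots> \<le> (\<Sum>\<^sub>\<infinity>u\<in>UNIV - {x}. q x u * (\<bar>f u - f y\<bar> - \<bar>f x - f y\<bar>))"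
    proof (rule infsum_mono)
      show "(\<lambda>u. \<sigma> * (q x u * (f u - f x))) summable_on UNIV - {x}"
        by (intro summable_on_cmult_right weighted_q_summable bd)
      show "(\<lambda>u. q x u * (\<bar>f u - f y\<bar> - \<bar>f x - f y\<bar>)) summable_on UNIV - {x}"
        by (intro weighted_q_summable bd)
      fix u
      have "\<sigma> * (f u - f x) \<le> \<bar>f u - f y\<bar> - \<bar>f x - f y\<bar>" by (auto simp: \<sigma>_def)
      then show "\<sigma> * (q x u * (f u - f x)) \<le> q x u * (\<bar>f u - f y\<bar> - \<bar>f x - f y\<bar>)"
        by (subst mult.left_commute) (rule mult_left_mono[OF _ q_nonneg])
    qed
    also have "\<dots> = (\<Sum>\<^sub>\<infinity>u\<in>{y} \<union> (UNIV - {x, y}). q x u * (\<bar>f u - f y\<bar> - \<bar>f x - f y\<bar>))"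
      by (rule arg_cong[where f = "infsum _"]) (use xy in auto)
    also have "\<dots> = (\<Sum>\<^sub>\<infinity>u\<in>{y}. q x u * (\<bar>f u - f y\<bar> - \<bar>f x - f y\<bar>)) +
        (\<Sum>\<^sub>\<infinity>u\<in>UNIV - {x, y}. q x u * (\<bar>f u - f y\<bar> - \<bar>f x - f y\<bar>))"
      by (intro infsum_Un_disjoint weighted_q_summable bd) auto
    finally show ?thesis by simp
  qed
  have sub: "4 * rate_bound * g p \<le> pair.gen g p + 4 * rate_bound * g p" for p
  proof (cases "p \<in> S2")
    case True
    then obtain x y where p: "p = (x, y)" "x \<noteq> y" by (auto simp: S2_def)
    have c: "\<bar>f x - f v\<bar> - \<bar>f x - f y\<bar> = \<bar>f v - f x\<bar> - \<bar>f y - f x\<bar>" for v by (simp add: abs_minus_commute)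
    have "pair.gen g p = (\<Sum>\<^sub>\<infinity>u\<in>UNIV - {x, y}. q x u * (\<bar>f u - f y\<bar> - \<bar>f x - f y\<bar>)) +
        (\<Sum>\<^sub>\<infinity>v\<in>UNIV - {y, x}. q y v * (\<bar>f v - f x\<bar> - \<bar>f y - f x\<bar>)) - (qv x y + qv y x) * \<bar>f x - f y\<bar>"
      unfolding p(1) pair_generator_eq[OF p(2) bg] by (simp add: g_def c insert_commute)
    moreover have "qv x y * \<bar>f x - f y\<bar> \<le> q x y * \<bar>f x - f y\<bar>" "qv y x * \<bar>f x - f y\<bar> \<le> q y x * \<bar>f y - f x\<bar>"
      using qe_nonneg by (auto simp: total_rate_def abs_minus_commute intro!: mult_right_mono)
    ultimately have "0 \<le> pair.gen g p"
      using half[OF p(2)] half[OF p(2)[symmetric]] unfolding distrib_right by linarith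
    then show ?thesis by simp
  qed (simp add: jump_generator_def)
  have "g (x, y) \<le> 2 * M * pair.evol t (\<lambda>p. 1) (x, y)" if t: "0 \<le> t" for t
  proof -
    have "g (x, y) \<le> pair.evol t g (x, y)" by (rule pair.evol_ge_of_subharmonic[OF bg sub t])
    also have "\<dots> \<le> pair.evol t (\<lambda>p. 2 * M) (x, y)"
      by (rule pair.evol_mono[OF bg bounded_fun_const order_trans[OF abs_ge_self g2] t])
    also have "\<dots> = 2 * M * pair.evol t (\<lambda>p. 1) (x, y)" by (rule pair.evol_const)
    finally show ?thesis .
  qed
  then have "\<forall>\<^sub>F t in at_top. g (x, y) \<le> 2 * M * pair.evol t (\<lambda>p. 1) (x, y)"
    by (rule eventually_at_top_linorderI)
  moreover have "((\<lambda>t. 2 * M * pair.evol t (\<lambda>p. 1) (x, y)) \<longlongrightarrow> 2 * M * 0) at_top"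
    using pair.survival_tendsto[of "(x, y)"] unfolding pairs_meet[OF False] by (intro tendsto_mult_left)
  ultimately have "g (x, y) \<le> 2 * M * 0"
    by (intro tendsto_lowerbound[OF _ _ trivial_limit_at_top_linorder])
  then show ?thesis by (simp add: g_def)
qed simp

text \<open>
  A nonnegative function that is invariant under the killed walk is subharmonic for the free walk, so its free
  evolution increases. The limit is a bounded harmonic function, hence constant.
\<close>

lemma free_limit_of_killed_invariant:
  assumes l: "\<And>x. 0 \<le> l x" "\<And>x. l x \<le> 1" and inv: "\<And>t x. 0 \<le> t \<Longrightarrow> killed.evol t l x = l x"
  shows "\<exists>\<kappa>. (\<forall>x. ((\<lambda>t. free.evol t l x) \<longlongrightarrow> \<kappa>) at_top) \<and> (\<forall>x. l x \<le> \<kappa>) \<and> 0 \<le> \<kappa> \<and> \<kappa> \<le> 1"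
proof -
  have l1: "\<bar>l x\<bar> \<le> 1" for x using l[of x] by simp
  have bl: "bounded_fun l" by (rule bounded_funI[OF l1])
  have b: "bounded_fun (free.evol t l)" if "0 \<le> t" for t by (rule free.bounded_fun_evol[OF bl that])
  have ge: "l x \<le> free.evol t l x" if "0 \<le> t" for t x
    using killed_le_free[OF bl l(1) that, of x] inv[OF that, of x] by simp
  have mono: "free.evol s l x \<le> free.evol t l x" if "0 \<le> s" "s \<le> t" for s t x
  proof -
    have "free.evol s l x \<le> free.evol s (free.evol (t - s) l) x"
      by (rule free.evol_mono[OF bl b ge]) (use that in auto)
    then show ?thesis using free.evol_semigroup[OF bl, of s "t - s" x] that by simp
  qed
  have le1: "\<bar>free.evol t l x\<bar> \<le> 1" if "0 \<le> t" for t x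
    by (rule free.evol_abs_le[where f = l, OF _ l1 that]) simp
  have "\<exists>k. ((\<lambda>t. free.evol t l x) \<longlongrightarrow> k) at_top \<and> (\<forall>t\<ge>0. free.evol t l x \<le> k)" for x
  proof (rule mono_bounded_tendsto_at_top[where M = 1])
    show "free.evol s l x \<le> free.evol t l x" if "0 \<le> s" "s \<le> t" for s t by (rule mono[OF that])
    show "free.evol t l x \<le> 1" if "0 \<le> t" for t using le1[OF that, of x] by simp
  qed
  then have "\<forall>x. \<exists>k. ((\<lambda>t. free.evol t l x) \<longlongrightarrow> k) at_top \<and> (\<forall>t\<ge>0. free.evol t l x \<le> k)" ..
  from choice[OF this] obtain k where kk: "\<forall>x. ((\<lambda>t. free.evol t l x) \<longlongrightarrow> k x) at_top \<and> (\<forall>t\<ge>0. free.evol t l x \<le> k x)" ..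
  have k: "((\<lambda>t. free.evol t l x) \<longlongrightarrow> k x) at_top" for x by (rule kk[rule_format, THEN conjunct1])
  have lek: "free.evol t l x \<le> k x" if "0 \<le> t" for t x using kk that by simp
  have k1: "\<bar>k x\<bar> \<le> 1" for x
    by (rule tendsto_upperbound[OF tendsto_rabs[OF k]])
      (auto intro!: eventually_at_top_linorderI[of 0] le1)
  have bk: "bounded_fun k" by (rule bounded_funI[OF k1])
  have fixed: "free.evol r k x = k x" if r: "0 \<le> r" for r x
  proof -
    have "((\<lambda>t. free.evol r (free.evol t l) x) \<longlongrightarrow> free.evol r k x) at_top"
      by (rule free.evol_tendsto_at_top[OF le1 k])
    moreover have "((\<lambda>t. free.evol r (free.evol t l) x) \<longlongrightarrow> k x) at_top"
    proof (rule Lim_transform_eventually[OF tendsto_at_top_add_const[OF k, of r x]])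
      show "\<forall>\<^sub>F t in at_top. free.evol (r + t) l x = free.evol r (free.evol t l) x"
        by (rule eventually_at_top_linorderI[of 0]) (rule free.evol_semigroup[OF bl r])
    qed
    ultimately show ?thesis by (rule tendsto_unique[OF trivial_limit_at_top_linorder])
  qed
  have "free.gen k x = 0" for x by (rule free.gen_eq_0_of_evol_fixed[OF bk fixed])
  then have const: "k x = k undefined" for x by (rule bounded_harmonic_constant[OF bk])
  have lk: "l x \<le> k undefined" for x
    using lek[of 0 x] const[of x] by (simp add: free.evol_0)
  show ?thesis
  proof (intro exI[of _ "k undefined"] conjI allI)
    show "((\<lambda>t. free.evol t l x) \<longlongrightarrow> k undefined) at_top" for x using k[of x] const[of x] by simp
    show "k undefined \<le> 1" using k1[of undefined] by simp
    show "0 \<le> k undefined" using lk[of undefined] l(1)[of undefined] by simp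
  qed (rule lk)
qed

end

locale survival_rates = voter_rates +
  assumes noise_survival: "\<exists>x. killed.survival x \<noteq> 0"
begin

text \<open>
  Let \<open>\<kappa>\<close> be the constant limit of the free evolution of \<open>survival\<close>. From \<open>survival \<le> \<kappa>\<close> and invariance under the
  killed evolution follows \<open>survival \<le> \<kappa> * survival\<close>, which forces \<open>\<kappa> = 1\<close> where \<open>survival\<close> is positive.
\<close>

lemma free_survival_tendsto: "((\<lambda>t. free.evol t killed.survival x) \<longlongrightarrow> 1) at_top"
proof -
  obtain \<kappa> where kk: "(\<forall>x. ((\<lambda>t. free.evol t killed.survival x) \<longlongrightarrow> \<kappa>) at_top) \<and>
      (\<forall>x. killed.survival x \<le> \<kappa>) \<and> 0 \<le> \<kappa> \<and> \<kappa> \<le> 1"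
    using free_limit_of_killed_invariant[of killed.survival, OF killed.survival_bounds killed.evol_survival] ..
  have k: "((\<lambda>t. free.evol t killed.survival x) \<longlongrightarrow> \<kappa>) at_top" "killed.survival x \<le> \<kappa>" "0 \<le> \<kappa>" "\<kappa> \<le> 1" for x
    using kk by auto
  obtain x0 where x0: "0 < killed.survival x0"
  proof -
    obtain x where "killed.survival x \<noteq> 0" using noise_survival ..
    with killed.survival_bounds(1)[of x] have "0 < killed.survival x" by linarith
    then show ?thesis by (rule that)
  qed
  have "killed.survival x0 \<le> \<kappa> * killed.evol t (\<lambda>x. 1) x0" if t: "0 \<le> t" for t
  proof -
    have "killed.survival x0 = killed.evol t killed.survival x0" by (rule killed.evol_survival[OF t, symmetric])
    also have "\<dots> \<le> killed.evol t (\<lambda>x. \<kappa>) x0"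
      by (rule killed.evol_mono[OF killed.bounded_fun_survival bounded_fun_const k(2) t])
    also have "\<dots> = \<kappa> * killed.evol t (\<lambda>x. 1) x0" by (rule killed.evol_const)
    finally show ?thesis .
  qed
  then have "\<forall>\<^sub>F t in at_top. killed.survival x0 \<le> \<kappa> * killed.evol t (\<lambda>x. 1) x0"
    by (rule eventually_at_top_linorderI)
  then have "killed.survival x0 \<le> \<kappa> * killed.survival x0"
    by (rule tendsto_lowerbound[OF tendsto_mult_left[OF killed.survival_tendsto] _ trivial_limit_at_top_linorder])
  then have "1 \<le> \<kappa>" using x0 by simp
  then have "\<kappa> = 1" using k(4) by simp
  then show ?thesis using k(1) by simp
qed

text \<open>
  A particle that has survived for long is unlikely to be killed any more. In formulas, the free and the killed evolution
  of \<open>\<rho>\<close> differ by at most \<open>gap = 1 - survival\<close> at every time, and \<open>gap\<close> vanishes in the limit both under the killed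
  evolution, where it becomes \<open>evol r 1 - survival\<close>, and under the free one, where \<open>survival\<close> tends to \<open>1\<close>. So the
  two evolutions may be exchanged after a long time \<open>r\<close>.
\<close>

lemma killed_tendsto_iff_free_tendsto:
  assumes \<rho>: "\<And>x. 0 \<le> \<rho> x" "\<And>x. \<rho> x \<le> 1" and \<theta>: "0 \<le> \<theta>" "\<theta> \<le> 1"
  shows "(\<forall>x. ((\<lambda>t. killed.evol t \<rho> x) \<longlongrightarrow> \<theta> * killed.survival x) at_top) \<longleftrightarrow>
    (\<forall>x. ((\<lambda>t. free.evol t \<rho> x) \<longlongrightarrow> \<theta>) at_top)"
proof -
  have \<rho>1: "\<bar>\<rho> x\<bar> \<le> 1" for x using \<rho>[of x] by simp
  have b\<rho>: "bounded_fun \<rho>" by (rule bounded_funI[OF \<rho>1])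
  have K1: "\<bar>killed.evol t \<rho> x\<bar> \<le> 1" if "0 \<le> t" for t x
    by (rule killed.evol_abs_le[where f = \<rho>, OF _ \<rho>1 that]) simp
  have F1: "\<bar>free.evol t \<rho> x\<bar> \<le> 1" if "0 \<le> t" for t x
    by (rule free.evol_abs_le[where f = \<rho>, OF _ \<rho>1 that]) simp
  have bK: "bounded_fun (killed.evol t \<rho>)" and bF: "bounded_fun (free.evol t \<rho>)" if "0 \<le> t" for t
    by (rule bounded_funI[OF K1[OF that]], rule bounded_funI[OF F1[OF that]])
  define gap where "gap x = 1 - killed.survival x" for x
  have bgap: "bounded_fun gap" unfolding gap_def
    by (intro bounded_fun_diff bounded_fun_const killed.bounded_fun_survival)
  have diff: "\<bar>free.evol t \<rho> x - killed.evol t \<rho> x\<bar> \<le> gap x" if t: "0 \<le> t" for t x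
  proof -
    have "0 \<le> free.evol t \<rho> x - killed.evol t \<rho> x"
      using killed_le_free[OF b\<rho> \<rho>(1) t, of x] by simp
    moreover have "killed.evol t (\<lambda>x. 1 - \<rho> x) x \<le> free.evol t (\<lambda>x. 1 - \<rho> x) x"
      by (rule killed_le_free[OF bounded_fun_diff[OF bounded_fun_const b\<rho>] _ t]) (simp add: \<rho>)
    then have "killed.evol t (\<lambda>x. 1) x - killed.evol t \<rho> x \<le> 1 - free.evol t \<rho> x"
      using killed.evol_diff[of "\<lambda>x. 1" \<rho> t x] free.evol_diff[of "\<lambda>x. 1" \<rho> t x] b\<rho>
      by (simp add: free_evol_one[OF t])
    ultimately show ?thesis using killed.survival_le[OF t, of x] by (simp add: gap_def)
  qed
  show ?thesis
  proof (intro iffI allI)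
    fix x assume F: "\<forall>x. ((\<lambda>t. free.evol t \<rho> x) \<longlongrightarrow> \<theta>) at_top"
    show "((\<lambda>t. killed.evol t \<rho> x) \<longlongrightarrow> \<theta> * killed.survival x) at_top"
    proof (rule tendsto_at_top_by_shift)
      fix e :: real assume e: "0 < e"
      have "\<forall>\<^sub>F r in at_top. killed.evol r (\<lambda>x. 1) x < killed.survival x + e / 4"
        by (rule order_tendstoD(2)[OF killed.survival_tendsto]) (use e in simp)
      then have "\<forall>\<^sub>F r in at_top. 0 \<le> r \<and> killed.evol r (\<lambda>x. 1) x < killed.survival x + e / 4"
        by (rule eventually_conj[OF eventually_ge_at_top])
      then obtain r where r: "0 \<le> r" "killed.evol r (\<lambda>x. 1) x < killed.survival x + e / 4"
        using eventually_happens'[OF trivial_limit_at_top_linorder] by blast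
      have "((\<lambda>t. killed.evol r (free.evol t \<rho>) x) \<longlongrightarrow> killed.evol r (\<lambda>x. \<theta>) x) at_top"
        by (rule killed.evol_tendsto_at_top[OF F1]) (use F in auto)
      then have "\<forall>\<^sub>F t in at_top. dist (killed.evol r (free.evol t \<rho>) x) (killed.evol r (\<lambda>x. \<theta>) x) < e / 4"
        by (rule tendstoD) (use e in simp)
      then have "\<forall>\<^sub>F t in at_top. \<bar>killed.evol (r + t) \<rho> x - \<theta> * killed.survival x\<bar> < e"
        using eventually_ge_at_top[of 0]
      proof eventually_elim
        case (elim t)
        have "\<bar>killed.evol r (free.evol t \<rho>) x - killed.evol r (killed.evol t \<rho>) x\<bar> \<le> killed.evol r gap x"
          unfolding killed.evol_diff[OF bF[OF elim(2)] bK[OF elim(2)], symmetric]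
          by (rule killed.evol_abs_le_evol[OF bounded_fun_diff[OF bF bK] bgap diff r(1)]) (rule elim(2))+
        also have "killed.evol r gap x = killed.evol r (\<lambda>x. 1) x - killed.survival x"
          unfolding gap_def using killed.evol_diff[of "\<lambda>x. 1" killed.survival r x] killed.bounded_fun_survival
          by (simp add: killed.evol_survival[OF r(1)])
        finally have 1: "\<bar>killed.evol r (free.evol t \<rho>) x - killed.evol (r + t) \<rho> x\<bar> < e / 4"
          using r(2) by (simp add: killed.evol_semigroup[OF b\<rho> r(1) elim(2)])
        have "0 \<le> killed.evol r (\<lambda>x. 1) x - killed.survival x"
          using killed.survival_le[OF r(1), of x] by simp
        then have "0 \<le> \<theta> * (killed.evol r (\<lambda>x. 1) x - killed.survival x)"
          "\<theta> * (killed.evol r (\<lambda>x. 1) x - killed.survival x) \<le> 1 * (killed.evol r (\<lambda>x. 1) x - killed.survival x)"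
          using \<theta> by (simp, intro mult_right_mono, auto)
        then have 2: "\<bar>killed.evol r (\<lambda>x. \<theta>) x - \<theta> * killed.survival x\<bar> < e / 4"
          using r(2) by (simp add: killed.evol_const[of r \<theta>] right_diff_distrib)
        show ?case using 1 2 elim(1) e unfolding dist_real_def by linarith
      qed
      then show "\<exists>r. \<forall>\<^sub>F t in at_top. \<bar>killed.evol (r + t) \<rho> x - \<theta> * killed.survival x\<bar> < e" by blast
    qed
  next
    fix x assume K: "\<forall>x. ((\<lambda>t. killed.evol t \<rho> x) \<longlongrightarrow> \<theta> * killed.survival x) at_top"
    show "((\<lambda>t. free.evol t \<rho> x) \<longlongrightarrow> \<theta>) at_top"
    proof (rule tendsto_at_top_by_shift)
      fix e :: real assume e: "0 < e"
      have "\<forall>\<^sub>F r in at_top. 1 - e / 4 < free.evol r killed.survival x"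
        by (rule order_tendstoD(1)[OF free_survival_tendsto]) (use e in simp)
      then have "\<forall>\<^sub>F r in at_top. 0 \<le> r \<and> 1 - e / 4 < free.evol r killed.survival x"
        by (rule eventually_conj[OF eventually_ge_at_top])
      then obtain r where r: "0 \<le> r" "1 - e / 4 < free.evol r killed.survival x"
        using eventually_happens'[OF trivial_limit_at_top_linorder] by blast
      have "((\<lambda>t. free.evol r (killed.evol t \<rho>) x) \<longlongrightarrow> free.evol r (\<lambda>x. \<theta> * killed.survival x) x) at_top"
        by (rule free.evol_tendsto_at_top[OF K1]) (use K in auto)
      then have "\<forall>\<^sub>F t in at_top. dist (free.evol r (killed.evol t \<rho>) x) (free.evol r (\<lambda>x. \<theta> * killed.survival x) x) < e / 4"
        by (rule tendstoD) (use e in simp)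
      then have "\<forall>\<^sub>F t in at_top. \<bar>free.evol (r + t) \<rho> x - \<theta>\<bar> < e"
        using eventually_ge_at_top[of 0]
      proof eventually_elim
        case (elim t)
        have "\<bar>free.evol r (free.evol t \<rho>) x - free.evol r (killed.evol t \<rho>) x\<bar> \<le> free.evol r gap x"
          unfolding free.evol_diff[OF bF[OF elim(2)] bK[OF elim(2)], symmetric]
          by (rule free.evol_abs_le_evol[OF bounded_fun_diff[OF bF bK] bgap diff r(1)]) (rule elim(2))+
        also have "free.evol r gap x = 1 - free.evol r killed.survival x"
          unfolding gap_def using free.evol_diff[of "\<lambda>x. 1" killed.survival r x] killed.bounded_fun_survival
          by (simp add: free_evol_one[OF r(1)])
        finally have 1: "\<bar>free.evol (r + t) \<rho> x - free.evol r (killed.evol t \<rho>) x\<bar> < e / 4"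
          using r(2) by (simp add: free.evol_semigroup[OF b\<rho> r(1) elim(2)])
        have "free.evol r killed.survival x \<le> free.evol r (\<lambda>x. 1) x"
          by (rule free.evol_mono[OF killed.bounded_fun_survival bounded_fun_const killed.survival_bounds(2) r(1)])
        then have "0 \<le> 1 - free.evol r killed.survival x" by (simp add: free_evol_one[OF r(1)])
        then have "0 \<le> \<theta> * (1 - free.evol r killed.survival x)"
          "\<theta> * (1 - free.evol r killed.survival x) \<le> 1 * (1 - free.evol r killed.survival x)"
          using \<theta> by (simp, intro mult_right_mono, auto)
        then have 2: "\<bar>free.evol r (\<lambda>x. \<theta> * killed.survival x) x - \<theta>\<bar> < e / 4"
          using r(2) by (simp add: free.evol_scale[OF killed.bounded_fun_survival] right_diff_distrib)
        show ?case using 1 2 elim(1) e unfolding dist_real_def by linarith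
      qed
      then show "\<exists>r. \<forall>\<^sub>F t in at_top. \<bar>free.evol (r + t) \<rho> x - \<theta>\<bar> < e" by blast
    qed
  qed
qed

end

section \<open>The dual process of finite sets\<close>

lemma sum_off_diagonal_swap:
  fixes h :: "'i \<Rightarrow> 'i \<Rightarrow> 'b::comm_monoid_add"
  assumes "finite B"
  shows "(\<Sum>a\<in>B. \<Sum>b\<in>B - {a}. h a b) = (\<Sum>a\<in>B. \<Sum>b\<in>B - {a}. h b a)"
proof -
  have eq: "(\<Sum>a\<in>B. \<Sum>b\<in>B - {a}. h a b) = (\<Sum>a\<in>B. \<Sum>b\<in>B. if a = b then 0 else h a b)" for h :: "'i \<Rightarrow> 'i \<Rightarrow> 'b"
    by (intro sum.cong refl sum.mono_neutral_cong_left) (use assms in auto)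
  show ?thesis
    unfolding eq by (subst sum.swap) (intro sum.cong refl, auto)
qed

lemma sum_off_diagonal_antisym:
  fixes h :: "'i \<Rightarrow> 'i \<Rightarrow> real"
  assumes "finite B" "\<And>a b. h b a = - h a b"
  shows "(\<Sum>a\<in>B. \<Sum>b\<in>B - {a}. h a b) = 0"
proof -
  have "(\<Sum>a\<in>B. \<Sum>b\<in>B - {a}. h b a) = (\<Sum>a\<in>B. \<Sum>b\<in>B - {a}. - h a b)"
    by (intro sum.cong refl assms(2))
  then show ?thesis using sum_off_diagonal_swap[OF assms(1), of h] by (simp add: sum_negf)
qed

definition pair_sum :: "('i \<times> 'i \<Rightarrow> real) \<Rightarrow> 'i set \<Rightarrow> real" where
  "pair_sum \<phi> B = (\<Sum>a\<in>B. \<Sum>b\<in>B - {a}. \<phi> (a, b))"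

lemma pair_sum_insert:
  assumes "finite C" "a \<notin> C"
  shows "pair_sum \<phi> (insert a C) = pair_sum \<phi> C + (\<Sum>b\<in>C. \<phi> (a, b) + \<phi> (b, a))"
proof -
  have "pair_sum \<phi> (insert a C) = (\<Sum>b\<in>C. \<phi> (a, b)) + (\<Sum>x\<in>C. \<Sum>b\<in>insert a C - {x}. \<phi> (x, b))"
    using assms by (simp add: pair_sum_def)
  also have "(\<Sum>x\<in>C. \<Sum>b\<in>insert a C - {x}. \<phi> (x, b)) = (\<Sum>x\<in>C. \<phi> (x, a) + (\<Sum>b\<in>C - {x}. \<phi> (x, b)))"
  proof (rule sum.cong[OF refl])
    fix x assume "x \<in> C"
    then have "insert a C - {x} = insert a (C - {x})" using assms by auto
    then show "(\<Sum>b\<in>insert a C - {x}. \<phi> (x, b)) = \<phi> (x, a) + (\<Sum>b\<in>C - {x}. \<phi> (x, b))"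
      using assms by simp
  qed
  finally show ?thesis by (simp add: pair_sum_def sum.distrib)
qed

lemma pair_sum_remove:
  assumes "finite B" "a \<in> B"
  shows "pair_sum \<phi> B = pair_sum \<phi> (B - {a}) + (\<Sum>b\<in>B - {a}. \<phi> (a, b) + \<phi> (b, a))"
  using pair_sum_insert[of "B - {a}" a \<phi>] assms by (simp add: insert_absorb)

context nve_rates
begin

text \<open>
  The generator of the dual: an exclusion step moves a particle to an empty site, a voter step moves it to
  any site where it may coalesce, \<open>\<beta>\<close> removes a particle, and \<open>\<delta>\<close> kills the whole system.
\<close>

definition dual_generator :: "('s set \<Rightarrow> real) \<Rightarrow> 's set \<Rightarrow> real" where
  "dual_generator f A = (\<Sum>x\<in>A.
     (\<Sum>\<^sub>\<infinity>z\<in>- A. qe x z * (f (insert z (A - {x})) - f A)) +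
     (\<Sum>\<^sub>\<infinity>z. qv x z * (f (insert z (A - {x})) - f A)) +
     \<beta> x * (f (A - {x}) - f A) - \<delta> x * f A)"

lemma weighted_qe_summable:
  assumes "bounded_fun f" shows "(\<lambda>z. qe x z * f z) summable_on S"
proof -
  obtain M where "\<And>x. \<bar>f x\<bar> \<le> M" using bounded_funD[OF assms] by auto
  then show ?thesis
    by (intro weighted_summable_on[where M = M] qe_nonneg summable_on_subset_banach[OF qe_summable]) auto
qed

lemma weighted_qv_summable:
  assumes "bounded_fun f" shows "(\<lambda>z. qv x z * f z) summable_on S"
proof -
  obtain M where "\<And>x. \<bar>f x\<bar> \<le> M" using bounded_funD[OF assms] by auto
  then show ?thesis
    by (intro weighted_summable_on[where M = M] qv_nonneg summable_on_subset_banach[OF qv_summable]) auto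
qed

definition dual_exit :: "'s set \<Rightarrow> 's \<Rightarrow> real" where
  "dual_exit A x = (\<Sum>\<^sub>\<infinity>z\<in>- A. qe x z) + (\<Sum>\<^sub>\<infinity>z. qv x z) + \<beta> x + \<delta> x"

lemma dual_generator_eq:
  assumes f: "bounded_fun f"
  shows "dual_generator f A = (\<Sum>x\<in>A.
     (\<Sum>\<^sub>\<infinity>z\<in>- A. qe x z * f (insert z (A - {x}))) +
     (\<Sum>\<^sub>\<infinity>z. qv x z * f (insert z (A - {x}))) + \<beta> x * f (A - {x})) - (\<Sum>x\<in>A. dual_exit A x) * f A"
proof -
  have b: "bounded_fun (\<lambda>z. f (insert z (A - {x})))" for x by (rule bounded_fun_compose[OF f])
  have e: "(\<Sum>\<^sub>\<infinity>z\<in>S. a z * (g z - m)) = (\<Sum>\<^sub>\<infinity>z\<in>S. a z * g z) - (\<Sum>\<^sub>\<infinity>z\<in>S. a z) * m"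
    if "(\<lambda>z. a z * g z) summable_on S" "a summable_on S" for a g :: "'s \<Rightarrow> real" and S m
  proof -
    have "(\<Sum>\<^sub>\<infinity>z\<in>S. a z * (g z - m)) = (\<Sum>\<^sub>\<infinity>z\<in>S. a z * g z + (- m) * a z)"
      by (simp add: algebra_simps)
    also have "\<dots> = (\<Sum>\<^sub>\<infinity>z\<in>S. a z * g z) + (\<Sum>\<^sub>\<infinity>z\<in>S. (- m) * a z)"
      by (intro infsum_add summable_on_cmult_right that)
    also have "\<dots> = (\<Sum>\<^sub>\<infinity>z\<in>S. a z * g z) - (\<Sum>\<^sub>\<infinity>z\<in>S. a z) * m"
      unfolding infsum_cmult_right' by simp
    finally show ?thesis .
  qed
  have 1: "(\<Sum>\<^sub>\<infinity>z\<in>- A. qe x z * (f (insert z (A - {x})) - f A)) =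
      (\<Sum>\<^sub>\<infinity>z\<in>- A. qe x z * f (insert z (A - {x}))) - (\<Sum>\<^sub>\<infinity>z\<in>- A. qe x z) * f A" for x
    by (intro e weighted_qe_summable b summable_on_subset_banach[OF qe_summable]) auto
  have 2: "(\<Sum>\<^sub>\<infinity>z. qv x z * (f (insert z (A - {x})) - f A)) =
      (\<Sum>\<^sub>\<infinity>z. qv x z * f (insert z (A - {x}))) - (\<Sum>\<^sub>\<infinity>z. qv x z) * f A" for x
    by (intro e weighted_qv_summable b qv_summable)
  show ?thesis
    unfolding dual_generator_def 1 2 dual_exit_def sum_distrib_right sum_subtractf[symmetric]
    by (intro sum.cong refl) (simp add: algebra_simps)
qed

lemma dual_exit_le: "dual_exit A x \<le> rate_bound"
proof -
  have "(\<Sum>\<^sub>\<infinity>z\<in>- A. qe x z) \<le> (\<Sum>\<^sub>\<infinity>z. qe x z)"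
    by (rule infsum_mono_neutral) (use qe_nonneg summable_on_subset_banach[OF qe_summable] in auto)
  moreover have "(\<Sum>\<^sub>\<infinity>z. qe x z) + (\<Sum>\<^sub>\<infinity>z. qv x z) = (\<Sum>\<^sub>\<infinity>z. q x z)"
    unfolding total_rate_def by (rule infsum_add[symmetric, OF qe_summable qv_summable])
  ultimately show ?thesis using infsum_q_le[of x UNIV x] unfolding dual_exit_def by linarith
qed

text \<open>
  The total rate grows with the number of particles, and this number never increases. Restricting to at most
  \<open>n\<close> particles makes the generator bounded.
\<close>

definition dual_operator :: "nat \<Rightarrow> ('s set \<Rightarrow> real) \<Rightarrow> 's set \<Rightarrow> real" where
  "dual_operator n f A =
     (if finite A \<and> card A \<le> n then dual_generator f A else 0) + real n * rate_bound * f A"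

lemma positive_operator_dual: "positive_operator (dual_operator n) (real n * rate_bound)"
proof (rule positive_operatorI)
  fix A :: "'s set"
  show "positive_functional (\<lambda>f. dual_operator n f A)"
  proof (cases "finite A \<and> card A \<le> n")
    case True
    have "(\<Sum>x\<in>A. dual_exit A x) \<le> real (card A) * rate_bound"
      using sum_bounded_above[of A "dual_exit A" rate_bound] dual_exit_le by simp
    also have "\<dots> \<le> real n * rate_bound"
      using True rate_bound_nonneg by (intro mult_right_mono) auto
    finally have c: "0 \<le> real n * rate_bound - (\<Sum>x\<in>A. dual_exit A x)" by simp
    show ?thesis
    proof (rule positive_functional_cong)
      show "positive_functional (\<lambda>f. (\<Sum>x\<in>A.
          (\<Sum>\<^sub>\<infinity>z\<in>- A. qe x z * f (insert z (A - {x}))) +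
          (\<Sum>\<^sub>\<infinity>z. qv x z * f (insert z (A - {x}))) + \<beta> x * f (A - {x})) +
          (real n * rate_bound - (\<Sum>x\<in>A. dual_exit A x)) * f A)"
        by (intro positive_functional_add positive_functional_sum positive_functional_infsum
            positive_functional_eval c)
          (use qe_nonneg qv_nonneg \<beta>_nonneg summable_on_subset_banach[OF qe_summable] qv_summable in auto)
      show "dual_operator n f A = (\<Sum>x\<in>A.
          (\<Sum>\<^sub>\<infinity>z\<in>- A. qe x z * f (insert z (A - {x}))) +
          (\<Sum>\<^sub>\<infinity>z. qv x z * f (insert z (A - {x}))) + \<beta> x * f (A - {x})) +
          (real n * rate_bound - (\<Sum>x\<in>A. dual_exit A x)) * f A" if "bounded_fun f" for f
        using True unfolding dual_operator_def dual_generator_eq[OF that] by (simp add: left_diff_distrib)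
    qed
  next
    case False
    have "positive_functional (\<lambda>f. (real n * rate_bound) * f A)"
      by (rule positive_functional_eval) (use rate_bound_nonneg in simp)
    then show ?thesis unfolding dual_operator_def if_not_P[OF False] by simp
  qed
  have "dual_generator (\<lambda>A. 1) A \<le> 0"
    unfolding dual_generator_def by (simp add: sum_nonneg \<delta>_nonneg sum_negf)
  then show "dual_operator n (\<lambda>A. 1) A \<le> real n * rate_bound"
    by (simp add: dual_operator_def)
qed

lemma dual_generator_cong:
  assumes "finite A" "card A \<le> n" "\<And>B. finite B \<Longrightarrow> card B \<le> n \<Longrightarrow> f B = g B"
  shows "dual_generator f A = dual_generator g A"
proof -
  have c: "card (insert z (A - {x})) \<le> n" if "x \<in> A" for x z
  proof -
    have "card (insert z (A - {x})) \<le> Suc (card (A - {x}))" by (rule card_insert_le_m1) (use assms in auto)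
    also have "\<dots> = card A" by (rule card_Suc_Diff1[OF assms(1) that])
    finally show ?thesis using assms(2) by simp
  qed
  have 1: "f (insert z (A - {x})) = g (insert z (A - {x}))" if "x \<in> A" for x z
    by (rule assms(3)) (use c[OF that] assms in auto)
  have 2: "f (A - {x}) = g (A - {x})" for x
    by (rule assms(3)) (use assms card_Diff1_le[of A x] in auto)
  have 3: "f A = g A" by (rule assms(3)) (use assms in auto)
  show ?thesis unfolding dual_generator_def 2 3 by (intro sum.cong refl) (simp add: 1)
qed

lemma dual_generator_singleton:
  assumes f: "bounded_fun f"
  shows "dual_generator f {x} = killed.gen (\<lambda>y. f {y}) x + \<beta> x * f {}"
proof -
  have b: "bounded_fun (\<lambda>z. f {z} - f {x})" by (intro bounded_fun_diff bounded_fun_compose[OF f] bounded_fun_const)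
  have "(\<Sum>\<^sub>\<infinity>z. qv x z * (f {z} - f {x})) = (\<Sum>\<^sub>\<infinity>z\<in>UNIV - {x}. qv x z * (f {z} - f {x}))"
    by (rule infsum_cong_neutral) auto
  moreover have "(\<Sum>\<^sub>\<infinity>z\<in>UNIV - {x}. qe x z * (f {z} - f {x})) + (\<Sum>\<^sub>\<infinity>z\<in>UNIV - {x}. qv x z * (f {z} - f {x})) =
      (\<Sum>\<^sub>\<infinity>z\<in>UNIV - {x}. q x z * (f {z} - f {x}))"
    unfolding total_rate_def distrib_right
    by (rule infsum_add[symmetric, OF weighted_qe_summable[OF b] weighted_qv_summable[OF b]])
  ultimately show ?thesis
    by (simp add: dual_generator_def jump_generator_def Compl_eq_Diff_UNIV algebra_simps)
qed

text \<open>
  The expected number of ordered pairs in the dual is dominated by the one obtained when each pair evolves on its own as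
  an exclusion pair killed at rate \<open>q\<^sub>v\<close>. The two sides differ in jumps from \<open>x\<close> to a site \<open>u\<close> that is occupied in \<open>B\<close> by a third particle
  and therefore free for the pair \<open>(x, b)\<close>. For exclusion jumps, which the dual suppresses, the contributions of \<open>(x, u)\<close>
  and \<open>(u, x)\<close> cancel by symmetry of \<open>q\<^sub>e\<close>. For voter jumps, which coalesce in the dual, the dual loses all pairs of
  \<open>x\<close> while the exclusion pair moves on. The noise only removes pairs.
\<close>

lemma dual_generator_pair_sum_le:
  assumes \<phi>: "bounded_fun \<phi>" "\<And>p. 0 \<le> \<phi> p" and B: "finite B"
  shows "dual_generator (pair_sum \<phi>) B \<le> (\<Sum>a\<in>B. \<Sum>b\<in>B - {a}. pair.gen \<phi> (a, b))"
proof -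
  define \<psi> where "\<psi> u b = \<phi> (u, b) + \<phi> (b, u)" for u b
  have \<psi>0: "0 \<le> \<psi> u b" for u b using \<phi>(2) by (simp add: \<psi>_def)
  have b\<psi>: "bounded_fun (\<lambda>u. \<psi> u b - m)" for b m
    unfolding \<psi>_def by (intro bounded_fun_diff bounded_fun_add bounded_fun_compose[OF \<phi>(1)] bounded_fun_const)
  have b\<phi>: "bounded_fun (\<lambda>u. \<phi> (u, b) - m)" "bounded_fun (\<lambda>u. \<phi> (b, u) - m)" for b m
    by (intro bounded_fun_diff bounded_fun_compose[OF \<phi>(1)] bounded_fun_const)+
  define s where "s x u = (\<Sum>b\<in>B - {x}. \<psi> u b)" for x u
  have s0: "0 \<le> s x u" for x u unfolding s_def by (intro sum_nonneg \<psi>0)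
  have bs: "bounded_fun (\<lambda>u. s x u - m)" for x m
    unfolding s_def using b\<psi>[of _ 0] by (intro bounded_fun_diff bounded_fun_sum bounded_fun_const) auto
  have p0: "0 \<le> pair_sum \<phi> B" unfolding pair_sum_def by (intro sum_nonneg \<phi>)
  have move: "pair_sum \<phi> (insert z (B - {x})) - pair_sum \<phi> B = s x z - s x x" if "x \<in> B" "z \<notin> B" for x z
    using pair_sum_insert[of "B - {x}" z \<phi>] pair_sum_remove[OF B that(1), of \<phi>] B that
    by (simp add: s_def \<psi>_def)
  have drop: "pair_sum \<phi> (B - {x}) - pair_sum \<phi> B = - s x x" if "x \<in> B" for x
    using pair_sum_remove[OF B that, of \<phi>] by (simp add: s_def \<psi>_def)
  \<comment> \<open>What the particle at \<open>x\<close> contributes to the left-hand side without the noise; \<open>s x u\<close> is the weight of the pairs that a particle at \<open>u\<close> forms with \<open>B - {x}\<close>.\<close>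
  define R where "R x = (\<Sum>\<^sub>\<infinity>z\<in>- B. q x z * (s x z - s x x)) - (\<Sum>z\<in>B - {x}. qv x z * s x x)" for x
  have lhs: "dual_generator (pair_sum \<phi>) B \<le> (\<Sum>x\<in>B. R x)"
    unfolding dual_generator_def
  proof (rule sum_mono)
    fix x assume x: "x \<in> B"
    have v: "qv x z * (pair_sum \<phi> (insert z (B - {x})) - pair_sum \<phi> B) =
        (if z \<in> B then (if z = x then 0 else - (qv x z * s x x)) else qv x z * (s x z - s x x))" for z
    proof (cases "z \<in> B")
      case True
      then show ?thesis
        using drop[OF x] by (cases "z = x") (auto simp: insert_absorb x)
    qed (use move[OF x] in auto)
    have "(\<Sum>\<^sub>\<infinity>z. qv x z * (pair_sum \<phi> (insert z (B - {x})) - pair_sum \<phi> B)) =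
        (\<Sum>\<^sub>\<infinity>z\<in>B \<union> (- B). (if z \<in> B then (if z = x then 0 else - (qv x z * s x x)) else qv x z * (s x z - s x x)))"
      unfolding v by simp
    also have "\<dots> = (\<Sum>\<^sub>\<infinity>z\<in>B. (if z \<in> B then (if z = x then 0 else - (qv x z * s x x)) else qv x z * (s x z - s x x))) +
        (\<Sum>\<^sub>\<infinity>z\<in>- B. (if z \<in> B then (if z = x then 0 else - (qv x z * s x x)) else qv x z * (s x z - s x x)))"
    proof (rule infsum_Un_disjoint)
      show "(\<lambda>z. if z \<in> B then (if z = x then 0 else - (qv x z * s x x)) else qv x z * (s x z - s x x)) summable_on - B"
        using weighted_qv_summable[OF bs, of x x "s x x" "- B"] by (rule summable_on_cong[THEN iffD1, rotated]) auto
    qed (use B in auto)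
    also have "(\<Sum>\<^sub>\<infinity>z\<in>- B. (if z \<in> B then (if z = x then 0 else - (qv x z * s x x)) else qv x z * (s x z - s x x))) =
        (\<Sum>\<^sub>\<infinity>z\<in>- B. qv x z * (s x z - s x x))"
      by (rule infsum_cong) auto
    also have "(\<Sum>\<^sub>\<infinity>z\<in>B. (if z \<in> B then (if z = x then 0 else - (qv x z * s x x)) else qv x z * (s x z - s x x))) =
        - (\<Sum>z\<in>B - {x}. qv x z * s x x)"
      using B x by (simp add: sum.remove[of B x] sum_negf)
    finally have V: "(\<Sum>\<^sub>\<infinity>z. qv x z * (pair_sum \<phi> (insert z (B - {x})) - pair_sum \<phi> B)) =
        (\<Sum>\<^sub>\<infinity>z\<in>- B. qv x z * (s x z - s x x)) - (\<Sum>z\<in>B - {x}. qv x z * s x x)" by simp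
    have "(\<Sum>\<^sub>\<infinity>z\<in>- B. qe x z * (pair_sum \<phi> (insert z (B - {x})) - pair_sum \<phi> B)) =
        (\<Sum>\<^sub>\<infinity>z\<in>- B. qe x z * (s x z - s x x))"
      by (rule infsum_cong) (simp add: move[OF x])
    moreover have "(\<Sum>\<^sub>\<infinity>z\<in>- B. qe x z * (s x z - s x x)) + (\<Sum>\<^sub>\<infinity>z\<in>- B. qv x z * (s x z - s x x)) =
        (\<Sum>\<^sub>\<infinity>z\<in>- B. q x z * (s x z - s x x))"
      unfolding total_rate_def distrib_right
      by (rule infsum_add[symmetric, OF weighted_qe_summable[OF bs] weighted_qv_summable[OF bs]])
    moreover have "\<beta> x * (pair_sum \<phi> (B - {x}) - pair_sum \<phi> B) \<le> 0"
      unfolding drop[OF x] using \<beta>_nonneg s0 by simp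
    moreover have "0 \<le> \<delta> x * pair_sum \<phi> B" using \<delta>_nonneg p0 by simp
    ultimately show "(\<Sum>\<^sub>\<infinity>z\<in>- B. qe x z * (pair_sum \<phi> (insert z (B - {x})) - pair_sum \<phi> B)) +
        (\<Sum>\<^sub>\<infinity>z. qv x z * (pair_sum \<phi> (insert z (B - {x})) - pair_sum \<phi> B)) +
        \<beta> x * (pair_sum \<phi> (B - {x}) - pair_sum \<phi> B) - \<delta> x * pair_sum \<phi> B \<le> R x"
      unfolding V R_def by linarith
  qed
  define G where "G x b = (\<Sum>\<^sub>\<infinity>u\<in>UNIV - {x, b}. q x u * (\<psi> u b - \<psi> x b)) - qv x b * \<psi> x b" for x b
  define H1 where "H1 a b = (\<Sum>\<^sub>\<infinity>u\<in>UNIV - {a, b}. q a u * (\<phi> (u, b) - \<phi> (a, b))) - qv a b * \<phi> (a, b)" for a b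
  define H2 where "H2 a b = (\<Sum>\<^sub>\<infinity>u\<in>UNIV - {a, b}. q a u * (\<phi> (b, u) - \<phi> (b, a))) - qv a b * \<phi> (b, a)" for a b
  have "(\<Sum>a\<in>B. \<Sum>b\<in>B - {a}. pair.gen \<phi> (a, b)) = (\<Sum>a\<in>B. \<Sum>b\<in>B - {a}. H1 a b + H2 b a)"
  proof (intro sum.cong refl)
    fix a b assume "a \<in> B" "b \<in> B - {a}"
    then have "a \<noteq> b" by auto
    then show "pair.gen \<phi> (a, b) = H1 a b + H2 b a"
      unfolding pair_generator_eq[OF \<open>a \<noteq> b\<close> \<phi>(1)] H1_def H2_def insert_commute[of b a]
      by (simp add: algebra_simps)
  qed
  also have "\<dots> = (\<Sum>a\<in>B. \<Sum>b\<in>B - {a}. H1 a b) + (\<Sum>a\<in>B. \<Sum>b\<in>B - {a}. H2 b a)"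
    by (simp add: sum.distrib)
  also have "(\<Sum>a\<in>B. \<Sum>b\<in>B - {a}. H2 b a) = (\<Sum>a\<in>B. \<Sum>b\<in>B - {a}. H2 a b)"
    by (rule sum_off_diagonal_swap[OF B])
  also have "(\<Sum>a\<in>B. \<Sum>b\<in>B - {a}. H1 a b) + (\<Sum>a\<in>B. \<Sum>b\<in>B - {a}. H2 a b) = (\<Sum>a\<in>B. \<Sum>b\<in>B - {a}. G a b)"
    unfolding sum.distrib[symmetric]
  proof (intro sum.cong refl)
    fix a b
    have "(\<Sum>\<^sub>\<infinity>u\<in>UNIV - {a, b}. q a u * (\<phi> (u, b) - \<phi> (a, b))) + (\<Sum>\<^sub>\<infinity>u\<in>UNIV - {a, b}. q a u * (\<phi> (b, u) - \<phi> (b, a)))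
        = (\<Sum>\<^sub>\<infinity>u\<in>UNIV - {a, b}. q a u * (\<phi> (u, b) - \<phi> (a, b)) + q a u * (\<phi> (b, u) - \<phi> (b, a)))"
      by (intro infsum_add[symmetric] weighted_q_summable b\<phi>)
    then show "H1 a b + H2 a b = G a b"
      unfolding H1_def H2_def G_def \<psi>_def by (simp add: algebra_simps)
  qed
  finally have rhs: "(\<Sum>a\<in>B. \<Sum>b\<in>B - {a}. pair.gen \<phi> (a, b)) = (\<Sum>x\<in>B. \<Sum>b\<in>B - {x}. G x b)" .
  \<comment> \<open>The exclusion jumps that only the pair process can make; their total vanishes by antisymmetry in \<open>x\<close> and \<open>u\<close>.\<close>
  define D where "D x b u = qe x u * (\<psi> u b - \<psi> x b)" for x b u
  have each: "R x + (\<Sum>b\<in>B - {x}. \<Sum>u\<in>B - {b} - {x}. D x b u) \<le> (\<Sum>b\<in>B - {x}. G x b)" if x: "x \<in> B" for x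
  proof -
    have split: "(\<Sum>\<^sub>\<infinity>u\<in>UNIV - {x, b}. q x u * (\<psi> u b - \<psi> x b)) =
        (\<Sum>\<^sub>\<infinity>u\<in>- B. q x u * (\<psi> u b - \<psi> x b)) + (\<Sum>u\<in>B - {b} - {x}. q x u * (\<psi> u b - \<psi> x b))"
      if b: "b \<in> B - {x}" for b
    proof -
      have "UNIV - {x, b} = - B \<union> (B - {b} - {x})" using x b by auto
      moreover have "(\<Sum>\<^sub>\<infinity>u\<in>- B \<union> (B - {b} - {x}). q x u * (\<psi> u b - \<psi> x b)) =
          (\<Sum>\<^sub>\<infinity>u\<in>- B. q x u * (\<psi> u b - \<psi> x b)) + (\<Sum>\<^sub>\<infinity>u\<in>B - {b} - {x}. q x u * (\<psi> u b - \<psi> x b))"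
        by (intro infsum_Un_disjoint weighted_q_summable b\<psi>) auto
      ultimately show ?thesis using B by simp
    qed
    have far: "(\<Sum>b\<in>B - {x}. \<Sum>\<^sub>\<infinity>u\<in>- B. q x u * (\<psi> u b - \<psi> x b)) = (\<Sum>\<^sub>\<infinity>z\<in>- B. q x z * (s x z - s x x))"
    proof -
      have "(\<Sum>b\<in>T. \<Sum>\<^sub>\<infinity>u\<in>- B. q x u * (\<psi> u b - \<psi> x b)) = (\<Sum>\<^sub>\<infinity>u\<in>- B. q x u * (\<Sum>b\<in>T. \<psi> u b - \<psi> x b))"
        if "finite T" for T
        using that
      proof (induction T rule: finite_induct)
        case (insert t T)
        have "bounded_fun (\<lambda>u. \<Sum>b\<in>T. \<psi> u b - \<psi> x b)" by (rule bounded_fun_sum) (rule b\<psi>)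
        then have "(\<Sum>\<^sub>\<infinity>u\<in>- B. q x u * (\<psi> u t - \<psi> x t)) + (\<Sum>\<^sub>\<infinity>u\<in>- B. q x u * (\<Sum>b\<in>T. \<psi> u b - \<psi> x b)) =
            (\<Sum>\<^sub>\<infinity>u\<in>- B. q x u * (\<psi> u t - \<psi> x t) + q x u * (\<Sum>b\<in>T. \<psi> u b - \<psi> x b))"
          by (intro infsum_add[symmetric] weighted_q_summable b\<psi>)
        then show ?case using insert by (simp add: distrib_left)
      qed simp
      from this[of "B - {x}"] show ?thesis using B by (simp add: s_def sum_subtractf)
    qed
    have coal: "(\<Sum>z\<in>B - {x}. qv x z * s x x) =
        (\<Sum>b\<in>B - {x}. qv x b * \<psi> x b + (\<Sum>u\<in>B - {b} - {x}. qv x u * \<psi> x b))"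
    proof -
      have "(\<Sum>z\<in>B - {x}. qv x z * s x x) = (\<Sum>b\<in>B - {x}. \<Sum>z\<in>B - {x}. qv x z * \<psi> x b)"
        unfolding s_def sum_distrib_left by (rule sum.swap)
      also have "\<dots> = (\<Sum>b\<in>B - {x}. qv x b * \<psi> x b + (\<Sum>u\<in>B - {b} - {x}. qv x u * \<psi> x b))"
      proof (rule sum.cong[OF refl])
        fix b assume "b \<in> B - {x}"
        moreover have "B - {x} - {b} = B - {b} - {x}" by auto
        ultimately show "(\<Sum>z\<in>B - {x}. qv x z * \<psi> x b) = qv x b * \<psi> x b + (\<Sum>u\<in>B - {b} - {x}. qv x u * \<psi> x b)"
          using B by (simp add: sum.remove[of "B - {x}" b])
      qed
      finally show ?thesis .
    qed
    have "R x + (\<Sum>b\<in>B - {x}. \<Sum>u\<in>B - {b} - {x}. D x b u) =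
        (\<Sum>b\<in>B - {x}. (\<Sum>\<^sub>\<infinity>u\<in>- B. q x u * (\<psi> u b - \<psi> x b)) - qv x b * \<psi> x b +
          ((\<Sum>u\<in>B - {b} - {x}. D x b u) - (\<Sum>u\<in>B - {b} - {x}. qv x u * \<psi> x b)))"
      unfolding R_def coal far[symmetric] by (simp add: sum.distrib sum_subtractf)
    also have "\<dots> \<le> (\<Sum>b\<in>B - {x}. G x b)"
    proof (rule sum_mono)
      fix b assume b: "b \<in> B - {x}"
      have "(\<Sum>u\<in>B - {b} - {x}. D x b u) - (\<Sum>u\<in>B - {b} - {x}. qv x u * \<psi> x b) \<le>
          (\<Sum>u\<in>B - {b} - {x}. q x u * (\<psi> u b - \<psi> x b))"
        unfolding sum_subtractf[symmetric]
      proof (rule sum_mono)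
        fix u
        have "0 \<le> qv x u * \<psi> u b" using qv_nonneg \<psi>0 by simp
        then show "D x b u - qv x u * \<psi> x b \<le> q x u * (\<psi> u b - \<psi> x b)"
          by (simp add: D_def total_rate_def algebra_simps)
      qed
      then show "(\<Sum>\<^sub>\<infinity>u\<in>- B. q x u * (\<psi> u b - \<psi> x b)) - qv x b * \<psi> x b +
          ((\<Sum>u\<in>B - {b} - {x}. D x b u) - (\<Sum>u\<in>B - {b} - {x}. qv x u * \<psi> x b)) \<le> G x b"
        unfolding G_def split[OF b] by linarith
    qed
    finally show ?thesis .
  qed
  have "(\<Sum>x\<in>B. \<Sum>b\<in>B - {x}. \<Sum>u\<in>B - {b} - {x}. D x b u) = (\<Sum>b\<in>B. \<Sum>x\<in>B - {b}. \<Sum>u\<in>B - {b} - {x}. D x b u)"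
    by (rule sum_off_diagonal_swap[OF B, of "\<lambda>x b. \<Sum>u\<in>B - {b} - {x}. D x b u"])
  also have "\<dots> = 0"
  proof (rule sum.neutral, rule ballI)
    fix b assume "b \<in> B"
    show "(\<Sum>x\<in>B - {b}. \<Sum>u\<in>B - {b} - {x}. D x b u) = 0"
      proof (rule sum_off_diagonal_antisym)
      show "D u b x = - D x b u" for x u unfolding D_def qe_sym[of u x] by (simp add: algebra_simps)
    qed (use B in simp)
  qed
  finally have "(\<Sum>x\<in>B. \<Sum>b\<in>B - {x}. \<Sum>u\<in>B - {b} - {x}. D x b u) = 0" .
  moreover have "(\<Sum>x\<in>B. R x) + (\<Sum>x\<in>B. \<Sum>b\<in>B - {x}. \<Sum>u\<in>B - {b} - {x}. D x b u) \<le> (\<Sum>x\<in>B. \<Sum>b\<in>B - {x}. G x b)"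
    unfolding sum.distrib[symmetric] by (rule sum_mono) (rule each)
  ultimately show ?thesis using lhs rhs by linarith
qed

end

section \<open>Limits of solutions of the dual equation\<close>

context nve_rates
begin

text \<open>
  Only right derivatives are demanded, since those are what the generator of the process provides.
\<close>

definition dual_solution :: "(real \<Rightarrow> 's set \<Rightarrow> real) \<Rightarrow> bool" where
  "dual_solution u \<longleftrightarrow> (\<exists>M. \<forall>t\<ge>0. \<forall>A. \<bar>u t A\<bar> \<le> M) \<and>
     (\<forall>A. finite A \<longrightarrow> continuous_on {0..} (\<lambda>t. u t A)) \<and>
     (\<forall>t\<ge>0. \<forall>A. finite A \<longrightarrow> ((\<lambda>t. u t A) has_real_derivative dual_generator (u t) A) (at_right t))"

text \<open>
  Bounded solutions on finite sets become solutions for the bounded operator \<open>dual_operator n\<close> when they are set to \<open>0\<close>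
  beyond \<open>n\<close> particles: this does not affect the smaller sets, from which larger ones are never reached.
\<close>

definition cut :: "nat \<Rightarrow> ('s set \<Rightarrow> real) \<Rightarrow> 's set \<Rightarrow> real" where
  "cut n f A = (if finite A \<and> card A \<le> n then f A else 0)"

definition dual_evol :: "nat \<Rightarrow> real \<Rightarrow> ('s set \<Rightarrow> real) \<Rightarrow> 's set \<Rightarrow> real" where
  "dual_evol n = positive_operator.evol (dual_operator n) (real n * rate_bound)"

lemma cut_small: "finite A \<Longrightarrow> card A \<le> n \<Longrightarrow> cut n f A = f A"
  by (simp add: cut_def)

lemma cut_large: "\<not> (finite A \<and> card A \<le> n) \<Longrightarrow> cut n f A = 0"
  unfolding cut_def by (rule if_not_P)

lemma dual_operator_large: "\<not> (finite A \<and> card A \<le> n) \<Longrightarrow> dual_operator n f A = real n * rate_bound * f A"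
  unfolding dual_operator_def by (simp only: if_not_P if_False add_0)

lemma cut_abs_le: "\<lbrakk>\<And>A. \<bar>f A\<bar> \<le> M\<rbrakk> \<Longrightarrow> \<bar>cut n f A\<bar> \<le> M"
proof -
  assume f: "\<And>A. \<bar>f A\<bar> \<le> M"
  have "0 \<le> M" using f[of A] by linarith
  then show ?thesis using f[of A] by (simp add: cut_def)
qed

lemma dual_solution_bounded: "dual_solution u \<Longrightarrow> 0 \<le> t \<Longrightarrow> bounded_fun (u t)"
  unfolding dual_solution_def bounded_fun_def by auto

lemma dual_solution_eq_evol:
  assumes u: "dual_solution u" and t: "0 \<le> t" and A: "finite A" "card A \<le> n"
  shows "u t A = dual_evol n t (cut n (u 0)) A"
proof -
  interpret dual: positive_operator "dual_operator n" "real n * rate_bound" by (rule positive_operator_dual)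
  obtain M where M: "\<forall>t\<ge>0. \<forall>A. \<bar>u t A\<bar> \<le> M" using u unfolding dual_solution_def by auto
  have "cut n (u t) A = dual.evol t (cut n (u 0)) A"
  proof (rule dual.evol_unique[where u = "\<lambda>t. cut n (u t)" and M = M])
    show "\<bar>cut n (u t) A\<bar> \<le> M" if "0 \<le> t" for t A
      by (rule cut_abs_le) (use M that in simp)
    show "continuous_on {0..} (\<lambda>t. cut n (u t) A)" for A
    proof (cases "finite A \<and> card A \<le> n")
      case True
      then show ?thesis using u by (simp add: dual_solution_def cut_small)
    qed (simp add: cut_large)
    fix t :: real and A :: "'s set" assume t: "0 \<le> t"
    show "((\<lambda>t. cut n (u t) A) has_real_derivative
        dual_operator n (cut n (u t)) A - real n * rate_bound * cut n (u t) A) (at_right t)"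
    proof (cases "finite A \<and> card A \<le> n")
      case True
      have "dual_generator (cut n (u t)) A = dual_generator (u t) A"
        by (rule dual_generator_cong[of A n]) (use True in \<open>auto simp: cut_def\<close>)
      moreover have "((\<lambda>t. u t A) has_real_derivative dual_generator (u t) A) (at_right t)"
        using u t True unfolding dual_solution_def by simp
      ultimately show ?thesis using True by (simp add: cut_def dual_operator_def)
    qed (simp add: cut_large dual_operator_large)
  qed (rule t)
  then show ?thesis using A by (simp add: cut_def[of n _ A] dual_evol_def)
qed

lemma dual_solution_shift:
  assumes u: "dual_solution u" and r: "0 \<le> r"
  shows "dual_solution (\<lambda>t. u (r + t))"
  unfolding dual_solution_def
proof (intro conjI allI impI)
  obtain M where M: "\<forall>t\<ge>0. \<forall>A. \<bar>u t A\<bar> \<le> M" using u unfolding dual_solution_def by auto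
  show "\<exists>M. \<forall>t\<ge>0. \<forall>A. \<bar>u (r + t) A\<bar> \<le> M" using M r by (intro exI[of _ M]) auto
  fix A :: "'s set" assume A: "finite A"
  have "continuous_on {0..} (\<lambda>t. u t A)" using u A by (simp add: dual_solution_def)
  then show "continuous_on {0..} (\<lambda>t. u (r + t) A)"
    by (rule continuous_on_compose2) (use r in \<open>auto intro!: continuous_intros\<close>)
  fix t :: real assume t: "0 \<le> t"
  have "((\<lambda>t. u t A) has_real_derivative dual_generator (u (r + t)) A) (at_right (r + t))"
    using u A r t by (simp add: dual_solution_def)
  then have "((\<lambda>s. (u (s + (r + t)) A - u (r + t) A) / (s + (r + t) - (r + t))) \<longlongrightarrow> dual_generator (u (r + t)) A) (at_right 0)"
    unfolding has_field_derivative_iff by (subst (asm) filterlim_at_right_to_0)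
  then show "((\<lambda>t. u (r + t) A) has_real_derivative dual_generator (u (r + t)) A) (at_right t)"
    unfolding has_field_derivative_iff by (subst filterlim_at_right_to_0) (simp add: ac_simps)
qed

lemma dual_generator_linear:
  assumes f: "bounded_fun f" and g: "bounded_fun g" and A: "finite A"
  shows "dual_generator (\<lambda>A. a * f A + b * g A) A = a * dual_generator f A + b * dual_generator g A"
proof -
  interpret dual: positive_operator "dual_operator (card A)" "real (card A) * rate_bound"
    by (rule positive_operator_dual)
  have eq: "dual_generator h A = dual_operator (card A) h A - real (card A) * rate_bound * h A" for h
    using A by (simp add: dual_operator_def)
  have "dual_operator (card A) (\<lambda>A. a * f A + b * g A) A =
      dual_operator (card A) (\<lambda>A. a * f A) A + dual_operator (card A) (\<lambda>A. b * g A) A"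
    by (rule dual.op_add[OF bounded_fun_mult[OF bounded_fun_const f] bounded_fun_mult[OF bounded_fun_const g]])
  also have "\<dots> = a * dual_operator (card A) f A + b * dual_operator (card A) g A"
    unfolding dual.op_scale[OF f] dual.op_scale[OF g] ..
  finally show ?thesis unfolding eq by (simp add: algebra_simps)
qed

lemma dual_solution_combination:
  assumes u: "dual_solution u" and v: "dual_solution v"
  shows "dual_solution (\<lambda>t A. a * u t A + b * v t A)"
  unfolding dual_solution_def
proof (intro conjI allI impI)
  obtain M where M: "\<forall>t\<ge>0. \<forall>A. \<bar>u t A\<bar> \<le> M" using u unfolding dual_solution_def by auto
  obtain N where N: "\<forall>t\<ge>0. \<forall>A. \<bar>v t A\<bar> \<le> N" using v unfolding dual_solution_def by auto
  have "\<bar>a * u t A + b * v t A\<bar> \<le> \<bar>a\<bar> * M + \<bar>b\<bar> * N" if "0 \<le> t" for t A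
  proof -
    have "\<bar>a * u t A + b * v t A\<bar> \<le> \<bar>a\<bar> * \<bar>u t A\<bar> + \<bar>b\<bar> * \<bar>v t A\<bar>"
      unfolding abs_mult[symmetric] by (rule abs_triangle_ineq)
    also have "\<dots> \<le> \<bar>a\<bar> * M + \<bar>b\<bar> * N"
      using M N that by (intro add_mono mult_left_mono) auto
    finally show ?thesis .
  qed
  then show "\<exists>M. \<forall>t\<ge>0. \<forall>A. \<bar>a * u t A + b * v t A\<bar> \<le> M" by blast
  fix A :: "'s set" assume A: "finite A"
  have "continuous_on {0..} (\<lambda>t. u t A)" "continuous_on {0..} (\<lambda>t. v t A)"
    using u v A by (simp_all add: dual_solution_def)
  then show "continuous_on {0..} (\<lambda>t. a * u t A + b * v t A)" by (intro continuous_intros)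
  fix t :: real assume t: "0 \<le> t"
  have "((\<lambda>t. u t A) has_real_derivative dual_generator (u t) A) (at_right t)"
    "((\<lambda>t. v t A) has_real_derivative dual_generator (v t) A) (at_right t)"
    using u v A t by (simp_all add: dual_solution_def)
  then have "((\<lambda>t. a * u t A + b * v t A) has_real_derivative a * dual_generator (u t) A + b * dual_generator (v t) A) (at_right t)"
    by (intro DERIV_add DERIV_cmult)
  then show "((\<lambda>t. a * u t A + b * v t A) has_real_derivative dual_generator (\<lambda>A. a * u t A + b * v t A) A) (at_right t)"
    unfolding dual_generator_linear[OF dual_solution_bounded[OF u t] dual_solution_bounded[OF v t] A] .
qed

lemma dual_solution_mono:
  assumes u: "dual_solution u" and v: "dual_solution v" and le: "\<And>A. finite A \<Longrightarrow> u 0 A \<le> v 0 A"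
    and t: "0 \<le> t" and A: "finite A"
  shows "u t A \<le> v t A"
proof -
  interpret dual: positive_operator "dual_operator (card A)" "real (card A) * rate_bound"
    by (rule positive_operator_dual)
  have b: "bounded_fun (cut (card A) (u 0))" if u: "dual_solution u" for u
  proof -
    obtain M where "\<forall>t\<ge>0. \<forall>A. \<bar>u t A\<bar> \<le> M" using u unfolding dual_solution_def by auto
    then show ?thesis by (intro bounded_funI[of _ M] cut_abs_le) auto
  qed
  have "dual.evol t (cut (card A) (u 0)) A \<le> dual.evol t (cut (card A) (v 0)) A"
    by (rule dual.evol_mono[OF b[OF u] b[OF v] _ t]) (simp add: cut_def le)
  then show ?thesis
    using dual_solution_eq_evol[OF u t A order_refl] dual_solution_eq_evol[OF v t A order_refl] by (simp add: dual_evol_def)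
qed

text \<open>
  The hypothesis on the empty set holds for the difference of two solutions that come from probability measures. It
  switches off the inhomogeneous term \<open>\<beta> x * f {}\<close> of the equation on singletons.
\<close>

lemma dual_solution_singleton:
  assumes u: "dual_solution u" and u0: "\<And>t. 0 \<le> t \<Longrightarrow> u t {} = 0" and t: "0 \<le> t"
  shows "u t {x} = killed.evol t (\<lambda>x. u 0 {x}) x"
proof -
  obtain M where M: "\<forall>t\<ge>0. \<forall>A. \<bar>u t A\<bar> \<le> M" using u unfolding dual_solution_def by auto
  show ?thesis
  proof (rule killed.evol_unique[where u = "\<lambda>t x. u t {x}" and M = M])
    show "\<bar>u t {x}\<bar> \<le> M" if "0 \<le> t" for t x using M that by simp
    show "continuous_on {0..} (\<lambda>t. u t {x})" for x using u by (simp add: dual_solution_def)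
    show "((\<lambda>t. u t {x}) has_real_derivative
        killed.gen (\<lambda>x. u t {x}) x + 4 * rate_bound * u t {x} - 4 * rate_bound * u t {x}) (at_right t)"
      if t: "0 \<le> t" for t x
    proof -
      have "((\<lambda>t. u t {x}) has_real_derivative dual_generator (u t) {x}) (at_right t)"
        using u t unfolding dual_solution_def by simp
      then show ?thesis
        by (simp add: dual_generator_singleton[OF dual_solution_bounded[OF u t]] u0[OF t])
    qed
  qed (rule t)
qed

text \<open>
  Shifting \<open>v\<close> by \<open>r\<close> does not change its limit, and the evolution for time \<open>r\<close> is continuous under bounded pointwise
  convergence, so it fixes the limit.
\<close>

lemma dual_solution_stationary:
  assumes u: "dual_solution u" and v: "dual_solution v"
    and lim: "\<And>A. finite A \<Longrightarrow> ((\<lambda>t. v t A) \<longlongrightarrow> u 0 A) at_top"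
    and r: "0 \<le> r" and A: "finite A"
  shows "u r A = u 0 A"
proof -
  interpret dual: positive_operator "dual_operator (card A)" "real (card A) * rate_bound"
    by (rule positive_operator_dual)
  obtain M where M: "\<forall>t\<ge>0. \<forall>A. \<bar>v t A\<bar> \<le> M" using v unfolding dual_solution_def by auto
  have "((\<lambda>t. dual.evol r (cut (card A) (v t)) A) \<longlongrightarrow> dual.evol r (cut (card A) (u 0)) A) at_top"
  proof (rule dual.evol_tendsto_at_top[where M = M])
    show "\<bar>cut (card A) (v t) B\<bar> \<le> M" if "0 \<le> t" for t B by (rule cut_abs_le) (use M that in simp)
    show "((\<lambda>t. cut (card A) (v t) B) \<longlongrightarrow> cut (card A) (u 0) B) at_top" for B
    proof (cases "finite B \<and> card B \<le> card A")
      case True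
      then show ?thesis using lim[of B] by (simp add: cut_small)
    qed (simp add: cut_large)
  qed
  moreover have "((\<lambda>t. dual.evol r (cut (card A) (v t)) A) \<longlongrightarrow> u 0 A) at_top"
  proof (rule Lim_transform_eventually[OF tendsto_at_top_add_const[OF lim[OF A], of r]])
    show "\<forall>\<^sub>F t in at_top. v (r + t) A = dual.evol r (cut (card A) (v t)) A"
    proof (rule eventually_at_top_linorderI)
      fix t :: real assume t: "0 \<le> t"
      show "v (r + t) A = dual.evol r (cut (card A) (v t)) A"
        using dual_solution_eq_evol[OF dual_solution_shift[OF v t] r A order_refl]
        by (simp add: dual_evol_def add.commute)
    qed
  qed
  ultimately have "dual.evol r (cut (card A) (u 0)) A = u 0 A"
    by (rule tendsto_unique[OF trivial_limit_at_top_linorder])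
  then show ?thesis using dual_solution_eq_evol[OF u r A order_refl] by (simp add: dual_evol_def)
qed

lemma pair_evol_one_bounds:
  assumes "0 \<le> t" shows "0 \<le> pair.evol t (\<lambda>p. 1) p" "pair.evol t (\<lambda>p. 1) p \<le> 1"
  by (rule pair.evol_nonneg[OF bounded_fun_const _ assms], simp) (rule pair.evol_one_le[OF assms])

text \<open>
  A set with at least two elements contains an ordered pair, and the pair sum of the killed pair evolution is a
  supersolution of the dual equation.
\<close>

lemma dual_evol_two_particles_le:
  assumes t: "0 \<le> t" and A: "finite A" "card A \<le> n"
  shows "dual_evol n t (cut n (\<lambda>B. of_bool (2 \<le> card B))) A \<le> pair_sum (pair.evol t (\<lambda>p. 1)) A"
proof -
  interpret dual: positive_operator "dual_operator n" "real n * rate_bound" by (rule positive_operator_dual)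
  let ?\<phi> = "\<lambda>t. pair.evol t (\<lambda>p. 1)"
  have b\<phi>: "bounded_fun (?\<phi> t)" if "0 \<le> t" for t by (rule pair.bounded_fun_evol[OF bounded_fun_const that])
  have "dual.evol t (cut n (\<lambda>B. of_bool (2 \<le> card B))) A \<le> cut n (pair_sum (?\<phi> t)) A"
  proof (rule dual.evol_le_supersolution[where u = "\<lambda>t. cut n (pair_sum (?\<phi> t))" and M = "real n * real n"
        and u' = "\<lambda>t. cut n (\<lambda>B. \<Sum>a\<in>B. \<Sum>b\<in>B - {a}. pair.gen (?\<phi> t) (a, b))"])
    fix t :: real and B :: "'s set" assume t: "0 \<le> t"
    show "\<bar>cut n (pair_sum (?\<phi> t)) B\<bar> \<le> real n * real n"
    proof (cases "finite B \<and> card B \<le> n")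
      case True
      have "pair_sum (?\<phi> t) B \<le> (\<Sum>a\<in>B. \<Sum>b\<in>B - {a}. 1)"
        unfolding pair_sum_def by (intro sum_mono pair_evol_one_bounds t)
      also have "\<dots> \<le> (\<Sum>a\<in>B. real n)"
        by (intro sum_mono) (use True card_Diff1_le[of B] le_trans in \<open>auto\<close>)
      also have "\<dots> = real (card B) * real n" by simp
      also have "\<dots> \<le> real n * real n" using True by (intro mult_right_mono) auto
      finally have "pair_sum (?\<phi> t) B \<le> real n * real n" .
      moreover have "0 \<le> pair_sum (?\<phi> t) B"
        unfolding pair_sum_def by (intro sum_nonneg pair_evol_one_bounds t)
      ultimately show ?thesis using True by (simp add: cut_small)
    qed (simp add: cut_large)
    show "((\<lambda>t. cut n (pair_sum (?\<phi> t)) B) has_real_derivative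
        cut n (\<lambda>B. \<Sum>a\<in>B. \<Sum>b\<in>B - {a}. pair.gen (?\<phi> t) (a, b)) B) (at_right t)"
    proof (cases "finite B \<and> card B \<le> n")
      case True
      have "((\<lambda>t. \<Sum>a\<in>B. \<Sum>b\<in>B - {a}. ?\<phi> t (a, b)) has_real_derivative
          (\<Sum>a\<in>B. \<Sum>b\<in>B - {a}. pair.gen (?\<phi> t) (a, b))) (at_right t)"
        by (intro DERIV_sum has_field_derivative_at_within[OF pair.gen_derivative] bounded_fun_const t)
      then show ?thesis using True by (simp add: cut_small pair_sum_def)
    qed (simp add: cut_large)
    show "dual_operator n (cut n (pair_sum (?\<phi> t))) B - real n * rate_bound * cut n (pair_sum (?\<phi> t)) B
        \<le> cut n (\<lambda>B. \<Sum>a\<in>B. \<Sum>b\<in>B - {a}. pair.gen (?\<phi> t) (a, b)) B"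
    proof (cases "finite B \<and> card B \<le> n")
      case True
      have "dual_generator (cut n (pair_sum (?\<phi> t))) B = dual_generator (pair_sum (?\<phi> t)) B"
        by (rule dual_generator_cong[of B n]) (use True in \<open>auto simp: cut_def\<close>)
      also have "\<dots> \<le> (\<Sum>a\<in>B. \<Sum>b\<in>B - {a}. pair.gen (?\<phi> t) (a, b))"
        by (rule dual_generator_pair_sum_le[OF b\<phi>[OF t] pair_evol_one_bounds(1)[OF t]]) (use True in simp)
      finally show ?thesis using True by (simp add: dual_operator_def cut_def[of n _ B])
    qed (simp add: cut_large dual_operator_large)
  next
    fix B :: "'s set"
    show "continuous_on {0..} (\<lambda>t. cut n (pair_sum (?\<phi> t)) B)"
    proof (cases "finite B \<and> card B \<le> n")
      case True
      have "continuous_on {0..} (\<lambda>t. \<Sum>a\<in>B. \<Sum>b\<in>B - {a}. ?\<phi> t (a, b))"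
        by (intro continuous_on_sum pair.evol_continuous bounded_fun_const)
      then show ?thesis using True by (simp add: cut_small pair_sum_def)
    qed (simp add: cut_large)
    show "cut n (\<lambda>B. of_bool (2 \<le> card B)) B \<le> cut n (pair_sum (?\<phi> 0)) B"
    proof (cases "finite B \<and> card B \<le> n \<and> 2 \<le> card B")
      case True
      then obtain a where a: "a \<in> B" by fastforce
      have "1 \<le> card (B - {a})" using True card_Diff_singleton[OF a] by linarith
      then have "1 \<le> real (card (B - {a}))" by simp
      also have "\<dots> = (\<Sum>b\<in>B - {a}. 1)" by simp
      also have "\<dots> \<le> (\<Sum>a\<in>B. \<Sum>b\<in>B - {a}. 1)"
        by (rule member_le_sum[OF a]) (use True in auto)
      finally show ?thesis using True by (simp add: cut_def pair_sum_def pair.evol_0)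
    next
      case False
      then have "cut n (\<lambda>B. of_bool (2 \<le> card B)) B = 0" by (auto simp: cut_def)
      moreover have "0 \<le> cut n (pair_sum (?\<phi> 0)) B"
        by (simp add: cut_def pair_sum_def pair.evol_0 sum_nonneg)
      ultimately show ?thesis by simp
    qed
  next
    show "bounded_fun (cut n (\<lambda>B. of_bool (2 \<le> card B)))"
      by (rule bounded_funI[of _ 1]) (simp add: cut_def)
  qed (rule t)
  then show ?thesis using A by (simp add: cut_def[of n _ A] dual_evol_def)
qed

end

context voter_rates
begin

text \<open>
  After a long time \<open>r\<close> the dual has at most one particle, except with small probability. So \<open>w (r + t) A\<close> is, up to a
  small error, an average of the values of \<open>w t\<close> on singletons and on the empty set.
\<close>

lemma dual_solution_tendsto_0:
  assumes w: "dual_solution w" and w0: "\<And>t. 0 \<le> t \<Longrightarrow> w t {} = 0"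
    and w1: "\<And>x. ((\<lambda>t. w t {x}) \<longlongrightarrow> 0) at_top" and A: "finite A"
  shows "((\<lambda>t. w t A) \<longlongrightarrow> 0) at_top"
proof (rule tendsto_at_top_by_shift)
  fix e :: real assume e: "0 < e"
  let ?n = "card A"
  interpret dual: positive_operator "dual_operator ?n" "real ?n * rate_bound" by (rule positive_operator_dual)
  obtain M where M: "\<forall>t\<ge>0. \<forall>A. \<bar>w t A\<bar> \<le> M" using w unfolding dual_solution_def by auto
  have M0: "0 \<le> M" using M[rule_format, of 0 "{}"] by simp
  define two where "two = cut ?n (\<lambda>B. of_bool (2 \<le> card B))"
  define one where "one t = cut ?n (\<lambda>B. of_bool (card B = 1) * \<bar>w t B\<bar>)" for t
  have two1: "\<bar>two B\<bar> \<le> 1" for B by (simp add: two_def cut_def)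
  have btwo: "bounded_fun two" by (rule bounded_funI[OF two1])
  have oneM: "\<bar>one t B\<bar> \<le> M" if "0 \<le> t" for t B
    unfolding one_def by (rule cut_abs_le) (use M M0 that in simp)
  have bone: "bounded_fun (one t)" if "0 \<le> t" for t by (rule bounded_funI[OF oneM[OF that]])
  have "((\<lambda>r. M * pair_sum (pair.evol r (\<lambda>p. 1)) A) \<longlongrightarrow> M * (\<Sum>a\<in>A. \<Sum>b\<in>A - {a}. 0)) at_top"
    unfolding pair_sum_def
  proof (intro tendsto_mult_left tendsto_sum)
    fix a b assume "b \<in> A - {a}"
    then have "a \<noteq> b" by auto
    show "((\<lambda>r. pair.evol r (\<lambda>p. 1) (a, b)) \<longlongrightarrow> 0) at_top"
      using pair.survival_tendsto[of "(a, b)"] unfolding pairs_meet[OF \<open>a \<noteq> b\<close>] .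
  qed
  then have "\<forall>\<^sub>F r in at_top. M * pair_sum (pair.evol r (\<lambda>p. 1)) A < e / 2"
    by (rule order_tendstoD(2)) (use e in simp)
  then have "\<forall>\<^sub>F r in at_top. 0 \<le> r \<and> M * pair_sum (pair.evol r (\<lambda>p. 1)) A < e / 2"
    by (rule eventually_conj[OF eventually_ge_at_top])
  then obtain r where r: "0 \<le> r" "M * pair_sum (pair.evol r (\<lambda>p. 1)) A < e / 2"
    using eventually_happens'[OF trivial_limit_at_top_linorder] by blast
  have "((\<lambda>t. dual.evol r (one t) A) \<longlongrightarrow> dual.evol r (\<lambda>B. 0) A) at_top"
  proof (rule dual.evol_tendsto_at_top[OF oneM])
    show "((\<lambda>t. one t B) \<longlongrightarrow> 0) at_top" for B
    proof (cases "finite B \<and> card B \<le> ?n \<and> card B = 1")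
      case True
      then obtain x where "B = {x}" using card_1_singletonE by metis
      then show ?thesis using True tendsto_rabs_zero[OF w1[of x]] by (simp add: one_def cut_def)
    next
      case False
      then have "one t B = 0" for t by (auto simp: one_def cut_def)
      then show ?thesis by simp
    qed
  qed
  moreover have "dual.evol r (\<lambda>B. 0) A = 0" using dual.evol_const[of r 0 A] by simp
  ultimately have "\<forall>\<^sub>F t in at_top. dual.evol r (one t) A < e / 2"
    using e by (intro order_tendstoD(2)[of _ 0]) auto
  then have "\<forall>\<^sub>F t in at_top. \<bar>w (r + t) A - 0\<bar> < e"
    using eventually_ge_at_top[of 0]
  proof eventually_elim
    case (elim t)
    have cutM: "\<bar>cut ?n (w t) B\<bar> \<le> M" for B by (rule cut_abs_le) (use M elim(2) in simp)
    have eq: "w (r + t) A = dual.evol r (cut ?n (w t)) A"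
      using dual_solution_eq_evol[OF dual_solution_shift[OF w elim(2)] r(1) A order_refl]
      by (simp add: dual_evol_def add.commute)
    have "\<bar>dual.evol r (cut ?n (w t)) A\<bar> \<le> dual.evol r (\<lambda>B. one t B + M * two B) A"
    proof (rule dual.evol_abs_le_evol)
      show "\<bar>cut ?n (w t) B\<bar> \<le> one t B + M * two B" for B
      proof (cases "finite B \<and> card B \<le> ?n")
        case True
        consider "card B = 0" | "card B = 1" | "2 \<le> card B" by linarith
        then show ?thesis
        proof cases
          case 1
          then have "B = {}" using True by simp
          then show ?thesis using w0[OF elim(2)] by (simp add: cut_def one_def two_def)
        next
          case 3
          then show ?thesis using True M elim(2) by (simp add: cut_def one_def two_def)
        qed (use True in \<open>simp add: cut_def one_def two_def\<close>)
      qed (simp add: cut_large one_def two_def)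
      show "bounded_fun (cut ?n (w t))" by (rule bounded_funI[OF cutM])
      show "bounded_fun (\<lambda>B. one t B + M * two B)"
        by (intro bounded_fun_add bounded_fun_mult bounded_fun_const bone[OF elim(2)] btwo)
    qed (rule r(1))
    also have "\<dots> = dual.evol r (one t) A + dual.evol r (\<lambda>B. M * two B) A"
      by (rule dual.evol_add[OF bone[OF elim(2)] bounded_fun_mult[OF bounded_fun_const btwo]])
    also have "dual.evol r (\<lambda>B. M * two B) A = M * dual.evol r two A"
      by (rule dual.evol_scale[OF btwo])
    also have "M * dual.evol r two A \<le> M * pair_sum (pair.evol r (\<lambda>p. 1)) A"
      using dual_evol_two_particles_le[OF r(1) A order_refl] M0
      by (intro mult_left_mono) (simp_all add: two_def dual_evol_def)
    finally have "\<bar>w (r + t) A\<bar> \<le> dual.evol r (one t) A + M * pair_sum (pair.evol r (\<lambda>p. 1)) A"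
      unfolding eq by simp
    then show ?case using elim(1) r(2) by simp
  qed
  then show "\<exists>r. \<forall>\<^sub>F t in at_top. \<bar>w (r + t) A - 0\<bar> < e" by blast
qed

end

text \<open>
  The solutions started from the empty and from the full configuration lie below and above all others that come from
  probability measures. By comparison with their own time shifts they are monotone in time, hence converge.
\<close>

locale reference_solutions = survival_rates +
  fixes u0 u1 :: "real \<Rightarrow> 'a set \<Rightarrow> real"
  assumes solution0: "dual_solution u0" and solution1: "dual_solution u1"
    and initial0: "finite A \<Longrightarrow> u0 0 A = of_bool (A = {})" and initial1: "finite A \<Longrightarrow> u1 0 A = 1"
    and empty0: "0 \<le> t \<Longrightarrow> u0 t {} = 1" and empty1: "0 \<le> t \<Longrightarrow> u1 t {} = 1"
    and range0: "0 \<le> t \<Longrightarrow> 0 \<le> u0 t A \<and> u0 t A \<le> 1" and range1: "0 \<le> t \<Longrightarrow> 0 \<le> u1 t A \<and> u1 t A \<le> 1"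
begin

definition limit0 :: "'a set \<Rightarrow> real" where "limit0 A = Lim at_top (\<lambda>t. u0 t A)"
definition limit1 :: "'a set \<Rightarrow> real" where "limit1 A = Lim at_top (\<lambda>t. u1 t A)"

lemma limit0: "finite A \<Longrightarrow> ((\<lambda>t. u0 t A) \<longlongrightarrow> limit0 A) at_top"
proof -
  assume A: "finite A"
  have "\<exists>L. ((\<lambda>t. u0 t A) \<longlongrightarrow> L) at_top \<and> (\<forall>t\<ge>0. u0 t A \<le> L)"
  proof (rule mono_bounded_tendsto_at_top[of _ 1])
    fix s t :: real assume st: "0 \<le> s" "s \<le> t"
    have "u0 s A \<le> u0 ((t - s) + s) A"
    proof (rule dual_solution_mono[OF solution0 dual_solution_shift[OF solution0]])
      show "u0 0 B \<le> u0 (t - s + 0) B" if "finite B" for B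
        using initial0[OF that] range0[of "t - s" B] empty0[of "t - s"] st by (cases "B = {}") auto
    qed (use st A in auto)
    then show "u0 s A \<le> u0 t A" by simp
  qed (use range0 in simp)
  then obtain L where L: "((\<lambda>t. u0 t A) \<longlongrightarrow> L) at_top" by blast
  then show ?thesis unfolding limit0_def using tendsto_Lim[OF trivial_limit_at_top_linorder L] by simp
qed

lemma limit1: "finite A \<Longrightarrow> ((\<lambda>t. u1 t A) \<longlongrightarrow> limit1 A) at_top"
proof -
  assume A: "finite A"
  have "\<exists>L. ((\<lambda>t. u1 t A) \<longlongrightarrow> L) at_top \<and> (\<forall>t\<ge>0. L \<le> u1 t A)"
  proof (rule antimono_bounded_tendsto_at_top[of _ 0])
    fix s t :: real assume st: "0 \<le> s" "s \<le> t"
    have "u1 ((t - s) + s) A \<le> u1 s A"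
    proof (rule dual_solution_mono[OF dual_solution_shift[OF solution1] solution1])
      show "u1 (t - s + 0) B \<le> u1 0 B" if "finite B" for B
        using initial1[OF that] range1[of "t - s" B] st by simp
    qed (use st A in auto)
    then show "u1 t A \<le> u1 s A" by simp
  qed (use range1 in simp)
  then obtain L where L: "((\<lambda>t. u1 t A) \<longlongrightarrow> L) at_top" by blast
  then show ?thesis unfolding limit1_def using tendsto_Lim[OF trivial_limit_at_top_linorder L] by simp
qed

text \<open>
  Subtracting \<open>u0\<close> leaves the initial density unchanged, because \<open>u0\<close> starts without particles.
\<close>

lemma singleton_minus_u0:
  assumes u: "dual_solution u" and e: "\<And>t. 0 \<le> t \<Longrightarrow> u t {} = 1" and t: "0 \<le> t"
  shows "u t {x} - u0 t {x} = killed.evol t (\<lambda>x. u 0 {x}) x"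
proof -
  have "1 * u t {x} + (- 1) * u0 t {x} = killed.evol t (\<lambda>x. 1 * u 0 {x} + (- 1) * u0 0 {x}) x"
    by (rule dual_solution_singleton[OF dual_solution_combination[OF u solution0, of 1 "-1"] _ t])
      (use e empty0 in simp)
  then show ?thesis by (simp add: initial0)
qed

lemma limit_difference: "limit1 {x} - limit0 {x} = killed.survival x"
proof (rule tendsto_unique[OF trivial_limit_at_top_linorder])
  show "((\<lambda>t. u1 t {x} - u0 t {x}) \<longlongrightarrow> limit1 {x} - limit0 {x}) at_top"
    by (intro tendsto_diff limit0 limit1) auto
  show "((\<lambda>t. u1 t {x} - u0 t {x}) \<longlongrightarrow> killed.survival x) at_top"
  proof (rule Lim_transform_eventually[OF killed.survival_tendsto])
    have "killed.evol t (\<lambda>x. 1) x = u1 t {x} - u0 t {x}" if "0 \<le> t" for t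
      using singleton_minus_u0[OF solution1 empty1 that, of x] by (simp add: initial1)
    then show "\<forall>\<^sub>F t in at_top. killed.evol t (\<lambda>x. 1) x = u1 t {x} - u0 t {x}"
      by (rule eventually_at_top_linorderI)
  qed
qed

text \<open>
  On singletons the left-hand side says that the killed evolution of the initial density tends to \<open>\<theta> * survival\<close>. This
  equals the right-hand side for the free evolution, and the larger sets follow since the difference of \<open>u\<close> and the mixture
  of \<open>u1\<close> and \<open>u0\<close> vanishes in the limit on singletons.
\<close>

lemma dual_solution_limit_iff:
  assumes u: "dual_solution u" and e: "\<And>t. 0 \<le> t \<Longrightarrow> u t {} = 1"
    and range: "\<And>x. 0 \<le> u 0 {x}" "\<And>x. u 0 {x} \<le> 1" and \<theta>: "0 \<le> \<theta>" "\<theta> \<le> 1"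
  shows "(\<forall>A. finite A \<longrightarrow> ((\<lambda>t. u t A) \<longlongrightarrow> \<theta> * limit1 A + (1 - \<theta>) * limit0 A) at_top) \<longleftrightarrow>
    (\<forall>x. ((\<lambda>t. free.evol t (\<lambda>x. u 0 {x}) x) \<longlongrightarrow> \<theta>) at_top)"
  unfolding killed_tendsto_iff_free_tendsto[of "\<lambda>x. u 0 {x}", OF range \<theta>, symmetric]
proof (intro iffI allI impI)
  fix x assume lim: "\<forall>A. finite A \<longrightarrow> ((\<lambda>t. u t A) \<longlongrightarrow> \<theta> * limit1 A + (1 - \<theta>) * limit0 A) at_top"
  have "((\<lambda>t. u t {x} - u0 t {x}) \<longlongrightarrow> (\<theta> * limit1 {x} + (1 - \<theta>) * limit0 {x}) - limit0 {x}) at_top"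
    by (intro tendsto_diff lim[rule_format] limit0) auto
  also have "(\<theta> * limit1 {x} + (1 - \<theta>) * limit0 {x}) - limit0 {x} = \<theta> * killed.survival x"
    unfolding limit_difference[symmetric] by (simp add: algebra_simps)
  finally show "((\<lambda>t. killed.evol t (\<lambda>x. u 0 {x}) x) \<longlongrightarrow> \<theta> * killed.survival x) at_top"
  proof (rule Lim_transform_eventually)
    show "\<forall>\<^sub>F t in at_top. u t {x} - u0 t {x} = killed.evol t (\<lambda>x. u 0 {x}) x"
      by (rule eventually_at_top_linorderI[of 0]) (rule singleton_minus_u0[OF u e])
  qed
next
  fix A :: "'a set"
  assume lim: "\<forall>x. ((\<lambda>t. killed.evol t (\<lambda>x. u 0 {x}) x) \<longlongrightarrow> \<theta> * killed.survival x) at_top" and A: "finite A"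
  define w where "w t A = 1 * u t A + (- 1) * (\<theta> * u1 t A + (1 - \<theta>) * u0 t A)" for t A
  have "((\<lambda>t. w t A) \<longlongrightarrow> 0) at_top"
  proof (rule dual_solution_tendsto_0[OF _ _ _ A])
    show "dual_solution w"
      unfolding w_def by (rule dual_solution_combination[OF u dual_solution_combination[OF solution1 solution0]])
    show "w t {} = 0" if "0 \<le> t" for t
      using that by (simp add: w_def e empty0 empty1)
    show "((\<lambda>t. w t {x}) \<longlongrightarrow> 0) at_top" for x
    proof -
      have "((\<lambda>t. killed.evol t (\<lambda>x. u 0 {x}) x - \<theta> * killed.evol t (\<lambda>x. 1) x) \<longlongrightarrow>
          \<theta> * killed.survival x - \<theta> * killed.survival x) at_top"
        by (intro tendsto_diff tendsto_mult_left lim[rule_format] killed.survival_tendsto)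
      then have "((\<lambda>t. killed.evol t (\<lambda>x. u 0 {x}) x - \<theta> * killed.evol t (\<lambda>x. 1) x) \<longlongrightarrow> 0) at_top" by simp
      then show ?thesis
      proof (rule Lim_transform_eventually)
        show "\<forall>\<^sub>F t in at_top. killed.evol t (\<lambda>x. u 0 {x}) x - \<theta> * killed.evol t (\<lambda>x. 1) x = w t {x}"
        proof (rule eventually_at_top_linorderI)
          fix t :: real assume t: "0 \<le> t"
          have "killed.evol t (\<lambda>x. 1) x = u1 t {x} - u0 t {x}"
            using singleton_minus_u0[OF solution1 empty1 t, of x] by (simp add: initial1)
          moreover have "killed.evol t (\<lambda>x. u 0 {x}) x = u t {x} - u0 t {x}"
            by (rule singleton_minus_u0[OF u e t, symmetric])
          ultimately show "killed.evol t (\<lambda>x. u 0 {x}) x - \<theta> * killed.evol t (\<lambda>x. 1) x = w t {x}"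
            unfolding w_def by (simp only:) (simp add: algebra_simps)
        qed
      qed
    qed
  qed
  then have "((\<lambda>t. w t A + (\<theta> * u1 t A + (1 - \<theta>) * u0 t A)) \<longlongrightarrow> 0 + (\<theta> * limit1 A + (1 - \<theta>) * limit0 A)) at_top"
    by (intro tendsto_add tendsto_mult_left limit0[OF A] limit1[OF A])
  then show "((\<lambda>t. u t A) \<longlongrightarrow> \<theta> * limit1 A + (1 - \<theta>) * limit0 A) at_top"
    by (simp add: w_def)
qed

text \<open>
  For a stationary solution \<open>u\<close> the function \<open>l x = u {x} - limit0 {x}\<close> is invariant under the killed walk. Its
  free evolution increases to a constant \<open>\<kappa>\<close>, hence \<open>l = \<kappa> survival\<close>.
\<close>

lemma stationary_dual_solution:
  assumes u: "dual_solution u" and e: "\<And>t. 0 \<le> t \<Longrightarrow> u t {} = 1"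
    and range: "\<And>x. 0 \<le> u 0 {x}" "\<And>x. u 0 {x} \<le> 1"
    and stat: "\<And>t A. 0 \<le> t \<Longrightarrow> finite A \<Longrightarrow> u t A = u 0 A"
  shows "\<exists>\<theta>. 0 \<le> \<theta> \<and> \<theta> \<le> 1 \<and> (\<forall>A. finite A \<longrightarrow> u 0 A = \<theta> * limit1 A + (1 - \<theta>) * limit0 A)"
proof -
  let ?\<rho> = "\<lambda>x. u 0 {x}"
  define l where "l x = u 0 {x} - limit0 {x}" for x
  have \<rho>1: "\<bar>?\<rho> x\<bar> \<le> 1" for x using range(1)[of x] range(2)[of x] by simp
  have b\<rho>: "bounded_fun ?\<rho>" by (rule bounded_funI[OF \<rho>1])
  have lim: "((\<lambda>t. killed.evol t ?\<rho> x) \<longlongrightarrow> l x) at_top" for x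
  proof -
    have "((\<lambda>t. u 0 {x} - u0 t {x}) \<longlongrightarrow> l x) at_top"
      unfolding l_def by (intro tendsto_diff tendsto_const limit0) auto
    then show ?thesis
    proof (rule Lim_transform_eventually)
      show "\<forall>\<^sub>F t in at_top. u 0 {x} - u0 t {x} = killed.evol t ?\<rho> x"
      proof (rule eventually_at_top_linorderI)
        fix t :: real assume t: "0 \<le> t"
        show "u 0 {x} - u0 t {x} = killed.evol t ?\<rho> x"
          using singleton_minus_u0[OF u e t, of x] stat[OF t, of "{x}"] by simp
      qed
    qed
  qed
  have l0: "0 \<le> l x" for x
    by (rule tendsto_lowerbound[OF lim _ trivial_limit_at_top_linorder])
      (rule eventually_at_top_linorderI[of 0], rule killed.evol_nonneg[OF b\<rho> range(1)])
  have kb: "\<bar>killed.evol t ?\<rho> x\<bar> \<le> 1" if "0 \<le> t" for t x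
    by (rule killed.evol_abs_le[where f = ?\<rho>, OF _ \<rho>1 that]) simp
  have l1: "l x \<le> 1" for x
  proof (rule tendsto_upperbound[OF lim _ trivial_limit_at_top_linorder])
    have "killed.evol t ?\<rho> x \<le> 1" if "0 \<le> t" for t using kb[OF that, of x] by simp
    then show "\<forall>\<^sub>F t in at_top. killed.evol t ?\<rho> x \<le> 1" by (rule eventually_at_top_linorderI)
  qed
  have inv: "killed.evol r l x = l x" if r: "0 \<le> r" for r x
  proof -
    have "((\<lambda>t. killed.evol r (killed.evol t ?\<rho>) x) \<longlongrightarrow> killed.evol r l x) at_top"
      by (rule killed.evol_tendsto_at_top[OF kb lim])
    moreover have "((\<lambda>t. killed.evol r (killed.evol t ?\<rho>) x) \<longlongrightarrow> l x) at_top"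
    proof (rule Lim_transform_eventually[OF tendsto_at_top_add_const[OF lim, of r x]])
      show "\<forall>\<^sub>F t in at_top. killed.evol (r + t) ?\<rho> x = killed.evol r (killed.evol t ?\<rho>) x"
        by (rule eventually_at_top_linorderI[of 0]) (rule killed.evol_semigroup[OF b\<rho> r])
    qed
    ultimately show ?thesis by (rule tendsto_unique[OF trivial_limit_at_top_linorder])
  qed
  obtain \<kappa> where k: "(\<forall>x. ((\<lambda>t. free.evol t l x) \<longlongrightarrow> \<kappa>) at_top) \<and> (\<forall>x. l x \<le> \<kappa>) \<and> 0 \<le> \<kappa> \<and> \<kappa> \<le> 1"
    using free_limit_of_killed_invariant[of l, OF l0 l1 inv] ..
  then have k01: "0 \<le> \<kappa>" "\<kappa> \<le> 1" and kf: "\<forall>x. ((\<lambda>t. free.evol t l x) \<longlongrightarrow> \<kappa>) at_top" by auto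
  have lk: "l x = \<kappa> * killed.survival x" for x
  proof (rule tendsto_unique[OF trivial_limit_at_top_linorder])
    show "((\<lambda>t. killed.evol t l x) \<longlongrightarrow> \<kappa> * killed.survival x) at_top"
      using killed_tendsto_iff_free_tendsto[of l, OF l0 l1 k01] kf by simp
    show "((\<lambda>t. killed.evol t l x) \<longlongrightarrow> l x) at_top"
      by (rule tendsto_eventually, rule eventually_at_top_linorderI[of 0], rule inv)
  qed
  have "\<forall>x. ((\<lambda>t. free.evol t ?\<rho> x) \<longlongrightarrow> \<kappa>) at_top"
    unfolding killed_tendsto_iff_free_tendsto[of ?\<rho>, OF range k01, symmetric] lk[symmetric]
    by (rule allI) (rule lim)
  moreover have "(\<forall>A. finite A \<longrightarrow> ((\<lambda>t. u t A) \<longlongrightarrow> \<kappa> * limit1 A + (1 - \<kappa>) * limit0 A) at_top) \<longleftrightarrow>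
    (\<forall>x. ((\<lambda>t. free.evol t (\<lambda>x. u 0 {x}) x) \<longlongrightarrow> \<kappa>) at_top)"
    by (rule dual_solution_limit_iff[OF u e range k01])
  ultimately have L: "\<forall>A. finite A \<longrightarrow> ((\<lambda>t. u t A) \<longlongrightarrow> \<kappa> * limit1 A + (1 - \<kappa>) * limit0 A) at_top"
    by (rule iffD2[rotated])
  have "u 0 A = \<kappa> * limit1 A + (1 - \<kappa>) * limit0 A" if A: "finite A" for A
  proof (rule tendsto_unique[OF trivial_limit_at_top_linorder _ L[rule_format, OF A]])
    show "((\<lambda>t. u t A) \<longlongrightarrow> u 0 A) at_top"
      by (rule tendsto_eventually, rule eventually_at_top_linorderI[of 0], rule stat[OF _ A])
  qed
  then show ?thesis using k01 by blast
qed

end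

section \<open>Probability measures on configurations\<close>

definition occupied :: "'s set \<Rightarrow> ('s \<Rightarrow> bool) \<Rightarrow> real" where
  "occupied A \<eta> = of_bool (\<forall>x\<in>A. \<eta> x)"

definition moment :: "('s \<Rightarrow> bool) measure \<Rightarrow> 's set \<Rightarrow> real" where
  "moment \<nu> A = measure \<nu> {\<eta>. \<forall>x\<in>A. \<eta> x}"

lemma occupied_bounds: "0 \<le> occupied A \<eta>" "occupied A \<eta> \<le> 1" "\<bar>occupied A \<eta>\<bar> \<le> 1"
  by (simp_all add: occupied_def)

lemma finitely_dependentI:
  "finite \<Lambda> \<Longrightarrow> (\<And>\<eta> \<zeta>. (\<And>x. x \<in> \<Lambda> \<Longrightarrow> \<eta> x = \<zeta> x) \<Longrightarrow> f \<eta> = f \<zeta>) \<Longrightarrow> finitely_dependent f"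
  unfolding finitely_dependent_def by blast

lemma finitely_dependent_occupied: "finite A \<Longrightarrow> finitely_dependent (occupied A)"
  by (rule finitely_dependentI[of A]) (auto simp: occupied_def)

text \<open>The functions \<^term>\<open>occupied A\<close> with finite \<open>A\<close> span all functions of finitely many coordinates.\<close>

lemma finitely_dependent_induct [consumes 1, case_names occupied linear]:
  assumes f: "finitely_dependent f"
    and occ: "\<And>A. finite A \<Longrightarrow> Q (occupied A)"
    and lin: "\<And>f g a b. Q f \<Longrightarrow> Q g \<Longrightarrow> Q (\<lambda>\<eta>. a * f \<eta> + b * g \<eta>)"
  shows "Q f"
proof -
  have "Q (\<lambda>\<eta>. occupied A \<eta> * f \<eta>)" if "finite \<Lambda>" "finite A" "\<forall>\<eta> \<zeta>. (\<forall>x\<in>\<Lambda>. \<eta> x = \<zeta> x) \<longrightarrow> f \<eta> = f \<zeta>" for \<Lambda> A and f :: "('a \<Rightarrow> bool) \<Rightarrow> real"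
    using that
  proof (induction \<Lambda> arbitrary: A f rule: finite_induct)
    case empty
    have eq: "(\<lambda>\<eta>. occupied A \<eta> * f \<eta>) = (\<lambda>\<eta>. f undefined * occupied A \<eta> + 0 * occupied A \<eta>)"
    proof
      fix \<eta> :: "'a \<Rightarrow> bool"
      have "f \<eta> = f undefined" using empty by blast
      then show "occupied A \<eta> * f \<eta> = f undefined * occupied A \<eta> + 0 * occupied A \<eta>" by simp
    qed
    show ?case unfolding eq by (rule lin[OF occ[OF empty(1)] occ[OF empty(1)], of "f undefined" 0])
  next
    case (insert x \<Lambda>)
    define f0 where "f0 \<eta> = f (\<eta>(x := False))" for \<eta>
    define f1 where "f1 \<eta> = f (\<eta>(x := True))" for \<eta>
    have d0: "\<forall>\<eta> \<zeta>. (\<forall>y\<in>\<Lambda>. \<eta> y = \<zeta> y) \<longrightarrow> f0 \<eta> = f0 \<zeta>"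
      unfolding f0_def by (intro allI impI insert.prems(2)[rule_format]) auto
    have d1: "\<forall>\<eta> \<zeta>. (\<forall>y\<in>\<Lambda>. \<eta> y = \<zeta> y) \<longrightarrow> f1 \<eta> = f1 \<zeta>"
      unfolding f1_def by (intro allI impI insert.prems(2)[rule_format]) auto
    have q0: "Q (\<lambda>\<eta>. occupied A \<eta> * f0 \<eta>)" by (rule insert.IH[OF insert.prems(1) d0])
    have q1: "Q (\<lambda>\<eta>. occupied (insert x A) \<eta> * f1 \<eta>)"
      by (rule insert.IH[OF _ d1]) (use insert.prems in simp)
    have q2: "Q (\<lambda>\<eta>. occupied (insert x A) \<eta> * f0 \<eta>)"
      by (rule insert.IH[OF _ d0]) (use insert.prems in simp)
    have eq: "occupied A \<eta> * f \<eta> = 1 * (1 * (occupied A \<eta> * f0 \<eta>) + 1 * (occupied (insert x A) \<eta> * f1 \<eta>)) +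
        (- 1) * (occupied (insert x A) \<eta> * f0 \<eta>)" for \<eta>
    proof (cases "\<eta> x")
      case True
      then have "\<eta>(x := True) = \<eta>" by (intro fun_upd_idem) simp
      then show ?thesis using True by (simp add: f1_def occupied_def)
    next
      case False
      then have "\<eta>(x := False) = \<eta>" by (intro fun_upd_idem) simp
      then show ?thesis using False by (simp add: f0_def occupied_def)
    qed
    show ?case unfolding eq by (rule lin[OF lin[OF q0 q1, of 1 1] q2, of 1 "- 1"])
  qed
  moreover obtain \<Lambda> where "finite \<Lambda>" "\<forall>\<eta> \<zeta>. (\<forall>x\<in>\<Lambda>. \<eta> x = \<zeta> x) \<longrightarrow> f \<eta> = f \<zeta>"
    using f unfolding finitely_dependent_def by blast
  ultimately have "Q (\<lambda>\<eta>. occupied {} \<eta> * f \<eta>)" by blast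
  then show ?thesis by (simp add: occupied_def)
qed

lemma open_agree:
  fixes \<eta> :: "'s \<Rightarrow> bool"
  assumes "finite \<Lambda>" shows "open {\<zeta>. \<forall>x\<in>\<Lambda>. \<zeta> x = \<eta> x}"
proof -
  have "open ((\<lambda>\<zeta>::'s \<Rightarrow> bool. \<zeta> x) -` {\<eta> x})" for x
    by (intro open_vimage Topological_Spaces.open_discrete continuous_on_product_coordinates)
  then have "open (\<Inter>x\<in>\<Lambda>. (\<lambda>\<zeta>::'s \<Rightarrow> bool. \<zeta> x) -` {\<eta> x})" using assms by (intro open_INT) auto
  moreover have "(\<Inter>x\<in>\<Lambda>. (\<lambda>\<zeta>::'s \<Rightarrow> bool. \<zeta> x) -` {\<eta> x}) = {\<zeta>. \<forall>x\<in>\<Lambda>. \<zeta> x = \<eta> x}" by auto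
  ultimately show ?thesis by simp
qed

lemma open_contains_agree:
  fixes \<eta> :: "'s \<Rightarrow> bool"
  assumes "open U" "\<eta> \<in> U"
  shows "\<exists>\<Lambda>. finite \<Lambda> \<and> {\<zeta>. \<forall>x\<in>\<Lambda>. \<zeta> x = \<eta> x} \<subseteq> U"
proof -
  obtain X where X: "\<eta> \<in> (\<Pi>\<^sub>E i\<in>UNIV. X i)" "finite {i. X i \<noteq> topspace euclidean}" "(\<Pi>\<^sub>E i\<in>UNIV. X i) \<subseteq> U"
    using product_topology_open_contains_basis[of "\<lambda>i. euclidean" UNIV U \<eta>] assms unfolding open_fun_def by blast
  have "{\<zeta>. \<forall>x\<in>{i. X i \<noteq> UNIV}. \<zeta> x = \<eta> x} \<subseteq> (\<Pi>\<^sub>E i\<in>UNIV. X i)"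
  proof
    fix \<zeta> assume z: "\<zeta> \<in> {\<zeta>. \<forall>x\<in>{i. X i \<noteq> UNIV}. \<zeta> x = \<eta> x}"
    have "\<zeta> i \<in> X i" for i
    proof (cases "X i = UNIV")
      case False
      then have "\<zeta> i = \<eta> i" using z by simp
      then show ?thesis using X(1) by (simp add: PiE_UNIV_domain Pi_iff)
    qed simp
    then show "\<zeta> \<in> (\<Pi>\<^sub>E i\<in>UNIV. X i)" by (simp add: PiE_UNIV_domain)
  qed
  then show ?thesis using X(2,3) by (intro exI[of _ "{i. X i \<noteq> UNIV}"]) auto
qed

lemma compact_configurations: "compact (UNIV :: ('s \<Rightarrow> bool) set)"
proof -
  have "compact_space (euclidean :: bool topology)"
    by (simp add: compact_space_def compactin_euclidean_iff finite_imp_compact)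
  then have "compact_space (product_topology (\<lambda>i::'s. euclidean :: bool topology) UNIV)"
    by (simp add: compact_space_product_topology)
  then show ?thesis
    by (simp add: euclidean_product_topology compact_space_def compactin_euclidean_iff)
qed

lemma finitely_dependent_continuous:
  fixes f :: "('s \<Rightarrow> bool) \<Rightarrow> real"
  assumes "finitely_dependent f" shows "continuous_on UNIV f"
proof -
  obtain \<Lambda> where L: "finite \<Lambda>" "\<forall>\<eta> \<zeta>. (\<forall>x\<in>\<Lambda>. \<eta> x = \<zeta> x) \<longrightarrow> f \<eta> = f \<zeta>"
    using assms unfolding finitely_dependent_def by blast
  have "open (f -` B)" for B
  proof (subst open_subopen, intro ballI)
    fix \<eta> assume e: "\<eta> \<in> f -` B"
    have "{\<zeta>. \<forall>x\<in>\<Lambda>. \<zeta> x = \<eta> x} \<subseteq> f -` B"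
    proof
      fix \<zeta> assume "\<zeta> \<in> {\<zeta>. \<forall>x\<in>\<Lambda>. \<zeta> x = \<eta> x}"
      then have "f \<zeta> = f \<eta>" using L(2) by simp
      then show "\<zeta> \<in> f -` B" using e by simp
    qed
    then show "\<exists>T. open T \<and> \<eta> \<in> T \<and> T \<subseteq> f -` B"
      using open_agree[OF L(1), of \<eta>] by (intro exI[of _ "{\<zeta>. \<forall>x\<in>\<Lambda>. \<zeta> x = \<eta> x}"]) simp
  qed
  then show ?thesis by (simp add: continuous_on_open_vimage)
qed

lemma occupied_continuous: "finite A \<Longrightarrow> continuous_on UNIV (occupied A)"
  by (intro finitely_dependent_continuous finitely_dependent_occupied)

text \<open>
  By compactness finitely many coordinates \<open>\<Lambda>\<close> determine \<open>f\<close> up to \<open>e\<close>, so all other coordinates may be set to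
  \<open>False\<close>.
\<close>

lemma continuous_approx_finitely_dependent:
  fixes f :: "('s \<Rightarrow> bool) \<Rightarrow> real"
  assumes f: "continuous_on UNIV f" and e: "0 < e"
  shows "\<exists>g. finitely_dependent g \<and> (\<forall>\<eta>. \<bar>f \<eta> - g \<eta>\<bar> \<le> e)"
proof -
  have "\<forall>\<eta>. \<exists>\<Lambda>. finite \<Lambda> \<and> {\<zeta>. \<forall>x\<in>\<Lambda>. \<zeta> x = \<eta> x} \<subseteq> f -` ball (f \<eta>) (e / 2)"
  proof
    fix \<eta>
    have "open (f -` ball (f \<eta>) (e / 2))" using f by (simp add: continuous_on_open_vimage)
    then show "\<exists>\<Lambda>. finite \<Lambda> \<and> {\<zeta>. \<forall>x\<in>\<Lambda>. \<zeta> x = \<eta> x} \<subseteq> f -` ball (f \<eta>) (e / 2)"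
      by (rule open_contains_agree) (use e in simp)
  qed
  from choice[OF this] obtain L where L: "\<forall>\<eta>. finite (L \<eta>) \<and> {\<zeta>. \<forall>x\<in>L \<eta>. \<zeta> x = \<eta> x} \<subseteq> f -` ball (f \<eta>) (e / 2)" ..
  let ?U = "\<lambda>\<eta>. {\<zeta>. \<forall>x\<in>L \<eta>. \<zeta> x = \<eta> x}"
  have op: "open (?U \<eta>)" for \<eta> by (rule open_agree) (use L in simp)
  have cov: "(UNIV :: ('s \<Rightarrow> bool) set) \<subseteq> (\<Union>\<eta>\<in>UNIV. ?U \<eta>)" by auto
  obtain C where "C \<subseteq> UNIV" and C: "finite C" "UNIV \<subseteq> (\<Union>\<eta>\<in>C. ?U \<eta>)"
    by (rule compactE_image[OF compact_configurations op cov])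
  define \<Lambda> where "\<Lambda> = (\<Union>\<eta>\<in>C. L \<eta>)"
  have fin: "finite \<Lambda>" unfolding \<Lambda>_def by (rule finite_UN_I[OF C(1)]) (use L in simp)
  define g where "g \<eta> = f (\<lambda>x. x \<in> \<Lambda> \<and> \<eta> x)" for \<eta>
  have "finitely_dependent g"
  proof (rule finitely_dependentI[OF fin])
    fix \<eta> \<zeta> :: "'s \<Rightarrow> bool" assume "\<And>x. x \<in> \<Lambda> \<Longrightarrow> \<eta> x = \<zeta> x"
    then have "(\<lambda>x. x \<in> \<Lambda> \<and> \<eta> x) = (\<lambda>x. x \<in> \<Lambda> \<and> \<zeta> x)" by auto
    then show "g \<eta> = g \<zeta>" by (simp add: g_def)
  qed
  moreover have "\<bar>f \<eta> - g \<eta>\<bar> \<le> e" for \<eta>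
  proof -
    obtain \<xi> where xi: "\<xi> \<in> C" "\<eta> \<in> ?U \<xi>" using C(2) by blast
    have "(\<lambda>x. x \<in> \<Lambda> \<and> \<eta> x) \<in> ?U \<xi>" using xi by (auto simp: \<Lambda>_def)
    then have "dist (f \<xi>) (g \<eta>) < e / 2" "dist (f \<xi>) (f \<eta>) < e / 2"
      using L xi(2) unfolding g_def by (auto simp: subset_iff)
    then show ?thesis unfolding dist_real_def by linarith
  qed
  ultimately show ?thesis by blast
qed

definition cylinder :: "('s \<Rightarrow> bool) set \<Rightarrow> bool" where
  "cylinder S \<longleftrightarrow> finitely_dependent (indicator S)"

lemma cylinder_iff: "cylinder S \<longleftrightarrow> (\<exists>\<Lambda>. finite \<Lambda> \<and> (\<forall>\<eta> \<zeta>. (\<forall>x\<in>\<Lambda>. \<eta> x = \<zeta> x) \<longrightarrow> (\<eta> \<in> S \<longleftrightarrow> \<zeta> \<in> S)))"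
proof -
  have eq: "(indicator S \<eta> :: real) = indicator S \<zeta> \<longleftrightarrow> (\<eta> \<in> S \<longleftrightarrow> \<zeta> \<in> S)" for \<eta> \<zeta>
    by (simp add: indicator_def)
  show ?thesis unfolding cylinder_def finitely_dependent_def eq ..
qed

lemma cylinder_Int: "cylinder S \<Longrightarrow> cylinder T \<Longrightarrow> cylinder (S \<inter> T)"
proof -
  assume "cylinder S" "cylinder T"
  then obtain K L where K: "finite K" "\<forall>\<eta> \<zeta>. (\<forall>x\<in>K. \<eta> x = \<zeta> x) \<longrightarrow> (\<eta> \<in> S \<longleftrightarrow> \<zeta> \<in> S)"
    and L: "finite L" "\<forall>\<eta> \<zeta>. (\<forall>x\<in>L. \<eta> x = \<zeta> x) \<longrightarrow> (\<eta> \<in> T \<longleftrightarrow> \<zeta> \<in> T)"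
    unfolding cylinder_iff by blast
  have "\<eta> \<in> S \<inter> T \<longleftrightarrow> \<zeta> \<in> S \<inter> T" if "\<forall>x\<in>K \<union> L. \<eta> x = \<zeta> x" for \<eta> \<zeta>
    using K(2)[rule_format, of \<eta> \<zeta>] L(2)[rule_format, of \<eta> \<zeta>] that by simp
  then show ?thesis unfolding cylinder_iff using K(1) L(1) by (intro exI[of _ "K \<union> L"]) simp
qed

lemma cylinder_Compl: "cylinder S \<Longrightarrow> cylinder (- S)"
  unfolding cylinder_iff by simp

lemma cylinder_open: "cylinder S \<Longrightarrow> open S"
proof -
  assume "cylinder S"
  then obtain L where L: "finite L" "\<forall>\<eta> \<zeta>. (\<forall>x\<in>L. \<eta> x = \<zeta> x) \<longrightarrow> (\<eta> \<in> S \<longleftrightarrow> \<zeta> \<in> S)"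
    unfolding cylinder_iff by blast
  show ?thesis
  proof (subst open_subopen, intro ballI)
    fix \<eta> assume e: "\<eta> \<in> S"
    have "{\<zeta>. \<forall>x\<in>L. \<zeta> x = \<eta> x} \<subseteq> S"
    proof
      fix \<zeta> assume "\<zeta> \<in> {\<zeta>. \<forall>x\<in>L. \<zeta> x = \<eta> x}"
      then show "\<zeta> \<in> S" using L(2)[rule_format, of \<zeta> \<eta>] e by simp
    qed
    then show "\<exists>T. open T \<and> \<eta> \<in> T \<and> T \<subseteq> S"
      using open_agree[OF L(1), of \<eta>] by (intro exI[of _ "{\<zeta>. \<forall>x\<in>L. \<zeta> x = \<eta> x}"]) simp
  qed
qed

lemma algebra_cylinders: "algebra UNIV (Collect cylinder)"
  unfolding algebra_iff_Int
proof (intro conjI ballI)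
  show "{} \<in> Collect cylinder" unfolding cylinder_iff by (auto intro: exI[of _ "{}"])
qed (auto intro: cylinder_Int cylinder_Compl simp: Compl_eq_Diff_UNIV[symmetric])

text \<open>
  Countability of the set of sites enters here: only then are there countably many basic cylinders, so that every open set
  is a countable union of them.
\<close>

lemma sets_borel_cylinders: "sets (borel :: ('s::countable \<Rightarrow> bool) measure) = sigma_sets UNIV (Collect cylinder)"
proof
  have "sigma_sets UNIV (Collect cylinder) \<subseteq> sigma_sets UNIV {S :: ('s \<Rightarrow> bool) set. open S}"
    by (rule sigma_sets_mono') (use cylinder_open in auto)
  then show "sigma_sets UNIV (Collect cylinder) \<subseteq> sets (borel :: ('s \<Rightarrow> bool) measure)"
    by (simp add: sets_borel)
  have "U \<in> sigma_sets UNIV (Collect cylinder)" if U: "open U" for U :: "('s \<Rightarrow> bool) set"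
  proof -
    define C where "C = (\<lambda>(L, B). {\<zeta> :: 's \<Rightarrow> bool. \<forall>x\<in>L. \<zeta> x = (x \<in> B)}) ` (Collect finite \<times> Collect finite)"
    have cyl: "cylinder S" if "S \<in> C" for S
      using that unfolding C_def cylinder_iff by (auto simp: case_prod_unfold)
    have "countable C" unfolding C_def by (intro countable_image countable_SIGMA countable_Collect_finite)
    then have cC: "countable {S \<in> C. S \<subseteq> U}" by (rule countable_subset[rotated]) auto
    have "U = \<Union>{S \<in> C. S \<subseteq> U}"
    proof
      show "U \<subseteq> \<Union>{S \<in> C. S \<subseteq> U}"
      proof
        fix \<eta> assume e: "\<eta> \<in> U"
        obtain L where L: "finite L" "{\<zeta>. \<forall>x\<in>L. \<zeta> x = \<eta> x} \<subseteq> U"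
          using open_contains_agree[OF U e] by blast
        let ?S = "{\<zeta>. \<forall>x\<in>L. \<zeta> x = (x \<in> {x \<in> L. \<eta> x})}"
        have eq: "?S = {\<zeta>. \<forall>x\<in>L. \<zeta> x = \<eta> x}" by auto
        have "?S \<in> C"
          unfolding C_def by (rule image_eqI[where x = "(L, {x \<in> L. \<eta> x})"]) (use L in auto)
        moreover have "?S \<subseteq> U" unfolding eq by (rule L(2))
        moreover have "\<eta> \<in> ?S" by simp
        ultimately show "\<eta> \<in> \<Union>{S \<in> C. S \<subseteq> U}" by blast
      qed
    qed auto
    moreover have "\<Union>{S \<in> C. S \<subseteq> U} \<in> sigma_sets UNIV (Collect cylinder)"
      by (rule sigma_sets_UNION[OF cC]) (use cyl in \<open>auto intro: sigma_sets.Basic\<close>)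
    ultimately show ?thesis by simp
  qed
  then have "sigma_sets UNIV {S :: ('s \<Rightarrow> bool) set. open S} \<subseteq> sigma_sets UNIV (Collect cylinder)"
    by (intro sigma_sets_mono) auto
  then show "sets (borel :: ('s \<Rightarrow> bool) measure) \<subseteq> sigma_sets UNIV (Collect cylinder)"
    by (simp add: sets_borel)
qed

abbreviation config_measures :: "('s \<Rightarrow> bool) measure set" where
  "config_measures \<equiv> space (prob_algebra borel)"

lemma config_measuresD:
  assumes "\<nu> \<in> config_measures"
  shows "prob_space \<nu>" "sets \<nu> = sets borel" "space \<nu> = UNIV"
proof -
  show 1: "prob_space \<nu>" "sets \<nu> = sets borel" using assms by (simp_all add: space_prob_algebra)
  show "space \<nu> = UNIV" using sets_eq_imp_space_eq[OF 1(2)] by simp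
qed

lemma config_integrable:
  fixes f :: "('s \<Rightarrow> bool) \<Rightarrow> real"
  assumes "\<nu> \<in> config_measures" "f \<in> borel_measurable borel" "\<And>\<eta>. \<bar>f \<eta>\<bar> \<le> M"
  shows "integrable \<nu> f"
proof -
  interpret prob_space \<nu> by (rule config_measuresD[OF assms(1)])
  have "f \<in> borel_measurable \<nu>"
    unfolding measurable_cong_sets[OF config_measuresD(2)[OF assms(1)] refl] by (rule assms(2))
  then show ?thesis by (rule integrable_const_bound[where B = M, rotated]) (use assms(3) in simp)
qed

lemma continuous_config_integrable:
  fixes f :: "('s \<Rightarrow> bool) \<Rightarrow> real"
  assumes "\<nu> \<in> config_measures" "continuous_on UNIV f"
  shows "integrable \<nu> f"
proof -
  have "compact (f ` UNIV)" by (rule compact_continuous_image[OF assms(2) compact_configurations])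
  then have "bounded (f ` UNIV)" by (rule compact_imp_bounded)
  then obtain M where "\<forall>y\<in>f ` UNIV. norm y \<le> M" unfolding bounded_iff ..
  then have "\<bar>f \<eta>\<bar> \<le> M" for \<eta> by simp
  then show ?thesis
    by (intro config_integrable[OF assms(1)] borel_measurable_continuous_onI assms(2))
qed

lemma measure_UNIV_config:
  assumes "\<nu> \<in> config_measures" shows "measure \<nu> UNIV = 1"
  using prob_space.prob_space[OF config_measuresD(1)[OF assms]] by (simp add: config_measuresD(3)[OF assms])

lemma moment_bounds: "\<nu> \<in> config_measures \<Longrightarrow> 0 \<le> moment \<nu> A \<and> moment \<nu> A \<le> 1"
  using prob_space.prob_le_1[OF config_measuresD(1)] by (simp add: moment_def)

lemma moment_empty: "\<nu> \<in> config_measures \<Longrightarrow> moment \<nu> {} = 1"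
  by (simp add: moment_def measure_UNIV_config)

lemma sets_cylinder: "\<nu> \<in> config_measures \<Longrightarrow> cylinder S \<Longrightarrow> S \<in> sets \<nu>"
  by (simp add: config_measuresD(2) cylinder_open)

lemma moment_eq_integral:
  assumes "\<nu> \<in> config_measures" "finite A"
  shows "moment \<nu> A = (\<integral>\<eta>. occupied A \<eta> \<partial>\<nu>)"
proof -
  have eq: "occupied A = indicator {\<eta>. \<forall>x\<in>A. \<eta> x}" by (auto simp: occupied_def indicator_def)
  have "cylinder {\<eta>. \<forall>x\<in>A. \<eta> x}"
    unfolding cylinder_iff using assms(2) by (auto intro!: exI[of _ A])
  then have "{\<eta>. \<forall>x\<in>A. \<eta> x} \<in> sets \<nu>" by (rule sets_cylinder[OF assms(1)])
  then show ?thesis using config_measuresD(3)[OF assms(1)] by (simp add: eq moment_def)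
qed

lemma integral_linear_config:
  fixes f g :: "('s \<Rightarrow> bool) \<Rightarrow> real"
  assumes "\<nu> \<in> config_measures" "continuous_on UNIV f" "continuous_on UNIV g"
  shows "(\<integral>\<eta>. a * f \<eta> + b * g \<eta> \<partial>\<nu>) = a * (\<integral>\<eta>. f \<eta> \<partial>\<nu>) + b * (\<integral>\<eta>. g \<eta> \<partial>\<nu>)"
  using continuous_config_integrable[OF assms(1,2)] continuous_config_integrable[OF assms(1,3)] by simp

text \<open>
  Moments determine the probabilities of cylinders, which form an intersection-stable generator.
\<close>

lemma config_measure_eqI:
  fixes \<mu> \<nu> :: "('s::countable \<Rightarrow> bool) measure"
  assumes \<mu>: "\<mu> \<in> config_measures" and \<nu>: "\<nu> \<in> config_measures"
    and eq: "\<And>A. finite A \<Longrightarrow> moment \<mu> A = moment \<nu> A"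
  shows "\<mu> = \<nu>"
proof (rule measure_eqI_generator_eq[of "Collect cylinder" UNIV])
  fix S :: "('s \<Rightarrow> bool) set" assume "S \<in> Collect cylinder"
  then have S: "cylinder S" by simp
  then have "finitely_dependent (indicator S :: _ \<Rightarrow> real)" by (simp add: cylinder_def)
  then have "continuous_on UNIV (indicator S :: _ \<Rightarrow> real) \<and> (\<integral>\<eta>. indicator S \<eta> \<partial>\<mu>) = (\<integral>\<eta>. (indicator S \<eta> :: real) \<partial>\<nu>)"
  proof (induction rule: finitely_dependent_induct)
    case (occupied A)
    then show ?case
      using eq[OF occupied] by (simp add: moment_eq_integral \<mu> \<nu> occupied_continuous)
  next
    case (linear f g a b)
    then show ?case
      by (auto simp: integral_linear_config \<mu> \<nu> simp del: Bochner_Integration.integral_add intro!: continuous_intros)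
  qed
  then have "measure \<mu> S = measure \<nu> S" using config_measuresD(3)[OF \<mu>] config_measuresD(3)[OF \<nu>] by simp
  then show "emeasure \<mu> S = emeasure \<nu> S"
    using config_measuresD(1)[OF \<mu>] config_measuresD(1)[OF \<nu>]
    by (simp add: finite_measure.emeasure_eq_measure prob_space_def)
next
  show "Int_stable (Collect cylinder :: ('s \<Rightarrow> bool) set set)"
    unfolding Int_stable_def using cylinder_Int by blast
  show "sets \<mu> = sigma_sets UNIV (Collect cylinder)" "sets \<nu> = sigma_sets UNIV (Collect cylinder)"
    using config_measuresD(2)[OF \<mu>] config_measuresD(2)[OF \<nu>] sets_borel_cylinders by simp_all
  show "range (\<lambda>i::nat. UNIV) \<subseteq> (Collect cylinder :: ('s \<Rightarrow> bool) set set)" unfolding cylinder_iff by auto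
  show "emeasure \<mu> UNIV \<noteq> \<infinity>" for i :: nat
    using prob_space.emeasure_space_1[OF config_measuresD(1)[OF \<mu>]] config_measuresD(3)[OF \<mu>] by simp
qed auto

lemma config_integral_diff_le:
  fixes f g :: "('s \<Rightarrow> bool) \<Rightarrow> real"
  assumes \<nu>: "\<nu> \<in> config_measures" and f: "continuous_on UNIV f" and g: "continuous_on UNIV g"
    and le: "\<And>\<eta>. \<bar>f \<eta> - g \<eta>\<bar> \<le> e"
  shows "\<bar>(\<integral>\<eta>. f \<eta> \<partial>\<nu>) - (\<integral>\<eta>. g \<eta> \<partial>\<nu>)\<bar> \<le> e"
proof -
  interpret prob_space \<nu> by (rule config_measuresD[OF \<nu>])
  have "(\<integral>\<eta>. f \<eta> \<partial>\<nu>) - (\<integral>\<eta>. g \<eta> \<partial>\<nu>) = (\<integral>\<eta>. f \<eta> - g \<eta> \<partial>\<nu>)"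
    using continuous_config_integrable[OF \<nu> f] continuous_config_integrable[OF \<nu> g] by simp
  moreover have "\<bar>\<integral>\<eta>. f \<eta> - g \<eta> \<partial>\<nu>\<bar> \<le> (\<integral>\<eta>. \<bar>f \<eta> - g \<eta>\<bar> \<partial>\<nu>)" by (rule integral_abs_bound)
  moreover have "(\<integral>\<eta>. \<bar>f \<eta> - g \<eta>\<bar> \<partial>\<nu>) \<le> e"
  proof (rule integral_le_const)
    have "continuous_on UNIV (\<lambda>\<eta>. \<bar>f \<eta> - g \<eta>\<bar>)" by (intro continuous_intros f g)
    then show "integrable \<nu> (\<lambda>\<eta>. \<bar>f \<eta> - g \<eta>\<bar>)" by (rule continuous_config_integrable[OF \<nu>])
  qed (simp add: le)
  ultimately show ?thesis by linarith
qed

text \<open>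
  Every continuous function is uniformly close to a function of finitely many coordinates, and the latter are linear
  combinations of functions \<^term>\<open>occupied A\<close>.
\<close>

lemma weak_lim_iff_moments:
  fixes M :: "real \<Rightarrow> ('s::countable \<Rightarrow> bool) measure"
  assumes M: "\<And>t. 0 \<le> t \<Longrightarrow> M t \<in> config_measures" and N: "N \<in> config_measures"
  shows "weak_lim M N at_top \<longleftrightarrow> (\<forall>A. finite A \<longrightarrow> ((\<lambda>t. moment (M t) A) \<longlongrightarrow> moment N A) at_top)"
proof
  assume weak: "weak_lim M N at_top"
  show "\<forall>A. finite A \<longrightarrow> ((\<lambda>t. moment (M t) A) \<longlongrightarrow> moment N A) at_top"
  proof (intro allI impI)
    fix A :: "'s set" assume A: "finite A"
    have "occupied A \<in> bcontfun"
      by (rule bcontfun_normI[where b = 1]) (simp_all add: occupied_continuous[OF A] occupied_bounds)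
    then have app: "apply_bcontfun (Bcontfun (occupied A)) = occupied A" by (rule Bcontfun_inverse)
    have "((\<lambda>t. \<integral>\<eta>. apply_bcontfun (Bcontfun (occupied A)) \<eta> \<partial>M t) \<longlongrightarrow>
        (\<integral>\<eta>. apply_bcontfun (Bcontfun (occupied A)) \<eta> \<partial>N)) at_top"
      using weak unfolding weak_lim_def by blast
    then have "((\<lambda>t. \<integral>\<eta>. occupied A \<eta> \<partial>M t) \<longlongrightarrow> moment N A) at_top"
      by (simp add: app moment_eq_integral[OF N A])
    then show "((\<lambda>t. moment (M t) A) \<longlongrightarrow> moment N A) at_top"
    proof (rule Lim_transform_eventually)
      show "\<forall>\<^sub>F t in at_top. (\<integral>\<eta>. occupied A \<eta> \<partial>M t) = moment (M t) A"
        by (rule eventually_at_top_linorderI[of 0]) (rule moment_eq_integral[OF M A, symmetric])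
    qed
  qed
next
  assume mom: "\<forall>A. finite A \<longrightarrow> ((\<lambda>t. moment (M t) A) \<longlongrightarrow> moment N A) at_top"
  have fd: "continuous_on UNIV g \<and> ((\<lambda>t. \<integral>\<eta>. g \<eta> \<partial>M t) \<longlongrightarrow> (\<integral>\<eta>. g \<eta> \<partial>N)) at_top"
    if "finitely_dependent g" for g :: "('s \<Rightarrow> bool) \<Rightarrow> real"
    using that
  proof (induction rule: finitely_dependent_induct)
    case (occupied A)
    have "((\<lambda>t. moment (M t) A) \<longlongrightarrow> (\<integral>\<eta>. occupied A \<eta> \<partial>N)) at_top"
      using mom occupied unfolding moment_eq_integral[OF N occupied, symmetric] by blast
    then have "((\<lambda>t. \<integral>\<eta>. occupied A \<eta> \<partial>M t) \<longlongrightarrow> (\<integral>\<eta>. occupied A \<eta> \<partial>N)) at_top"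
    proof (rule Lim_transform_eventually)
      show "\<forall>\<^sub>F t in at_top. moment (M t) A = (\<integral>\<eta>. occupied A \<eta> \<partial>M t)"
        by (rule eventually_at_top_linorderI[of 0]) (rule moment_eq_integral[OF M occupied])
    qed
    then show ?case using occupied_continuous[OF occupied] by simp
  next
    case (linear f g a b)
    then have cf: "continuous_on UNIV f" and cg: "continuous_on UNIV g" by auto
    have "((\<lambda>t. a * (\<integral>\<eta>. f \<eta> \<partial>M t) + b * (\<integral>\<eta>. g \<eta> \<partial>M t)) \<longlongrightarrow> a * (\<integral>\<eta>. f \<eta> \<partial>N) + b * (\<integral>\<eta>. g \<eta> \<partial>N)) at_top"
      using linear by (intro tendsto_intros) auto
    then have "((\<lambda>t. \<integral>\<eta>. a * f \<eta> + b * g \<eta> \<partial>M t) \<longlongrightarrow> a * (\<integral>\<eta>. f \<eta> \<partial>N) + b * (\<integral>\<eta>. g \<eta> \<partial>N)) at_top"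
    proof (rule Lim_transform_eventually)
      show "\<forall>\<^sub>F t in at_top. a * (\<integral>\<eta>. f \<eta> \<partial>M t) + b * (\<integral>\<eta>. g \<eta> \<partial>M t) = (\<integral>\<eta>. a * f \<eta> + b * g \<eta> \<partial>M t)"
        by (rule eventually_at_top_linorderI[of 0]) (rule integral_linear_config[OF M cf cg, symmetric])
    qed
    then show ?case
      unfolding integral_linear_config[OF N cf cg] using cf cg by (intro conjI continuous_intros)
  qed
  show "weak_lim M N at_top"
    unfolding weak_lim_def
  proof (intro allI tendstoI)
    fix f :: "('s \<Rightarrow> bool) \<Rightarrow>\<^sub>C real" and e :: real assume e: "0 < e"
    have cf: "continuous_on UNIV (apply_bcontfun f)" by (rule continuous_on_apply_bcontfun)
    obtain g where g: "finitely_dependent g" "\<forall>\<eta>. \<bar>apply_bcontfun f \<eta> - g \<eta>\<bar> \<le> e / 4"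
      using continuous_approx_finitely_dependent[OF cf, of "e / 4"] e by auto
    have cg: "continuous_on UNIV g" using fd[OF g(1)] by simp
    have near: "\<bar>(\<integral>\<eta>. apply_bcontfun f \<eta> \<partial>\<nu>) - (\<integral>\<eta>. g \<eta> \<partial>\<nu>)\<bar> \<le> e / 4" if "\<nu> \<in> config_measures" for \<nu>
      by (rule config_integral_diff_le[OF that cf cg]) (use g(2) in simp)
    have "\<forall>\<^sub>F t in at_top. dist (\<integral>\<eta>. g \<eta> \<partial>M t) (\<integral>\<eta>. g \<eta> \<partial>N) < e / 4"
      by (rule tendstoD) (use fd[OF g(1)] e in auto)
    then show "\<forall>\<^sub>F t in at_top. dist (\<integral>\<eta>. apply_bcontfun f \<eta> \<partial>M t) (\<integral>\<eta>. apply_bcontfun f \<eta> \<partial>N) < e"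
      using eventually_ge_at_top[of 0]
    proof eventually_elim
      case (elim t)
      show ?case using near[OF M[OF elim(2)]] near[OF N] elim(1) e unfolding dist_real_def by linarith
    qed
  qed
qed

text \<open>
  If the moments converge, so do the probabilities of cylinders. The limit is finitely additive, and by
  compactness a decreasing sequence of cylinders with empty intersection is eventually empty, so Caratheodory's
  theorem extends it to a measure.
\<close>

lemma limit_measure_exists:
  fixes M :: "real \<Rightarrow> ('s::countable \<Rightarrow> bool) measure"
  assumes M: "\<And>t. 0 \<le> t \<Longrightarrow> M t \<in> config_measures"
    and lim: "\<And>A. finite A \<Longrightarrow> ((\<lambda>t. moment (M t) A) \<longlongrightarrow> k A) at_top"
  shows "\<exists>N\<in>config_measures. \<forall>A. finite A \<longrightarrow> moment N A = k A"
proof -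
  have fd: "continuous_on UNIV g \<and> (\<exists>l. ((\<lambda>t. \<integral>\<eta>. g \<eta> \<partial>M t) \<longlongrightarrow> l) at_top)"
    if "finitely_dependent g" for g :: "('s \<Rightarrow> bool) \<Rightarrow> real"
    using that
  proof (induction rule: finitely_dependent_induct)
    case (occupied A)
    have "((\<lambda>t. \<integral>\<eta>. occupied A \<eta> \<partial>M t) \<longlongrightarrow> k A) at_top"
    proof (rule Lim_transform_eventually[OF lim[OF occupied]])
      show "\<forall>\<^sub>F t in at_top. moment (M t) A = (\<integral>\<eta>. occupied A \<eta> \<partial>M t)"
        by (rule eventually_at_top_linorderI[of 0]) (rule moment_eq_integral[OF M occupied])
    qed
    then show ?case using occupied_continuous[OF occupied] by blast
  next
    case (linear f g a b)
    then obtain l m where l: "((\<lambda>t. \<integral>\<eta>. f \<eta> \<partial>M t) \<longlongrightarrow> l) at_top" and m: "((\<lambda>t. \<integral>\<eta>. g \<eta> \<partial>M t) \<longlongrightarrow> m) at_top" by blast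
    have cf: "continuous_on UNIV f" and cg: "continuous_on UNIV g" using linear by auto
    have "((\<lambda>t. a * (\<integral>\<eta>. f \<eta> \<partial>M t) + b * (\<integral>\<eta>. g \<eta> \<partial>M t)) \<longlongrightarrow> a * l + b * m) at_top"
      by (intro tendsto_intros l m)
    then have "((\<lambda>t. \<integral>\<eta>. a * f \<eta> + b * g \<eta> \<partial>M t) \<longlongrightarrow> a * l + b * m) at_top"
    proof (rule Lim_transform_eventually)
      show "\<forall>\<^sub>F t in at_top. a * (\<integral>\<eta>. f \<eta> \<partial>M t) + b * (\<integral>\<eta>. g \<eta> \<partial>M t) = (\<integral>\<eta>. a * f \<eta> + b * g \<eta> \<partial>M t)"
        by (rule eventually_at_top_linorderI[of 0]) (rule integral_linear_config[OF M cf cg, symmetric])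
    qed
    moreover have "continuous_on UNIV (\<lambda>\<eta>. a * f \<eta> + b * g \<eta>)" by (intro continuous_intros cf cg)
    ultimately show ?case by blast
  qed
  define P where "P S = Lim at_top (\<lambda>t. measure (M t) S)" for S
  have P: "((\<lambda>t. measure (M t) S) \<longlongrightarrow> P S) at_top" if S: "cylinder S" for S
  proof -
    obtain l where l: "((\<lambda>t. \<integral>\<eta>. (indicator S \<eta> :: real) \<partial>M t) \<longlongrightarrow> l) at_top"
      using fd[OF S[unfolded cylinder_def]] by blast
    have "((\<lambda>t. measure (M t) S) \<longlongrightarrow> l) at_top"
    proof (rule Lim_transform_eventually[OF l])
      show "\<forall>\<^sub>F t in at_top. (\<integral>\<eta>. (indicator S \<eta> :: real) \<partial>M t) = measure (M t) S"
      proof (rule eventually_at_top_linorderI)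
        fix t :: real assume t: "0 \<le> t"
        show "(\<integral>\<eta>. (indicator S \<eta> :: real) \<partial>M t) = measure (M t) S"
          using config_measuresD(3)[OF M[OF t]] by simp
      qed
    qed
    then show ?thesis unfolding P_def using tendsto_Lim[OF trivial_limit_at_top_linorder] by force
  qed
  have P0: "0 \<le> P S" if "cylinder S" for S
    by (rule tendsto_lowerbound[OF P[OF that] _ trivial_limit_at_top_linorder]) simp
  have Padd: "P (S \<union> T) = P S + P T" if S: "cylinder S" and T: "cylinder T" and d: "S \<inter> T = {}" for S T
  proof (rule tendsto_unique[OF trivial_limit_at_top_linorder])
    have "cylinder (- (- S \<inter> - T))" by (intro cylinder_Compl cylinder_Int S T)
    then have U: "cylinder (S \<union> T)" by (simp add: Compl_Int)
    show "((\<lambda>t. measure (M t) (S \<union> T)) \<longlongrightarrow> P (S \<union> T)) at_top" by (rule P[OF U])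
    have "((\<lambda>t. measure (M t) S + measure (M t) T) \<longlongrightarrow> P S + P T) at_top" by (intro tendsto_add P S T)
    then show "((\<lambda>t. measure (M t) (S \<union> T)) \<longlongrightarrow> P S + P T) at_top"
    proof (rule Lim_transform_eventually)
      show "\<forall>\<^sub>F t in at_top. measure (M t) S + measure (M t) T = measure (M t) (S \<union> T)"
      proof (rule eventually_at_top_linorderI)
        fix t :: real assume t: "0 \<le> t"
        interpret prob_space "M t" by (rule config_measuresD[OF M[OF t]])
        show "measure (M t) S + measure (M t) T = measure (M t) (S \<union> T)"
          by (rule finite_measure_Union[symmetric]) (use sets_cylinder[OF M[OF t]] S T d in auto)
      qed
    qed
  qed
  have cU: "cylinder (UNIV :: ('s \<Rightarrow> bool) set)" unfolding cylinder_iff by auto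
  have cE: "cylinder ({} :: ('s \<Rightarrow> bool) set)" unfolding cylinder_iff by auto
  have PU: "P UNIV = 1"
  proof (rule tendsto_unique[OF trivial_limit_at_top_linorder P[OF cU]])
    show "((\<lambda>t. measure (M t) UNIV) \<longlongrightarrow> 1) at_top"
      by (rule tendsto_eventually, rule eventually_at_top_linorderI[of 0]) (rule measure_UNIV_config[OF M])
  qed
  have PE: "P {} = 0" unfolding P_def by (simp add: tendsto_Lim)
  interpret A: algebra UNIV "Collect cylinder :: ('s \<Rightarrow> bool) set set" by (rule algebra_cylinders)
  have "\<exists>\<mu>. (\<forall>S\<in>Collect cylinder. \<mu> S = ennreal (P S)) \<and> measure_space UNIV (sigma_sets UNIV (Collect cylinder :: ('s \<Rightarrow> bool) set set)) \<mu>"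
  proof (rule A.caratheodory_empty_continuous)
    show "positive (Collect cylinder) (\<lambda>S. ennreal (P S))" by (simp add: positive_def PE)
    show "additive (Collect cylinder) (\<lambda>S. ennreal (P S))"
      unfolding additive_def using Padd P0 by (simp add: ennreal_plus)
    fix S :: "nat \<Rightarrow> ('s \<Rightarrow> bool) set"
    assume S: "range S \<subseteq> Collect cylinder" "decseq S" "(\<Inter>i. S i) = {}"
    have cyl: "cylinder (S i)" for i using S(1) by auto
    have "\<exists>i. S i = {}"
    proof (rule ccontr)
      assume ne: "\<nexists>i. S i = {}"
      have "UNIV \<inter> (\<Inter>i\<in>UNIV. S i) \<noteq> {}"
      proof (rule compact_imp_fip_image[OF compact_configurations])
        show "closed (S i)" for i using cylinder_open[OF cylinder_Compl[OF cyl[of i]]] by (simp add: closed_def)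
        fix I :: "nat set" assume I: "finite I"
        have "S (Max (insert 0 I)) \<subseteq> (\<Inter>i\<in>I. S i)"
        proof (rule INT_greatest)
          fix i assume "i \<in> I"
          then have "i \<le> Max (insert 0 I)" using I by (intro Max_ge) auto
          then show "S (Max (insert 0 I)) \<subseteq> S i" using S(2) by (rule decseqD[rotated])
        qed
        then show "UNIV \<inter> (\<Inter>i\<in>I. S i) \<noteq> {}" using ne by blast
      qed
      then show False using S(3) by simp
    qed
    then obtain i0 where i0: "S i0 = {}" by blast
    have "S i = {}" if "i0 \<le> i" for i using decseqD[OF S(2) that] i0 by simp
    then have "\<forall>\<^sub>F i in sequentially. ennreal (P (S i)) = 0"
      unfolding eventually_sequentially by (intro exI[of _ i0]) (simp add: PE)
    then show "(\<lambda>i. ennreal (P (S i))) \<longlonglongrightarrow> 0" by (rule tendsto_eventually)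
  qed auto
  then obtain \<mu> where \<mu>: "\<forall>S\<in>Collect cylinder. \<mu> S = ennreal (P S)"
    "measure_space UNIV (sigma_sets UNIV (Collect cylinder :: ('s \<Rightarrow> bool) set set)) \<mu>" by blast
  define N where "N = measure_of UNIV (sigma_sets UNIV (Collect cylinder)) \<mu>"
  have sN: "sets N = sigma_sets UNIV (Collect cylinder)" and spN: "space N = UNIV"
    unfolding N_def by (auto simp: sigma_sets_sigma_sets_eq intro: sets_measure_of space_measure_of)
  have eN: "emeasure N S = ennreal (P S)" if "cylinder S" for S
  proof -
    have "emeasure N S = \<mu> S"
      unfolding N_def
      by (rule emeasure_measure_of_sigma) (use \<mu>(2) that in \<open>auto simp: measure_space_def\<close>)
    then show ?thesis using \<mu>(1) that by simp
  qed
  have "prob_space N" by (rule prob_spaceI) (simp add: spN eN[OF cU] PU)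
  then have Nc: "N \<in> config_measures"
    by (simp add: space_prob_algebra sN sets_borel_cylinders)
  moreover have "moment N A = k A" if A: "finite A" for A
  proof (rule tendsto_unique[OF trivial_limit_at_top_linorder _ lim[OF A]])
    have c: "cylinder {\<eta>. \<forall>x\<in>A. \<eta> x}"
      unfolding cylinder_iff using A by (auto intro!: exI[of _ A])
    have "moment N A = P {\<eta>. \<forall>x\<in>A. \<eta> x}"
      unfolding moment_def measure_def eN[OF c] using P0[OF c] by simp
    then show "((\<lambda>t. moment (M t) A) \<longlongrightarrow> moment N A) at_top"
      using P[OF c] by (simp add: moment_def)
  qed
  ultimately show ?thesis by blast
qed

section \<open>Duality for the noisy voter-exclusion process\<close>

lemma has_sum_finite_Times:
  fixes f :: "'i \<times> 'j \<Rightarrow> real"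
  assumes "finite A" "\<And>x. x \<in> A \<Longrightarrow> ((\<lambda>y. f (x, y)) has_sum s x) B"
  shows "(f has_sum (\<Sum>x\<in>A. s x)) (A \<times> B)"
  using assms
proof (induction A rule: finite_induct)
  case (insert x A)
  have "((f \<circ> Pair x) has_sum s x) B" using insert.prems[of x] by (simp add: comp_def)
  then have "(f has_sum s x) (Pair x ` B)" by (subst has_sum_reindex) (auto simp: inj_on_def)
  moreover have "(f has_sum (\<Sum>x\<in>A. s x)) (A \<times> B)" by (rule insert.IH) (use insert.prems in simp)
  ultimately have "(f has_sum (s x + (\<Sum>x\<in>A. s x))) (Pair x ` B \<union> A \<times> B)"
    by (rule has_sum_Un_disjoint) (use insert.hyps in auto)
  moreover have "Pair x ` B \<union> A \<times> B = insert x A \<times> B" by auto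
  ultimately show ?case using insert.hyps by simp
qed simp

lemma continuous_weighted_infsum:
  fixes a :: "'i \<Rightarrow> real" and g :: "'i \<Rightarrow> 'b::topological_space \<Rightarrow> real"
  assumes a: "\<And>i. i \<in> S \<Longrightarrow> 0 \<le> a i" "a summable_on S"
    and g: "\<And>i. i \<in> S \<Longrightarrow> continuous_on UNIV (g i)" "\<And>i w. i \<in> S \<Longrightarrow> \<bar>g i w\<bar> \<le> M"
  shows "continuous_on UNIV (\<lambda>w. \<Sum>\<^sub>\<infinity>i\<in>S. a i * g i w)"
proof (rule uniform_limit_theorem)
  show "uniform_limit UNIV (\<lambda>T w. \<Sum>i\<in>T. a i * g i w) (\<lambda>w. \<Sum>\<^sub>\<infinity>i\<in>S. a i * g i w) (finite_subsets_at_top S)"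
  proof (rule Weierstrass_m_test_general[where M = "\<lambda>i. M * a i"])
    show "norm (a i * g i w) \<le> M * a i" if "i \<in> S" for i w
      using mult_left_mono[OF g(2)[OF that, of w] a(1)[OF that]] a(1)[OF that] by (simp add: abs_mult mult.commute)
    show "(\<lambda>i. M * a i) summable_on S" by (rule summable_on_cmult_right[OF a(2)])
  qed
  have "continuous_on UNIV (\<lambda>w. \<Sum>i\<in>T. a i * g i w)" if "T \<subseteq> S" for T
    by (intro continuous_on_sum continuous_on_mult continuous_on_const g(1)) (use that in auto)
  then show "\<forall>\<^sub>F T in finite_subsets_at_top S. continuous_on UNIV (\<lambda>w. \<Sum>i\<in>T. a i * g i w)"
    by (auto simp: eventually_finite_subsets_at_top)
qed simp

lemma occupied_insert: "occupied (insert z C) \<eta> = of_bool (\<eta> z) * occupied C \<eta>"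
  by (simp add: occupied_def)

lemma occupied_remove: "x \<in> A \<Longrightarrow> occupied A \<eta> = of_bool (\<eta> x) * occupied (A - {x}) \<eta>"
  using occupied_insert[of x "A - {x}" \<eta>] by (simp add: insert_absorb)

lemma continuous_bcontfun:
  fixes f :: "('s \<Rightarrow> bool) \<Rightarrow> real"
  assumes "continuous_on UNIV f" shows "apply_bcontfun (Bcontfun f) = f"
proof (rule Bcontfun_inverse)
  have "compact (f ` UNIV)" by (rule compact_continuous_image[OF assms compact_configurations])
  then have "bounded (f ` UNIV)" by (rule compact_imp_bounded)
  then show "f \<in> bcontfun" using assms by (simp add: bcontfun_def)
qed

context nve_rates
begin

text \<open>
  The exclusion part of the generator applied to \<^term>\<open>occupied A\<close>: a particle leaves \<open>A\<close> for an empty site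
  outside, or enters the only empty site of \<open>A\<close>. Symmetry of \<open>q\<^sub>e\<close> combines both into moves of the dual.
\<close>

lemma exclusion_part_occupied:
  assumes A: "finite A"
  shows "(\<Sum>\<^sub>\<infinity>(x, y)\<in>{(x, y). \<eta> x \<and> \<not> \<eta> y}. qe x y * (occupied A (swap \<eta> x y) - occupied A \<eta>)) =
    (\<Sum>x\<in>A. \<Sum>\<^sub>\<infinity>z\<in>- A. qe x z * (occupied (insert z (A - {x})) \<eta> - occupied A \<eta>))"
proof -
  let ?e = "\<lambda>x. of_bool (\<eta> x) :: real"
  let ?h = "\<lambda>x. occupied (A - {x}) \<eta>"
  define F where "F p = (case p of (x, y) \<Rightarrow>
    if \<eta> x \<and> \<not> \<eta> y then qe x y * (occupied A (swap \<eta> x y) - occupied A \<eta>) else 0)" for p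
  define out where "out x = (\<Sum>\<^sub>\<infinity>z\<in>- A. qe x z * (- (?h x * ?e x * (1 - ?e z))))" for x
  define inn where "inn x = (\<Sum>\<^sub>\<infinity>z\<in>- A. qe x z * (?h x * (1 - ?e x) * ?e z))" for x
  have sw: "swap \<eta> x y = \<eta>(x := False, y := True)" if "\<eta> x" "\<not> \<eta> y" for x y
    using that by (simp add: swap_def)
  have s1: "(\<lambda>z. qe x z * (- (?h x * ?e x * (1 - ?e z)))) summable_on - A" for x
    by (rule weighted_qe_summable, rule bounded_funI[of _ 1]) (simp add: occupied_def)
  have s2: "(\<lambda>z. qe x z * (?h x * (1 - ?e x) * ?e z)) summable_on - A" for x
    by (rule weighted_qe_summable, rule bounded_funI[of _ 1]) (simp add: occupied_def)
  have F1: "F (x, z) = qe x z * (- (?h x * ?e x * (1 - ?e z)))" if "x \<in> A" "z \<in> - A" for x z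
  proof (cases "\<eta> x \<and> \<not> \<eta> z")
    case True
    have "occupied A (swap \<eta> x z) = 0"
      using True that unfolding occupied_def by (auto simp: sw)
    then show ?thesis using True occupied_remove[OF that(1), of \<eta>] by (simp add: F_def)
  qed (auto simp: F_def)
  have F2: "F (z, x) = qe x z * (?h x * (1 - ?e x) * ?e z)" if "x \<in> A" "z \<in> - A" for x z
  proof (cases "\<eta> z \<and> \<not> \<eta> x")
    case True
    have "occupied A (swap \<eta> z x) = ?h x"
      using True that unfolding occupied_def by (auto simp: sw)
    then show ?thesis using True occupied_remove[OF that(1), of \<eta>] by (simp add: F_def qe_sym)
  qed (auto simp: F_def)
  have "((\<lambda>z. F (x, z)) has_sum out x) (- A)" if x: "x \<in> A" for x
    by (rule has_sum_cong[THEN iffD1, OF _ has_sum_infsum[OF s1[of x], folded out_def]]) (simp add: F1[OF x])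
  then have h1: "(F has_sum (\<Sum>x\<in>A. out x)) (A \<times> - A)" by (rule has_sum_finite_Times[OF A])
  have "((\<lambda>z. (F \<circ> prod.swap) (x, z)) has_sum inn x) (- A)" if x: "x \<in> A" for x
    by (rule has_sum_cong[THEN iffD1, OF _ has_sum_infsum[OF s2[of x], folded inn_def]]) (simp add: F2[OF x])
  then have "((F \<circ> prod.swap) has_sum (\<Sum>x\<in>A. inn x)) (A \<times> - A)" by (rule has_sum_finite_Times[OF A])
  then have h2: "(F has_sum (\<Sum>x\<in>A. inn x)) (prod.swap ` (A \<times> - A))"
    by (subst has_sum_reindex) (auto simp: inj_on_def)
  have h: "(F has_sum ((\<Sum>x\<in>A. out x) + (\<Sum>x\<in>A. inn x))) (A \<times> - A \<union> prod.swap ` (A \<times> - A))"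
    by (rule has_sum_Un_disjoint[OF h1 h2]) auto
  have "((\<lambda>(x, y). qe x y * (occupied A (swap \<eta> x y) - occupied A \<eta>)) has_sum ((\<Sum>x\<in>A. out x) + (\<Sum>x\<in>A. inn x)))
      {(x, y). \<eta> x \<and> \<not> \<eta> y}"
  proof (rule has_sum_cong_neutral[THEN iffD1, OF _ _ _ h])
    fix p assume p: "p \<in> {(x, y). \<eta> x \<and> \<not> \<eta> y} - (A \<times> - A \<union> prod.swap ` (A \<times> - A))"
    obtain x y where xy: "p = (x, y)" by (cases p)
    then have e: "\<eta> x" "\<not> \<eta> y" using p by auto
    have "(x \<in> A \<and> y \<in> A) \<or> (x \<notin> A \<and> y \<notin> A)" using p xy by (auto simp: image_iff)
    then have "occupied A (swap \<eta> x y) = occupied A \<eta>"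
      unfolding sw[OF e] using e by (auto simp: occupied_def)
    then show "(case p of (x, y) \<Rightarrow> qe x y * (occupied A (swap \<eta> x y) - occupied A \<eta>)) = 0" by (simp add: xy)
  qed (auto simp: F_def split: if_splits)
  then have "(\<Sum>\<^sub>\<infinity>(x, y)\<in>{(x, y). \<eta> x \<and> \<not> \<eta> y}. qe x y * (occupied A (swap \<eta> x y) - occupied A \<eta>)) =
      (\<Sum>x\<in>A. out x + inn x)"
    unfolding sum.distrib by (rule infsumI)
  also have "\<dots> = (\<Sum>x\<in>A. \<Sum>\<^sub>\<infinity>z\<in>- A. qe x z * (occupied (insert z (A - {x})) \<eta> - occupied A \<eta>))"
  proof (rule sum.cong[OF refl])
    fix x assume x: "x \<in> A"
    have "out x + inn x = (\<Sum>\<^sub>\<infinity>z\<in>- A. qe x z * (- (?h x * ?e x * (1 - ?e z))) + qe x z * (?h x * (1 - ?e x) * ?e z))"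
      unfolding out_def inn_def by (rule infsum_add[symmetric, OF s1 s2])
    also have "\<dots> = (\<Sum>\<^sub>\<infinity>z\<in>- A. qe x z * (occupied (insert z (A - {x})) \<eta> - occupied A \<eta>))"
      unfolding occupied_insert occupied_remove[OF x] by (rule infsum_cong) (simp add: algebra_simps)
    finally show "out x + inn x = (\<Sum>\<^sub>\<infinity>z\<in>- A. qe x z * (occupied (insert z (A - {x})) \<eta> - occupied A \<eta>))" .
  qed
  finally show ?thesis .
qed

text \<open>
  A voter event at \<open>x\<close> copies the state of \<open>z\<close>, so that \<open>z\<close> takes the place of \<open>x\<close> in the set that must be occupied.
  The event \<open>\<beta>\<close> makes \<open>x\<close> occupied, so \<open>x\<close> is no longer a condition, and \<open>\<delta>\<close> makes the condition fail.
\<close>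

lemma flip_part_occupied:
  assumes x: "x \<in> A"
  shows "flip_rate qv \<beta> \<delta> x \<eta> * (occupied A (flip \<eta> x) - occupied A \<eta>) =
    (\<Sum>\<^sub>\<infinity>z. qv x z * (occupied (insert z (A - {x})) \<eta> - occupied A \<eta>)) +
    \<beta> x * (occupied (A - {x}) \<eta> - occupied A \<eta>) - \<delta> x * occupied A \<eta>"
proof -
  let ?h = "occupied (A - {x}) \<eta>"
  have f: "occupied A (flip \<eta> x) = of_bool (\<not> \<eta> x) * ?h"
    unfolding occupied_remove[OF x] by (simp add: flip_def occupied_def)
  show ?thesis
  proof (cases "\<eta> x")
    case True
    have "(\<Sum>\<^sub>\<infinity>z. qv x z * (of_bool (\<eta> z) * ?h - of_bool (\<eta> x) * ?h)) = (\<Sum>\<^sub>\<infinity>z. (- ?h) * (qv x z * (1 - of_bool (\<eta> z))))"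
      using True by (intro infsum_cong) (simp add: algebra_simps)
    also have "\<dots> = (- ?h) * (\<Sum>\<^sub>\<infinity>z. qv x z * (1 - of_bool (\<eta> z)))" by (rule infsum_cmult_right')
    finally show ?thesis
      unfolding f unfolding occupied_insert occupied_remove[OF x] flip_rate_def using True by (simp add: algebra_simps)
  next
    case False
    have "(\<Sum>\<^sub>\<infinity>z. qv x z * (of_bool (\<eta> z) * ?h - of_bool (\<eta> x) * ?h)) = (\<Sum>\<^sub>\<infinity>z. ?h * (qv x z * of_bool (\<eta> z)))"
      using False by (intro infsum_cong) (simp add: algebra_simps)
    also have "\<dots> = ?h * (\<Sum>\<^sub>\<infinity>z. qv x z * of_bool (\<eta> z))" by (rule infsum_cmult_right')
    finally show ?thesis
      unfolding f unfolding occupied_insert occupied_remove[OF x] flip_rate_def using False by (simp add: algebra_simps)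
  qed
qed

text \<open>
  The duality relation: the generator acts on \<^term>\<open>\<lambda>\<eta>. occupied A \<eta>\<close> as the dual generator acts in the variable \<open>A\<close>.
\<close>

lemma nve_operator_occupied:
  assumes A: "finite A"
  shows "nve_operator qe qv \<beta> \<delta> (occupied A) \<eta> = dual_generator (\<lambda>B. occupied B \<eta>) A"
proof -
  have "(\<Sum>\<^sub>\<infinity>x. flip_rate qv \<beta> \<delta> x \<eta> * (occupied A (flip \<eta> x) - occupied A \<eta>)) =
      (\<Sum>\<^sub>\<infinity>x\<in>A. flip_rate qv \<beta> \<delta> x \<eta> * (occupied A (flip \<eta> x) - occupied A \<eta>))"
  proof (rule infsum_cong_neutral)
    fix x assume "x \<in> UNIV - A"
    then have "occupied A (flip \<eta> x) = occupied A \<eta>" by (auto simp: occupied_def flip_def)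
    then show "flip_rate qv \<beta> \<delta> x \<eta> * (occupied A (flip \<eta> x) - occupied A \<eta>) = 0" by simp
  qed auto
  also have "\<dots> = (\<Sum>x\<in>A. flip_rate qv \<beta> \<delta> x \<eta> * (occupied A (flip \<eta> x) - occupied A \<eta>))"
    using A by simp
  finally have flip: "(\<Sum>\<^sub>\<infinity>x. flip_rate qv \<beta> \<delta> x \<eta> * (occupied A (flip \<eta> x) - occupied A \<eta>)) =
      (\<Sum>x\<in>A. flip_rate qv \<beta> \<delta> x \<eta> * (occupied A (flip \<eta> x) - occupied A \<eta>))" .
  show ?thesis
    unfolding nve_operator_def dual_generator_def flip exclusion_part_occupied[OF A] sum.distrib[symmetric]
    by (intro sum.cong refl) (simp add: flip_part_occupied)
qed

lemma occupied_increment_bounds: "\<bar>occupied B \<eta> - occupied A \<eta>\<bar> \<le> 1"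
  by (simp add: occupied_def)

lemma continuous_dual_generator_occupied:
  assumes A: "finite A"
  shows "continuous_on UNIV (\<lambda>\<eta>. dual_generator (\<lambda>B. occupied B \<eta>) A)"
proof -
  have c: "continuous_on UNIV (\<lambda>\<eta>. occupied (insert z (A - {x})) \<eta> - occupied A \<eta>)" for x z
    by (intro continuous_on_diff occupied_continuous) (use A in auto)
  have 1: "continuous_on UNIV (\<lambda>\<eta>. \<Sum>\<^sub>\<infinity>z\<in>- A. qe x z * (occupied (insert z (A - {x})) \<eta> - occupied A \<eta>))" for x
    by (rule continuous_weighted_infsum[where M = 1])
      (use c qe_nonneg occupied_increment_bounds summable_on_subset_banach[OF qe_summable] in auto)
  have 2: "continuous_on UNIV (\<lambda>\<eta>. \<Sum>\<^sub>\<infinity>z. qv x z * (occupied (insert z (A - {x})) \<eta> - occupied A \<eta>))" for x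
    by (rule continuous_weighted_infsum[where M = 1])
      (use c qv_nonneg occupied_increment_bounds qv_summable in auto)
  have 3: "continuous_on UNIV (occupied (A - {x}))" "continuous_on UNIV (occupied A)" for x
    by (intro occupied_continuous; use A in simp)+
  show ?thesis
    unfolding dual_generator_def
    by (intro continuous_on_sum continuous_on_add continuous_on_diff continuous_on_mult continuous_on_const 1 2 3)
qed

lemma integral_dual_generator_occupied:
  assumes \<nu>: "\<nu> \<in> config_measures" and A: "finite A"
  shows "(\<integral>\<eta>. dual_generator (\<lambda>B. occupied B \<eta>) A \<partial>\<nu>) = dual_generator (moment \<nu>) A"
proof -
  interpret prob_space \<nu> by (rule config_measuresD[OF \<nu>])
  have occ: "integrable \<nu> (occupied B)" if "finite B" for B
    by (rule continuous_config_integrable[OF \<nu> occupied_continuous[OF that]])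
  have fin: "finite (insert z (A - {x}))" "finite (A - {x})" for x z using A by auto
  have m: "(\<lambda>\<eta>. occupied (insert z (A - {x})) \<eta> - occupied A \<eta>) \<in> borel_measurable \<nu>" for x z
    by (intro borel_measurable_diff borel_measurable_integrable occ fin A)
  have d: "(\<integral>\<eta>. occupied B \<eta> - occupied A \<eta> \<partial>\<nu>) = moment \<nu> B - moment \<nu> A" if "finite B" for B
    using occ[OF that] occ[OF A] by (simp add: moment_eq_integral[OF \<nu>] that A)
  have 1: "(\<integral>\<eta>. (\<Sum>\<^sub>\<infinity>z\<in>- A. qe x z * (occupied (insert z (A - {x})) \<eta> - occupied A \<eta>)) \<partial>\<nu>) =
      (\<Sum>\<^sub>\<infinity>z\<in>- A. qe x z * (moment \<nu> (insert z (A - {x})) - moment \<nu> A))" for x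
    unfolding d[OF fin(1), symmetric]
    by (rule integral_weighted_infsum[where M = 1])
      (use m qe_nonneg occupied_increment_bounds summable_on_subset_banach[OF qe_summable] in \<open>auto intro: finite_measure_axioms\<close>)
  have 2: "(\<integral>\<eta>. (\<Sum>\<^sub>\<infinity>z. qv x z * (occupied (insert z (A - {x})) \<eta> - occupied A \<eta>)) \<partial>\<nu>) =
      (\<Sum>\<^sub>\<infinity>z. qv x z * (moment \<nu> (insert z (A - {x})) - moment \<nu> A))" for x
    unfolding d[OF fin(1), symmetric]
    by (rule integral_weighted_infsum[where M = 1])
      (use m qv_nonneg occupied_increment_bounds qv_summable in \<open>auto intro: finite_measure_axioms\<close>)
  have c: "continuous_on UNIV (\<lambda>\<eta>. occupied (insert z (A - {x})) \<eta> - occupied A \<eta>)" for x z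
    by (intro continuous_on_diff occupied_continuous) (use A in auto)
  have i1: "integrable \<nu> (\<lambda>\<eta>. \<Sum>\<^sub>\<infinity>z\<in>- A. qe x z * (occupied (insert z (A - {x})) \<eta> - occupied A \<eta>))" for x
    by (intro continuous_config_integrable[OF \<nu>] continuous_weighted_infsum[where M = 1])
      (use c qe_nonneg occupied_increment_bounds summable_on_subset_banach[OF qe_summable] in auto)
  have i2: "integrable \<nu> (\<lambda>\<eta>. \<Sum>\<^sub>\<infinity>z. qv x z * (occupied (insert z (A - {x})) \<eta> - occupied A \<eta>))" for x
    by (intro continuous_config_integrable[OF \<nu>] continuous_weighted_infsum[where M = 1])
      (use c qv_nonneg occupied_increment_bounds qv_summable in auto)
  have 3: "(\<integral>\<eta>. \<beta> x * (occupied (A - {x}) \<eta> - occupied A \<eta>) \<partial>\<nu>) = \<beta> x * (moment \<nu> (A - {x}) - moment \<nu> A)" for x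
    using d[OF fin(2)] by simp
  have 4: "(\<integral>\<eta>. \<delta> x * occupied A \<eta> \<partial>\<nu>) = \<delta> x * moment \<nu> A" for x
    by (simp add: moment_eq_integral[OF \<nu> A])
  have i3: "integrable \<nu> (\<lambda>\<eta>. \<beta> x * (occupied (A - {x}) \<eta> - occupied A \<eta>))" for x
    by (intro integrable_mult_right Bochner_Integration.integrable_diff occ fin A)
  have i4: "integrable \<nu> (\<lambda>\<eta>. \<delta> x * occupied A \<eta>)" for x
    by (intro integrable_mult_right occ A)
  note ii = Bochner_Integration.integrable_add[OF Bochner_Integration.integrable_add[OF i1 i2] i3]
  show ?thesis
    unfolding dual_generator_def
    by (subst Bochner_Integration.integral_sum[OF Bochner_Integration.integrable_diff[OF ii i4]])
      (simp only: Bochner_Integration.integral_diff[OF ii i4]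
        Bochner_Integration.integral_add[OF Bochner_Integration.integrable_add[OF i1 i2] i3]
        Bochner_Integration.integral_add[OF i1 i2] 1 2 3 4)
qed

end

locale nve_dynamics = nve_rates +
  fixes K :: "real \<Rightarrow> ('a \<Rightarrow> bool) \<Rightarrow> ('a \<Rightarrow> bool) measure"
  assumes nve: "nve_process qe qv \<beta> \<delta> K"
begin

lemma K_measurable: "0 \<le> t \<Longrightarrow> K t \<in> borel \<rightarrow>\<^sub>M prob_algebra borel"
  using nve by (simp add: nve_process_def feller_kernel_def)

lemma K_config: "0 \<le> t \<Longrightarrow> K t \<eta> \<in> config_measures"
  using measurable_space[OF K_measurable, of t \<eta>] by simp

lemma bind_config: "\<mu> \<in> config_measures \<Longrightarrow> 0 \<le> t \<Longrightarrow> \<mu> \<bind> K t \<in> config_measures"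
  using prob_space_bind'[OF _ K_measurable, of \<mu> t] sets_bind'[OF _ K_measurable, of \<mu> t]
  by (simp add: space_prob_algebra[of borel])

lemma bind_0: "\<mu> \<in> config_measures \<Longrightarrow> \<mu> \<bind> K 0 = \<mu>"
proof -
  assume \<mu>: "\<mu> \<in> config_measures"
  have "K 0 = return borel" using nve by (auto simp: nve_process_def feller_kernel_def)
  then show ?thesis using bind_return''[OF config_measuresD(2)[OF \<mu>]] by simp
qed

lemma bind_bind:
  assumes \<mu>: "\<mu> \<in> config_measures" and s: "0 \<le> s" and t: "0 \<le> t"
  shows "(\<mu> \<bind> K s) \<bind> K t = \<mu> \<bind> K (s + t)"
proof -
  have "K s \<in> \<mu> \<rightarrow>\<^sub>M subprob_algebra borel"
    using measurable_prob_algebraD[OF K_measurable[OF s]]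
    unfolding measurable_cong_sets[OF config_measuresD(2)[OF \<mu>] refl] .
  then have "(\<mu> \<bind> K s) \<bind> K t = \<mu> \<bind> (\<lambda>\<eta>. K s \<eta> \<bind> K t)"
    by (rule bind_assoc) (rule measurable_prob_algebraD[OF K_measurable[OF t]])
  also have "(\<lambda>\<eta>. K s \<eta> \<bind> K t) = K (s + t)"
    using nve s t by (auto simp: nve_process_def feller_kernel_def)
  finally show ?thesis .
qed

lemma moment_bind:
  assumes \<mu>: "\<mu> \<in> config_measures" and t: "0 \<le> t" and A: "finite A"
  shows "moment (\<mu> \<bind> K t) A = (\<integral>\<eta>. semigroup_fun K t (occupied A) \<eta> \<partial>\<mu>)"
proof -
  interpret prob_space \<mu> by (rule config_measuresD[OF \<mu>])
  have K: "K t \<in> \<mu> \<rightarrow>\<^sub>M subprob_algebra borel"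
    using measurable_prob_algebraD[OF K_measurable[OF t]]
    unfolding measurable_cong_sets[OF config_measuresD(2)[OF \<mu>] refl] .
  have c: "cylinder {\<eta>. \<forall>x\<in>A. \<eta> x}"
    unfolding cylinder_iff using A by (auto intro!: exI[of _ A])
  have S: "{\<eta>. \<forall>x\<in>A. \<eta> x} \<in> sets (borel :: ('a \<Rightarrow> bool) measure)"
    using cylinder_open[OF c] by simp
  have "measure (\<mu> \<bind> K t) {\<eta>. \<forall>x\<in>A. \<eta> x} = (\<integral>\<eta>. measure (K t \<eta>) {\<eta>. \<forall>x\<in>A. \<eta> x} \<partial>\<mu>)"
    by (rule measure_bind[OF K S])
  also have "\<dots> = (\<integral>\<eta>. semigroup_fun K t (occupied A) \<eta> \<partial>\<mu>)"
    by (simp only: moment_def[symmetric] moment_eq_integral[OF K_config[OF t] A] semigroup_fun_def)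
  finally show ?thesis unfolding moment_def .
qed

lemma semigroup_occupied_continuous:
  assumes "0 \<le> t" "finite A"
  shows "continuous_on UNIV (semigroup_fun K t (occupied A))"
proof -
  have "\<forall>t\<ge>0. \<forall>f :: ('a \<Rightarrow> bool) \<Rightarrow>\<^sub>C real. continuous_on UNIV (semigroup_fun K t f)"
    using nve by (simp add: nve_process_def feller_kernel_def)
  then have "continuous_on UNIV (semigroup_fun K t (apply_bcontfun (Bcontfun (occupied A))))"
    using assms(1) by blast
  then show ?thesis by (simp add: continuous_bcontfun[OF occupied_continuous[OF assms(2)]])
qed

lemma semigroup_occupied_uniform_limit:
  assumes A: "finite A"
  shows "uniform_limit UNIV (\<lambda>t. semigroup_fun K t (occupied A)) (occupied A) (at_right 0)"
proof -
  have "\<forall>f :: ('a \<Rightarrow> bool) \<Rightarrow>\<^sub>C real. uniform_limit UNIV (\<lambda>t. semigroup_fun K t f) f (at_right 0)"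
    using nve by (simp add: nve_process_def feller_kernel_def)
  from this[rule_format, of "Bcontfun (occupied A)"] show ?thesis
    by (simp add: continuous_bcontfun[OF occupied_continuous[OF A]])
qed

lemma generator_occupied:
  assumes A: "finite A"
  shows "uniform_limit UNIV (\<lambda>t \<eta>. (semigroup_fun K t (occupied A) \<eta> - occupied A \<eta>) / t)
    (\<lambda>\<eta>. dual_generator (\<lambda>B. occupied B \<eta>) A) (at_right 0)"
proof -
  define f g where "f = Bcontfun (occupied A)" and "g = Bcontfun (\<lambda>\<eta>. dual_generator (\<lambda>B. occupied B \<eta>) A)"
  have f: "apply_bcontfun f = occupied A"
    unfolding f_def by (rule continuous_bcontfun[OF occupied_continuous[OF A]])
  have g: "apply_bcontfun g = (\<lambda>\<eta>. dual_generator (\<lambda>B. occupied B \<eta>) A)"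
    unfolding g_def by (rule continuous_bcontfun[OF continuous_dual_generator_occupied[OF A]])
  have "apply_bcontfun g = nve_operator qe qv \<beta> \<delta> (apply_bcontfun f)"
    unfolding f g by (rule ext) (rule nve_operator_occupied[OF A, symmetric])
  then have "(f, g) \<in> {(f, g). finitely_dependent (apply_bcontfun f) \<and>
       apply_bcontfun g = nve_operator qe qv \<beta> \<delta> (apply_bcontfun f)}"
    using finitely_dependent_occupied[OF A] by (simp add: f)
  then have "(f, g) \<in> closure {(f, g). finitely_dependent (apply_bcontfun f) \<and>
       apply_bcontfun g = nve_operator qe qv \<beta> \<delta> (apply_bcontfun f)}"
    by (rule subsetD[OF closure_subset])
  then have "(f, g) \<in> generator K"
    unfolding nve[unfolded nve_process_def, THEN conjunct2] .
  then show ?thesis by (simp add: generator_def f g)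
qed

lemma moment_increment:
  assumes \<nu>: "\<nu> \<in> config_measures" and h: "0 \<le> h" and A: "finite A"
  shows "moment (\<nu> \<bind> K h) A - moment \<nu> A = (\<integral>\<eta>. semigroup_fun K h (occupied A) \<eta> - occupied A \<eta> \<partial>\<nu>)"
  unfolding moment_bind[OF \<nu> h A] moment_eq_integral[OF \<nu> A]
  by (rule Bochner_Integration.integral_diff[symmetric])
    (rule continuous_config_integrable[OF \<nu> semigroup_occupied_continuous[OF h A]],
      rule continuous_config_integrable[OF \<nu> occupied_continuous[OF A]])

text \<open>
  The difference quotients of the semigroup converge uniformly in the configuration, so they may be integrated against any
  initial measure.
\<close>

lemma moment_right_derivative:
  assumes \<nu>: "\<nu> \<in> config_measures" and A: "finite A"
  shows "((\<lambda>h. (moment (\<nu> \<bind> K h) A - moment \<nu> A) / h) \<longlongrightarrow> dual_generator (moment \<nu>) A) (at_right 0)"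
proof (rule tendstoI)
  fix e :: real assume e: "0 < e"
  have "\<forall>\<^sub>F h in at_right 0. \<forall>\<eta>\<in>UNIV. dist ((semigroup_fun K h (occupied A) \<eta> - occupied A \<eta>) / h)
      (dual_generator (\<lambda>B. occupied B \<eta>) A) < e / 2"
    by (rule uniform_limitD[OF generator_occupied[OF A]]) (use e in simp)
  moreover have "\<forall>\<^sub>F h in at_right (0::real). 0 < h" by (simp add: eventually_at_right_less)
  ultimately show "\<forall>\<^sub>F h in at_right 0. dist ((moment (\<nu> \<bind> K h) A - moment \<nu> A) / h) (dual_generator (moment \<nu>) A) < e"
  proof eventually_elim
    case (elim h)
    then have h: "0 \<le> h" by simp
    have eq: "(moment (\<nu> \<bind> K h) A - moment \<nu> A) / h = (\<integral>\<eta>. (semigroup_fun K h (occupied A) \<eta> - occupied A \<eta>) / h \<partial>\<nu>)"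
      unfolding moment_increment[OF \<nu> h A] by simp
    have "\<bar>(\<integral>\<eta>. (semigroup_fun K h (occupied A) \<eta> - occupied A \<eta>) / h \<partial>\<nu>) -
        (\<integral>\<eta>. dual_generator (\<lambda>B. occupied B \<eta>) A \<partial>\<nu>)\<bar> \<le> e / 2"
    proof (rule config_integral_diff_le[OF \<nu> _ continuous_dual_generator_occupied[OF A]])
      show "continuous_on UNIV (\<lambda>\<eta>. (semigroup_fun K h (occupied A) \<eta> - occupied A \<eta>) / h)"
        unfolding divide_inverse
        by (intro continuous_on_mult continuous_on_diff continuous_on_const
            semigroup_occupied_continuous[OF h A] occupied_continuous[OF A])
      show "\<bar>(semigroup_fun K h (occupied A) \<eta> - occupied A \<eta>) / h - dual_generator (\<lambda>B. occupied B \<eta>) A\<bar> \<le> e / 2" for \<eta>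
        using elim(1) unfolding dist_real_def by (simp add: less_imp_le)
    qed
    then show ?case
      unfolding eq integral_dual_generator_occupied[OF \<nu> A] dist_real_def using e by simp
  qed
qed

lemma moment_continuous:
  assumes \<mu>: "\<mu> \<in> config_measures" and A: "finite A"
  shows "continuous_on {0..} (\<lambda>t. moment (\<mu> \<bind> K t) A)"
  unfolding continuous_on_iff
proof (intro ballI allI impI)
  fix t e :: real assume t: "t \<in> {0..}" and e: "0 < e"
  have "\<forall>\<^sub>F h in at_right 0. \<forall>\<eta>\<in>UNIV. dist (semigroup_fun K h (occupied A) \<eta>) (occupied A \<eta>) < e / 2"
    by (rule uniform_limitD[OF semigroup_occupied_uniform_limit[OF A]]) (use e in simp)
  then obtain d where d: "0 < d"
    "\<forall>h>0. h < d \<longrightarrow> (\<forall>\<eta>\<in>UNIV. dist (semigroup_fun K h (occupied A) \<eta>) (occupied A \<eta>) < e / 2)"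
    unfolding eventually_at_right_field by blast
  have inc: "\<bar>moment (\<mu> \<bind> K (s + h)) A - moment (\<mu> \<bind> K s) A\<bar> < e" if s: "0 \<le> s" and h: "0 < h" "h < d" for s h
  proof -
    have \<nu>: "\<mu> \<bind> K s \<in> config_measures" by (rule bind_config[OF \<mu> s])
    have h0: "0 \<le> h" using h by simp
    have "\<bar>(\<integral>\<eta>. semigroup_fun K h (occupied A) \<eta> \<partial>(\<mu> \<bind> K s)) - (\<integral>\<eta>. occupied A \<eta> \<partial>(\<mu> \<bind> K s))\<bar> \<le> e / 2"
    proof (rule config_integral_diff_le[OF \<nu> semigroup_occupied_continuous[OF h0 A] occupied_continuous[OF A]])
      show "\<bar>semigroup_fun K h (occupied A) \<eta> - occupied A \<eta>\<bar> \<le> e / 2" for \<eta>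
        using d(2)[rule_format, OF h] unfolding dist_real_def by (simp add: less_imp_le)
    qed
    then show ?thesis
      unfolding moment_bind[OF \<nu> h0 A, symmetric] moment_eq_integral[OF \<nu> A, symmetric] bind_bind[OF \<mu> s h0]
      using e by simp
  qed
  show "\<exists>d>0. \<forall>s\<in>{0..}. dist s t < d \<longrightarrow> dist (moment (\<mu> \<bind> K s) A) (moment (\<mu> \<bind> K t) A) < e"
  proof (intro exI[of _ d] conjI ballI impI d(1))
    fix s assume s: "s \<in> {0..}" "dist s t < d"
    consider "s = t" | "s < t" | "t < s" by linarith
    then show "dist (moment (\<mu> \<bind> K s) A) (moment (\<mu> \<bind> K t) A) < e"
    proof cases
      case 2
      then show ?thesis using inc[of s "t - s"] s by (simp add: dist_real_def abs_minus_commute)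
    next
      case 3
      then show ?thesis using inc[of t "s - t"] s t by (simp add: dist_real_def)
    qed (use e in simp)
  qed
qed

lemma dual_solution_moment:
  assumes \<mu>: "\<mu> \<in> config_measures"
  shows "dual_solution (\<lambda>t. moment (\<mu> \<bind> K t))"
  unfolding dual_solution_def
proof (intro conjI allI impI)
  show "\<exists>M. \<forall>t\<ge>0. \<forall>A. \<bar>moment (\<mu> \<bind> K t) A\<bar> \<le> M"
    using moment_bounds[OF bind_config[OF \<mu>]] by (intro exI[of _ 1]) simp
  fix A :: "'a set" assume A: "finite A"
  show "continuous_on {0..} (\<lambda>t. moment (\<mu> \<bind> K t) A)" by (rule moment_continuous[OF \<mu> A])
  fix t :: real assume t: "0 \<le> t"
  have "((\<lambda>h. (moment ((\<mu> \<bind> K t) \<bind> K h) A - moment (\<mu> \<bind> K t) A) / h) \<longlongrightarrow>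
      dual_generator (moment (\<mu> \<bind> K t)) A) (at_right 0)"
    by (rule moment_right_derivative[OF bind_config[OF \<mu> t] A])
  then have "((\<lambda>h. (moment (\<mu> \<bind> K (h + t)) A - moment (\<mu> \<bind> K t) A) / (h + t - t)) \<longlongrightarrow>
      dual_generator (moment (\<mu> \<bind> K t)) A) (at_right 0)"
  proof (rule Lim_transform_eventually)
    have "\<forall>\<^sub>F h in at_right (0::real). 0 < h" by (simp add: eventually_at_right_less)
    then show "\<forall>\<^sub>F h in at_right 0. (moment ((\<mu> \<bind> K t) \<bind> K h) A - moment (\<mu> \<bind> K t) A) / h =
        (moment (\<mu> \<bind> K (h + t)) A - moment (\<mu> \<bind> K t) A) / (h + t - t)"
    proof eventually_elim
      case (elim h)
      then show ?case using bind_bind[OF \<mu> t, of h] by (simp add: add.commute)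
    qed
  qed
  then show "((\<lambda>t. moment (\<mu> \<bind> K t) A) has_real_derivative dual_generator (moment (\<mu> \<bind> K t)) A) (at_right t)"
    unfolding has_field_derivative_iff by (subst filterlim_at_right_to_0)
qed

end

section \<open>Invariant measures and convergence\<close>

lemma (in markov_jump_process) mean_eq_infsum:
  assumes x: "x \<in> A" and t: "0 \<le> t" and f: "bounded_fun f"
  shows "mean t f x = (\<Sum>\<^sub>\<infinity>y. trans_prob P X t x y * f y)"
proof -
  obtain M where M: "\<And>x. \<bar>f x\<bar> \<le> M" using bounded_funD[OF f] by auto
  have s: "Infinite_Set_Sum.abs_summable_on (\<lambda>y. pmf (law t x) y * f y) UNIV"
    unfolding abs_summable_equivalent[symmetric] summable_on_iff_abs_summable_on_real[symmetric]
    by (rule weighted_summable_on[where M = M]) (use pmf_summable_on M in auto)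
  have "mean t f x = (\<Sum>\<^sub>\<infinity>y. pmf (law t x) y * f y)"
    unfolding mean_def pmf_expectation_eq_infsetsum by (rule infsetsum_infsum[OF s])
  then show ?thesis by (simp only: pmf_law[OF x t])
qed

lemma mixture_config:
  fixes \<mu> \<nu> :: "('s \<Rightarrow> bool) measure"
  assumes \<mu>: "\<mu> \<in> config_measures" and \<nu>: "\<nu> \<in> config_measures" and a: "0 \<le> a" "a \<le> 1"
  shows "mixture a \<mu> \<nu> \<in> config_measures"
    and "finite A \<Longrightarrow> moment (mixture a \<mu> \<nu>) A = a * moment \<mu> A + (1 - a) * moment \<nu> A"
proof -
  note s = config_measuresD(2)[OF \<mu>] config_measuresD(2)[OF \<nu>]
  have sm: "sets (mixture a \<mu> \<nu>) = sets borel"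
    unfolding mixture_def using sets.sigma_sets_eq[of "borel :: ('s \<Rightarrow> bool) measure"] by (subst sets_measure_of) auto
  have spm: "space (mixture a \<mu> \<nu>) = UNIV" using sets_eq_imp_space_eq[OF sm] by simp
  interpret M: prob_space \<mu> by (rule config_measuresD[OF \<mu>])
  interpret N: prob_space \<nu> by (rule config_measuresD[OF \<nu>])
  have e: "emeasure (mixture a \<mu> \<nu>) B = ennreal (a * measure \<mu> B + (1 - a) * measure \<nu> B)" if "B \<in> sets borel" for B
    unfolding emeasure_mixture[OF s that] M.emeasure_eq_measure N.emeasure_eq_measure
    using a by (simp add: ennreal_mult[symmetric] ennreal_plus[symmetric] del: ennreal_plus)
  have "prob_space (mixture a \<mu> \<nu>)"
    by (rule prob_spaceI) (simp add: spm e measure_UNIV_config[OF \<mu>] measure_UNIV_config[OF \<nu>])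
  then show "mixture a \<mu> \<nu> \<in> config_measures" by (simp add: space_prob_algebra sm)
  show "moment (mixture a \<mu> \<nu>) A = a * moment \<mu> A + (1 - a) * moment \<nu> A" if A: "finite A"
  proof -
    have c: "cylinder {\<eta> :: 's \<Rightarrow> bool. \<forall>x\<in>A. \<eta> x}"
      unfolding cylinder_iff using A by (auto intro!: exI[of _ A])
    have m: "{\<eta> :: 's \<Rightarrow> bool. \<forall>x\<in>A. \<eta> x} \<in> sets borel" using cylinder_open[OF c] by simp
    have "measure (mixture a \<mu> \<nu>) {\<eta>. \<forall>x\<in>A. \<eta> x} = a * measure \<mu> {\<eta>. \<forall>x\<in>A. \<eta> x} + (1 - a) * measure \<nu> {\<eta>. \<forall>x\<in>A. \<eta> x}"
      unfolding measure_def[of "mixture a \<mu> \<nu>"] e[OF m] by (rule enn2real_ennreal) (use a in simp)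
    then show ?thesis unfolding moment_def .
  qed
qed

lemma return_config: "return borel \<eta> \<in> config_measures"
  by (simp add: space_prob_algebra prob_space_return)

lemma moment_return: "finite A \<Longrightarrow> moment (return borel \<eta>) A = occupied A \<eta>"
proof -
  assume A: "finite A"
  have "(\<integral>\<zeta>. occupied A \<zeta> \<partial>return borel \<eta>) = occupied A \<eta>"
    by (rule integral_return) (auto intro: borel_measurable_continuous_onI occupied_continuous[OF A])
  then show ?thesis by (simp add: moment_eq_integral[OF return_config A])
qed

locale nve_survival = survival_rates + nve_dynamics
begin

definition "u0 t = moment (return borel (\<lambda>_. False) \<bind> K t)"
definition "u1 t = moment (return borel (\<lambda>_. True) \<bind> K t)"

sublocale reference_solutions qe qv \<beta> \<delta> u0 u1
proof
  show "dual_solution u0" "dual_solution u1"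
    unfolding u0_def u1_def by (rule dual_solution_moment[OF return_config])+
  fix A :: "'a set" and t :: real
  show "u0 0 A = of_bool (A = {})" if "finite A"
    using that by (simp add: u0_def bind_0[OF return_config] moment_return) (auto simp: occupied_def)
  show "u1 0 A = 1" if "finite A"
    using that by (simp add: u1_def bind_0[OF return_config] moment_return occupied_def)
  assume t: "0 \<le> t"
  show "u0 t {} = 1" "u1 t {} = 1"
    unfolding u0_def u1_def by (rule moment_empty[OF bind_config[OF return_config t]])+
  show "0 \<le> u0 t A \<and> u0 t A \<le> 1" "0 \<le> u1 t A \<and> u1 t A \<le> 1"
    unfolding u0_def u1_def by (rule moment_bounds[OF bind_config[OF return_config t]])+
qed

text \<open>
  Measures are identified by their moments throughout: \<open>mixture \<theta> \<mu>1 \<mu>0\<close> is the only measure with the moments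
  \<open>\<theta> * limit1 + (1 - \<theta>) * limit0\<close>.
\<close>

context
  fixes \<mu>0 \<mu>1 :: "('a \<Rightarrow> bool) measure"
  assumes \<mu>0: "\<mu>0 \<in> config_measures" and \<mu>1: "\<mu>1 \<in> config_measures"
    and m0: "\<And>A. finite A \<Longrightarrow> moment \<mu>0 A = limit0 A" and m1: "\<And>A. finite A \<Longrightarrow> moment \<mu>1 A = limit1 A"
begin

lemma mixture_moment:
  assumes "0 \<le> \<theta>" "\<theta> \<le> 1" "finite A"
  shows "moment (mixture \<theta> \<mu>1 \<mu>0) A = \<theta> * limit1 A + (1 - \<theta>) * limit0 A"
  using mixture_config(2)[OF \<mu>1 \<mu>0 assms] m0[OF assms(3)] m1[OF assms(3)] by simp

lemma mixture_in_config: "0 \<le> \<theta> \<Longrightarrow> \<theta> \<le> 1 \<Longrightarrow> mixture \<theta> \<mu>1 \<mu>0 \<in> config_measures"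
  by (rule mixture_config[OF \<mu>1 \<mu>0])

lemma mixture_0: "mixture 0 \<mu>1 \<mu>0 = \<mu>0"
  by (rule config_measure_eqI[OF mixture_in_config \<mu>0]) (simp_all add: mixture_moment m0)

lemma mixture_1: "mixture 1 \<mu>1 \<mu>0 = \<mu>1"
  by (rule config_measure_eqI[OF mixture_in_config \<mu>1]) (simp_all add: mixture_moment m1)

lemma mixture_inject:
  assumes "0 \<le> \<theta>" "\<theta> \<le> 1" "0 \<le> \<theta>'" "\<theta>' \<le> 1" "mixture \<theta> \<mu>1 \<mu>0 = mixture \<theta>' \<mu>1 \<mu>0"
  shows "\<theta> = \<theta>'"
proof -
  obtain x where x: "killed.survival x \<noteq> 0" using noise_survival ..
  have eq: "moment (mixture \<theta> \<mu>1 \<mu>0) {x} = limit0 {x} + \<theta> * killed.survival x" if "0 \<le> \<theta>" "\<theta> \<le> 1" for \<theta>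
    unfolding mixture_moment[OF that finite.insertI[OF finite.emptyI]] limit_difference[symmetric]
    by (simp only: algebra_simps)
  have "limit0 {x} + \<theta> * killed.survival x = limit0 {x} + \<theta>' * killed.survival x"
    unfolding eq[OF assms(1,2), symmetric] eq[OF assms(3,4), symmetric] assms(5) ..
  then show ?thesis using x by simp
qed

lemma mixture_of_mixtures:
  assumes a: "0 \<le> a" "a \<le> 1" and t1: "0 \<le> \<theta>1" "\<theta>1 \<le> 1" and t2: "0 \<le> \<theta>2" "\<theta>2 \<le> 1"
  shows "mixture a (mixture \<theta>1 \<mu>1 \<mu>0) (mixture \<theta>2 \<mu>1 \<mu>0) = mixture (a * \<theta>1 + (1 - a) * \<theta>2) \<mu>1 \<mu>0"
    and "0 \<le> a * \<theta>1 + (1 - a) * \<theta>2" "a * \<theta>1 + (1 - a) * \<theta>2 \<le> 1"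
proof -
  show 0: "0 \<le> a * \<theta>1 + (1 - a) * \<theta>2" using assms by simp
  have "a * \<theta>1 + (1 - a) * \<theta>2 \<le> a * 1 + (1 - a) * 1" using assms by (intro add_mono mult_left_mono) auto
  then show 1: "a * \<theta>1 + (1 - a) * \<theta>2 \<le> 1" by simp
  show "mixture a (mixture \<theta>1 \<mu>1 \<mu>0) (mixture \<theta>2 \<mu>1 \<mu>0) = mixture (a * \<theta>1 + (1 - a) * \<theta>2) \<mu>1 \<mu>0"
  proof (rule config_measure_eqI[OF mixture_config(1)[OF mixture_in_config[OF t1] mixture_in_config[OF t2] a] mixture_in_config[OF 0 1]])
    fix A :: "'a set" assume A: "finite A"
    show "moment (mixture a (mixture \<theta>1 \<mu>1 \<mu>0) (mixture \<theta>2 \<mu>1 \<mu>0)) A = moment (mixture (a * \<theta>1 + (1 - a) * \<theta>2) \<mu>1 \<mu>0) A"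
      unfolding mixture_config(2)[OF mixture_in_config[OF t1] mixture_in_config[OF t2] a A]
        mixture_moment[OF 0 1 A] mixture_moment[OF t1 A] mixture_moment[OF t2 A]
      by (simp add: algebra_simps)
  qed
qed

text \<open>
  The moments of an invariant measure are a stationary solution. Conversely the moments of a mixture are the limit of the
  corresponding mixture of solutions, and limits of solutions are stationary.
\<close>

lemma invariant_iff_mixture:
  "\<nu> \<in> invariant_measures K \<longleftrightarrow> (\<exists>\<theta>. 0 \<le> \<theta> \<and> \<theta> \<le> 1 \<and> \<nu> = mixture \<theta> \<mu>1 \<mu>0)"
proof
  assume "\<nu> \<in> invariant_measures K"
  then have \<nu>: "\<nu> \<in> config_measures" and inv: "\<And>t. 0 \<le> t \<Longrightarrow> \<nu> \<bind> K t = \<nu>"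
    by (simp_all add: invariant_measures_def)
  let ?u = "\<lambda>t. moment (\<nu> \<bind> K t)"
  have e: "?u t {} = 1" if "0 \<le> t" for t by (rule moment_empty[OF bind_config[OF \<nu> that]])
  have r: "0 \<le> ?u 0 {x}" "?u 0 {x} \<le> 1" for x using moment_bounds[OF \<nu>, of "{x}"] by (simp_all add: inv)
  have stat: "?u t A = ?u 0 A" if "0 \<le> t" for t A using that by (simp add: inv)
  have "\<exists>\<theta>. 0 \<le> \<theta> \<and> \<theta> \<le> 1 \<and> (\<forall>A. finite A \<longrightarrow> ?u 0 A = \<theta> * limit1 A + (1 - \<theta>) * limit0 A)"
    by (rule stationary_dual_solution[OF dual_solution_moment[OF \<nu>] e r stat])
  then obtain \<theta> where t: "0 \<le> \<theta>" "\<theta> \<le> 1" and m: "\<forall>A. finite A \<longrightarrow> ?u 0 A = \<theta> * limit1 A + (1 - \<theta>) * limit0 A" by blast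
  have "\<nu> = mixture \<theta> \<mu>1 \<mu>0"
    by (rule config_measure_eqI[OF \<nu> mixture_in_config[OF t]]) (use m in \<open>simp add: inv mixture_moment[OF t]\<close>)
  then show "\<exists>\<theta>. 0 \<le> \<theta> \<and> \<theta> \<le> 1 \<and> \<nu> = mixture \<theta> \<mu>1 \<mu>0" using t by blast
next
  assume "\<exists>\<theta>. 0 \<le> \<theta> \<and> \<theta> \<le> 1 \<and> \<nu> = mixture \<theta> \<mu>1 \<mu>0"
  then obtain \<theta> where t: "0 \<le> \<theta>" "\<theta> \<le> 1" and \<nu>: "\<nu> = mixture \<theta> \<mu>1 \<mu>0" by blast
  have \<nu>c: "\<nu> \<in> config_measures" unfolding \<nu> by (rule mixture_in_config[OF t])
  have "\<nu> \<bind> K r = \<nu>" if r: "0 \<le> r" for r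
  proof (rule config_measure_eqI[OF bind_config[OF \<nu>c r] \<nu>c])
    fix A :: "'a set" assume A: "finite A"
    have "moment (\<nu> \<bind> K r) A = moment (\<nu> \<bind> K 0) A"
    proof (rule dual_solution_stationary[OF dual_solution_moment[OF \<nu>c]
          dual_solution_combination[OF solution1 solution0, of \<theta> "1 - \<theta>"] _ r A])
      fix B :: "'a set" assume B: "finite B"
      have "moment (\<nu> \<bind> K 0) B = \<theta> * limit1 B + (1 - \<theta>) * limit0 B"
        unfolding bind_0[OF \<nu>c] unfolding \<nu> by (rule mixture_moment[OF t B])
      then show "((\<lambda>t. \<theta> * u1 t B + (1 - \<theta>) * u0 t B) \<longlongrightarrow> moment (\<nu> \<bind> K 0) B) at_top"
        by (simp only:) (intro tendsto_add tendsto_mult_left limit0[OF B] limit1[OF B])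
    qed
    then show "moment (\<nu> \<bind> K r) A = moment \<nu> A" by (simp only: bind_0[OF \<nu>c])
  qed
  then show "\<nu> \<in> invariant_measures K" using \<nu>c by (simp add: invariant_measures_def)
qed

text \<open>
  The map from \<open>\<theta>\<close> to the mixture is affine and injective, so the invariant measures are a copy of the interval
  \<open>[0, 1]\<close>, whose extreme points are its ends.
\<close>

lemma extreme_invariant_measures: "extreme_measures (invariant_measures K) = {\<mu>0, \<mu>1}"
proof
  have inv0: "\<mu>0 \<in> invariant_measures K" and inv1: "\<mu>1 \<in> invariant_measures K"
    unfolding invariant_iff_mixture
    by (rule exI[of _ 0], simp add: mixture_0) (rule exI[of _ 1], simp add: mixture_1)
  have ne: "\<mu>1 \<noteq> \<mu>0" using mixture_inject[of 1 0] mixture_0 mixture_1 by auto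
  show "extreme_measures (invariant_measures K) \<subseteq> {\<mu>0, \<mu>1}"
  proof
    fix \<nu> assume ex: "\<nu> \<in> extreme_measures (invariant_measures K)"
    then have "\<nu> \<in> invariant_measures K" by (simp add: extreme_measures_def)
    then obtain \<theta> where t: "0 \<le> \<theta>" "\<theta> \<le> 1" and \<nu>: "\<nu> = mixture \<theta> \<mu>1 \<mu>0" unfolding invariant_iff_mixture by blast
    have "\<not> (0 < \<theta> \<and> \<theta> < 1)"
      using ex inv0 inv1 ne \<nu> unfolding extreme_measures_def by blast
    then have "\<theta> = 0 \<or> \<theta> = 1" using t by auto
    then show "\<nu> \<in> {\<mu>0, \<mu>1}" using \<nu> mixture_0 mixture_1 by auto
  qed
  have ext: "mixture \<theta> \<mu>1 \<mu>0 \<in> extreme_measures (invariant_measures K)"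
    if \<theta>: "\<theta> = 0 \<or> \<theta> = 1" for \<theta>
    unfolding extreme_measures_def
  proof (intro CollectI conjI ballI allI impI)
    have t: "0 \<le> \<theta>" "\<theta> \<le> 1" using \<theta> by auto
    then show "mixture \<theta> \<mu>1 \<mu>0 \<in> invariant_measures K" unfolding invariant_iff_mixture by blast
    fix \<nu>1 \<nu>2 a
    assume 1: "\<nu>1 \<in> invariant_measures K" and 2: "\<nu>2 \<in> invariant_measures K"
      and a: "0 < a \<and> a < 1 \<and> mixture \<theta> \<mu>1 \<mu>0 = mixture a \<nu>1 \<nu>2"
    obtain \<theta>1 where t1: "0 \<le> \<theta>1" "\<theta>1 \<le> 1" "\<nu>1 = mixture \<theta>1 \<mu>1 \<mu>0" using 1 unfolding invariant_iff_mixture by blast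
    obtain \<theta>2 where t2: "0 \<le> \<theta>2" "\<theta>2 \<le> 1" "\<nu>2 = mixture \<theta>2 \<mu>1 \<mu>0" using 2 unfolding invariant_iff_mixture by blast
    have a01: "0 \<le> a" "a \<le> 1" using a by auto
    note mm = mixture_of_mixtures[OF a01 t1(1,2) t2(1,2)]
    have "mixture \<theta> \<mu>1 \<mu>0 = mixture (a * \<theta>1 + (1 - a) * \<theta>2) \<mu>1 \<mu>0"
      using a unfolding t1(3) t2(3) mm(1) by (elim conjE)
    then have eq: "\<theta> = a * \<theta>1 + (1 - a) * \<theta>2" by (rule mixture_inject[OF t mm(2,3)])
    have p: "0 \<le> a * \<theta>1" "0 \<le> (1 - a) * \<theta>2" "0 \<le> a * (1 - \<theta>1)" "0 \<le> (1 - a) * (1 - \<theta>2)"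
      using a01 t1 t2 by auto
    have "\<theta>1 = \<theta>2"
    proof (cases "\<theta> = 0")
      case True
      then have "a * \<theta>1 = 0" "(1 - a) * \<theta>2 = 0" using p eq by linarith+
      then show ?thesis using a by auto
    next
      case False
      then have "\<theta> = 1" using \<theta> by simp
      then have "a * (1 - \<theta>1) + (1 - a) * (1 - \<theta>2) = 0" using eq by (simp add: algebra_simps)
      then have "a * (1 - \<theta>1) = 0" "(1 - a) * (1 - \<theta>2) = 0" using p by linarith+
      then show ?thesis using a by auto
    qed
    then show "\<nu>1 = \<nu>2" using t1(3) t2(3) by simp
  qed
  show "{\<mu>0, \<mu>1} \<subseteq> extreme_measures (invariant_measures K)"
    using ext[of 0] ext[of 1] mixture_0 mixture_1 by simp
qed

lemma weak_lim_mixture_iff: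
  assumes \<mu>: "\<mu> \<in> config_measures" and \<theta>: "0 \<le> \<theta>" "\<theta> \<le> 1"
  shows "weak_lim (\<lambda>t. \<mu> \<bind> K t) (mixture \<theta> \<mu>1 \<mu>0) at_top \<longleftrightarrow>
    (\<forall>x. ((\<lambda>t. free.evol t (\<lambda>y. measure \<mu> {\<eta>. \<eta> y}) x) \<longlongrightarrow> \<theta>) at_top)"
proof -
  let ?u = "\<lambda>t. moment (\<mu> \<bind> K t)"
  have u0: "?u 0 {y} = measure \<mu> {\<eta>. \<eta> y}" for y by (simp add: bind_0[OF \<mu>] moment_def)
  have e: "?u t {} = 1" if "0 \<le> t" for t by (rule moment_empty[OF bind_config[OF \<mu> that]])
  have r: "0 \<le> ?u 0 {x}" "?u 0 {x} \<le> 1" for x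
    using moment_bounds[OF \<mu>, of "{x}"] by (simp_all add: bind_0[OF \<mu>])
  have "weak_lim (\<lambda>t. \<mu> \<bind> K t) (mixture \<theta> \<mu>1 \<mu>0) at_top \<longleftrightarrow>
      (\<forall>A. finite A \<longrightarrow> ((\<lambda>t. ?u t A) \<longlongrightarrow> moment (mixture \<theta> \<mu>1 \<mu>0) A) at_top)"
    by (rule weak_lim_iff_moments[OF bind_config[OF \<mu>] mixture_in_config[OF \<theta>]])
  also have "\<dots> \<longleftrightarrow> (\<forall>A. finite A \<longrightarrow> ((\<lambda>t. ?u t A) \<longlongrightarrow> \<theta> * limit1 A + (1 - \<theta>) * limit0 A) at_top)"
    by (simp add: mixture_moment[OF \<theta>])
  also have "\<dots> \<longleftrightarrow> (\<forall>x. ((\<lambda>t. free.evol t (\<lambda>y. ?u 0 {y}) x) \<longlongrightarrow> \<theta>) at_top)"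
    by (rule dual_solution_limit_iff[OF dual_solution_moment[OF \<mu>] e r \<theta>])
  finally show ?thesis unfolding u0 .
qed

end

lemma reference_measures_exist:
  shows "\<exists>\<mu>0\<in>config_measures. \<forall>A. finite A \<longrightarrow> moment \<mu>0 A = limit0 A"
    and "\<exists>\<mu>1\<in>config_measures. \<forall>A. finite A \<longrightarrow> moment \<mu>1 A = limit1 A"
proof -
  show "\<exists>\<mu>0\<in>config_measures. \<forall>A. finite A \<longrightarrow> moment \<mu>0 A = limit0 A"
  proof (rule limit_measure_exists[where M = "\<lambda>t. return borel (\<lambda>_. False) \<bind> K t"])
    show "return borel (\<lambda>_. False) \<bind> K t \<in> config_measures" if "0 \<le> t" for t
      by (rule bind_config[OF return_config that])
    show "((\<lambda>t. moment (return borel (\<lambda>_. False) \<bind> K t) A) \<longlongrightarrow> limit0 A) at_top" if "finite A" for A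
      using limit0[OF that] unfolding u0_def .
  qed
  show "\<exists>\<mu>1\<in>config_measures. \<forall>A. finite A \<longrightarrow> moment \<mu>1 A = limit1 A"
  proof (rule limit_measure_exists[where M = "\<lambda>t. return borel (\<lambda>_. True) \<bind> K t"])
    show "return borel (\<lambda>_. True) \<bind> K t \<in> config_measures" if "0 \<le> t" for t
      by (rule bind_config[OF return_config that])
    show "((\<lambda>t. moment (return borel (\<lambda>_. True) \<bind> K t) A) \<longlongrightarrow> limit1 A) at_top" if "finite A" for A
      using limit1[OF that] unfolding u1_def .
  qed
qed

end

theorem theorem1p2:
  fixes qe qv :: "'s::countable \<Rightarrow> 's \<Rightarrow> real"
    and \<beta> \<delta> :: "'s \<Rightarrow> real"
    and K :: "real \<Rightarrow> ('s \<Rightarrow> bool) \<Rightarrow> ('s \<Rightarrow> bool) measure"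
    and P :: "'s \<Rightarrow> 'w measure" and X :: "real \<Rightarrow> 'w \<Rightarrow> 's"
    and PE :: "'s \<times> 's \<Rightarrow> 'v measure" and E :: "real \<Rightarrow> 'v \<Rightarrow> 's \<times> 's"
  assumes qe_nonneg: "\<And>x y. 0 \<le> qe x y"
    and qv_nonneg: "\<And>x y. 0 \<le> qv x y"
    and irreducible: "irreducible_rates (total_rate qe qv)"
    and qe_sym: "\<And>x y. qe x y = qe y x"
    and q_summable: "\<And>x. total_rate qe qv x summable_on UNIV"
    and q_bounded: "bdd_above (range (exit_rate (total_rate qe qv)))"
    and q_inf_pos: "0 < (INF x. exit_rate (total_rate qe qv) x)"
    and \<beta>_nonneg: "\<And>x. 0 \<le> \<beta> x"
    and \<delta>_nonneg: "\<And>x. 0 \<le> \<delta> x"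
    and \<beta>\<delta>_bounded: "bdd_above (range (\<lambda>x. \<beta> x + \<delta> x))"
    and qv_nontrivial: "\<exists>x y. 0 < qv x y"
    and nve: "nve_process qe qv \<beta> \<delta> K"
    and chain: "markov_chain UNIV (total_rate qe qv) P X"
    and exclusion: "markov_chain S2 (exclusion_rate (total_rate qe qv)) PE E"
    and noise_fails: "\<not> as_infinite_integral UNIV P X (\<lambda>x. \<beta> x + \<delta> x)"
    and voter: "as_infinite_integral S2 PE E (pair_rate qv)"
  shows "\<exists>\<mu>0\<in>space (prob_algebra borel). \<exists>\<mu>1\<in>space (prob_algebra borel).
      weak_lim (\<lambda>t. return borel (\<lambda>_. False) \<bind> K t) \<mu>0 at_top \<and>
      weak_lim (\<lambda>t. return borel (\<lambda>_. True) \<bind> K t) \<mu>1 at_top \<and>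
      extreme_measures (invariant_measures K) = {\<mu>0, \<mu>1} \<and>
      (\<forall>\<mu>\<in>space (prob_algebra borel). \<forall>\<theta>\<in>{0..1}.
        weak_lim (\<lambda>t. \<mu> \<bind> K t) (mixture \<theta> \<mu>1 \<mu>0) at_top \<longleftrightarrow>
        (\<forall>x. ((\<lambda>t. \<Sum>\<^sub>\<infinity>y. trans_prob P X t x y * measure \<mu> {\<eta>. \<eta> y}) \<longlongrightarrow> \<theta>) at_top))"
proof -
  interpret nve_rates qe qv \<beta> \<delta>
    by unfold_locales
      (fact qe_nonneg qv_nonneg qe_sym q_summable q_bounded \<beta>_nonneg \<delta>_nonneg \<beta>\<delta>_bounded)+
  interpret walk: markov_jump_process UNIV q "\<lambda>x. \<beta> x + \<delta> x" "4 * rate_bound" P X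
    by unfold_locales (rule chain)
  interpret two: markov_jump_process S2 "exclusion_rate q" "pair_rate qv" "4 * rate_bound" PE E
    by unfold_locales (rule exclusion)
  have meet: "pair.survival (x, y) = 0" if "x \<noteq> y" for x y
  proof (rule pair.evol_one_tendsto_0)
    have S: "(x, y) \<in> S2" using that by (simp add: S2_def)
    then have "measure (PE (x, y)) {w \<in> space (PE (x, y)). (\<integral>\<^sup>+t\<in>{0..}. ennreal (pair_rate qv (E t w)) \<partial>lborel) = \<infinity>} = 1"
      using voter unfolding as_infinite_integral_def by blast
    then show "(\<lambda>m. pair.evol (real m) (\<lambda>p. 1) (x, y)) \<longlonglongrightarrow> 0"
      unfolding two.infinite_integral_iff[OF S] .
  qed
  have noise: "\<exists>x. killed.survival x \<noteq> 0"
  proof (rule ccontr)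
    assume "\<nexists>x. killed.survival x \<noteq> 0"
    then have s: "killed.survival x = 0" for x by blast
    have "measure (P x) {w \<in> space (P x). (\<integral>\<^sup>+t\<in>{0..}. ennreal (\<beta> (X t w) + \<delta> (X t w)) \<partial>lborel) = \<infinity>} = 1" for x
      unfolding walk.infinite_integral_iff[OF UNIV_I]
      using filterlim_compose[OF killed.survival_tendsto[of x] filterlim_real_sequentially] unfolding s .
    then show False using noise_fails unfolding as_infinite_integral_def by blast
  qed
  interpret nve_survival qe qv \<beta> \<delta> K
    by unfold_locales (fact meet noise nve)+
  obtain \<mu>0 where \<mu>0: "\<mu>0 \<in> config_measures" and m0: "\<And>A. finite A \<Longrightarrow> moment \<mu>0 A = limit0 A"
    using reference_measures_exist(1) by auto
  obtain \<mu>1 where \<mu>1: "\<mu>1 \<in> config_measures" and m1: "\<And>A. finite A \<Longrightarrow> moment \<mu>1 A = limit1 A"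
    using reference_measures_exist(2) by auto
  have lim0: "weak_lim (\<lambda>t. return borel (\<lambda>_. False) \<bind> K t) \<mu>0 at_top"
  proof (rule iffD2[OF weak_lim_iff_moments[OF bind_config[OF return_config] \<mu>0]])
    show "\<forall>A. finite A \<longrightarrow> ((\<lambda>t. moment (return borel (\<lambda>_. False) \<bind> K t) A) \<longlongrightarrow> moment \<mu>0 A) at_top"
      using limit0 by (simp add: m0 u0_def)
  qed
  have lim1: "weak_lim (\<lambda>t. return borel (\<lambda>_. True) \<bind> K t) \<mu>1 at_top"
  proof (rule iffD2[OF weak_lim_iff_moments[OF bind_config[OF return_config] \<mu>1]])
    show "\<forall>A. finite A \<longrightarrow> ((\<lambda>t. moment (return borel (\<lambda>_. True) \<bind> K t) A) \<longlongrightarrow> moment \<mu>1 A) at_top"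
      using limit1 by (simp add: m1 u1_def)
  qed
  have ext: "extreme_measures (invariant_measures K) = {\<mu>0, \<mu>1}"
    by (rule extreme_invariant_measures[OF \<mu>0 \<mu>1 m0 m1])
  have conv: "weak_lim (\<lambda>t. \<mu> \<bind> K t) (mixture \<theta> \<mu>1 \<mu>0) at_top \<longleftrightarrow>
      (\<forall>x. ((\<lambda>t. \<Sum>\<^sub>\<infinity>y. trans_prob P X t x y * measure \<mu> {\<eta>. \<eta> y}) \<longlongrightarrow> \<theta>) at_top)"
    if \<mu>: "\<mu> \<in> config_measures" and \<theta>: "\<theta> \<in> {0..1}" for \<mu> \<theta>
  proof -
    interpret M: prob_space \<mu> by (rule config_measuresD[OF \<mu>])
    have b: "bounded_fun (\<lambda>y. measure \<mu> {\<eta>. \<eta> y})" by (rule bounded_funI[of _ 1]) simp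
    have eq: "free.evol t (\<lambda>y. measure \<mu> {\<eta>. \<eta> y}) x = (\<Sum>\<^sub>\<infinity>y. trans_prob P X t x y * measure \<mu> {\<eta>. \<eta> y})"
      if "0 \<le> t" for t x
      unfolding walk.mean_eq_infsum[OF UNIV_I that b, symmetric] by (rule walk.mean_eq_evol[OF b that, symmetric])
    have "((\<lambda>t. free.evol t (\<lambda>y. measure \<mu> {\<eta>. \<eta> y}) x) \<longlongrightarrow> \<theta>) at_top \<longleftrightarrow>
        ((\<lambda>t. \<Sum>\<^sub>\<infinity>y. trans_prob P X t x y * measure \<mu> {\<eta>. \<eta> y}) \<longlongrightarrow> \<theta>) at_top" for x
      by (rule filterlim_cong[OF refl refl], rule eventually_at_top_linorderI[of 0], rule eq)
    then show ?thesis
      using weak_lim_mixture_iff[OF \<mu>0 \<mu>1 m0 m1 \<mu>, of \<theta>] \<theta> by simp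
  qed
  show ?thesis
    using \<mu>0 \<mu>1 lim0 lim1 ext conv by (intro bexI[of _ \<mu>0] bexI[of _ \<mu>1] conjI ballI)
qed

end
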